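(* Let $\rho$ be a critical radius function on $\mathbb R^d$ with constants $k_0,C_0\ge1$. Let $T$ be an exponential Schrödinger--Calderón--Zygmund operator of $(\nu,\infty,\delta)$ type with parameters $c$ and $m$, for some $0\le\nu<d$ and $0<\delta\le1$. Let $0\le\alpha<\delta$ and $1\le\kappa<\frac{\delta-\alpha-\nu}d+1$. Then the boundedness of $T$ from $\mathrm{BMO}_\rho^\alpha(w)$ into $\mathrm{BMO}_\rho^{\alpha+\nu}(w)$ whenever $w\in E^{\rho,m}_{\infty,c_1,c_2}\cap D^{\rho,m}_{\kappa,c_3}$ with $c_1,c_2,c_3\ge0$ such that $$c_2+c_3<c\left(1-\frac{d(\kappa-1)+\alpha+\nu}{\delta}\right)(4C_0)^{-m}$$ is equivalent to either of the following conditions. (i) There exists a constant $C$ such that, for every ball $B=B(x_0,r)$ with $x_0\in\mathbb R^d$ and $0<r\le\frac12\rho(x_0)$, $$\frac{1}{|B|^{1+\nu/d}}\int_B|T1(y)-(T1)_B|\,dy\le C\left(\frac{r}{\rho(x_0)}\right)^{\alpha+d(\kappa-1)}$$ when $\alpha>0$ or $\kappa>1$, or $$\frac{1}{|B|^{1+\nu/d}}\int_B|T1(y)-(T1)_B|\,dy\le C\log^{-1}\left(\frac{\rho(x_0)}{r}\right)$$ when $\alpha=0$ and $\kappa=1$. (iii) $T$ is bounded from $\mathrm{BMO}_\rho^\alpha(w)$ into $\mathrm{BMO}_\rho^{\alpha+\nu}(w)$ for every weight of the form $w(x)=|x-x_0|^{d(\kappa-1)}$, $x_0\in\mathbb R^d$,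 with operator norm independent of $x_0$.
   Context: $B(x,r)$ is the Euclidean ball in $\mathbb R^d$, $|B|$ its Lebesgue measure, $f_B=\frac1{|B|}\int_B f$. A weight is a nonnegative locally integrable function, and $w(B)=\int_B w$. $s'$, $\eta'$ denote conjugate exponents. Critical radius function: $\rho:\mathbb R^d\to[0,\infty)$ for which there are constants $k_0,C_0\ge1$ with $$C_0^{-1}\rho(x)\Big(1+\tfrac{|x-y|}{\rho(x)}\Big)^{-k_0}\le\rho(y)\le C_0\rho(x)\Big(1+\tfrac{|x-y|}{\rho(x)}\Big)^{\frac{k_0}{k_0+1}},\quad x,y\in\mathbb R^d.$$ $\mathrm{BMO}_\rho^\alpha(w)$, for $0\le\alpha<1$ and a weight $w$: all $f\in L^1_{\mathrm{loc}}(\mathbb R^d)$ such that $\frac1{w(B)}\int_B|f-f_B|\le C|B|^{\alpha/d}$ for every ball $B$, and $\frac1{w(B)}\int_B|f|\le C|B|^{\alpha/d}$ for every ball $B=B(x,r)$ with $r\ge\rho(x)$; the norm is the smallest constant in these two conditions. Exponential Schrödinger--Calderón--Zygmund operator of $(\nu,\infty,\delta)$ type with parameters $c,m>0$, for $0\le\nu<d$, $0<\delta\le1$: a linear operator $T$ such that (1) $T$ is of weak type $\left(1,\frac d{d-\nu}\right)$; (2) there is a kernel $K:\mathbb R^d\times\mathbb R^d\to\mathbb R$ with $Tf(x)=\int K(x,y)f(y)\,dy$ for $f\in L^1(\mathbb R^d)$ and $x\notin\operatorname{supp} f$, and a constant $C$ such that $$|K(x,y)|\le\frac{C}{|x-y|^{d-\nu}}\exp\Big(-c\big(1+\tfrac{|x-y|}{\rho(x)}\big)^m\Big),\quad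 x\ne y,$$ $$|K(x,y)-K(x_0,y)|\le\frac{C}{|x-y|^{d-\nu}}\Big(\frac{|x-x_0|}{|x-y|}\Big)^\delta,\quad |x-y|>2|x-x_0|.$$ Meaning of $Tf$ for $f\in\mathrm{BMO}^\alpha_\rho(w)$ or $f=1$: for $x_0\in\mathbb R^d$ and $R\ge\rho(x_0)$, $Tf(x)=T(f\chi_{B(x_0,2R)})(x)+\int_{B(x_0,2R)^c}K(x,y)f(y)\,dy$ for $x\in B(x_0,R)$ (this does not depend on the choice of $R$). Weight classes ($c,m\ge0$; in each case the inequality is required for all balls $B=B(x,r)$ with a constant $C$ independent of the ball): - $H^{\rho,m}_{p,c}$, $1<p<\infty$: $\left(\int_Bw\right)^{1/p}\left(\int_Bw^{-\frac1{p-1}}\right)^{\frac{p-1}p}\le C|B|\exp\left(c(1+\frac r{\rho(x)})^m\right)$. - $RH^{\rho,m}_{\eta,c}$, $\eta>1$: $\left(\frac1{|B|}\int_Bw^\eta\right)^{1/\eta}\le C\exp\left(c(1+\frac r{\rho(x)})^m\right)\frac1{|B|}\int_Bw$. - $D^{\rho,m}_{\kappa,c}$, $\kappa\ge1$: $w(B(x,R))\le C\left(\frac Rr\right)^{d\kappa}\exp\left(c(1+\frac R{\rho(x)})^m\right)w(B(x,r))$ for all $x$ and $r\le R$. - $E^{\rho,m}_{s,c_1,c_2}=\bigcup_{\eta>s'}\left(H^{\rho,m}_{s/\eta',c_1}\cap RH^{\rho,m}_{\eta,c_2}\right)$ for $1<s<\infty$, and $E^{\rho,m}_{\infty,c_1,c_2}=\bigcup_{1<s<\infty}E^{\rho,m}_{s,c_1,c_2}$.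 *)

theory Defs
  imports "HOL-Analysis.Analysis"
begin

section \<open>Balls, averages and weights\<close>

definition vol :: "'a::euclidean_space set \<Rightarrow> real" where
  "vol B = measure lebesgue B"

definition avg :: "('a::euclidean_space \<Rightarrow> real) \<Rightarrow> 'a set \<Rightarrow> real" where
  "avg f B = (LINT y:B|lebesgue. f y) / vol B"

definition wmeas :: "('a::euclidean_space \<Rightarrow> real) \<Rightarrow> 'a set \<Rightarrow> real" where
  "wmeas w B = (LINT y:B|lebesgue. w y)"

definition loc_integrable :: "('a::euclidean_space \<Rightarrow> real) \<Rightarrow> bool" where
  "loc_integrable f \<longleftrightarrow> (\<forall>S. compact S \<longrightarrow> f absolutely_integrable_on S)"

definition weight :: "('a::euclidean_space \<Rightarrow> real) \<Rightarrow> bool" where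
  "weight w \<longleftrightarrow> (\<forall>x. 0 \<le> w x) \<and> loc_integrable w"

definition conj_exponent :: "real \<Rightarrow> real" where
  "conj_exponent p = p / (p - 1)"

section \<open>Critical radius functions\<close>

text \<open>The defining inequalities divide by \<open>\<rho> x\<close>, so \<open>\<rho>\<close> has to be positive. (Read with
  limits at \<open>\<rho> x = 0\<close>, they would force a \<open>\<rho>\<close> with a zero to vanish identically.)\<close>

definition critical_radius :: "real \<Rightarrow> real \<Rightarrow> ('a::euclidean_space \<Rightarrow> real) \<Rightarrow> bool" where
  "critical_radius k0 C0 \<rho> \<longleftrightarrow>
     1 \<le> k0 \<and> 1 \<le> C0 \<and> (\<forall>x. 0 < \<rho> x) \<and>
     (\<forall>x y. inverse C0 * \<rho> x * (1 + norm (x - y) / \<rho> x) powr (- k0) \<le> \<rho> y \<and>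
            \<rho> y \<le> C0 * \<rho> x * (1 + norm (x - y) / \<rho> x) powr (k0 / (k0 + 1)))"

section \<open>Weighted BMO spaces adapted to the critical radius\<close>

text \<open>Both conditions are multiplied through by \<open>w(B)\<close>, so that division by zero does not
  make them vacuous on balls with \<open>w(B) = 0\<close>.\<close>

definition BMO_bound ::
  "('a::euclidean_space \<Rightarrow> real) \<Rightarrow> real \<Rightarrow> ('a \<Rightarrow> real) \<Rightarrow> ('a \<Rightarrow> real) \<Rightarrow> real \<Rightarrow> bool" where
  "BMO_bound \<rho> \<alpha> w f C \<longleftrightarrow>
     (\<forall>x r. 0 < r \<longrightarrow>
        (LINT y:ball x r|lebesgue. \<bar>f y - avg f (ball x r)\<bar>)
          \<le> C * vol (ball x r) powr (\<alpha> / real DIM('a)) * wmeas w (ball x r)) \<and>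
     (\<forall>x r. \<rho> x \<le> r \<longrightarrow>
        (LINT y:ball x r|lebesgue. \<bar>f y\<bar>)
          \<le> C * vol (ball x r) powr (\<alpha> / real DIM('a)) * wmeas w (ball x r))"

definition BMO ::
  "('a::euclidean_space \<Rightarrow> real) \<Rightarrow> real \<Rightarrow> ('a \<Rightarrow> real) \<Rightarrow> ('a \<Rightarrow> real) set" where
  "BMO \<rho> \<alpha> w = {f. loc_integrable f \<and> (\<exists>C\<ge>0. BMO_bound \<rho> \<alpha> w f C)}"

definition BMO_norm ::
  "('a::euclidean_space \<Rightarrow> real) \<Rightarrow> real \<Rightarrow> ('a \<Rightarrow> real) \<Rightarrow> ('a \<Rightarrow> real) \<Rightarrow> real" where
  "BMO_norm \<rho> \<alpha> w f = Inf {C. 0 \<le> C \<and> BMO_bound \<rho> \<alpha> w f C}"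

section \<open>Exponential Schroedinger--Calderon--Zygmund operators\<close>

text \<open>An operator on \<open>L\<^sup>1\<close> is a map on functions of which only the values at integrable functions
  matter. All identities between its values hold almost everywhere, and the weak type estimate
  makes it well defined on classes of functions equal almost everywhere.\<close>

definition linear_on_L1 ::
  "(('a::euclidean_space \<Rightarrow> real) \<Rightarrow> 'a \<Rightarrow> real) \<Rightarrow> bool" where
  "linear_on_L1 T \<longleftrightarrow>
     (\<forall>f g a b. integrable lebesgue f \<longrightarrow> integrable lebesgue g \<longrightarrow>
        (AE x in lebesgue. T (\<lambda>y. a * f y + b * g y) x = a * T f x + b * T g x))"

definition weak_type_1 ::
  "real \<Rightarrow> (('a::euclidean_space \<Rightarrow> real) \<Rightarrow> 'a \<Rightarrow> real) \<Rightarrow> bool" where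
  "weak_type_1 q T \<longleftrightarrow>
     (\<forall>f. integrable lebesgue f \<longrightarrow> T f \<in> borel_measurable lebesgue) \<and>
     (\<exists>C\<ge>0. \<forall>f t. integrable lebesgue f \<longrightarrow> 0 < t \<longrightarrow>
        emeasure lebesgue {x. t < \<bar>T f x\<bar>}
          \<le> ennreal ((C * (LINT y|lebesgue. \<bar>f y\<bar>) / t) powr q))"

text \<open>Measurability of \<open>K x\<close> is what makes the integrals against \<open>K\<close> meaningful.\<close>

definition exp_SCZ_operator ::
  "('a::euclidean_space \<Rightarrow> real) \<Rightarrow> real \<Rightarrow> real \<Rightarrow> real \<Rightarrow> real \<Rightarrow>
   (('a \<Rightarrow> real) \<Rightarrow> 'a \<Rightarrow> real) \<Rightarrow> ('a \<Rightarrow> 'a \<Rightarrow> real) \<Rightarrow> bool" where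
  "exp_SCZ_operator \<rho> \<nu> \<delta> c m T K \<longleftrightarrow>
     linear_on_L1 T \<and>
     weak_type_1 (real DIM('a) / (real DIM('a) - \<nu>)) T \<and>
     (\<forall>x. K x \<in> borel_measurable lebesgue) \<and>
     (\<forall>f. integrable lebesgue f \<longrightarrow>
        (AE x in lebesgue. x \<notin> closure {y. f y \<noteq> 0} \<longrightarrow>
           T f x = (LINT y|lebesgue. K x y * f y))) \<and>
     (\<exists>C.
        (\<forall>x y. x \<noteq> y \<longrightarrow>
           \<bar>K x y\<bar> \<le> C / norm (x - y) powr (real DIM('a) - \<nu>)
                       * exp (- c * (1 + norm (x - y) / \<rho> x) powr m)) \<and>
        (\<forall>x x0 y. norm (x - y) > 2 * norm (x - x0) \<longrightarrow>
           \<bar>K x y - K x0 y\<bar> \<le> C / norm (x - y) powr (real DIM('a) - \<nu>)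
                       * (norm (x - x0) / norm (x - y)) powr \<delta>))"

text \<open>\<open>is_extended_value \<rho> T K f g\<close>: the function \<open>g\<close>, determined almost everywhere, is \<open>T f\<close>
  for \<open>f\<close> that need not be integrable.\<close>

definition is_extended_value ::
  "('a::euclidean_space \<Rightarrow> real) \<Rightarrow> (('a \<Rightarrow> real) \<Rightarrow> 'a \<Rightarrow> real) \<Rightarrow> ('a \<Rightarrow> 'a \<Rightarrow> real) \<Rightarrow>
   ('a \<Rightarrow> real) \<Rightarrow> ('a \<Rightarrow> real) \<Rightarrow> bool" where
  "is_extended_value \<rho> T K f g \<longleftrightarrow>
     (\<forall>x0 R. \<rho> x0 \<le> R \<longrightarrow>
        (AE x in lebesgue. x \<in> ball x0 R \<longrightarrow>
           set_integrable lebesgue (- ball x0 (2 * R)) (\<lambda>y. K x y * f y) \<and>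
           g x = T (\<lambda>y. f y * indicator (ball x0 (2 * R)) y) x
                 + (LINT y:- ball x0 (2 * R)|lebesgue. K x y * f y)))"

definition BMO_bounded_by ::
  "('a::euclidean_space \<Rightarrow> real) \<Rightarrow> (('a \<Rightarrow> real) \<Rightarrow> 'a \<Rightarrow> real) \<Rightarrow> ('a \<Rightarrow> 'a \<Rightarrow> real) \<Rightarrow>
   real \<Rightarrow> real \<Rightarrow> ('a \<Rightarrow> real) \<Rightarrow> real \<Rightarrow> bool" where
  "BMO_bounded_by \<rho> T K \<alpha> \<beta> w A \<longleftrightarrow>
     (\<forall>f \<in> BMO \<rho> \<alpha> w. \<exists>g. is_extended_value \<rho> T K f g \<and> g \<in> BMO \<rho> \<beta> w \<and>
        BMO_norm \<rho> \<beta> w g \<le> A * BMO_norm \<rho> \<alpha> w f)"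

section \<open>Weight classes\<close>

text \<open>Finiteness of the second integral requires \<open>w > 0\<close> almost everywhere; this is stated
  separately because \<open>0 powr t = 0\<close>, also for negative \<open>t\<close>.\<close>

definition H_class ::
  "('a::euclidean_space \<Rightarrow> real) \<Rightarrow> real \<Rightarrow> real \<Rightarrow> real \<Rightarrow> ('a \<Rightarrow> real) set" where
  "H_class \<rho> m p c = {w. weight w \<and>
     (AE x in lebesgue. 0 < w x) \<and> loc_integrable (\<lambda>y. w y powr (- 1 / (p - 1))) \<and>
     (\<exists>C. \<forall>x r. 0 < r \<longrightarrow>
        wmeas w (ball x r) powr (1 / p)
          * (LINT y:ball x r|lebesgue. w y powr (- 1 / (p - 1))) powr ((p - 1) / p)
        \<le> C * vol (ball x r) * exp (c * (1 + r / \<rho> x) powr m))}"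

definition RH_class ::
  "('a::euclidean_space \<Rightarrow> real) \<Rightarrow> real \<Rightarrow> real \<Rightarrow> real \<Rightarrow> ('a \<Rightarrow> real) set" where
  "RH_class \<rho> m \<eta> c = {w. weight w \<and> loc_integrable (\<lambda>y. w y powr \<eta>) \<and>
     (\<exists>C. \<forall>x r. 0 < r \<longrightarrow>
        avg (\<lambda>y. w y powr \<eta>) (ball x r) powr (1 / \<eta>)
        \<le> C * exp (c * (1 + r / \<rho> x) powr m) * avg w (ball x r))}"

definition D_class ::
  "('a::euclidean_space \<Rightarrow> real) \<Rightarrow> real \<Rightarrow> real \<Rightarrow> real \<Rightarrow> ('a \<Rightarrow> real) set" where
  "D_class \<rho> m \<kappa> c = {w. weight w \<and>
     (\<exists>C. \<forall>x r R. 0 < r \<longrightarrow> r \<le> R \<longrightarrow>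
        wmeas w (ball x R)
        \<le> C * (R / r) powr (real DIM('a) * \<kappa>) * exp (c * (1 + R / \<rho> x) powr m)
            * wmeas w (ball x r))}"

definition E_class ::
  "('a::euclidean_space \<Rightarrow> real) \<Rightarrow> real \<Rightarrow> real \<Rightarrow> real \<Rightarrow> real \<Rightarrow> ('a \<Rightarrow> real) set" where
  "E_class \<rho> m s c1 c2 =
     (\<Union>\<eta>\<in>{conj_exponent s<..}. H_class \<rho> m (s / conj_exponent \<eta>) c1 \<inter> RH_class \<rho> m \<eta> c2)"

definition E_infty_class ::
  "('a::euclidean_space \<Rightarrow> real) \<Rightarrow> real \<Rightarrow> real \<Rightarrow> real \<Rightarrow> ('a \<Rightarrow> real) set" where
  "E_infty_class \<rho> m c1 c2 = (\<Union>s\<in>{1<..}. E_class \<rho> m s c1 c2)"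

section \<open>The three conditions compared\<close>

text \<open>The operator norm may depend on the weight.\<close>

definition bounded_for_admissible_weights ::
  "('a::euclidean_space \<Rightarrow> real) \<Rightarrow> real \<Rightarrow> (('a \<Rightarrow> real) \<Rightarrow> 'a \<Rightarrow> real) \<Rightarrow>
   ('a \<Rightarrow> 'a \<Rightarrow> real) \<Rightarrow> real \<Rightarrow> real \<Rightarrow> real \<Rightarrow> real \<Rightarrow> real \<Rightarrow> real \<Rightarrow> bool" where
  "bounded_for_admissible_weights \<rho> C0 T K \<nu> \<delta> c m \<alpha> \<kappa> \<longleftrightarrow>
     (\<forall>c1 c2 c3 w. 0 \<le> c1 \<longrightarrow> 0 \<le> c2 \<longrightarrow> 0 \<le> c3 \<longrightarrow>
        c2 + c3 < c * (1 - (real DIM('a) * (\<kappa> - 1) + \<alpha> + \<nu>) / \<delta>) * (4 * C0) powr (- m) \<longrightarrow>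
        w \<in> E_infty_class \<rho> m c1 c2 \<inter> D_class \<rho> m \<kappa> c3 \<longrightarrow>
        (\<exists>A. BMO_bounded_by \<rho> T K \<alpha> (\<alpha> + \<nu>) w A))"

text \<open>In the next definition \<open>g\<close> is \<open>T 1\<close>; integrability on the balls is part of the meaning of
  its mean oscillation.\<close>

definition T1_condition ::
  "('a::euclidean_space \<Rightarrow> real) \<Rightarrow> (('a \<Rightarrow> real) \<Rightarrow> 'a \<Rightarrow> real) \<Rightarrow>
   ('a \<Rightarrow> 'a \<Rightarrow> real) \<Rightarrow> real \<Rightarrow> real \<Rightarrow> real \<Rightarrow> bool" where
  "T1_condition \<rho> T K \<nu> \<alpha> \<kappa> \<longleftrightarrow>
     (\<exists>g. is_extended_value \<rho> T K (\<lambda>_. 1) g \<and>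
        (\<exists>C. \<forall>x0 r. 0 < r \<longrightarrow> r \<le> \<rho> x0 / 2 \<longrightarrow>
           g absolutely_integrable_on ball x0 r \<and>
           (LINT y:ball x0 r|lebesgue. \<bar>g y - avg g (ball x0 r)\<bar>)
               / vol (ball x0 r) powr (1 + \<nu> / real DIM('a))
           \<le> C * (if \<alpha> > 0 \<or> \<kappa> > 1
                  then (r / \<rho> x0) powr (\<alpha> + real DIM('a) * (\<kappa> - 1))
                  else inverse (ln (\<rho> x0 / r)))))"

text \<open>For \<open>\<kappa> = 1\<close> the weight below is \<open>1\<close> except at the single point \<open>x0\<close>, as \<open>0 powr 0 = 0\<close>.\<close>

definition bounded_for_power_weights ::
  "('a::euclidean_space \<Rightarrow> real) \<Rightarrow> (('a \<Rightarrow> real) \<Rightarrow> 'a \<Rightarrow> real) \<Rightarrow>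
   ('a \<Rightarrow> 'a \<Rightarrow> real) \<Rightarrow> real \<Rightarrow> real \<Rightarrow> real \<Rightarrow> bool" where
  "bounded_for_power_weights \<rho> T K \<nu> \<alpha> \<kappa> \<longleftrightarrow>
     (\<exists>A. \<forall>x0. BMO_bounded_by \<rho> T K \<alpha> (\<alpha> + \<nu>)
                  (\<lambda>x. norm (x - x0) powr (real DIM('a) * (\<kappa> - 1))) A)"

end

(*
  Off a dilate of a ball the kernel bounds and the doubling of w control the oscillation of T f: the
  smoothness of K gives a gain (r/t)^delta, the exponential decay of K beats the exponential factors of
  the weight classes, and interpolating between the two produces the smallness required of c3. So, up to
  terms of the size wanted, T f oscillates on B like T((f - a) 1_{3B}) + a T1 with a = f_{3B}.

  The local term is the delicate one, because |f - a| is only controlled in L^1 with respect to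
  Lebesgue measure, and T is merely of weak type. The level sets of T((f - a) 1_{3B}) are covered by
  Calderon-Zygmund stopping balls, on which T splits into a nearly constant part and the same problem
  at a smaller scale. The weight has the A_infinity property below the critical scale, so the stopping
  balls carry a small part of w, and the remaining term is absorbed.

  Thus everything is decided by a T1. Since a is at most of the order of r^alpha w(B)/|B| times
  (rho/r)^(alpha + d (kappa - 1)), or times log(rho/r), condition (i) suffices; it is necessary because
  for w comparable to |x - x0|^(d (kappa - 1)) a truncated power or logarithm attains this growth.
  When only boundedness for each separate weight is known, no uniform constant is available: a failure of
  (i) gives a sequence of bad centres, which one may take lacunary, and a power of the distance to that
  sequence is a single admissible weight which is bad at all of them.
*)

theory Submission
  imports Defs
begin

section \<open>Absolute integrals over balls\<close>

text \<open>Absorbing a term into the left side requires it to be finite, and an endpoint weak type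
  bound gives no finiteness. The integrand is therefore truncated at a level \<open>N\<close>: after
  k rounds of stopping the unresolved part costs at most N 2^(-k) |B|, because each round at least
  halves the total volume of the dilated stopping balls; k goes to infinity before \<open>N\<close>.
  To make this possible all estimates compare [0,\<infinity>]-valued integrals
  \<open>nn_abs\<close>, and integrability of T f on balls is a conclusion. Condition (iii) asks for
  one bound for a whole family of weights, so a constant may depend on the weight only through the
  data recorded in \<open>dbl\<close> and \<open>ainf\<close>: the doubling data and an A_infinity
  modulus. Two numbers recur. The dilation 3 makes the smoothness of K available off 3B. The power
  |y - p|^(-1/2) is locally integrable in every dimension; it yields the lower bounds and the H
  class of the power weights, and the mean oscillation of the logarithm.\<close>

definition nn_abs :: "('a::euclidean_space \<Rightarrow> real) \<Rightarrow> 'a set \<Rightarrow> ennreal" where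
  "nn_abs h A = (\<integral>\<^sup>+y\<in>A. ennreal \<bar>h y\<bar> \<partial>lebesgue)"

abbreviation unit_vol :: "'a::euclidean_space itself \<Rightarrow> real" where
  "unit_vol _ \<equiv> unit_ball_vol (real DIM('a))"

lemma ball_sets_lebesgue [measurable, simp]: "ball (x::'a::euclidean_space) r \<in> sets lebesgue"
  by simp

lemma emeasure_ball_lebesgue:
  assumes "0 \<le> r"
  shows "emeasure lebesgue (ball (x::'a::euclidean_space) r) = ennreal (unit_vol TYPE('a) * r powr real DIM('a))"
  using assms by (cases "r = 0") (simp_all add: emeasure_ball powr_realpow)

lemma vol_ball:
  assumes "0 \<le> r"
  shows "vol (ball (x::'a::euclidean_space) r) = unit_vol TYPE('a) * r powr real DIM('a)"
  using emeasure_ball_lebesgue[OF assms, of x] by (simp add: vol_def measure_def)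

lemma vol_ball_pos: "0 < r \<Longrightarrow> 0 < vol (ball (x::'a::euclidean_space) r)"
  by (simp add: vol_ball)

lemma emeasure_ball_vol: "0 \<le> r \<Longrightarrow> emeasure lebesgue (ball x r) = ennreal (vol (ball x r))"
  using emeasure_ball_lebesgue[of r x] by (simp only: vol_ball)

lemma nn_abs_mono: "A \<subseteq> B \<Longrightarrow> nn_abs h A \<le> nn_abs h B"
  unfolding nn_abs_def by (intro nn_integral_mono) (auto split: split_indicator)

lemma nn_abs_add:
  assumes [measurable]: "f \<in> borel_measurable lebesgue" "g \<in> borel_measurable lebesgue" "A \<in> sets lebesgue"
  shows "nn_abs (\<lambda>y. f y + g y) A \<le> nn_abs f A + nn_abs g A"
proof -
  have "nn_abs (\<lambda>y. f y + g y) A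
      \<le> (\<integral>\<^sup>+y. ennreal \<bar>f y\<bar> * indicator A y + ennreal \<bar>g y\<bar> * indicator A y \<partial>lebesgue)"
    unfolding nn_abs_def
    by (intro nn_integral_mono) (auto split: split_indicator simp flip: ennreal_plus intro!: ennreal_leI)
  also have "\<dots> = nn_abs f A + nn_abs g A"
    unfolding nn_abs_def by (rule nn_integral_add) measurable
  finally show ?thesis .
qed

lemma nn_abs_const: "A \<in> sets lebesgue \<Longrightarrow> nn_abs (\<lambda>_. a) A = ennreal \<bar>a\<bar> * emeasure lebesgue A"
  unfolding nn_abs_def by (rule nn_integral_cmult_indicator)

lemma nn_abs_eq_set_integral:
  assumes "set_integrable lebesgue A h"
  shows "nn_abs h A = ennreal (LINT y:A|lebesgue. \<bar>h y\<bar>)"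
proof -
  have "integrable lebesgue (\<lambda>y. indicator A y * \<bar>h y\<bar>)"
    using set_integrable_abs[OF assms] by (simp add: set_integrable_def)
  from nn_integral_eq_integral[OF this] have "(\<integral>\<^sup>+ x. ennreal (indicator A x * \<bar>h x\<bar>) \<partial>lebesgue)
      = ennreal (LINT y:A|lebesgue. \<bar>h y\<bar>)"
    by (simp add: set_lebesgue_integral_def)
  moreover have "nn_abs h A = (\<integral>\<^sup>+ x. ennreal (indicator A x * \<bar>h x\<bar>) \<partial>lebesgue)"
    unfolding nn_abs_def by (intro nn_integral_cong) (auto split: split_indicator)
  ultimately show ?thesis by simp
qed

lemma set_integrable_nn_abs:
  assumes [measurable]: "h \<in> borel_measurable lebesgue" "A \<in> sets lebesgue" and "nn_abs h A < \<infinity>"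
  shows "set_integrable lebesgue A h"
  unfolding set_integrable_def
proof (rule integrableI_bounded)
  show "(\<lambda>x. indicat_real A x *\<^sub>R h x) \<in> borel_measurable lebesgue" by measurable
  have "(\<integral>\<^sup>+ x. ennreal (norm (indicat_real A x *\<^sub>R h x)) \<partial>lebesgue) = nn_abs h A"
    unfolding nn_abs_def by (intro nn_integral_cong) (auto split: split_indicator)
  then show "(\<integral>\<^sup>+ x. ennreal (norm (indicat_real A x *\<^sub>R h x)) \<partial>lebesgue) < \<infinity>"
    using assms by simp
qed

text \<open>If the integrand is not integrable, the Bochner integral is 0 by convention and the
  bound is trivial. Thus a bound on \<open>nn_abs\<close> turns into one on an integral before
  anything is known about integrability.\<close>

lemma set_integral_abs_le_nn_abs:
  assumes "nn_abs h A \<le> ennreal c" "0 \<le> c" 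
  shows "(LINT y:A|lebesgue. \<bar>h y\<bar>) \<le> c"
proof (cases "set_integrable lebesgue A (\<lambda>y. \<bar>h y\<bar>)")
  case True
  from nn_abs_eq_set_integral[OF this] assms show ?thesis by (simp add: nn_abs_def)
next
  case False
  then show ?thesis using assms
    by (simp add: set_lebesgue_integral_def set_integrable_def not_integrable_integral_eq)
qed

lemma abs_set_integral_le_nn_abs:
  assumes "nn_abs h A \<le> ennreal c" "0 \<le> c" 
  shows "\<bar>LINT y:A|lebesgue. h y\<bar> \<le> c"
proof (cases "set_integrable lebesgue A h")
  case True
  have "\<bar>LINT y:A|lebesgue. h y\<bar> \<le> (LINT y:A|lebesgue. \<bar>h y\<bar>)"
    using set_integral_norm_bound[OF True] by simp
  also have "\<dots> \<le> c" by (rule set_integral_abs_le_nn_abs[OF assms])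
  finally show ?thesis .
next
  case False
  then show ?thesis using assms
    by (simp add: set_lebesgue_integral_def set_integrable_def not_integrable_integral_eq)
qed

lemma loc_integrable_measurable:
  assumes "loc_integrable (f::'a::euclidean_space \<Rightarrow> real)"
  shows "f \<in> borel_measurable lebesgue"
proof -
  have "(\<lambda>x. indicator (cball 0 (real n)) x *\<^sub>R f x) \<in> borel_measurable lebesgue" for n
  proof -
    have "set_integrable lebesgue (cball 0 (real n)) f"
      using assms[unfolded loc_integrable_def] by simp
    then show ?thesis unfolding set_integrable_def by (rule borel_measurable_integrable)
  qed
  moreover have "(\<lambda>n. indicator (cball 0 (real n)) x *\<^sub>R f x) \<longlonglongrightarrow> f x" for x :: 'a
  proof (rule tendsto_eventually)
    obtain N where "norm x \<le> real N" using real_arch_simple by blast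
    then show "\<forall>\<^sub>F n in sequentially. indicator (cball 0 (real n)) x *\<^sub>R f x = f x"
      unfolding eventually_sequentially by (intro exI[of _ N]) (auto simp: indicator_def)
  qed
  ultimately show ?thesis
    by (rule borel_measurable_LIMSEQ_metric)
qed

lemma loc_integrable_bounded:
  assumes "loc_integrable (f::'a::euclidean_space \<Rightarrow> real)" "bounded A" "A \<in> sets lebesgue"
  shows "set_integrable lebesgue A f"
proof -
  obtain r where r: "A \<subseteq> ball 0 r" using bounded_subset_ballD[OF assms(2), of 0] by auto
  have "A \<subseteq> cball 0 r" using r ball_subset_cball by (rule subset_trans)
  moreover have "set_integrable lebesgue (cball 0 r) f"
    using assms(1)[unfolded loc_integrable_def] by simp
  ultimately show ?thesis using assms(3) by (intro set_integrable_subset[of lebesgue "cball 0 r" f A]) auto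
qed

lemma loc_integrable_ball: "loc_integrable f \<Longrightarrow> set_integrable lebesgue (ball x r) f"
  by (rule loc_integrable_bounded) auto

lemma loc_integrable_nn_abs:
  assumes "f \<in> borel_measurable lebesgue" "\<And>n::nat. nn_abs f (ball 0 (real n)) < \<infinity>"
  shows "loc_integrable (f::'a::euclidean_space \<Rightarrow> real)"
  unfolding loc_integrable_def
proof (intro allI impI)
  fix S :: "'a set" assume S: "compact S"
  obtain b where "S \<subseteq> ball 0 b" using bounded_subset_ballD[OF compact_imp_bounded[OF S], of 0] by auto
  moreover obtain n :: nat where "b \<le> real n" using real_arch_simple by blast
  ultimately have "S \<subseteq> ball 0 (real n)" by auto
  then show "set_integrable lebesgue S f"
    using set_integrable_nn_abs[OF assms(1) ball_sets_lebesgue assms(2)[of n]] S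
    by (intro set_integrable_subset[of lebesgue "ball 0 (real n)" f S]) (auto simp: borel_compact)
qed

lemma weight_nn_abs:
  assumes "weight w"
  shows "nn_abs w (ball x r) = ennreal (wmeas w (ball x r))"
proof -
  have "\<bar>w y\<bar> = w y" for y using assms by (simp add: weight_def)
  then show ?thesis
    using nn_abs_eq_set_integral[OF loc_integrable_ball, of w x r] assms by (simp add: weight_def wmeas_def)
qed

lemma wmeas_nonneg: "weight w \<Longrightarrow> 0 \<le> wmeas w A"
  unfolding wmeas_def set_lebesgue_integral_def weight_def by (intro integral_nonneg_AE) auto

text \<open>The map sending \<open>A\<close> to \<open>nn_abs h A\<close> is the measure with
  density |h|, so this is countable additivity, written as an integral over counting measure to
  allow any countable index set.\<close>

lemma nn_abs_disjoint_UN: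
  assumes "countable J" "h \<in> borel_measurable lebesgue" "\<And>j. j \<in> J \<Longrightarrow> X j \<in> sets lebesgue"
    and "disjoint_family_on X J"
  shows "(\<integral>\<^sup>+j. nn_abs h (X j) \<partial>count_space J) = nn_abs h (\<Union>j\<in>J. X j)"
proof -
  let ?M = "density lebesgue (\<lambda>y. ennreal \<bar>h y\<bar>)"
  note [measurable] = assms(2)
  have "nn_abs h A = emeasure ?M A" if "A \<in> sets lebesgue" for A
    using that unfolding nn_abs_def by (subst emeasure_density) auto
  moreover have "(\<Union>j\<in>J. X j) \<in> sets lebesgue" using assms(1,3) by auto
  ultimately show ?thesis
    using emeasure_UN_countable[of J X ?M] assms
    by (simp cong: nn_integral_cong_simp)
qed

text \<open>G is compared with \<open>g k\<close> only on the k-th dyadic shell, while F is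
  integrated over the whole ball around the shell. This enlargement costs only constants, since F is
  always controlled on balls. The shells start at \<open>R\<close> itself, so \<open>k = 0\<close>
  includes the boundary sphere.\<close>

lemma nn_integral_annuli:
  assumes [measurable]: "F \<in> borel_measurable lebesgue" and "0 < R"
    and G: "\<And>k u. 2 ^ k * R \<le> norm (u - x) \<Longrightarrow> norm (u - x) < 2 ^ Suc k * R \<Longrightarrow> G u \<le> g k"
  shows "(\<integral>\<^sup>+u\<in>- ball x R. G u * ennreal \<bar>F u\<bar> \<partial>lebesgue) \<le> (\<Sum>k. g k * nn_abs F (ball (x::'a::euclidean_space) (2 ^ Suc k * R)))"
proof -
  have ex: "\<exists>k. 2 ^ k * R \<le> norm (u - x) \<and> norm (u - x) < 2 ^ Suc k * R" if "R \<le> norm (u - x)" for u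
  proof -
    obtain n where "norm (u - x) / R < 2 ^ n" using real_arch_pow[of 2] by auto
    then have ne: "norm (u - x) < 2 ^ n * R" using \<open>0 < R\<close> by (simp add: field_simps)
    define n0 where "n0 = (LEAST n. norm (u - x) < 2 ^ n * R)"
    have 1: "norm (u - x) < 2 ^ n0 * R" unfolding n0_def by (rule LeastI[of _ n]) (rule ne)
    have "n0 \<noteq> 0" using 1 that by (auto intro!: gr0I)
    then obtain k where k: "n0 = Suc k" by (cases n0) auto
    have "\<not> norm (u - x) < 2 ^ k * R"
      using not_less_Least[of k "\<lambda>n. norm (u - x) < 2 ^ n * R"] k n0_def by auto
    then show ?thesis using 1 k by (intro exI[of _ k]) auto
  qed
  have "(\<integral>\<^sup>+u\<in>- ball x R. G u * ennreal \<bar>F u\<bar> \<partial>lebesgue)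
     \<le> (\<integral>\<^sup>+u. (\<Sum>k. g k * (ennreal \<bar>F u\<bar> * indicator (ball x (2 ^ Suc k * R)) u)) \<partial>lebesgue)"
  proof (rule nn_integral_mono)
    fix u
    show "G u * ennreal \<bar>F u\<bar> * indicator (- ball x R) u \<le> (\<Sum>k. g k * (ennreal \<bar>F u\<bar> * indicator (ball x (2 ^ Suc k * R)) u))"
    proof (cases "u \<in> ball x R")
      case False
      then have "R \<le> norm (u - x)" by (simp add: dist_norm norm_minus_commute)
      from ex[OF this] obtain k where k: "2 ^ k * R \<le> norm (u - x)" "norm (u - x) < 2 ^ Suc k * R" by auto
      have "G u * ennreal \<bar>F u\<bar> * indicator (- ball x R) u = G u * ennreal \<bar>F u\<bar>"
        using False by simp
      also have "\<dots> \<le> g k * (ennreal \<bar>F u\<bar> * indicator (ball x (2 ^ Suc k * R)) u)"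
        using k G[OF k] by (auto simp: dist_norm norm_minus_commute intro!: mult_right_mono)
      also have "\<dots> \<le> (\<Sum>k. g k * (ennreal \<bar>F u\<bar> * indicator (ball x (2 ^ Suc k * R)) u))"
        using sum_le_suminf[of "\<lambda>k. g k * (ennreal \<bar>F u\<bar> * indicator (ball x (2 ^ Suc k * R)) u)" "{k}"] by auto
      finally show ?thesis .
    qed simp
  qed
  also have "\<dots> = (\<Sum>k. g k * nn_abs F (ball x (2 ^ Suc k * R)))"
    unfolding nn_abs_def
    by (subst nn_integral_suminf) (simp_all add: nn_integral_cmult)
  finally show ?thesis .
qed

text \<open>Vitali's covering lemma, started from balls on which the mean of |\<phi>| is at least 1.
  The finite total mass bounds the radii and, by disjointness, the sum of the volumes;
  near-maximality of the radii bounds the means on all balls at least twice as large.\<close>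

lemma stopping_balls:
  fixes \<phi> :: "'a::euclidean_space \<Rightarrow> real"
  assumes [measurable]: "\<phi> \<in> borel_measurable lebesgue"
    and tot: "nn_abs \<phi> UNIV \<le> ennreal M" and "0 \<le> M"
    and ex: "\<And>z. z \<in> E \<Longrightarrow> \<exists>s>0. ennreal (vol (ball z s)) \<le> nn_abs \<phi> (ball z s)"
  obtains J s where "countable J" "J \<subseteq> E" "disjoint_family_on (\<lambda>z. ball z (s z)) J"
    "\<And>z. z \<in> J \<Longrightarrow> 0 < s z \<and> vol (ball z (s z)) \<le> M"
    "(\<integral>\<^sup>+z. ennreal (vol (ball z (s z))) \<partial>count_space J) \<le> ennreal M"
    "E \<subseteq> (\<Union>z\<in>J. ball z (5 * s z))"
    "\<And>z t. z \<in> J \<Longrightarrow> 2 * s z \<le> t \<Longrightarrow> nn_abs \<phi> (ball z t) < ennreal (vol (ball z t))"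
proof -
  define S where "S z = {s. 0 < s \<and> ennreal (vol (ball z s)) \<le> nn_abs \<phi> (ball z s)}" for z
  have volM: "vol (ball z s) \<le> M" if "s \<in> S z" for z s
  proof -
    have "ennreal (vol (ball z s)) \<le> nn_abs \<phi> UNIV"
      using that nn_abs_mono[of "ball z s" UNIV \<phi>] unfolding S_def by auto
    also note tot
    finally have "ennreal (vol (ball z s)) \<le> ennreal M" .
    then show ?thesis using \<open>0 \<le> M\<close> by (simp add: ennreal_le_iff)
  qed
  define V where "V = unit_vol TYPE('a)"
  have V: "0 < V" by (simp add: V_def)
  define b where "b = (M / V) powr (1 / real DIM('a))"
  have Sb: "s \<le> b" if "s \<in> S z" for z s
  proof -
    have s: "0 < s" using that by (simp add: S_def)
    have "s powr real DIM('a) \<le> M / V"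
      using volM[OF that] s V by (simp add: vol_ball V_def field_simps)
    then have "(s powr real DIM('a)) powr (1 / real DIM('a)) \<le> b"
      unfolding b_def by (intro powr_mono2) auto
    then show ?thesis using s by (simp add: powr_powr)
  qed
  \<comment> \<open>The supremum of the admissible radii need not be attained. Any radius beyond
    half of it will do, and this is the origin of the factor 2 in the last conclusion.\<close>
  have "\<exists>s. s \<in> S z \<and> (\<forall>t. 2 * s \<le> t \<longrightarrow> t \<notin> S z)" if z: "z \<in> E" for z
  proof -
    obtain s0 where s0: "s0 \<in> S z" using ex[OF z] by (auto simp: S_def)
    have bdd: "bdd_above (S z)" using Sb by (rule bdd_aboveI)
    have "s0 \<le> Sup (S z)" using cSup_upper[OF s0 bdd] .
    moreover have "0 < s0" using s0 by (simp add: S_def)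
    ultimately have "Sup (S z) / 2 < Sup (S z)" by simp
    then obtain s where s: "s \<in> S z" "Sup (S z) / 2 < s"
      using less_cSup_iff[OF _ bdd, of "Sup (S z) / 2"] s0 by blast
    have "t \<notin> S z" if "2 * s \<le> t" for t
      using cSup_upper[OF _ bdd, of t] s(2) that by force
    then show ?thesis using s by blast
  qed
  then obtain s where s: "\<And>z. z \<in> E \<Longrightarrow> s z \<in> S z" "\<And>z t. z \<in> E \<Longrightarrow> 2 * s z \<le> t \<Longrightarrow> t \<notin> S z"
    by metis
  have spos: "0 < s z" if "z \<in> E" for z using s(1)[OF that] by (simp add: S_def)
  have "0 < s z \<and> s z \<le> b" if "z \<in> E" for z using s(1)[OF that] Sb spos[OF that] by auto
  from Vitali_covering_lemma_cballs_balls[of E s b "\<lambda>z. z", OF this]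
  obtain J where J: "countable J" "J \<subseteq> E"
     "pairwise (\<lambda>i j. disjnt (cball i (s i)) (cball j (s j))) J"
     "\<And>i. i \<in> E \<Longrightarrow> \<exists>j. j \<in> J \<and> \<not> disjnt (cball i (s i)) (cball j (s j)) \<and>
                        cball i (s i) \<subseteq> ball j (5 * s j)"
    by blast
  have disj: "disjoint_family_on (\<lambda>z. ball z (s z)) J"
    unfolding disjoint_family_on_def
  proof (intro ballI impI)
    fix i j assume "i \<in> J" "j \<in> J" "i \<noteq> j"
    then have "disjnt (cball i (s i)) (cball j (s j))" using J(3) by (auto simp: pairwise_def)
    then show "ball i (s i) \<inter> ball j (s j) = {}"
      unfolding disjnt_def using ball_subset_cball by blast
  qed
  have "(\<integral>\<^sup>+z. ennreal (vol (ball z (s z))) \<partial>count_space J)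
      \<le> (\<integral>\<^sup>+z. nn_abs \<phi> (ball z (s z)) \<partial>count_space J)"
    using J(2) s(1) by (intro nn_integral_mono) (auto simp: S_def)
  also have "\<dots> = nn_abs \<phi> (\<Union>z\<in>J. ball z (s z))"
    by (rule nn_abs_disjoint_UN) (use J(1) disj in auto)
  also have "\<dots> \<le> nn_abs \<phi> UNIV" by (rule nn_abs_mono) simp
  also note tot
  finally have sum: "(\<integral>\<^sup>+z. ennreal (vol (ball z (s z))) \<partial>count_space J) \<le> ennreal M" .
  have cov: "E \<subseteq> (\<Union>z\<in>J. ball z (5 * s z))"
  proof
    fix z assume z: "z \<in> E"
    from J(4)[OF z] obtain j where "j \<in> J" "cball z (s z) \<subseteq> ball j (5 * s j)" by blast
    moreover have "z \<in> cball z (s z)" using spos[OF z] by simp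
    ultimately show "z \<in> (\<Union>z\<in>J. ball z (5 * s z))" by blast
  qed
  show ?thesis
  proof (rule that[OF J(1,2) disj _ sum cov])
    fix z assume "z \<in> J" then have "z \<in> E" using J(2) by blast
    then show "0 < s z \<and> vol (ball z (s z)) \<le> M" using s(1) volM spos by auto
  next
    fix z t assume "z \<in> J" and t: "2 * s z \<le> t" then have z: "z \<in> E" using J(2) by blast
    have "t \<notin> S z" by (rule s(2)[OF z t])
    moreover have "0 < t" using spos[OF z] t by simp
    ultimately show "nn_abs \<phi> (ball z t) < ennreal (vol (ball z t))"
      by (simp add: S_def)
  qed
qed

section \<open>The operator\<close>

text \<open>The weak type and kernel constants are parameters, so that the constants found below are
  uniform in functions and balls. \<open>\<nu> < \<delta>\<close> is a consequence of the range of
  \<kappa> in the theorem; it makes the smooth tail of K summable.\<close>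

locale scz =
  fixes \<rho> :: "'a::euclidean_space \<Rightarrow> real" and k0 C0 \<nu> \<delta> c m :: real
    and T :: "('a \<Rightarrow> real) \<Rightarrow> 'a \<Rightarrow> real" and K :: "'a \<Rightarrow> 'a \<Rightarrow> real" and CT CK :: real
  assumes rho: "critical_radius k0 C0 \<rho>"
    and c_pos: "0 < c" and m_pos: "0 < m" and nu_nonneg: "0 \<le> \<nu>" and nu_less_DIM: "\<nu> < real DIM('a)"
    and delta_pos: "0 < \<delta>" and delta_le1: "\<delta> \<le> 1" and nu_less_delta: "\<nu> < \<delta>"
    and lin: "linear_on_L1 T"
    and T_measurable: "integrable lebesgue f \<Longrightarrow> T f \<in> borel_measurable lebesgue"
    and CT_nonneg: "0 \<le> CT"
    and weak: "integrable lebesgue f \<Longrightarrow> 0 < t \<Longrightarrow>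
        emeasure lebesgue {x. t < \<bar>T f x\<bar>}
          \<le> ennreal ((CT * (LINT y|lebesgue. \<bar>f y\<bar>) / t) powr (real DIM('a) / (real DIM('a) - \<nu>)))"
    and K_measurable [measurable]: "K x \<in> borel_measurable lebesgue"
    and T_off_support: "integrable lebesgue f \<Longrightarrow>
        AE x in lebesgue. x \<notin> closure {y. f y \<noteq> 0} \<longrightarrow> T f x = (LINT y|lebesgue. K x y * f y)"
    and CK_nonneg: "0 \<le> CK"
    and K_size: "x \<noteq> y \<Longrightarrow>
           \<bar>K x y\<bar> \<le> CK / norm (x - y) powr (real DIM('a) - \<nu>)
                       * exp (- c * (1 + norm (x - y) / \<rho> x) powr m)"
    and K_smooth: "norm (x - y) > 2 * norm (x - x0) \<Longrightarrow>
           \<bar>K x y - K x0 y\<bar> \<le> CK / norm (x - y) powr (real DIM('a) - \<nu>)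
                       * (norm (x - x0) / norm (x - y)) powr \<delta>"
begin

definition "V = unit_vol TYPE('a)"

lemma V_pos: "0 < V" by (simp add: V_def)

lemma vol_V: "0 \<le> r \<Longrightarrow> vol (ball (x::'a) r) = V * r powr real DIM('a)"
  by (simp add: V_def vol_ball)

lemma rho_pos: "0 < \<rho> x" using rho by (simp add: critical_radius_def)

lemma T_add:
  assumes "integrable lebesgue f" "integrable lebesgue g"
  shows "AE x in lebesgue. T (\<lambda>y. f y + g y) x = T f x + T g x"
  using lin[unfolded linear_on_L1_def, rule_format, OF assms, of 1 1] by simp

lemma T_cmult:
  assumes "integrable lebesgue f"
  shows "AE x in lebesgue. T (\<lambda>y. a * f y) x = a * T f x"
  using lin[unfolded linear_on_L1_def, rule_format, OF assms assms, of a 0] by simp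

lemma T_off_open:
  assumes "integrable lebesgue f" "open G" "\<And>y. y \<in> G \<Longrightarrow> f y = 0"
  shows "AE x in lebesgue. x \<in> G \<longrightarrow> T f x = (LINT y|lebesgue. K x y * f y)"
proof -
  have "closure {y. f y \<noteq> 0} \<subseteq> - G"
    by (rule closure_minimal) (use assms in auto)
  then show ?thesis using T_off_support[OF assms(1)] by (auto elim!: eventually_mono)
qed

text \<open>Homogeneity fixes the threshold: the exponent d/(d - \<nu>) turns r^(d - \<nu>) into
  r^d. Hence one \<open>L\<close> bounds the exceptional set by a fraction \<open>e\<close> of a
  ball of radius r, simultaneously for all r and all masses \<open>H\<close>.\<close>

lemma weak_small:
  assumes "0 < e"
  shows "\<exists>L>0. \<forall>h H r. integrable lebesgue h \<longrightarrow> (LINT y|lebesgue. \<bar>h y\<bar>) \<le> H \<longrightarrow> 0 < H \<longrightarrow> 0 < r \<longrightarrow>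
    emeasure lebesgue {y. L * H * r powr (\<nu> - real DIM('a)) < \<bar>T h y\<bar>} \<le> ennreal (e * V * r powr real DIM('a))"
proof -
  define q where "q = real DIM('a) / (real DIM('a) - \<nu>)"
  have q1: "1 \<le> q" using nu_nonneg nu_less_DIM by (simp add: q_def)
  \<comment> \<open>The cap 1 is there because q is at least 1: once CT/L \<le> 1, raising it to the
    power q does not increase it.\<close>
  define b where "b = min 1 (e * V)"
  define L where "L = (CT + 1) / b"
  have b: "0 < b" using assms V_pos by (simp add: b_def)
  have L: "0 < L" using b CT_nonneg by (simp add: L_def)
  have "CT / L \<le> b"
    using b CT_nonneg by (simp add: L_def field_simps)
  then have C1: "CT / L \<le> 1" "CT / L \<le> e * V" "0 \<le> CT / L" using CT_nonneg L by (auto simp: b_def)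
  have Cq: "(CT / L) powr q \<le> e * V"
  proof -
    have "(CT / L) powr q \<le> (CT / L) powr 1" using C1 q1 by (intro powr_mono') auto
    then show ?thesis using C1 by simp
  qed
  show ?thesis
  proof (intro exI[of _ L] conjI L allI impI)
    fix h :: "'a \<Rightarrow> real" and H r :: real
    assume h: "integrable lebesgue h" and H: "(LINT y|lebesgue. \<bar>h y\<bar>) \<le> H" "0 < H" and r: "0 < r"
    let ?t = "L * H * r powr (\<nu> - real DIM('a))"
    have t: "0 < ?t" using L H r by simp
    have "(CT * (LINT y|lebesgue. \<bar>h y\<bar>) / ?t) \<le> CT * H / ?t"
      using H t CT_nonneg by (intro divide_right_mono mult_left_mono) auto
    also have "\<dots> = (CT / L) * r powr (real DIM('a) - \<nu>)"
      using H r L by (simp add: field_simps powr_diff)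
    finally have le: "(CT * (LINT y|lebesgue. \<bar>h y\<bar>) / ?t) \<le> (CT / L) * r powr (real DIM('a) - \<nu>)" .
    have nn: "0 \<le> CT * (LINT y|lebesgue. \<bar>h y\<bar>) / ?t"
      using t CT_nonneg by (intro divide_nonneg_pos mult_nonneg_nonneg integral_nonneg_AE) auto
    have "(CT * (LINT y|lebesgue. \<bar>h y\<bar>) / ?t) powr q \<le> ((CT / L) * r powr (real DIM('a) - \<nu>)) powr q"
      using le nn q1 by (intro powr_mono2) auto
    also have "\<dots> = (CT / L) powr q * r powr ((real DIM('a) - \<nu>) * q)"
      using C1 by (subst powr_mult) (simp_all add: powr_powr)
    also have "(real DIM('a) - \<nu>) * q = real DIM('a)"
      using nu_less_DIM by (simp add: q_def)
    also have "(CT / L) powr q * r powr real DIM('a) \<le> e * V * r powr real DIM('a)"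
      using Cq by (intro mult_right_mono) auto
    finally have "(CT * (LINT y|lebesgue. \<bar>h y\<bar>) / ?t) powr q \<le> e * V * r powr real DIM('a)" .
    then show "emeasure lebesgue {y. ?t < \<bar>T h y\<bar>} \<le> ennreal (e * V * r powr real DIM('a))"
      using weak[OF h t] unfolding q_def by (meson ennreal_leI order_trans)
  qed
qed

text \<open>Covers zero mass, which \<open>weak_small\<close> excludes because its threshold would
  be 0.\<close>

lemma T_null:
  assumes h: "integrable lebesgue h" and 0: "(LINT y|lebesgue. \<bar>h y\<bar>) = 0"
  shows "AE y in lebesgue. T h y = 0"
proof -
  have "emeasure lebesgue {x. t < \<bar>T h x\<bar>} = 0" if "0 < t" for t
    using weak[OF h that] 0 by simp
  moreover have "{x. t < \<bar>T h x\<bar>} \<in> sets lebesgue" for t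
  proof -
    note [measurable] = T_measurable[OF h]
    have "{x \<in> space lebesgue. t < \<bar>T h x\<bar>} \<in> sets lebesgue" by measurable
    then show ?thesis by simp
  qed
  ultimately have "AE x in lebesgue. \<not> t < \<bar>T h x\<bar>" if "0 < t" for t
    using that by (intro AE_not_in[of "{x. t < \<bar>T h x\<bar>}", simplified]) (auto simp: null_sets_def)
  then have "AE x in lebesgue. \<forall>n::nat. \<not> inverse (real (Suc n)) < \<bar>T h x\<bar>"
    unfolding AE_all_countable by auto
  then show ?thesis
  proof (rule eventually_mono)
    fix x assume *: "\<forall>n::nat. \<not> inverse (real (Suc n)) < \<bar>T h x\<bar>"
    show "T h x = 0"
    proof (rule ccontr)
      assume "T h x \<noteq> 0"
      then obtain n where "inverse (real (Suc n)) < \<bar>T h x\<bar>" using reals_Archimedean[of "\<bar>T h x\<bar>"] by auto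
      with * show False by blast
    qed
  qed
qed

lemma K_bdd:
  assumes "0 < t" "t \<le> norm (x - y)"
  shows "\<bar>K x y\<bar> \<le> CK * t powr (\<nu> - real DIM('a))"
proof -
  have xy: "x \<noteq> y" using assms by auto
  have "\<bar>K x y\<bar> \<le> CK / norm (x - y) powr (real DIM('a) - \<nu>) * exp (- c * (1 + norm (x - y) / \<rho> x) powr m)"
    by (rule K_size[OF xy])
  also have "\<dots> \<le> CK / norm (x - y) powr (real DIM('a) - \<nu>) * 1"
    using CK_nonneg c_pos by (intro mult_left_mono) auto
  also have "\<dots> \<le> CK / t powr (real DIM('a) - \<nu>)"
    using CK_nonneg assms nu_less_DIM xy unfolding mult_1_right
    by (intro divide_left_mono powr_mono2 mult_pos_pos) auto
  also have "\<dots> = CK * t powr (\<nu> - real DIM('a))"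
    using assms powr_minus_divide[of t "real DIM('a) - \<nu>"] by simp
  finally show ?thesis .
qed

lemma K_mult_integrable:
  assumes "integrable lebesgue h" "0 < t" "\<And>u. norm (x - u) < t \<Longrightarrow> h u = 0"
  shows "integrable lebesgue (\<lambda>u. K x u * h u)"
proof (rule Bochner_Integration.integrable_bound)
  show "integrable lebesgue (\<lambda>u. (CK * t powr (\<nu> - real DIM('a))) * h u)" using assms by simp
  show "(\<lambda>u. K x u * h u) \<in> borel_measurable lebesgue" using assms by measurable
  show "AE u in lebesgue. norm (K x u * h u) \<le> norm (CK * t powr (\<nu> - real DIM('a)) * h u)"
  proof (rule AE_I2)
    fix u show "norm (K x u * h u) \<le> norm (CK * t powr (\<nu> - real DIM('a)) * h u)"
      using K_bdd[of t x u] CK_nonneg assms(2) assms(3)[of u]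
      by (cases "norm (x - u) < t") (auto simp: abs_mult intro!: mult_right_mono)
  qed
qed

text \<open>The sum of the series over dyadic shells in \<open>smooth_tail\<close>; its ratio
  2^(\<nu> - \<delta>) is less than 1 by \<open>nu_less_delta\<close>.\<close>

definition "Ctail = CK * V * 3 powr real DIM('a) / (1 - 2 powr (\<nu> - \<delta>))"

lemma Ctail_nonneg: "0 \<le> Ctail"
  using CK_nonneg V_pos nu_less_delta powr_less_one[of 2 "\<nu> - \<delta>"] unfolding Ctail_def by simp

text \<open>On the k-th shell around 3B one has |y - u| \<ge> 3 * 2^k p - p \<ge> 2^(k+1) p > 2 |y -
  z|. This is why balls are removed with dilation 3: the smoothness condition then applies
  everywhere outside.\<close>

lemma K_smooth_annulus:
  assumes p: "0 < p" "norm (y - z) < p" and u: "2 ^ k * (3 * p) \<le> norm (u - z)"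
  shows "\<bar>K y u - K z u\<bar> \<le> CK * (2 ^ Suc k * p) powr (\<nu> - real DIM('a)) * (1 / 2 ^ Suc k) powr \<delta>"
proof -
  have k1: "(1::real) \<le> 2 ^ k" by simp
  have kp: "p \<le> 2 ^ k * p" using k1 p by simp
  have D: "2 ^ Suc k * p \<le> norm (y - u)"
  proof -
    have "3 * (2 ^ k * p) \<le> norm (u - z)" using u by (simp add: algebra_simps)
    moreover have "norm (u - z) \<le> norm (y - z) + norm (y - u)"
      using norm_triangle_ineq4[of "y - z" "y - u"] by simp
    moreover have "2 ^ Suc k * p = 2 * (2 ^ k * p)" by simp
    ultimately show ?thesis using p kp by linarith
  qed
  then have "2 * norm (y - z) < norm (y - u)" using p kp unfolding power_Suc mult.assoc by linarith
  from K_smooth[OF this] have "\<bar>K y u - K z u\<bar>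
     \<le> CK / norm (y - u) powr (real DIM('a) - \<nu>) * (norm (y - z) / norm (y - u)) powr \<delta>" .
  also have "\<dots> \<le> CK / (2 ^ Suc k * p) powr (real DIM('a) - \<nu>) * (1 / 2 ^ Suc k) powr \<delta>"
  proof (intro mult_mono divide_left_mono powr_mono2)
    show "norm (y - z) / norm (y - u) \<le> 1 / 2 ^ Suc k"
    proof -
      have "norm (y - z) / norm (y - u) \<le> p / (2 ^ Suc k * p)"
        using D p by (intro frac_le) auto
      then show ?thesis using p by simp
    qed
    have "0 < norm (y - u)" using D p by (smt (verit) zero_less_mult_iff zero_less_power)
    then show "0 < norm (y - u) powr (real DIM('a) - \<nu>) * (2 ^ Suc k * p) powr (real DIM('a) - \<nu>)"
      using p by simp
  qed (use D p CK_nonneg delta_pos nu_less_DIM in auto)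
  also have "CK / (2 ^ Suc k * p) powr (real DIM('a) - \<nu>) = CK * (2 ^ Suc k * p) powr (\<nu> - real DIM('a))"
    using p powr_minus_divide[of "2 ^ Suc k * p" "real DIM('a) - \<nu>"] by simp
  finally show ?thesis .
qed

text \<open>If the means of |h| on balls about z of radius at least 3p are at most \<mu>, shell k
  contributes a multiple of \<mu> p^\<nu> 2^((k+1)(\<nu> - \<delta>)): the size of the kernel times
  the volume leaves the power \<nu>, and smoothness gains \<delta>.\<close>

lemma smooth_tail:
  assumes h: "h \<in> borel_measurable lebesgue" and p: "0 < p" and mu: "0 \<le> \<mu>"
    and bd: "\<And>t. 3 * p \<le> t \<Longrightarrow> nn_abs h (ball z t) \<le> ennreal (\<mu> * (V * t powr real DIM('a)))"
    and y: "y \<in> ball z p"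
  shows "(\<integral>\<^sup>+u\<in>- ball z (3 * p). ennreal \<bar>K y u - K z u\<bar> * ennreal \<bar>h u\<bar> \<partial>lebesgue) \<le> ennreal (Ctail * \<mu> * p powr \<nu>)"
proof -
  define g where "g k = CK * (2 ^ Suc k * p) powr (\<nu> - real DIM('a)) * (1 / 2 ^ Suc k) powr \<delta>" for k :: nat
  define x where "x = 2 powr (\<nu> - \<delta>)"
  have x: "0 < x" "x < 1" using nu_less_delta unfolding x_def by (auto simp: powr_less_one)
  have g0: "0 \<le> g k" for k using CK_nonneg by (simp add: g_def)
  have yz: "norm (y - z) < p" using y by (simp add: dist_norm norm_minus_commute)
  have "(\<integral>\<^sup>+u\<in>- ball z (3 * p). ennreal \<bar>K y u - K z u\<bar> * ennreal \<bar>h u\<bar> \<partial>lebesgue)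
     \<le> (\<Sum>k. ennreal (g k) * nn_abs h (ball z (2 ^ Suc k * (3 * p))))"
    by (rule nn_integral_annuli[OF h])
       (use p K_smooth_annulus[OF p yz] in \<open>auto intro!: ennreal_leI simp: g_def\<close>)
  also have "\<dots> \<le> (\<Sum>k. ennreal (CK * V * 3 powr real DIM('a) * \<mu> * p powr \<nu> * x ^ Suc k))"
  proof (rule suminf_le)
    fix k
    have "(1::real) \<le> 2 ^ Suc k" by (rule one_le_power) simp
    then have "3 * p \<le> 2 ^ Suc k * (3 * p)" using p mult_right_mono[of 1 "2 ^ Suc k" "3 * p"] by simp
    from bd[OF this] have "ennreal (g k) * nn_abs h (ball z (2 ^ Suc k * (3 * p)))
       \<le> ennreal (g k) * ennreal (\<mu> * (V * (2 ^ Suc k * (3 * p)) powr real DIM('a)))"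
      by (rule mult_left_mono) simp
    also have "\<dots> = ennreal (g k * (\<mu> * (V * (2 ^ Suc k * (3 * p)) powr real DIM('a))))"
      using g0 mu V_pos by (simp add: ennreal_mult)
    also have "g k * (\<mu> * (V * (2 ^ Suc k * (3 * p)) powr real DIM('a)))
       = CK * V * 3 powr real DIM('a) * \<mu> * p powr \<nu> * x ^ Suc k"
    proof -
      define t :: real where "t = 2 ^ Suc k"
      have t: "0 < t" by (simp add: t_def)
      have xk: "x ^ Suc k = t powr (\<nu> - \<delta>)"
        unfolding x_def t_def by (simp add: powr_power powr_realpow[symmetric] powr_powr del: power_Suc)
           (simp add: mult.commute)
      have "g k * (\<mu> * (V * (2 ^ Suc k * (3 * p)) powr real DIM('a)))
        = CK * (t * p) powr (\<nu> - real DIM('a)) * (1 / t) powr \<delta> * (\<mu> * (V * (3 * (t * p)) powr real DIM('a)))"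
        by (simp add: g_def t_def algebra_simps)
      also have "\<dots> = CK * V * 3 powr real DIM('a) * \<mu> * ((t * p) powr (\<nu> - real DIM('a)) * (t * p) powr real DIM('a)) * t powr (- \<delta>)"
        using t p by (simp add: powr_mult powr_divide powr_minus field_simps)
      also have "(t * p) powr (\<nu> - real DIM('a)) * (t * p) powr real DIM('a) = t powr \<nu> * p powr \<nu>"
        using t p by (simp add: powr_mult powr_diff field_simps)
      also have "CK * V * 3 powr real DIM('a) * \<mu> * (t powr \<nu> * p powr \<nu>) * t powr - \<delta>
         = CK * V * 3 powr real DIM('a) * \<mu> * p powr \<nu> * (t powr \<nu> * t powr - \<delta>)" by simp
      finally show ?thesis unfolding xk by (simp flip: powr_add)
    qed
    finally show "ennreal (g k) * nn_abs h (ball z (2 ^ Suc k * (3 * p)))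
       \<le> ennreal (CK * V * 3 powr real DIM('a) * \<mu> * p powr \<nu> * x ^ Suc k)" .
  qed auto
  also have "\<dots> = ennreal (\<Sum>k. CK * V * 3 powr real DIM('a) * \<mu> * p powr \<nu> * x ^ Suc k)"
    using x CK_nonneg V_pos mu
    by (intro suminf_ennreal2) (auto intro!: summable_mult summable_geometric simp del: power_Suc
         simp: summable_Suc_iff)
  also have "(\<Sum>k. CK * V * 3 powr real DIM('a) * \<mu> * p powr \<nu> * x ^ Suc k)
     = CK * V * 3 powr real DIM('a) * \<mu> * p powr \<nu> * (x / (1 - x))"
    using x by (subst suminf_mult) (auto simp: suminf_mult suminf_geometric summable_geometric intro!: summable_mult)
  also have "\<dots> \<le> CK * V * 3 powr real DIM('a) * \<mu> * p powr \<nu> * (1 / (1 - x))"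
    using x CK_nonneg V_pos mu by (intro mult_left_mono divide_right_mono) auto
  also have "\<dots> = Ctail * \<mu> * p powr \<nu>" by (simp add: Ctail_def x_def)
  finally show ?thesis by (simp add: ennreal_leI)
qed

end

section \<open>Stopping balls and the local estimate\<close>

lemma nn_abs_le_cmult:
  assumes "g \<in> borel_measurable lebesgue" "A \<in> sets lebesgue" "0 \<le> a" "\<And>y. y \<in> A \<Longrightarrow> \<bar>f y\<bar> \<le> a * \<bar>g y\<bar>"
  shows "nn_abs f A \<le> ennreal a * nn_abs g A"
proof -
  note [measurable] = assms(1,2)
  have "nn_abs f A \<le> (\<integral>\<^sup>+y. ennreal a * (ennreal \<bar>g y\<bar> * indicator A y) \<partial>lebesgue)"
    unfolding nn_abs_def using assms(3,4)
    by (intro nn_integral_mono) (auto split: split_indicator intro!: ennreal_leI simp flip: ennreal_mult)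
  also have "\<dots> = ennreal a * nn_abs g A"
    unfolding nn_abs_def by (rule nn_integral_cmult) measurable
  finally show ?thesis .
qed

lemma nn_abs_mono_fun:
  assumes "\<And>y. y \<in> A \<Longrightarrow> \<bar>f y\<bar> \<le> \<bar>g y\<bar>"
  shows "nn_abs f A \<le> nn_abs g A"
  unfolding nn_abs_def using assms by (intro nn_integral_mono) (auto split: split_indicator)

lemma nn_abs_indicator: "nn_abs (\<lambda>y. h y * indicator B y) A = nn_abs h (A \<inter> B)"
  unfolding nn_abs_def by (intro nn_integral_cong) (auto split: split_indicator)

lemma integrable_mult_indicator_nn_abs:
  assumes "h \<in> borel_measurable lebesgue" "A \<in> sets lebesgue" "nn_abs h A < \<infinity>"
  shows "integrable lebesgue (\<lambda>y. h y * indicator A y :: real)"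
  using set_integrable_nn_abs[OF assms] unfolding set_integrable_def by (simp add: mult.commute)

lemma LINT_abs_eq: "(LINT y|lebesgue. \<bar>h y * indicator A y :: real\<bar>) = (LINT y:A|lebesgue. \<bar>h y\<bar>)"
  unfolding set_lebesgue_integral_def by (intro Bochner_Integration.integral_cong) (auto split: split_indicator)

lemma LINT_abs_le:
  assumes "nn_abs h A \<le> ennreal H" "0 \<le> H"
  shows "(LINT y|lebesgue. \<bar>h y * indicator A y :: real\<bar>) \<le> H"
  unfolding LINT_abs_eq by (rule set_integral_abs_le_nn_abs[OF assms])

context scz
begin

text \<open>The fraction 1/4 is for a comparison of volumes: next to an exceptional set filling half
  of a ball it still leaves a quarter of the ball, where a good point can be chosen.\<close>

definition "weak_const L \<longleftrightarrow> (\<forall>h H r. integrable lebesgue h \<longrightarrow> (LINT y|lebesgue. \<bar>h y\<bar>) \<le> H \<longrightarrow> 0 < H \<longrightarrow> 0 < r \<longrightarrow>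
    emeasure lebesgue {y. L * H * r powr (\<nu> - real DIM('a)) < \<bar>T h y\<bar>} \<le> ennreal (1/4 * V * r powr real DIM('a)))"

definition "L4 = (SOME L. 0 < L \<and> weak_const L)"

lemma L4_weak: "0 < L4 \<and> weak_const L4"
proof -
  have "\<exists>L. 0 < L \<and> weak_const L"
    unfolding weak_const_def by (rule weak_small) simp
  from someI_ex[OF this] show ?thesis unfolding L4_def .
qed

lemmas L4 = conjunct1[OF L4_weak] conjunct2[OF L4_weak, unfolded weak_const_def, rule_format]

text \<open>On a stopping ball \<open>P\<close> the part of the operator coming from outside \<open>3P\<close> is nearly
  constant, and its size is read off at a point of \<open>P\<close> outside the exceptional set.\<close>

lemma stopping_ball_bound:
  assumes h: "integrable lebesgue h" and p: "0 < p" and mu: "0 < \<mu>"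
    and bd: "\<And>t. 3 * p \<le> t \<Longrightarrow> nn_abs h (ball z t) \<le> ennreal (\<mu> * (V * t powr real DIM('a)))"
    and U [measurable]: "U \<in> sets lebesgue"
    and Us: "emeasure lebesgue (U \<inter> ball z p) \<le> ennreal (1/2 * V * p powr real DIM('a))"
    and good: "\<And>y. y \<notin> U \<Longrightarrow> \<bar>T h y\<bar> \<le> lam"
  shows "AE y in lebesgue. y \<in> ball z p \<longrightarrow> \<bar>T h y\<bar> \<le> \<bar>T (\<lambda>u. h u * indicator (ball z (3 * p)) u) y\<bar>
            + (lam + (L4 * V * 3 powr real DIM('a) + 2 * Ctail) * \<mu> * p powr \<nu>)"
proof -
  let ?P = "ball z p" and ?Q = "ball z (3 * p)"
  define h3 where "h3 = (\<lambda>u. h u * indicator ?Q u)"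
  define h2 where "h2 = (\<lambda>u. h u * indicator (- ?Q) u)"
  have [measurable]: "h \<in> borel_measurable lebesgue" using h by auto
  have Qs: "- ?Q \<in> sets lebesgue" by (simp add: Compl_in_sets_lebesgue)
  have h3i: "integrable lebesgue h3" and h2i: "integrable lebesgue h2"
    unfolding h3_def h2_def using h Qs by (auto intro: integrable_real_mult_indicator)
  define tl where "tl = Ctail * \<mu> * p powr \<nu>"
  have tl0: "0 \<le> tl" using Ctail_nonneg mu by (simp add: tl_def)
  have h2_0: "h2 u = 0" if "u \<in> ?P" for u
    using that p by (auto simp: h2_def indicator_def)
  have Kint: "integrable lebesgue (\<lambda>u. K y u * h2 u)" if "y \<in> ?P" for y
  proof (rule K_mult_integrable[OF h2i p])
    fix u assume u: "norm (y - u) < p"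
    have "dist z u < 3 * p" using that u p dist_triangle_less_add[of z y p u p] by (simp add: dist_norm norm_minus_commute)
    then show "h2 u = 0" by (simp add: h2_def)
  qed
  \<comment> \<open>The far part of T h at the centre. Its size is inferred from a single good point
    below, since summing |K| over the shells would lack the decaying factor 2^(-k \<delta>).\<close>
  define k where "k = (LINT u|lebesgue. K z u * h2 u)"
  have tail: "\<bar>(LINT u|lebesgue. K y u * h2 u) - k\<bar> \<le> tl" if y: "y \<in> ?P" for y
  proof -
    have zP: "z \<in> ?P" using p by simp
    have "(LINT u|lebesgue. K y u * h2 u) - k = (LINT u|lebesgue. K y u * h2 u - K z u * h2 u)"
      unfolding k_def by (rule Bochner_Integration.integral_diff[symmetric]) (use Kint y zP in auto)
    also have "(\<lambda>u. K y u * h2 u - K z u * h2 u) = (\<lambda>u. indicator (- ?Q) u *\<^sub>R ((K y u - K z u) * h u))"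
      by (auto simp: h2_def fun_eq_iff algebra_simps split: split_indicator)
    finally have eq: "(LINT u|lebesgue. K y u * h2 u) - k = (LINT u:- ?Q|lebesgue. (K y u - K z u) * h u)"
      by (simp add: set_lebesgue_integral_def)
    have "nn_abs (\<lambda>u. (K y u - K z u) * h u) (- ?Q) \<le> ennreal tl"
      using smooth_tail[of h p \<mu> z y] bd p mu y unfolding nn_abs_def tl_def
      by (simp add: abs_mult ennreal_mult)
    from abs_set_integral_le_nn_abs[OF this tl0] show ?thesis unfolding eq .
  qed
  have split: "AE y in lebesgue. T h y = T h3 y + T h2 y"
  proof -
    have "(\<lambda>u. h3 u + h2 u) = h" by (auto simp: h3_def h2_def fun_eq_iff split: split_indicator)
    then show ?thesis using T_add[OF h3i h2i] by simp
  qed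
  have off: "AE y in lebesgue. y \<in> ?P \<longrightarrow> T h2 y = (LINT u|lebesgue. K y u * h2 u)"
    by (rule T_off_open[OF h2i open_ball h2_0])
  define H3 where "H3 = \<mu> * (V * (3 * p) powr real DIM('a))"
  have H3: "0 < H3" using mu V_pos p by (simp add: H3_def)
  have "(LINT y|lebesgue. \<bar>h3 y\<bar>) \<le> H3"
    unfolding h3_def by (rule LINT_abs_le) (use bd[of "3 * p"] H3 in \<open>auto simp: H3_def\<close>)
  note w = L4(2)[OF h3i this H3 p]
  define lam2 where "lam2 = L4 * H3 * p powr (\<nu> - real DIM('a))"
  have lam2: "lam2 = L4 * V * 3 powr real DIM('a) * \<mu> * p powr \<nu>"
    using p by (simp add: lam2_def H3_def powr_mult powr_diff)
  define Bd where "Bd = {y. lam2 < \<bar>T h3 y\<bar>}"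
  have Bds: "Bd \<in> sets lebesgue"
  proof -
    note [measurable] = T_measurable[OF h3i]
    have "{y \<in> space lebesgue. lam2 < \<bar>T h3 y\<bar>} \<in> sets lebesgue" by measurable
    then show ?thesis by (simp add: Bd_def)
  qed
  have ae: "AE y in lebesgue. T h y = T h3 y + T h2 y \<and> (y \<in> ?P \<longrightarrow> T h2 y = (LINT u|lebesgue. K y u * h2 u))"
    using split off by auto
  \<comment> \<open>A point of the ball outside \<open>U\<close> and outside the level set of T h3
    exists because 1/2 + 1/4 < 1. There T h and T h3 are bounded, hence so is their difference, the
    far part.\<close>
  have "\<exists>y. T h y = T h3 y + T h2 y \<and> T h2 y = (LINT u|lebesgue. K y u * h2 u) \<and> y \<in> ?P \<and> y \<notin> U \<and> \<bar>T h3 y\<bar> \<le> lam2"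
  proof (rule ccontr)
    assume no: "\<not> ?thesis"
    have sub: "AE y in lebesgue. y \<in> ?P \<longrightarrow> y \<in> (U \<inter> ?P) \<union> Bd"
      using ae by (rule eventually_mono) (use no in \<open>auto simp: Bd_def\<close>)
    have "emeasure lebesgue ?P \<le> emeasure lebesgue ((U \<inter> ?P) \<union> Bd)"
      by (rule emeasure_mono_AE[OF sub]) (use Bds in auto)
    also have "\<dots> \<le> emeasure lebesgue (U \<inter> ?P) + emeasure lebesgue Bd"
      by (rule emeasure_subadditive) (use Bds in auto)
    also have "\<dots> \<le> ennreal (1/2 * V * p powr real DIM('a)) + ennreal (1/4 * V * p powr real DIM('a))"
      using Us w unfolding Bd_def lam2_def by (rule add_mono)
    also have "\<dots> = ennreal (3/4 * V * p powr real DIM('a))"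
      using V_pos by (subst ennreal_plus[symmetric]) auto
    finally have "ennreal (V * p powr real DIM('a)) \<le> ennreal (3/4 * V * p powr real DIM('a))"
      using emeasure_ball_lebesgue[of p z] p by (simp add: V_def)
    then show False using V_pos p by (simp add: ennreal_le_iff)
  qed
  then obtain y0 where y0: "T h y0 = T h3 y0 + T h2 y0" "T h2 y0 = (LINT u|lebesgue. K y0 u * h2 u)"
    "y0 \<in> ?P" "y0 \<notin> U" "\<bar>T h3 y0\<bar> \<le> lam2" by blast
  have k: "\<bar>k\<bar> \<le> lam + lam2 + tl"
    using tail[OF y0(3)] good[OF y0(4)] y0 by linarith
  show ?thesis using ae
  proof (rule eventually_mono)
    fix y assume y: "T h y = T h3 y + T h2 y \<and> (y \<in> ?P \<longrightarrow> T h2 y = (LINT u|lebesgue. K y u * h2 u))"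
    show "y \<in> ball z p \<longrightarrow> \<bar>T h y\<bar> \<le> \<bar>T (\<lambda>u. h u * indicator (ball z (3 * p)) u) y\<bar>
            + (lam + (L4 * V * 3 powr real DIM('a) + 2 * Ctail) * \<mu> * p powr \<nu>)"
    proof
      assume yP: "y \<in> ?P"
      have "\<bar>T h y\<bar> \<le> \<bar>T h3 y\<bar> + (lam + lam2 + 2 * tl)"
        using tail[OF yP] y yP k by linarith
      then show "\<bar>T h y\<bar> \<le> \<bar>T (\<lambda>u. h u * indicator (ball z (3 * p)) u) y\<bar>
            + (lam + (L4 * V * 3 powr real DIM('a) + 2 * Ctail) * \<mu> * p powr \<nu>)"
        unfolding h3_def[symmetric] lam2 tl_def by (simp add: algebra_simps)
    qed
  qed
qed

end

lemma UNIV_sets_lebesgue [measurable, simp]: "UNIV \<in> sets (lebesgue :: 'a::euclidean_space measure)"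
  using sets.top[of "lebesgue :: 'a measure"] by (simp del: sets.top)

context scz
begin

lemma emeasure_ball_V: "0 \<le> r \<Longrightarrow> emeasure lebesgue (ball (x::'a) r) = ennreal (V * r powr real DIM('a))"
  by (simp only: emeasure_ball_vol vol_V)

text \<open>The stopping rule serves two purposes at once. \<open>U\<close> is open around the level
  set of T h1, and \<phi> combines the density of \<open>U\<close> with the mean of |h1|. Beyond the
  stopping radius at least half of a ball lies outside \<open>U\<close> and the mean of |h1| is at
  most \<mu>; with these two facts \<open>stopping_ball_bound\<close> compares T h1 on the 5-fold
  ball with T of the part of h in the 15-fold ball. There the same h reappears at a smaller scale,
  so the lemma can be iterated.\<close>

lemma one_step:
  assumes e: "0 < e" "e \<le> 1/2"
  shows "\<exists>C\<ge>0. \<forall>x r h H. 0 < r \<longrightarrow> h \<in> borel_measurable lebesgue \<longrightarrow> 0 \<le> H \<longrightarrow> nn_abs h (ball x (3 * r)) \<le> ennreal H \<longrightarrow>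
    (\<exists>J s. countable J \<and> J \<subseteq> ball x r \<and> disjoint_family_on (\<lambda>z. ball z (s z)) J \<and> (\<forall>z\<in>J. 0 < s z \<and> 5 * s z \<le> e * r)
      \<and> (\<integral>\<^sup>+z. ennreal (vol (ball z (s z))) \<partial>count_space J) \<le> ennreal (e * vol (ball x r))
      \<and> (\<forall>z\<in>J. nn_abs h (ball z (15 * s z)) \<le> ennreal (C * H * (s z / r) powr real DIM('a)))
      \<and> (AE y in lebesgue. y \<in> ball x r \<longrightarrow>
           \<bar>T (\<lambda>u. h u * indicator (ball x (3 * r)) u) y\<bar> \<le> C * H * r powr (\<nu> - real DIM('a))
         \<or> (\<exists>z\<in>J. y \<in> ball z (5 * s z) \<and> \<bar>T (\<lambda>u. h u * indicator (ball x (3 * r)) u) y\<bar>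
                \<le> \<bar>T (\<lambda>u. h u * indicator (ball z (15 * s z)) u) y\<bar> + C * H * r powr (\<nu> - real DIM('a)))))"
proof -
  let ?d = "real DIM('a)"
  \<comment> \<open>Relative to |B| the total mass of \<phi> is at most 5 \<eta>: 4 \<eta> from
    \<open>U\<close> and \<eta> from h1. The bound of 5 \<eta> by \<open>e\<close> controls the sum
    of the volumes, the bound by (e/5)^d each single radius.\<close>
  define \<eta> where "\<eta> = min (e / 5) ((e / 5) powr ?d / 5)"
  have eta: "0 < \<eta>" "5 * \<eta> \<le> e" "5 * \<eta> \<le> (e / 5) powr ?d"
    using e by (auto simp: \<eta>_def min_def)
  obtain L where L: "0 < L" and Lw: "\<And>h H r. integrable lebesgue h \<Longrightarrow> (LINT y|lebesgue. \<bar>h y\<bar>) \<le> H \<Longrightarrow> 0 < H \<Longrightarrow> 0 < r \<Longrightarrow>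
    emeasure lebesgue {y. L * H * r powr (\<nu> - ?d) < \<bar>T h y\<bar>} \<le> ennreal (\<eta> * V * r powr ?d)"
    using weak_small[OF eta(1)] by blast
  define C1 where "C1 = L + (L4 * V * 3 powr ?d + 2 * Ctail) * (1 / (\<eta> * V))"
  define C2 where "C2 = 15 powr ?d / \<eta>"
  have nn: "0 \<le> (L4 * V * 3 powr ?d + 2 * Ctail)" using L4(1) V_pos Ctail_nonneg by simp
  have C12: "L \<le> C1" "0 \<le> C1" "0 \<le> C2" using nn L eta V_pos by (auto simp: C1_def C2_def)
  show ?thesis
  proof (intro exI[of _ "C1 + C2"] conjI allI impI)
    show "0 \<le> C1 + C2" using C12 by simp
    fix x :: 'a and r :: real and h :: "'a \<Rightarrow> real" and H :: real
    assume r: "0 < r" and [measurable]: "h \<in> borel_measurable lebesgue" and H0: "0 \<le> H"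
      and hH: "nn_abs h (ball x (3 * r)) \<le> ennreal H"
    define h1 where "h1 = (\<lambda>u. h u * indicator (ball x (3 * r)) u)"
    have h1m [measurable]: "h1 \<in> borel_measurable lebesgue" unfolding h1_def by measurable
    have h1i: "integrable lebesgue h1"
      unfolding h1_def by (rule integrable_mult_indicator_nn_abs) (use order_le_less_trans[OF hH] in auto)
    have h1H: "(LINT y|lebesgue. \<bar>h1 y\<bar>) \<le> H"
      unfolding h1_def by (rule LINT_abs_le[OF hH H0])
    show "\<exists>J s. countable J \<and> J \<subseteq> ball x r \<and> disjoint_family_on (\<lambda>z. ball z (s z)) J \<and> (\<forall>z\<in>J. 0 < s z \<and> 5 * s z \<le> e * r)
      \<and> (\<integral>\<^sup>+z. ennreal (vol (ball z (s z))) \<partial>count_space J) \<le> ennreal (e * vol (ball x r))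
      \<and> (\<forall>z\<in>J. nn_abs h (ball z (15 * s z)) \<le> ennreal ((C1 + C2) * H * (s z / r) powr ?d))
      \<and> (AE y in lebesgue. y \<in> ball x r \<longrightarrow>
           \<bar>T (\<lambda>u. h u * indicator (ball x (3 * r)) u) y\<bar> \<le> (C1 + C2) * H * r powr (\<nu> - ?d)
         \<or> (\<exists>z\<in>J. y \<in> ball z (5 * s z) \<and> \<bar>T (\<lambda>u. h u * indicator (ball x (3 * r)) u) y\<bar>
                \<le> \<bar>T (\<lambda>u. h u * indicator (ball z (15 * s z)) u) y\<bar> + (C1 + C2) * H * r powr (\<nu> - ?d)))"
    \<comment> \<open>For \<open>H = 0\<close> a threshold proportional to \<open>H\<close> is not
      positive. Then T h1 vanishes almost everywhere and the empty family works.\<close>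
    proof (cases "H = 0")
      case True
      have "(LINT y|lebesgue. \<bar>h1 y\<bar>) = 0"
        using h1H True by (intro antisym integral_nonneg_AE) auto
      from T_null[OF h1i this] show ?thesis
        by (intro exI[of _ "{}"] exI[of _ "\<lambda>_. 1"])
           (use e vol_ball_pos[OF r, of x] True in \<open>auto simp: disjoint_family_on_def h1_def nn_integral_count_space_finite\<close>)
    next
      case False
      with H0 have H: "0 < H" by simp
      define lam where "lam = L * H * r powr (\<nu> - ?d)"
      have lam0: "0 < lam" using L H r by (simp add: lam_def)
      \<comment> \<open>Normalised so that |h1| / \<mu> has integral at most \<eta> |B|.\<close>
      define \<mu> where "\<mu> = H / (\<eta> * V * r powr ?d)"
      have mu: "0 < \<mu>" using H eta V_pos r by (simp add: \<mu>_def)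
      define E where "E = {y. lam < \<bar>T h1 y\<bar>}"
      have Es: "E \<in> sets lebesgue"
      proof -
        note [measurable] = T_measurable[OF h1i]
        have "{y \<in> space lebesgue. lam < \<bar>T h1 y\<bar>} \<in> sets lebesgue" by measurable
        then show ?thesis by (simp add: E_def)
      qed
      have Em: "emeasure lebesgue E \<le> ennreal (\<eta> * V * r powr ?d)"
        using Lw[OF h1i h1H H r] unfolding E_def lam_def .
      have pos: "0 < \<eta> * V * r powr ?d" using eta V_pos r by simp
      \<comment> \<open>The level set \<open>E\<close> is merely measurable, so its points need not
        have a ball inside it. An open superset, for which the volume bound is only doubled, lets
        every point of \<open>E\<close> start a stopping ball.\<close>
      obtain U where U: "open U" "E \<subseteq> U" "U - E \<in> lmeasurable"
        "emeasure lebesgue (U - E) < ennreal (\<eta> * V * r powr ?d)"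
        by (rule sets_lebesgue_outer_open[OF Es pos])
      have Us [measurable]: "U \<in> sets lebesgue" using U(1) by simp
      have Um: "emeasure lebesgue U \<le> ennreal (2 * (\<eta> * V * r powr ?d))"
      proof -
        have "emeasure lebesgue U \<le> emeasure lebesgue E + emeasure lebesgue (U - E)"
          using emeasure_subadditive[of E lebesgue "U - E"] Es Us U(2) by (simp add: Un_absorb1)
        also have "\<dots> \<le> ennreal (\<eta> * V * r powr ?d) + ennreal (\<eta> * V * r powr ?d)"
          using Em U(4) by (intro add_mono) auto
        also have "\<dots> = ennreal (2 * (\<eta> * V * r powr ?d))"
          using eta V_pos by (subst ennreal_plus[symmetric]) auto
        finally show ?thesis .
      qed
      \<comment> \<open>The factor 2 turns a mean of \<phi> below 1 into a density of
        \<open>U\<close> of at most 1/2.\<close>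
      define \<phi> where "\<phi> = (\<lambda>y. 2 * indicator U y + \<bar>h1 y\<bar> / \<mu>)"
      have [measurable]: "\<phi> \<in> borel_measurable lebesgue" unfolding \<phi>_def by measurable
      have phi0: "\<bar>\<phi> y\<bar> = \<phi> y" for y using mu by (simp add: \<phi>_def)
      have tot: "nn_abs \<phi> UNIV \<le> ennreal (5 * \<eta> * V * r powr ?d)"
      proof -
        have "nn_abs \<phi> UNIV \<le> nn_abs (\<lambda>y. 2 * indicator U y) UNIV + nn_abs (\<lambda>y. \<bar>h1 y\<bar> / \<mu>) UNIV"
          unfolding \<phi>_def by (rule nn_abs_add) measurable
        also have "nn_abs (\<lambda>y. 2 * indicator U y :: real) UNIV = 2 * emeasure lebesgue U"
          unfolding nn_abs_indicator by (subst nn_abs_const) auto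
        also have "2 * emeasure lebesgue U \<le> 2 * ennreal (2 * (\<eta> * V * r powr ?d))"
          using Um by (rule mult_left_mono) simp
        also have "2 * ennreal (2 * (\<eta> * V * r powr ?d)) = ennreal (4 * \<eta> * V * r powr ?d)"
          using eta V_pos by (simp flip: ennreal_mult'' ennreal_numeral)
        also have "nn_abs (\<lambda>y. \<bar>h1 y\<bar> / \<mu>) UNIV \<le> ennreal (1 / \<mu>) * nn_abs h1 UNIV"
          by (rule nn_abs_le_cmult) (use mu in auto)
        also have "nn_abs h1 UNIV = nn_abs h (ball x (3 * r))"
          unfolding h1_def nn_abs_indicator by simp
        also have "ennreal (1 / \<mu>) * nn_abs h (ball x (3 * r)) \<le> ennreal (1 / \<mu>) * ennreal H"
          using hH by (rule mult_left_mono) simp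
        also have "\<dots> = ennreal (\<eta> * V * r powr ?d)"
          using mu H by (simp flip: ennreal_mult) (simp add: \<mu>_def)
        finally have "nn_abs \<phi> UNIV \<le> ennreal (4 * \<eta> * V * r powr ?d) + ennreal (\<eta> * V * r powr ?d)"
          by (simp add: add_mono)
        also have "\<dots> = ennreal (5 * \<eta> * V * r powr ?d)"
          using eta V_pos by (subst ennreal_plus[symmetric]) (auto simp: algebra_simps)
        finally show ?thesis .
      qed
      have M0: "0 \<le> 5 * \<eta> * V * r powr ?d" using eta V_pos by simp
      have stop: "\<exists>s>0. ennreal (vol (ball z s)) \<le> nn_abs \<phi> (ball z s)" if z: "z \<in> E \<inter> ball x r" for z
      proof -
        obtain s where s: "0 < s" "ball z s \<subseteq> U" using U z by (meson IntD1 open_contains_ball subsetD)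
        have "ennreal (vol (ball z s)) = nn_abs (\<lambda>_. 1) (ball z s)"
          using s by (subst nn_abs_const) (auto simp: emeasure_ball_vol simp del: emeasure_completion)
        also have "\<dots> \<le> nn_abs \<phi> (ball z s)"
          by (rule nn_abs_mono_fun) (use s(2) mu in \<open>auto simp: phi0, auto simp: \<phi>_def subset_iff\<close>)
        finally show ?thesis using s by blast
      qed
      obtain J s where J: "countable J" "J \<subseteq> E \<inter> ball x r" "disjoint_family_on (\<lambda>z. ball z (s z)) J"
        "\<And>z. z \<in> J \<Longrightarrow> 0 < s z \<and> vol (ball z (s z)) \<le> 5 * \<eta> * V * r powr ?d"
        "(\<integral>\<^sup>+z. ennreal (vol (ball z (s z))) \<partial>count_space J) \<le> ennreal (5 * \<eta> * V * r powr ?d)"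
        "E \<inter> ball x r \<subseteq> (\<Union>z\<in>J. ball z (5 * s z))"
        "\<And>z t. z \<in> J \<Longrightarrow> 2 * s z \<le> t \<Longrightarrow> nn_abs \<phi> (ball z t) < ennreal (vol (ball z t))"
        using stopping_balls[of \<phi> "5 * \<eta> * V * r powr ?d" "E \<inter> ball x r", OF _ tot M0 stop] by auto
      have small: "0 < s z \<and> 5 * s z \<le> e * r" if z: "z \<in> J" for z
      proof -
        have "s z powr ?d \<le> 5 * \<eta> * r powr ?d"
        proof -
          have "V * s z powr ?d \<le> V * (5 * \<eta> * r powr ?d)"
            using J(4)[OF z] vol_V[of "s z" z] by (simp add: mult_ac)
          then show ?thesis using V_pos by simp
        qed
        also have "\<dots> \<le> (e / 5) powr ?d * r powr ?d" using eta by (intro mult_right_mono) auto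
        also have "\<dots> = (e / 5 * r) powr ?d" using e r by (subst powr_mult) auto
        finally have "s z \<le> e / 5 * r" using J(4)[OF z] e r
          by (meson DIM_positive not_le of_nat_0_less_iff powr_less_mono2 less_imp_le mult_nonneg_nonneg divide_nonneg_nonneg zero_le_numeral)
        then show ?thesis using J(4)[OF z] by simp
      qed
      have sum: "(\<integral>\<^sup>+z. ennreal (vol (ball z (s z))) \<partial>count_space J) \<le> ennreal (e * vol (ball x r))"
      proof -
        have "5 * \<eta> * V * r powr ?d \<le> e * (V * r powr ?d)"
          using eta V_pos r mult_right_mono[OF eta(2), of "V * r powr ?d"] by (simp add: mult.assoc)
        then show ?thesis using J(5) r by (simp add: vol_V) (meson ennreal_leI order_trans)
      qed
      have h1bd: "nn_abs h1 (ball z t) \<le> ennreal (\<mu> * (V * t powr ?d))"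
        and Ubd: "2 * emeasure lebesgue (U \<inter> ball z t) \<le> ennreal (V * t powr ?d)" if z: "z \<in> J" and t: "2 * s z \<le> t" for z t
      proof -
        have t0: "0 < t" using t J(4)[OF z] by simp
        have lt: "nn_abs \<phi> (ball z t) \<le> ennreal (V * t powr ?d)"
          using J(7)[OF z t] t0 by (simp add: vol_V)
        have "nn_abs h1 (ball z t) \<le> ennreal \<mu> * nn_abs \<phi> (ball z t)"
        proof (rule nn_abs_le_cmult)
          fix y show "\<bar>h1 y\<bar> \<le> \<mu> * \<bar>\<phi> y\<bar>"
            unfolding phi0 using mu by (simp add: \<phi>_def algebra_simps)
        qed (use mu in auto)
        also have "\<dots> \<le> ennreal \<mu> * ennreal (V * t powr ?d)" using lt by (rule mult_left_mono) simp
        also have "\<dots> = ennreal (\<mu> * (V * t powr ?d))" using mu V_pos by (simp add: ennreal_mult)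
        finally show "nn_abs h1 (ball z t) \<le> ennreal (\<mu> * (V * t powr ?d))" .
        have "2 * emeasure lebesgue (U \<inter> ball z t) = nn_abs (\<lambda>y. 2 * indicator U y) (ball z t)"
          unfolding nn_abs_indicator by (subst nn_abs_const) (auto simp: Int_commute)
        also have "\<dots> \<le> nn_abs \<phi> (ball z t)"
          by (rule nn_abs_mono_fun) (use mu in \<open>auto simp: phi0, auto simp: \<phi>_def\<close>)
        also note lt
        finally show "2 * emeasure lebesgue (U \<inter> ball z t) \<le> ennreal (V * t powr ?d)" .
      qed
      have sub: "ball z (15 * s z) \<subseteq> ball x (3 * r)" if z: "z \<in> J" for z
      proof
        fix y assume "y \<in> ball z (15 * s z)"
        then have "dist z y < 15 * s z" by simp
        moreover have "dist x z < r" using J(2) z by auto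
        moreover have "e * r \<le> 1/2 * r" using e r by (intro mult_right_mono) auto
        then have "15 * s z \<le> 2 * r" using small[OF z] r by linarith
        ultimately show "y \<in> ball x (3 * r)" using dist_triangle[of x y z] by simp
      qed
      have c: "nn_abs h (ball z (15 * s z)) \<le> ennreal ((C1 + C2) * H * (s z / r) powr ?d)" if z: "z \<in> J" for z
      proof -
        have s0: "0 < s z" using small[OF z] by simp
        have "nn_abs h (ball z (15 * s z)) = nn_abs h1 (ball z (15 * s z))"
          unfolding h1_def nn_abs_indicator using sub[OF z] by (simp add: Int_absorb2)
        also have "\<dots> \<le> ennreal (\<mu> * (V * (15 * s z) powr ?d))"
          by (rule h1bd[OF z]) (use s0 in simp)
        also have "\<mu> * (V * (15 * s z) powr ?d) = C2 * H * (s z / r) powr ?d"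
          using V_pos s0 r by (simp add: \<mu>_def C2_def powr_mult powr_divide)
        also have "C2 * H * (s z / r) powr ?d \<le> (C1 + C2) * H * (s z / r) powr ?d"
          using C12 H by (intro mult_right_mono) auto
        finally show ?thesis by (meson ennreal_leI order_trans)
      qed
      have good: "\<bar>T h1 y\<bar> \<le> lam" if "y \<notin> U" for y
        using that U(2) by (auto simp: E_def subset_iff not_less)
      have pt: "AE y in lebesgue. y \<in> ball z (5 * s z) \<longrightarrow> \<bar>T h1 y\<bar> \<le>
          \<bar>T (\<lambda>u. h u * indicator (ball z (15 * s z)) u) y\<bar> + (C1 + C2) * H * r powr (\<nu> - ?d)" if z: "z \<in> J" for z
      proof -
        have s0: "0 < s z" using small[OF z] by simp
        have U2: "emeasure lebesgue (U \<inter> ball z (5 * s z)) \<le> ennreal (1/2 * V * (5 * s z) powr ?d)"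
        proof -
          have "2 * emeasure lebesgue (U \<inter> ball z (5 * s z)) \<le> 2 * ennreal (1/2 * V * (5 * s z) powr ?d)"
            using Ubd[OF z, of "5 * s z"] s0 V_pos by (simp flip: ennreal_mult'' ennreal_numeral)
          then show ?thesis by (simp add: ennreal_mult_le_mult_iff)
        qed
        have eq: "(\<lambda>u. h1 u * indicator (ball z (3 * (5 * s z))) u) = (\<lambda>u. h u * indicator (ball z (15 * s z)) u)"
          using sub[OF z] by (auto simp: h1_def fun_eq_iff indicator_def)
        have "\<mu> * (5 * s z) powr \<nu> \<le> \<mu> * r powr \<nu>"
        proof -
          have "e * r \<le> 1 * r" using e r by (intro mult_right_mono) auto
          then have "5 * s z \<le> r" using small[OF z] by simp
          then show ?thesis using s0 mu nu_nonneg by (intro mult_left_mono powr_mono2) auto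
        qed
        also have "\<mu> * r powr \<nu> = 1 / (\<eta> * V) * (H * r powr (\<nu> - ?d))"
          using r by (simp add: \<mu>_def powr_diff)
        finally have 1: "(L4 * V * 3 powr ?d + 2 * Ctail) * (\<mu> * (5 * s z) powr \<nu>)
           \<le> (L4 * V * 3 powr ?d + 2 * Ctail) * (1 / (\<eta> * V) * (H * r powr (\<nu> - ?d)))"
          using nn by (rule mult_left_mono)
        have "lam + (L4 * V * 3 powr ?d + 2 * Ctail) * \<mu> * (5 * s z) powr \<nu> \<le> C1 * H * r powr (\<nu> - ?d)"
        proof -
          have "L * X + A * q \<le> (L + A * (1 / (\<eta> * V))) * X" if "A * q \<le> A * (1 / (\<eta> * V) * X)" for A q X
            using that by (simp add: algebra_simps)
          from this[OF 1] show ?thesis by (simp only: lam_def C1_def mult.assoc)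
        qed
        also have "\<dots> \<le> (C1 + C2) * H * r powr (\<nu> - ?d)" using C12 H by (intro mult_right_mono) auto
        finally have 2: "lam + (L4 * V * 3 powr ?d + 2 * Ctail) * \<mu> * (5 * s z) powr \<nu> \<le> (C1 + C2) * H * r powr (\<nu> - ?d)" .
        have "AE y in lebesgue. y \<in> ball z (5 * s z) \<longrightarrow> \<bar>T h1 y\<bar> \<le> \<bar>T (\<lambda>u. h1 u * indicator (ball z (3 * (5 * s z))) u) y\<bar>
            + (lam + (L4 * V * 3 powr ?d + 2 * Ctail) * \<mu> * (5 * s z) powr \<nu>)"
          by (rule stopping_ball_bound[OF h1i _ mu _ Us U2 good]) (use s0 h1bd[OF z] in auto)
        then show ?thesis
          unfolding eq by (rule eventually_mono) (use 2 in fastforce)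
      qed
      have "AE y in lebesgue. \<forall>z\<in>J. y \<in> ball z (5 * s z) \<longrightarrow> \<bar>T h1 y\<bar> \<le>
          \<bar>T (\<lambda>u. h u * indicator (ball z (15 * s z)) u) y\<bar> + (C1 + C2) * H * r powr (\<nu> - ?d)"
        using pt by (subst AE_ball_countable[OF J(1)]) auto
      then have d: "AE y in lebesgue. y \<in> ball x r \<longrightarrow>
           \<bar>T h1 y\<bar> \<le> (C1 + C2) * H * r powr (\<nu> - ?d)
         \<or> (\<exists>z\<in>J. y \<in> ball z (5 * s z) \<and> \<bar>T h1 y\<bar>
                \<le> \<bar>T (\<lambda>u. h u * indicator (ball z (15 * s z)) u) y\<bar> + (C1 + C2) * H * r powr (\<nu> - ?d))"
      proof (rule eventually_mono)
        fix y assume *: "\<forall>z\<in>J. y \<in> ball z (5 * s z) \<longrightarrow> \<bar>T h1 y\<bar> \<le>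
          \<bar>T (\<lambda>u. h u * indicator (ball z (15 * s z)) u) y\<bar> + (C1 + C2) * H * r powr (\<nu> - ?d)"
        have lamC: "lam \<le> (C1 + C2) * H * r powr (\<nu> - ?d)"
          unfolding lam_def using C12 H by (intro mult_right_mono) auto
        show "y \<in> ball x r \<longrightarrow>
           \<bar>T h1 y\<bar> \<le> (C1 + C2) * H * r powr (\<nu> - ?d)
         \<or> (\<exists>z\<in>J. y \<in> ball z (5 * s z) \<and> \<bar>T h1 y\<bar>
                \<le> \<bar>T (\<lambda>u. h u * indicator (ball z (15 * s z)) u) y\<bar> + (C1 + C2) * H * r powr (\<nu> - ?d))"
        proof
          assume y: "y \<in> ball x r"
          show "\<bar>T h1 y\<bar> \<le> (C1 + C2) * H * r powr (\<nu> - ?d)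
         \<or> (\<exists>z\<in>J. y \<in> ball z (5 * s z) \<and> \<bar>T h1 y\<bar>
                \<le> \<bar>T (\<lambda>u. h u * indicator (ball z (15 * s z)) u) y\<bar> + (C1 + C2) * H * r powr (\<nu> - ?d))"
          proof (cases "y \<in> E")
            case True
            then obtain z where "z \<in> J" "y \<in> ball z (5 * s z)" using J(6) y by blast
            with * show ?thesis by blast
          next
            case False
            then show ?thesis using lamC by (auto simp: E_def not_less)
          qed
        qed
      qed
      have "J \<subseteq> ball x r" using J(2) by blast
      then show ?thesis
        unfolding h1_def[symmetric] using J(1,3) small sum c d by (intro exI[of _ J] exI[of _ s]) simp
    qed
  qed
qed

end

text \<open>The two halvings play different roles. That of \<Lambda> closes the induction with the
  factor 2, as \<Lambda> + 2 (\<Lambda>/2) = 2 \<Lambda>; that of the volumes drives the truncation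
  error to 0 for fixed \<open>N\<close>. Monotone convergence in \<open>N\<close> then removes the
  truncation.\<close>

lemma absorb:
  fixes F :: "'a::euclidean_space \<Rightarrow> real \<Rightarrow> 'a \<Rightarrow> ennreal" and \<Lambda> :: "'a \<Rightarrow> real \<Rightarrow> ennreal"
  assumes meas: "\<And>z r. P z r \<Longrightarrow> F z r \<in> borel_measurable lebesgue"
    and step: "\<And>x r. P x r \<Longrightarrow> \<exists>J s. countable J \<and> (\<forall>z\<in>J. P z (s z))
       \<and> (\<forall>N::nat. (\<integral>\<^sup>+y\<in>ball x r. min (F x r y) (of_nat N) \<partial>lebesgue)
              \<le> \<Lambda> x r + (\<integral>\<^sup>+z. (\<integral>\<^sup>+y\<in>ball z (s z). min (F z (s z) y) (of_nat N) \<partial>lebesgue) \<partial>count_space J))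
       \<and> 2 * (\<integral>\<^sup>+z. \<Lambda> z (s z) \<partial>count_space J) \<le> \<Lambda> x r
       \<and> 2 * (\<integral>\<^sup>+z. emeasure lebesgue (ball z (s z)) \<partial>count_space J) \<le> emeasure lebesgue (ball x r)"
    and P: "P x r"
  shows "(\<integral>\<^sup>+y\<in>ball x r. F x r y \<partial>lebesgue) \<le> 2 * \<Lambda> x r"
proof -
  have bound: "(\<integral>\<^sup>+y\<in>ball x r. min (F x r y) (of_nat N) \<partial>lebesgue)
      \<le> 2 * \<Lambda> x r + of_nat N * ennreal ((1/2) ^ k) * emeasure lebesgue (ball x r)" if "P x r" for N k x r
    using that
  proof (induction k arbitrary: x r)
    case 0
    have "(\<integral>\<^sup>+y\<in>ball x r. min (F x r y) (of_nat N) \<partial>lebesgue) \<le> (\<integral>\<^sup>+y\<in>ball x r. of_nat N \<partial>lebesgue)"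
      by (intro nn_integral_mono mult_right_mono) auto
    also have "\<dots> = of_nat N * emeasure lebesgue (ball x r)"
      by (rule nn_integral_cmult_indicator) simp
    finally show ?case by (simp add: add_increasing)
  next
    case (Suc k)
    from step[OF Suc.prems] obtain J s where J: "countable J" "\<And>z. z \<in> J \<Longrightarrow> P z (s z)"
       and 1: "\<And>N::nat. (\<integral>\<^sup>+y\<in>ball x r. min (F x r y) (of_nat N) \<partial>lebesgue)
              \<le> \<Lambda> x r + (\<integral>\<^sup>+z. (\<integral>\<^sup>+y\<in>ball z (s z). min (F z (s z) y) (of_nat N) \<partial>lebesgue) \<partial>count_space J)"
       and 2: "2 * (\<integral>\<^sup>+z. \<Lambda> z (s z) \<partial>count_space J) \<le> \<Lambda> x r"
       and 3: "2 * (\<integral>\<^sup>+z. emeasure lebesgue (ball z (s z)) \<partial>count_space J) \<le> emeasure lebesgue (ball x r)"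
      by blast
    let ?c = "of_nat N * ennreal ((1/2) ^ k)"
    have "(\<integral>\<^sup>+z. (\<integral>\<^sup>+y\<in>ball z (s z). min (F z (s z) y) (of_nat N) \<partial>lebesgue) \<partial>count_space J)
       \<le> (\<integral>\<^sup>+z. 2 * \<Lambda> z (s z) + ?c * emeasure lebesgue (ball z (s z)) \<partial>count_space J)"
      by (intro nn_integral_mono Suc.IH J(2)) auto
    also have "\<dots> = 2 * (\<integral>\<^sup>+z. \<Lambda> z (s z) \<partial>count_space J) + ?c * (\<integral>\<^sup>+z. emeasure lebesgue (ball z (s z)) \<partial>count_space J)"
      by (simp add: nn_integral_add nn_integral_cmult del: emeasure_completion)
    also have "?c = of_nat N * ennreal ((1/2) ^ Suc k) * 2"
      by (simp add: mult.assoc flip: ennreal_mult'' ennreal_numeral)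
    also have "2 * (\<integral>\<^sup>+z. \<Lambda> z (s z) \<partial>count_space J) +
        of_nat N * ennreal ((1/2) ^ Suc k) * 2 * (\<integral>\<^sup>+z. emeasure lebesgue (ball z (s z)) \<partial>count_space J)
      \<le> \<Lambda> x r + of_nat N * ennreal ((1/2) ^ Suc k) * emeasure lebesgue (ball x r)"
      using 2 3 unfolding mult.assoc[of _ 2] by (intro add_mono mult_left_mono) auto
    finally have "(\<integral>\<^sup>+y\<in>ball x r. min (F x r y) (of_nat N) \<partial>lebesgue)
       \<le> \<Lambda> x r + (\<Lambda> x r + of_nat N * ennreal ((1/2) ^ Suc k) * emeasure lebesgue (ball x r))"
      using 1[of N] by (meson add_left_mono order_trans)
    then show ?case by (simp add: mult_2 add.assoc)
  qed
  have lim: "(\<integral>\<^sup>+y\<in>ball x r. min (F x r y) (of_nat N) \<partial>lebesgue) \<le> 2 * \<Lambda> x r" for N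
  proof (rule ennreal_le_epsilon)
    fix e :: real assume e: "0 < e"
    define q where "q = real N * vol (ball x r)"
    have q: "of_nat N * emeasure lebesgue (ball x r) \<le> ennreal q"
    proof (cases "0 \<le> r")
      case True then show ?thesis
        by (simp add: emeasure_ball_vol q_def ennreal_mult'' ennreal_of_nat_eq_real_of_nat vol_ball del: emeasure_completion)
    next
      case False then show ?thesis by (simp add: ball_empty)
    qed
    have q0: "0 \<le> q" by (simp add: q_def vol_def)
    obtain k where k: "(1/2) ^ k < e / (q + 1)" using real_arch_pow_inv[of "e / (q+1)" "1/2"] e q0 by auto
    have "(1/2) ^ k * q \<le> e / (q + 1) * q" using k q0 by (intro mult_right_mono) auto
    also have "\<dots> \<le> e" using e q0 by (simp add: field_simps)
    finally have k2: "(1/2) ^ k * q \<le> e" .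
    have "(\<integral>\<^sup>+y\<in>ball x r. min (F x r y) (of_nat N) \<partial>lebesgue)
      \<le> 2 * \<Lambda> x r + of_nat N * ennreal ((1/2) ^ k) * emeasure lebesgue (ball x r)"
      by (rule bound[OF P])
    also have "of_nat N * ennreal ((1/2) ^ k) * emeasure lebesgue (ball x r)
        = ennreal ((1/2) ^ k) * (of_nat N * emeasure lebesgue (ball x r))" by (simp add: mult_ac)
    also have "\<dots> \<le> ennreal ((1/2) ^ k) * ennreal q" using q by (rule mult_left_mono) simp
    also have "\<dots> \<le> ennreal e" using k2 q0 by (simp add: ennreal_leI flip: ennreal_mult)
    finally show "(\<integral>\<^sup>+y\<in>ball x r. min (F x r y) (of_nat N) \<partial>lebesgue) \<le> 2 * \<Lambda> x r + ennreal e"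
      by (simp add: add_left_mono)
  qed
  note [measurable] = meas[OF P]
  have sup: "F x r y * indicator (ball x r) y = (SUP N. min (F x r y) (of_nat N) * indicator (ball x r) y)" for y
  proof -
    have "(SUP N. min (F x r y) (of_nat N :: ennreal)) = min (F x r y) (SUP N. of_nat N :: ennreal)"
      by (simp add: inf_min[symmetric] inf_SUP)
    then have "(SUP N. min (F x r y) (of_nat N :: ennreal)) = F x r y"
      by (simp add: ennreal_SUP_of_nat_eq_top)
    then show ?thesis by (auto split: split_indicator)
  qed
  have "(\<integral>\<^sup>+y\<in>ball x r. F x r y \<partial>lebesgue)
     = (SUP N. \<integral>\<^sup>+y\<in>ball x r. min (F x r y) (of_nat N) \<partial>lebesgue)"
    unfolding sup
  proof (rule nn_integral_monotone_convergence_SUP)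
    show "incseq (\<lambda>N y. min (F x r y) (of_nat N) * indicator (ball x r) y)"
      by (auto simp: incseq_def le_fun_def intro!: mult_right_mono min.mono)
  qed simp
  also have "\<dots> \<le> 2 * \<Lambda> x r" by (rule SUP_least) (rule lim)
  finally show ?thesis .
qed

lemma borel_measurable_nn_integral_count_space:
  fixes f :: "'i \<Rightarrow> 'a \<Rightarrow> ennreal"
  assumes "countable I" and [measurable]: "\<And>i. i \<in> I \<Longrightarrow> f i \<in> borel_measurable M"
  shows "(\<lambda>x. \<integral>\<^sup>+i. f i x \<partial>count_space I) \<in> borel_measurable M"
proof (cases "finite I")
  case True
  then show ?thesis by (simp add: nn_integral_count_space_finite)
next
  case False
  then have [simp]: "I \<noteq> {}" by auto
  note * = bij_betw_from_nat_into[OF \<open>countable I\<close> False]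
  have "(\<integral>\<^sup>+i. f i x \<partial>count_space I) = (\<Sum>n. f (from_nat_into I n) x)" for x
    by (simp add: nn_integral_bij_count_space[symmetric, OF *] nn_integral_count_space_nat)
  then show ?thesis by (simp add: from_nat_into)
qed

text \<open>Only the recursive term has to stay truncated, because min (G + g + c) N \<le> c + g +
  min G N. The dilated balls may overlap; the sum over z dominates the term of whichever z covers
  the point y.\<close>

lemma integrate_step:
  fixes F :: "'a::euclidean_space \<Rightarrow> ennreal"
  assumes J: "countable J" and [measurable]: "\<And>z. z \<in> J \<Longrightarrow> G z \<in> borel_measurable lebesgue"
    "\<And>z. z \<in> J \<Longrightarrow> g z \<in> borel_measurable lebesgue"
    and ae: "AE y in lebesgue. y \<in> ball x r \<longrightarrow> F y \<le> c \<or> (\<exists>z\<in>J. y \<in> ball z (s z) \<and> F y \<le> G z y + g z y + c)"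
  shows "(\<integral>\<^sup>+y\<in>ball x r. min (F y) N \<partial>lebesgue) \<le> c * emeasure lebesgue (ball x r)
     + (\<integral>\<^sup>+z. (\<integral>\<^sup>+y\<in>ball z (s z). g z y \<partial>lebesgue) \<partial>count_space J)
     + (\<integral>\<^sup>+z. (\<integral>\<^sup>+y\<in>ball z (s z). min (G z y) N \<partial>lebesgue) \<partial>count_space J)"
proof -
  let ?g = "\<lambda>z y. g z y * indicator (ball z (s z)) y"
  let ?G = "\<lambda>z y. min (G z y) N * indicator (ball z (s z)) y"
  have gm [measurable]: "(\<lambda>y. \<integral>\<^sup>+z. ?g z y \<partial>count_space J) \<in> borel_measurable lebesgue"
    and Gm [measurable]: "(\<lambda>y. \<integral>\<^sup>+z. ?G z y \<partial>count_space J) \<in> borel_measurable lebesgue"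
    by (rule borel_measurable_nn_integral_count_space[OF J], measurable)+
  have "(\<integral>\<^sup>+y\<in>ball x r. min (F y) N \<partial>lebesgue)
     \<le> (\<integral>\<^sup>+y. c * indicator (ball x r) y + (\<integral>\<^sup>+z. ?g z y \<partial>count_space J) + (\<integral>\<^sup>+z. ?G z y \<partial>count_space J) \<partial>lebesgue)"
  proof (rule nn_integral_mono_AE, use ae in \<open>rule eventually_mono\<close>)
    fix y assume y: "y \<in> ball x r \<longrightarrow> F y \<le> c \<or> (\<exists>z\<in>J. y \<in> ball z (s z) \<and> F y \<le> G z y + g z y + c)"
    show "min (F y) N * indicator (ball x r) y
       \<le> c * indicator (ball x r) y + (\<integral>\<^sup>+z. ?g z y \<partial>count_space J) + (\<integral>\<^sup>+z. ?G z y \<partial>count_space J)"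
    proof (cases "y \<in> ball x r \<and> \<not> F y \<le> c")
      case True
      with y obtain z where z: "z \<in> J" "y \<in> ball z (s z)" "F y \<le> G z y + g z y + c" by blast
      have "min (F y) N \<le> c + (g z y + min (G z y) N)"
      proof (cases "G z y \<le> N")
        case True
        have "min (F y) N \<le> F y" by simp
        also have "\<dots> \<le> c + (g z y + min (G z y) N)" using z(3) True by (simp add: min_absorb1 add_ac)
        finally show ?thesis .
      next
        case False
        have "min (F y) N \<le> 0 + (0 + min (G z y) N)" using False by (simp add: min_absorb2)
        also have "\<dots> \<le> c + (g z y + min (G z y) N)" by (intro add_mono) auto
        finally show ?thesis .
      qed
      moreover have "g z y \<le> (\<integral>\<^sup>+z. ?g z y \<partial>count_space J)"
        using nn_integral_ge_point[OF z(1), of "\<lambda>z. ?g z y"] z(2) by simp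
      moreover have "min (G z y) N \<le> (\<integral>\<^sup>+z. ?G z y \<partial>count_space J)"
        using nn_integral_ge_point[OF z(1), of "\<lambda>z. ?G z y"] z(2) by simp
      ultimately have "min (F y) N \<le> c + ((\<integral>\<^sup>+z. ?g z y \<partial>count_space J) + (\<integral>\<^sup>+z. ?G z y \<partial>count_space J))"
        by (meson add_left_mono add_mono order_trans)
      then show ?thesis using True by (simp add: add.assoc)
    next
      case False
      then show ?thesis by (auto split: split_indicator simp: add.assoc min.coboundedI1 intro!: add_increasing2)
    qed
  qed
  also have "\<dots> = c * emeasure lebesgue (ball x r) + (\<integral>\<^sup>+y. (\<integral>\<^sup>+z. ?g z y \<partial>count_space J) \<partial>lebesgue)
      + (\<integral>\<^sup>+y. (\<integral>\<^sup>+z. ?G z y \<partial>count_space J) \<partial>lebesgue)"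
    by (simp add: nn_integral_add nn_integral_cmult_indicator del: emeasure_completion)
  also have "(\<integral>\<^sup>+y. (\<integral>\<^sup>+z. ?g z y \<partial>count_space J) \<partial>lebesgue) = (\<integral>\<^sup>+z. (\<integral>\<^sup>+y. ?g z y \<partial>lebesgue) \<partial>count_space J)"
    by (rule nn_integral_count_space_nn_integral[OF J]) measurable
  also have "(\<integral>\<^sup>+y. (\<integral>\<^sup>+z. ?G z y \<partial>count_space J) \<partial>lebesgue) = (\<integral>\<^sup>+z. (\<integral>\<^sup>+y. ?G z y \<partial>lebesgue) \<partial>count_space J)"
    by (rule nn_integral_count_space_nn_integral[OF J]) measurable
  finally show ?thesis .
qed

lemma nn_integral_count_space_cmult_le:
  assumes "\<And>z. z \<in> J \<Longrightarrow> f z \<le> c * g z"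
  shows "(\<integral>\<^sup>+z. f z \<partial>count_space J) \<le> c * (\<integral>\<^sup>+z. g z \<partial>count_space J)"
proof -
  have "(\<integral>\<^sup>+z. f z \<partial>count_space J) \<le> (\<integral>\<^sup>+z. c * g z \<partial>count_space J)"
    using assms by (intro nn_integral_mono) auto
  then show ?thesis by (simp add: nn_integral_cmult)
qed

section \<open>Local bounds for T on indicators and on recentred BMO functions\<close>

context scz
begin

lemma indicator_integrable: "integrable lebesgue (\<lambda>u. indicator (ball (x::'a) r) u :: real)"
proof -
  have "integrable lebesgue (\<lambda>u. 1 * indicator (ball x r) u :: real)"
    by (rule integrable_mult_indicator_nn_abs) (auto simp: nn_abs_const emeasure_ball_vol simp del: emeasure_completion, cases "0 \<le> r", auto simp: emeasure_ball_vol ball_empty simp del: emeasure_completion)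
  then show ?thesis by simp
qed

text \<open>The scheme for h = 1, where \<open>H\<close> is proportional to |B| and the restriction
  of h to a stopping ball is again an indicator, so nothing has to be recentred. In
  \<open>local_bound\<close> this estimate pays for the recentring of f.\<close>

lemma T_indicator_bound:
  "\<exists>C\<ge>0. \<forall>x r. 0 < r \<longrightarrow> nn_abs (T (indicator (ball x (3 * r)))) (ball x r) \<le> ennreal (C * r powr \<nu> * (V * r powr real DIM('a)))"
proof -
  let ?d = "real DIM('a)"
  \<comment> \<open>With this fraction the 5-fold balls carry at most half of the volume. \<Lambda>
    is a constant times r^\<nu> times the volume and is halved with it.\<close>
  define e where "e = 1 / (2 * 5 powr ?d)"
  have e: "0 < e" "e \<le> 1/2" "2 * (5 powr ?d * e) = 1"
    using powr_mono[of 0 ?d 5] by (auto simp: e_def field_simps)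
  obtain C where C: "0 \<le> C" and st: "\<And>x r h H. 0 < r \<Longrightarrow> h \<in> borel_measurable lebesgue \<Longrightarrow> 0 \<le> H \<Longrightarrow> nn_abs h (ball x (3 * r)) \<le> ennreal H \<Longrightarrow>
    (\<exists>J s. countable J \<and> J \<subseteq> ball x r \<and> disjoint_family_on (\<lambda>z. ball z (s z)) J \<and> (\<forall>z\<in>J. 0 < s z \<and> 5 * s z \<le> e * r)
      \<and> (\<integral>\<^sup>+z. ennreal (vol (ball z (s z))) \<partial>count_space J) \<le> ennreal (e * vol (ball x r))
      \<and> (\<forall>z\<in>J. nn_abs h (ball z (15 * s z)) \<le> ennreal (C * H * (s z / r) powr ?d))
      \<and> (AE y in lebesgue. y \<in> ball x r \<longrightarrow>
           \<bar>T (\<lambda>u. h u * indicator (ball x (3 * r)) u) y\<bar> \<le> C * H * r powr (\<nu> - ?d)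
         \<or> (\<exists>z\<in>J. y \<in> ball z (5 * s z) \<and> \<bar>T (\<lambda>u. h u * indicator (ball x (3 * r)) u) y\<bar>
                \<le> \<bar>T (\<lambda>u. h u * indicator (ball z (15 * s z)) u) y\<bar> + C * H * r powr (\<nu> - ?d))))"
    using one_step[OF e(1,2)] by blast
  define A where "A = C * (V * 3 powr ?d)"
  have A: "0 \<le> A" using C V_pos by (simp add: A_def)
  define F where "F z r y = ennreal \<bar>T (indicator (ball z (3 * r))) y\<bar>" for z r y
  have Fm: "F z r \<in> borel_measurable lebesgue" for z r
    unfolding F_def using T_measurable[OF indicator_integrable, of z "3 * r"] by measurable
  define \<Lambda> where "\<Lambda> x r = ennreal (A * r powr \<nu> * (V * r powr ?d))" for x :: 'a and r
  have "(\<integral>\<^sup>+y\<in>ball x r. F x r y \<partial>lebesgue) \<le> 2 * \<Lambda> x r" if r: "0 < r" for x r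
  proof (rule absorb[where P = "\<lambda>x r. 0 < r" and F = F and \<Lambda> = \<Lambda>])
    fix x :: 'a and r :: real assume r: "0 < r"
    define H where "H = V * (3 * r) powr ?d"
    have H: "0 \<le> H" using V_pos by (simp add: H_def)
    have "nn_abs (\<lambda>_. 1) (ball x (3 * r)) \<le> ennreal H"
      using r by (simp add: nn_abs_const emeasure_ball_V H_def del: emeasure_completion)
    from st[OF r _ H this] obtain J s where J: "countable J" "J \<subseteq> ball x r" "\<And>z. z \<in> J \<Longrightarrow> 0 < s z \<and> 5 * s z \<le> e * r"
       and vs: "(\<integral>\<^sup>+z. ennreal (vol (ball z (s z))) \<partial>count_space J) \<le> ennreal (e * vol (ball x r))"
       and ae: "AE y in lebesgue. y \<in> ball x r \<longrightarrow>
           \<bar>T (indicator (ball x (3 * r))) y\<bar> \<le> C * H * r powr (\<nu> - ?d)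
         \<or> (\<exists>z\<in>J. y \<in> ball z (5 * s z) \<and> \<bar>T (indicator (ball x (3 * r))) y\<bar>
                \<le> \<bar>T (indicator (ball z (15 * s z))) y\<bar> + C * H * r powr (\<nu> - ?d))"
      by auto
    have cH: "C * H * r powr (\<nu> - ?d) = A * r powr \<nu>"
      using r by (simp add: H_def A_def powr_mult powr_diff)
    have p: "0 < 5 * s z \<and> 5 * s z \<le> r" if "z \<in> J" for z
    proof -
      have "e * r \<le> 1 * r" using e r by (intro mult_right_mono) auto
      then show ?thesis using J(3)[OF that] by simp
    qed
    have volp: "emeasure lebesgue (ball z (5 * s z)) = ennreal (5 powr ?d) * ennreal (vol (ball z (s z)))" if "z \<in> J" for z
      using J(3)[OF that] V_pos by (simp add: emeasure_ball_vol vol_V powr_mult mult_ac flip: ennreal_mult del: emeasure_completion)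
    show "\<exists>J s. countable J \<and> (\<forall>z\<in>J. 0 < s z)
       \<and> (\<forall>N::nat. (\<integral>\<^sup>+y\<in>ball x r. min (F x r y) (of_nat N) \<partial>lebesgue)
              \<le> \<Lambda> x r + (\<integral>\<^sup>+z. (\<integral>\<^sup>+y\<in>ball z (s z). min (F z (s z) y) (of_nat N) \<partial>lebesgue) \<partial>count_space J))
       \<and> 2 * (\<integral>\<^sup>+z. \<Lambda> z (s z) \<partial>count_space J) \<le> \<Lambda> x r
       \<and> 2 * (\<integral>\<^sup>+z. emeasure lebesgue (ball z (s z)) \<partial>count_space J) \<le> emeasure lebesgue (ball x r)"
    proof (intro exI[of _ J] exI[of _ "\<lambda>z. 5 * s z"] conjI allI ballI)
      show "countable J" by fact
      show "0 < 5 * s z" if "z \<in> J" for z using p[OF that] by simp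
      have sum: "2 * (\<integral>\<^sup>+z. emeasure lebesgue (ball z (5 * s z)) \<partial>count_space J) \<le> ennreal (V * r powr ?d)"
      proof -
        have "(\<integral>\<^sup>+z. emeasure lebesgue (ball z (5 * s z)) \<partial>count_space J)
          \<le> ennreal (5 powr ?d) * (\<integral>\<^sup>+z. ennreal (vol (ball z (s z))) \<partial>count_space J)"
          by (rule nn_integral_count_space_cmult_le) (simp only: volp order_refl)
        also have "\<dots> \<le> ennreal (5 powr ?d) * ennreal (e * vol (ball x r))"
          using vs by (rule mult_left_mono) simp
        finally have "2 * (\<integral>\<^sup>+z. emeasure lebesgue (ball z (5 * s z)) \<partial>count_space J) \<le> 2 * (ennreal (5 powr ?d) * ennreal (e * vol (ball x r)))"
          by (rule mult_left_mono) simp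
        also have "\<dots> = ennreal (2 * (5 powr ?d * e) * vol (ball x r))"
          using e vol_ball_pos[OF r, of x] by (simp add: mult_ac flip: ennreal_mult'' ennreal_numeral)
        finally show ?thesis unfolding e using r by (simp add: vol_V)
      qed
      then show "2 * (\<integral>\<^sup>+z. emeasure lebesgue (ball z (5 * s z)) \<partial>count_space J) \<le> emeasure lebesgue (ball x r)"
        using emeasure_ball_V[of r x] r by (simp del: emeasure_completion)
      have "(\<integral>\<^sup>+z. \<Lambda> z (5 * s z) \<partial>count_space J) \<le> ennreal (A * r powr \<nu>) * (\<integral>\<^sup>+z. emeasure lebesgue (ball z (5 * s z)) \<partial>count_space J)"
      proof (rule nn_integral_count_space_cmult_le)
        fix z assume z: "z \<in> J"
        have "A * (5 * s z) powr \<nu> * (V * (5 * s z) powr ?d) \<le> A * r powr \<nu> * (V * (5 * s z) powr ?d)"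
          using p[OF z] A V_pos nu_nonneg by (intro mult_right_mono mult_left_mono powr_mono2) auto
        then have "\<Lambda> z (5 * s z) \<le> ennreal (A * r powr \<nu> * (V * (5 * s z) powr ?d))"
          unfolding \<Lambda>_def by (rule ennreal_leI)
        also have "\<dots> = ennreal (A * r powr \<nu>) * emeasure lebesgue (ball z (5 * s z))"
          using emeasure_ball_V[of "5 * s z" z] p[OF z] A V_pos by (simp add: ennreal_mult del: emeasure_completion)
        finally show "\<Lambda> z (5 * s z) \<le> ennreal (A * r powr \<nu>) * emeasure lebesgue (ball z (5 * s z))" .
      qed
      then have "2 * (\<integral>\<^sup>+z. \<Lambda> z (5 * s z) \<partial>count_space J) \<le> ennreal (A * r powr \<nu>) * (2 * (\<integral>\<^sup>+z. emeasure lebesgue (ball z (5 * s z)) \<partial>count_space J))"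
        unfolding mult.left_commute[of "ennreal (A * r powr \<nu>)"] by (rule mult_left_mono) simp
      also have "\<dots> \<le> ennreal (A * r powr \<nu>) * ennreal (V * r powr ?d)" using sum by (rule mult_left_mono) simp
      also have "\<dots> = \<Lambda> x r" using A V_pos by (simp add: \<Lambda>_def ennreal_mult)
      finally show "2 * (\<integral>\<^sup>+z. \<Lambda> z (5 * s z) \<partial>count_space J) \<le> \<Lambda> x r" .
      fix N :: nat
      have "(\<integral>\<^sup>+y\<in>ball x r. min (F x r y) (of_nat N) \<partial>lebesgue) \<le> ennreal (A * r powr \<nu>) * emeasure lebesgue (ball x r)
         + (\<integral>\<^sup>+z. (\<integral>\<^sup>+y\<in>ball z (5 * s z). 0 \<partial>lebesgue) \<partial>count_space J)
         + (\<integral>\<^sup>+z. (\<integral>\<^sup>+y\<in>ball z (5 * s z). min (F z (5 * s z) y) (of_nat N) \<partial>lebesgue) \<partial>count_space J)"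
      proof (rule integrate_step[OF J(1), where g = "\<lambda>z y. 0"])
        show "AE y in lebesgue. y \<in> ball x r \<longrightarrow> F x r y \<le> ennreal (A * r powr \<nu>) \<or>
           (\<exists>z\<in>J. y \<in> ball z (5 * s z) \<and> F x r y \<le> F z (5 * s z) y + 0 + ennreal (A * r powr \<nu>))"
          using ae unfolding cH F_def
          by (rule eventually_mono) (use A in \<open>auto simp: ennreal_leI simp flip: ennreal_plus\<close>)
      qed (use Fm in auto)
      also have "ennreal (A * r powr \<nu>) * emeasure lebesgue (ball x r) = \<Lambda> x r"
        using emeasure_ball_V[of r x] r A V_pos by (simp add: \<Lambda>_def ennreal_mult del: emeasure_completion)
      finally show "(\<integral>\<^sup>+y\<in>ball x r. min (F x r y) (of_nat N) \<partial>lebesgue)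
              \<le> \<Lambda> x r + (\<integral>\<^sup>+z. (\<integral>\<^sup>+y\<in>ball z (5 * s z). min (F z (5 * s z) y) (of_nat N) \<partial>lebesgue) \<partial>count_space J)"
        by simp
    qed
  qed (use r Fm in auto)
  then have "nn_abs (T (indicator (ball x (3 * r)))) (ball x r) \<le> ennreal (2 * A * r powr \<nu> * (V * r powr ?d))" if "0 < r" for x r
    using that A V_pos unfolding F_def \<Lambda>_def nn_abs_def by (simp add: mult.assoc flip: ennreal_mult'' ennreal_numeral)
  then show ?thesis using A by (intro exI[of _ "2 * A"]) auto
qed

text \<open>The D class with its constant exhibited, since estimates are wanted uniformly over all
  weights with the same \<open>CD\<close>.\<close>

definition dbl :: "real \<Rightarrow> real \<Rightarrow> real \<Rightarrow> ('a \<Rightarrow> real) \<Rightarrow> bool" where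
  "dbl \<kappa> c3 CD w \<longleftrightarrow> weight w \<and> (\<forall>x r R. 0 < r \<longrightarrow> r \<le> R \<longrightarrow>
      wmeas w (ball x R) \<le> CD * (R / r) powr (real DIM('a) * \<kappa>) * exp (c3 * (1 + R / \<rho> x) powr m) * wmeas w (ball x r))"

text \<open>An A_infinity property with an explicit modulus: a subset of relative volume \<phi>(e)
  has relative weight at most e. Radii go up to 2 \<rho>(x) because stopping balls centred in B(x,r)
  with r \<le> \<rho>(x) lie in B(x,2r).\<close>

definition ainf :: "(real \<Rightarrow> real) \<Rightarrow> ('a \<Rightarrow> real) \<Rightarrow> bool" where
  "ainf \<phi> w \<longleftrightarrow> (\<forall>x r E e. 0 < r \<longrightarrow> r \<le> 2 * \<rho> x \<longrightarrow> 0 < e \<longrightarrow> E \<in> sets lebesgue \<longrightarrow> E \<subseteq> ball x r \<longrightarrow>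
      emeasure lebesgue E \<le> ennreal (\<phi> e * vol (ball x r)) \<longrightarrow> nn_abs w E \<le> ennreal (e * wmeas w (ball x r)))"

text \<open>Here r^\<alpha> replaces |B|^(\<alpha>/d), a change by a power of \<open>V\<close>, and
  \<open>n\<close> is any admissible bound rather than the norm, so that no infimum has to be
  handled in the estimates.\<close>

definition bmo :: "real \<Rightarrow> ('a \<Rightarrow> real) \<Rightarrow> ('a \<Rightarrow> real) \<Rightarrow> real \<Rightarrow> bool" where
  "bmo \<alpha> w f n \<longleftrightarrow> loc_integrable f \<and> 0 \<le> n
     \<and> (\<forall>x r. 0 < r \<longrightarrow> nn_abs (\<lambda>y. f y - avg f (ball x r)) (ball x r) \<le> ennreal (n * r powr \<alpha> * wmeas w (ball x r)))
     \<and> (\<forall>x r. \<rho> x \<le> r \<longrightarrow> nn_abs f (ball x r) \<le> ennreal (n * r powr \<alpha> * wmeas w (ball x r)))"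

lemma dbl_bounded:
  assumes "dbl \<kappa> c3 CD w" "0 \<le> CD" "0 \<le> c3" "0 \<le> \<kappa>" "0 < r" "r \<le> R" "R \<le> a * r" "R \<le> b * \<rho> x"
  shows "wmeas w (ball x R) \<le> CD * a powr (real DIM('a) * \<kappa>) * exp (c3 * (1 + b) powr m) * wmeas w (ball x r)"
proof -
  have w: "weight w" using assms(1) by (simp add: dbl_def)
  have "R / r \<le> a" "R / \<rho> x \<le> b" using assms rho_pos[of x] by (auto simp: field_simps)
  have "wmeas w (ball x R) \<le> CD * (R / r) powr (real DIM('a) * \<kappa>) * exp (c3 * (1 + R / \<rho> x) powr m) * wmeas w (ball x r)"
    using assms by (simp add: dbl_def)
  also have "\<dots> \<le> CD * a powr (real DIM('a) * \<kappa>) * exp (c3 * (1 + b) powr m) * wmeas w (ball x r)"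
    using \<open>R / r \<le> a\<close> \<open>R / \<rho> x \<le> b\<close> assms rho_pos[of x] m_pos wmeas_nonneg[OF w]
    by (intro mult_right_mono mult_mono powr_mono2 mult_left_mono iffD2[OF exp_le_cancel_iff])
       (auto intro!: divide_nonneg_pos add_nonneg_nonneg)
  finally show ?thesis .
qed

lemma rho_lower:
  assumes "dist x z \<le> a * \<rho> x" "0 \<le> a"
  shows "inverse C0 * (1 + a) powr (- k0) * \<rho> x \<le> \<rho> z"
proof -
  have r: "1 \<le> k0" "1 \<le> C0" "inverse C0 * \<rho> x * (1 + norm (x - z) / \<rho> x) powr (- k0) \<le> \<rho> z"
    using rho by (auto simp: critical_radius_def)
  have "(1 + a) powr (- k0) \<le> (1 + norm (x - z) / \<rho> x) powr (- k0)"
    using assms rho_pos[of x] r by (intro powr_mono2') (auto simp: dist_norm field_simps intro!: add_pos_nonneg)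
  then have "inverse C0 * \<rho> x * (1 + a) powr (- k0) \<le> inverse C0 * \<rho> x * (1 + norm (x - z) / \<rho> x) powr (- k0)"
    using r rho_pos[of x] by (intro mult_left_mono) auto
  then show ?thesis using r(3) by (simp add: mult_ac)
qed

lemma loc_integrable_diff_const:
  assumes "loc_integrable (f :: 'a \<Rightarrow> real)"
  shows "integrable lebesgue (\<lambda>u. (f u - a) * indicator (ball x r) u)"
proof -
  have "integrable lebesgue (\<lambda>u. f u * indicator (ball x r) u)"
    using loc_integrable_ball[OF assms, of x r] by (simp add: set_integrable_def mult.commute)
  moreover have "integrable lebesgue (\<lambda>u. a * indicator (ball x r) u :: real)"
    using indicator_integrable[of x r] by simp
  ultimately have "integrable lebesgue (\<lambda>u. f u * indicator (ball x r) u - a * indicator (ball x r) u)"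
    by (rule Bochner_Integration.integrable_diff)
  then show ?thesis by (simp add: algebra_simps)
qed

lemma T_recentre:
  assumes f: "loc_integrable f"
  shows "AE y in lebesgue. T (\<lambda>u. (f u - a) * indicator (ball x r) u) y
      = T (\<lambda>u. (f u - b) * indicator (ball x r) u) y + (b - a) * T (indicator (ball x r)) y"
proof -
  have 1: "(\<lambda>u. (f u - a) * indicator (ball x r) u) = (\<lambda>u. (f u - b) * indicator (ball x r) u + (b - a) * indicator (ball x r) u)"
    by (auto simp: fun_eq_iff algebra_simps)
  have 2: "integrable lebesgue (\<lambda>u. (b - a) * indicator (ball x r) u :: real)"
    using indicator_integrable[of x r] by simp
  show ?thesis
    using T_add[OF loc_integrable_diff_const[OF f, of b x r] 2] T_cmult[OF indicator_integrable, of "b - a" x r]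
    unfolding 1[symmetric] by eventually_elim simp
qed

text \<open>On a stopping ball f - a is not centred at the mean of f there. Recentring costs |a_z -
  a| times T of an indicator; this is the term \<open>g\<close>, which is not recursive. The
  recursive terms have size \<open>H z (5 * s z)\<close>, controlled by w of the stopping balls;
  these are disjoint and small in volume, and \<open>ainf\<close> makes the total at most half of
  \<open>H x r\<close>.\<close>

lemma local_bound:
  assumes CD: "0 \<le> CD" and c3: "0 \<le> c3" and ka: "0 \<le> \<kappa>" and al: "0 \<le> \<alpha>" and phi: "\<And>e. 0 < e \<Longrightarrow> 0 < \<phi> e"
  shows "\<exists>A\<ge>0. \<forall>w f n x r. dbl \<kappa> c3 CD w \<longrightarrow> ainf \<phi> w \<longrightarrow> bmo \<alpha> w f n \<longrightarrow> 0 < r \<longrightarrow> r \<le> \<rho> x \<longrightarrow>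
    nn_abs (T (\<lambda>u. (f u - avg f (ball x (3 * r))) * indicator (ball x (3 * r)) u)) (ball x r)
      \<le> ennreal (A * n * r powr (\<nu> + \<alpha>) * wmeas w (ball x r))"
proof -
  let ?d = "real DIM('a)"
  define D where "D = CD * 5 powr (?d * \<kappa>) * exp (c3 * (1 + 3) powr m)"
  have D: "0 \<le> D" using CD by (simp add: D_def)
  \<comment> \<open>In 2 (D (e' D)) \<le> 1 one \<open>D\<close> pays for the dilation of the
    stopping balls by 5, the other for the return from B(x,2r) to B(x,r).\<close>
  define e' where "e' = 1 / (2 * D\<^sup>2 + 1)"
  have "0 < 2 * D\<^sup>2 + 1" by (simp add: add_nonneg_pos)
  then have e': "0 < e'" "2 * (D * (e' * D)) \<le> 1"
    by (auto simp: e'_def field_simps power2_eq_square)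
  have k0: "1 \<le> k0" "1 \<le> C0" using rho by (auto simp: critical_radius_def)
  \<comment> \<open>Four demands on the stopping fraction: small weight of the stopping balls, half
    of the volume after dilation by 5, the range of \<open>one_step\<close>, and 5 s \<le>
    \<rho>(z), so that the new balls are again subcritical.\<close>
  define e where "e = min (\<phi> e') (min (1 / (2 * 5 powr ?d)) (min (1/2) (inverse C0 * 2 powr (- k0))))"
  have e: "0 < e" "e \<le> \<phi> e'" "e \<le> 1 / (2 * 5 powr ?d)" "e \<le> 1/2" "e \<le> inverse C0 * 2 powr (- k0)"
    using phi[OF e'(1)] k0 by (auto simp: e_def min_le_iff_disj)
  have e5: "2 * (5 powr ?d * e) \<le> 1" using e(3) by (simp add: field_simps)
  obtain C where C: "0 \<le> C" and st: "\<And>x r h H. 0 < r \<Longrightarrow> h \<in> borel_measurable lebesgue \<Longrightarrow> 0 \<le> H \<Longrightarrow> nn_abs h (ball x (3 * r)) \<le> ennreal H \<Longrightarrow>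
    (\<exists>J s. countable J \<and> J \<subseteq> ball x r \<and> disjoint_family_on (\<lambda>z. ball z (s z)) J \<and> (\<forall>z\<in>J. 0 < s z \<and> 5 * s z \<le> e * r)
      \<and> (\<integral>\<^sup>+z. ennreal (vol (ball z (s z))) \<partial>count_space J) \<le> ennreal (e * vol (ball x r))
      \<and> (\<forall>z\<in>J. nn_abs h (ball z (15 * s z)) \<le> ennreal (C * H * (s z / r) powr ?d))
      \<and> (AE y in lebesgue. y \<in> ball x r \<longrightarrow>
           \<bar>T (\<lambda>u. h u * indicator (ball x (3 * r)) u) y\<bar> \<le> C * H * r powr (\<nu> - ?d)
         \<or> (\<exists>z\<in>J. y \<in> ball z (5 * s z) \<and> \<bar>T (\<lambda>u. h u * indicator (ball x (3 * r)) u) y\<bar>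
                \<le> \<bar>T (\<lambda>u. h u * indicator (ball z (15 * s z)) u) y\<bar> + C * H * r powr (\<nu> - ?d))))"
    using one_step[OF e(1) e(4)] by blast
  obtain C2 where C2: "0 \<le> C2" "\<And>x r. 0 < r \<Longrightarrow> nn_abs (T (indicator (ball x (3 * r)))) (ball x r) \<le> ennreal (C2 * r powr \<nu> * (V * r powr ?d))"
    using T_indicator_bound by blast
  \<comment> \<open>\<open>C * V\<close> comes from the bounded alternative of
    \<open>one_step\<close>, integrated over B; the other term is the cost of recentring.\<close>
  define A where "A = C * V + C2 * (1 + C)"
  have A: "0 \<le> A" using C C2 V_pos by (simp add: A_def)
  have main: "nn_abs (T (\<lambda>u. (f u - avg f (ball x (3 * r))) * indicator (ball x (3 * r)) u)) (ball x r)
      \<le> ennreal ((2 * A * 3 powr \<alpha> * D) * n * r powr (\<nu> + \<alpha>) * wmeas w (ball x r))"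
    if w: "dbl \<kappa> c3 CD w" "ainf \<phi> w" and f: "bmo \<alpha> w f n" and xr: "0 < r" "r \<le> \<rho> x" for w f n x r
  proof -
    have wt: "weight w" using w by (simp add: dbl_def)
    have fl: "loc_integrable f" and n: "0 \<le> n" using f by (auto simp: bmo_def)
    have fm [measurable]: "f \<in> borel_measurable lebesgue" by (rule loc_integrable_measurable[OF fl])
    define W where "W z r = wmeas w (ball z r)" for z r
    have W0: "0 \<le> W z r" for z r unfolding W_def by (rule wmeas_nonneg[OF wt])
    have WD: "W z R \<le> D * W z r" if "0 < r" "r \<le> R" "R \<le> 5 * r" "R \<le> 3 * \<rho> z" for z r R
      unfolding W_def D_def by (rule dbl_bounded[OF w(1) CD c3 ka that])
    define a where "a z r = avg f (ball z (3 * r))" for z r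
    define H where "H z r = n * 3 powr \<alpha> * D * r powr \<alpha> * W z r" for z r
    have H0: "0 \<le> H z r" for z r using n D W0 by (simp add: H_def)
    have fH: "nn_abs (\<lambda>u. f u - a z r) (ball z (3 * r)) \<le> ennreal (H z r)" if "0 < r" "r \<le> \<rho> z" for z r
    proof -
      have "nn_abs (\<lambda>u. f u - a z r) (ball z (3 * r)) \<le> ennreal (n * (3 * r) powr \<alpha> * W z (3 * r))"
        using f that unfolding bmo_def a_def W_def by simp
      also have "n * (3 * r) powr \<alpha> * W z (3 * r) \<le> n * (3 * r) powr \<alpha> * (D * W z r)"
        using n that by (intro mult_left_mono WD) auto
      also have "\<dots> = H z r" using that by (simp add: H_def powr_mult)
      finally show ?thesis by (simp add: ennreal_leI)
    qed
    define F where "F z r y = ennreal \<bar>T (\<lambda>u. (f u - a z r) * indicator (ball z (3 * r)) u) y\<bar>" for z r y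
    have Fm: "F z r \<in> borel_measurable lebesgue" for z r
      unfolding F_def using T_measurable[OF loc_integrable_diff_const[OF fl, of "a z r" z "3 * r"]] by measurable
    define \<Lambda> where "\<Lambda> z r = ennreal (A * r powr \<nu> * H z r)" for z r
    have "(\<integral>\<^sup>+y\<in>ball x r. F x r y \<partial>lebesgue) \<le> 2 * \<Lambda> x r"
    proof (rule absorb[where P = "\<lambda>x r. 0 < r \<and> r \<le> \<rho> x" and F = F and \<Lambda> = \<Lambda>])
      show "0 < r \<and> r \<le> \<rho> x" using xr by simp
      fix x :: 'a and r :: real assume "0 < r \<and> r \<le> \<rho> x"
      then have r: "0 < r" "r \<le> \<rho> x" by auto
      from st[OF r(1) _ H0 fH[OF r]]
      obtain J s where J: "countable J" "J \<subseteq> ball x r" "disjoint_family_on (\<lambda>z. ball z (s z)) J"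
           "\<And>z. z \<in> J \<Longrightarrow> 0 < s z \<and> 5 * s z \<le> e * r"
         and vs: "(\<integral>\<^sup>+z. ennreal (vol (ball z (s z))) \<partial>count_space J) \<le> ennreal (e * vol (ball x r))"
         and hs: "\<And>z. z \<in> J \<Longrightarrow> nn_abs (\<lambda>u. f u - a x r) (ball z (15 * s z)) \<le> ennreal (C * H x r * (s z / r) powr ?d)"
         and ae: "AE y in lebesgue. y \<in> ball x r \<longrightarrow>
             \<bar>T (\<lambda>u. (f u - a x r) * indicator (ball x (3 * r)) u) y\<bar> \<le> C * H x r * r powr (\<nu> - ?d)
           \<or> (\<exists>z\<in>J. y \<in> ball z (5 * s z) \<and> \<bar>T (\<lambda>u. (f u - a x r) * indicator (ball x (3 * r)) u) y\<bar>
                  \<le> \<bar>T (\<lambda>u. (f u - a x r) * indicator (ball z (15 * s z)) u) y\<bar> + C * H x r * r powr (\<nu> - ?d))"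
        by auto
      have er: "e * r \<le> 1/2 * r" using e r by (intro mult_right_mono) auto
      have p: "0 < 5 * s z \<and> 5 * s z \<le> r \<and> 5 * s z \<le> \<rho> z" if z: "z \<in> J" for z
      proof -
        have "dist x z \<le> 1 * \<rho> x" using J(2) z r by fastforce
        from rho_lower[OF this] have "inverse C0 * 2 powr (- k0) * \<rho> x \<le> \<rho> z" by simp
        moreover have "e * r \<le> inverse C0 * 2 powr (- k0) * \<rho> x"
          using e r k0 by (intro mult_mono) auto
        moreover have "0 < s z" "5 * s z \<le> e * r" using J(4)[OF z] by auto
        ultimately show ?thesis using er r by linarith
      qed
      have volp: "emeasure lebesgue (ball z (5 * s z)) = ennreal (5 powr ?d) * ennreal (vol (ball z (s z)))" if "z \<in> J" for z
        using p[OF that] V_pos by (simp add: emeasure_ball_vol vol_V powr_mult mult_ac flip: ennreal_mult del: emeasure_completion)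
      have sumW: "(\<integral>\<^sup>+z. ennreal (W z (s z)) \<partial>count_space J) \<le> ennreal (e' * D * W x r)"
      proof -
        let ?E = "\<Union>z\<in>J. ball z (s z)"
        have Es: "?E \<in> sets lebesgue" using J(1) by auto
        have "emeasure lebesgue ?E = (\<integral>\<^sup>+z. emeasure lebesgue (ball z (s z)) \<partial>count_space J)"
          by (rule emeasure_UN_countable) (use J in auto)
        also have "\<dots> = (\<integral>\<^sup>+z. ennreal (vol (ball z (s z))) \<partial>count_space J)"
          by (intro nn_integral_cong emeasure_ball_vol) (use p in force)
        also note vs
        also have "e * vol (ball x r) \<le> \<phi> e' * vol (ball x (2 * r))"
          using e r V_pos by (intro mult_mono) (auto simp: vol_V intro!: powr_mono2)
        finally have "emeasure lebesgue ?E \<le> ennreal (\<phi> e' * vol (ball x (2 * r)))" by (simp add: ennreal_leI)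
        moreover have "?E \<subseteq> ball x (2 * r)"
        proof
          fix y assume "y \<in> ?E"
          then obtain z where "z \<in> J" "dist z y < s z" by auto
          moreover have "dist x z < r" using J(2) \<open>z \<in> J\<close> by auto
          ultimately show "y \<in> ball x (2 * r)" using p[of z] dist_triangle[of x y z] by simp
        qed
        ultimately have "nn_abs w ?E \<le> ennreal (e' * W x (2 * r))"
          using w(2) r e' Es unfolding ainf_def W_def by simp
        moreover have "nn_abs w ?E = (\<integral>\<^sup>+z. nn_abs w (ball z (s z)) \<partial>count_space J)"
          using nn_abs_disjoint_UN[OF J(1), of w "\<lambda>z. ball z (s z)"] wt J(3)
          by (simp add: weight_def loc_integrable_measurable)
        moreover have "nn_abs w (ball z (s z)) = ennreal (W z (s z))" for z
          unfolding W_def by (rule weight_nn_abs[OF wt])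
        moreover have "e' * W x (2 * r) \<le> e' * (D * W x r)"
          using e' r by (intro mult_left_mono WD) auto
        ultimately show ?thesis by (simp add: mult.assoc) (meson ennreal_leI order_trans)
      qed
      have sumH: "2 * (\<integral>\<^sup>+z. ennreal (H z (5 * s z)) \<partial>count_space J) \<le> ennreal (H x r)"
      proof -
        have "(\<integral>\<^sup>+z. ennreal (H z (5 * s z)) \<partial>count_space J) \<le> ennreal (n * 3 powr \<alpha> * D * r powr \<alpha> * D) * (\<integral>\<^sup>+z. ennreal (W z (s z)) \<partial>count_space J)"
        proof (rule nn_integral_count_space_cmult_le)
          fix z assume z: "z \<in> J"
          have "H z (5 * s z) \<le> n * 3 powr \<alpha> * D * r powr \<alpha> * (D * W z (s z))"
          proof -
            have "(5 * s z) powr \<alpha> * W z (5 * s z) \<le> r powr \<alpha> * (D * W z (s z))"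
            proof (rule mult_mono)
              show "W z (5 * s z) \<le> D * W z (s z)" by (rule WD) (use p[OF z] in auto)
              show "(5 * s z) powr \<alpha> \<le> r powr \<alpha>" using p[OF z] al by (intro powr_mono2) auto
            qed (use W0 in auto)
            then have "(n * 3 powr \<alpha> * D) * ((5 * s z) powr \<alpha> * W z (5 * s z)) \<le> (n * 3 powr \<alpha> * D) * (r powr \<alpha> * (D * W z (s z)))"
              using n D by (intro mult_left_mono) auto
            then show ?thesis unfolding H_def by (simp add: mult.assoc)
          qed
          then show "ennreal (H z (5 * s z)) \<le> ennreal (n * 3 powr \<alpha> * D * r powr \<alpha> * D) * ennreal (W z (s z))"
            using n D W0 by (simp add: ennreal_leI mult_ac flip: ennreal_mult)
        qed
        also have "\<dots> \<le> ennreal (n * 3 powr \<alpha> * D * r powr \<alpha> * D) * ennreal (e' * D * W x r)"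
          using sumW by (rule mult_left_mono) simp
        also have "\<dots> = ennreal ((D * (e' * D)) * H x r)"
          using n D W0 e' by (simp add: H_def mult_ac flip: ennreal_mult)
        finally have "2 * (\<integral>\<^sup>+z. ennreal (H z (5 * s z)) \<partial>count_space J) \<le> 2 * ennreal ((D * (e' * D)) * H x r)"
          by (rule mult_left_mono) simp
        also have "\<dots> = ennreal ((2 * (D * (e' * D))) * H x r)"
          using H0 D e' by (simp add: mult_ac flip: ennreal_mult ennreal_numeral)
        also have "(2 * (D * (e' * D))) * H x r \<le> 1 * H x r"
          using e' H0 by (intro mult_right_mono) auto
        finally show ?thesis by (simp add: ennreal_leI)
      qed
      have sumd: "(\<integral>\<^sup>+z. ennreal ((s z / r) powr ?d) \<partial>count_space J) \<le> 1"
      proof -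
        have "(\<integral>\<^sup>+z. ennreal ((s z / r) powr ?d) \<partial>count_space J)
           \<le> ennreal (1 / (V * r powr ?d)) * (\<integral>\<^sup>+z. ennreal (vol (ball z (s z))) \<partial>count_space J)"
        proof (rule nn_integral_count_space_cmult_le)
          fix z assume "z \<in> J"
          then have "0 < s z" using p by force
          then show "ennreal ((s z / r) powr ?d) \<le> ennreal (1 / (V * r powr ?d)) * ennreal (vol (ball z (s z)))"
            using r V_pos by (simp add: vol_V powr_divide flip: ennreal_mult)
        qed
        also have "\<dots> \<le> ennreal (1 / (V * r powr ?d)) * ennreal (e * vol (ball x r))"
          using vs by (rule mult_left_mono) simp
        also have "\<dots> \<le> 1" using r V_pos e by (simp add: vol_V flip: ennreal_mult)
        finally show ?thesis .
      qed
      define g where "g z y = ennreal (\<bar>a z (5 * s z) - a x r\<bar> * \<bar>T (indicator (ball z (15 * s z))) y\<bar>)" for z y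
      have gm: "g z \<in> borel_measurable lebesgue" for z
        unfolding g_def using T_measurable[OF indicator_integrable, of z "15 * s z"] by measurable
      \<comment> \<open>Both means are compared with f on the 15-fold ball: \<open>a x r\<close> by
        the stopping bound \<open>hs\<close>, and \<open>a z (5 * s z)\<close> by the BMO
        condition.\<close>
      have adiff: "\<bar>a z (5 * s z) - a x r\<bar> * (V * (15 * s z) powr ?d) \<le> H z (5 * s z) + C * H x r * (s z / r) powr ?d" if z: "z \<in> J" for z
      proof -
        have "ennreal (\<bar>a z (5 * s z) - a x r\<bar> * (V * (15 * s z) powr ?d)) = nn_abs (\<lambda>u. (f u - a x r) + (a z (5 * s z) - f u)) (ball z (15 * s z))"
          using p[OF z] V_pos by (simp add: nn_abs_const emeasure_ball_V ennreal_mult del: emeasure_completion)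
        also have "\<dots> \<le> nn_abs (\<lambda>u. f u - a x r) (ball z (15 * s z)) + nn_abs (\<lambda>u. a z (5 * s z) - f u) (ball z (15 * s z))"
          by (rule nn_abs_add) measurable
        also have "nn_abs (\<lambda>u. a z (5 * s z) - f u) (ball z (15 * s z)) = nn_abs (\<lambda>u. f u - a z (5 * s z)) (ball z (15 * s z))"
          by (simp add: nn_abs_def abs_minus_commute)
        also have "nn_abs (\<lambda>u. f u - a x r) (ball z (15 * s z)) + \<dots> \<le> ennreal (C * H x r * (s z / r) powr ?d) + ennreal (H z (5 * s z))"
          using hs[OF z] fH[of "5 * s z" z] p[OF z] by (intro add_mono) auto
        also have "\<dots> = ennreal (H z (5 * s z) + C * H x r * (s z / r) powr ?d)"
          using H0 C by (simp add: add.commute flip: ennreal_plus)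
        finally show ?thesis using H0[of z "5 * s z"] H0[of x r] C by (subst (asm) ennreal_le_iff) auto
      qed
      have gint: "(\<integral>\<^sup>+z. (\<integral>\<^sup>+y\<in>ball z (5 * s z). g z y \<partial>lebesgue) \<partial>count_space J) \<le> ennreal (C2 * r powr \<nu> * (H x r + C * H x r))"
      proof -
        have "(\<integral>\<^sup>+z. (\<integral>\<^sup>+y\<in>ball z (5 * s z). g z y \<partial>lebesgue) \<partial>count_space J)
          \<le> ennreal (C2 * r powr \<nu>) * (\<integral>\<^sup>+z. ennreal (H z (5 * s z)) + ennreal (C * H x r) * ennreal ((s z / r) powr ?d) \<partial>count_space J)"
        proof (rule nn_integral_count_space_cmult_le)
          fix z assume z: "z \<in> J"
          let ?D = "\<bar>a z (5 * s z) - a x r\<bar>"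
          define t where "t = T (indicator (ball z (15 * s z)))"
          have [measurable]: "t \<in> borel_measurable lebesgue"
            unfolding t_def by (rule T_measurable[OF indicator_integrable])
          have "(\<integral>\<^sup>+y\<in>ball z (5 * s z). g z y \<partial>lebesgue) = (\<integral>\<^sup>+y. ennreal ?D * (ennreal \<bar>t y\<bar> * indicator (ball z (5 * s z)) y) \<partial>lebesgue)"
            unfolding g_def t_def by (simp add: ennreal_mult mult_ac)
          also have "\<dots> = ennreal ?D * nn_abs (T (indicator (ball z (15 * s z)))) (ball z (5 * s z))"
            unfolding nn_abs_def t_def[symmetric] by (rule nn_integral_cmult) measurable
          also have "\<dots> \<le> ennreal ?D * ennreal (C2 * (5 * s z) powr \<nu> * (V * (5 * s z) powr ?d))"
            using C2(2)[of "5 * s z" z] p[OF z] by (intro mult_left_mono) auto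
          also have "\<dots> = ennreal (C2 * (5 * s z) powr \<nu> * (?D * (V * (5 * s z) powr ?d)))"
            using C2 V_pos by (simp add: mult_ac flip: ennreal_mult)
          also have "C2 * (5 * s z) powr \<nu> * (?D * (V * (5 * s z) powr ?d)) \<le> C2 * r powr \<nu> * (?D * (V * (15 * s z) powr ?d))"
            using p[OF z] C2 V_pos nu_nonneg by (intro mult_mono powr_mono2 mult_nonneg_nonneg) auto
          also have "\<dots> \<le> C2 * r powr \<nu> * (H z (5 * s z) + C * H x r * (s z / r) powr ?d)"
            using adiff[OF z] C2 by (intro mult_left_mono) auto
          also have "ennreal \<dots> = ennreal (C2 * r powr \<nu>) * (ennreal (H z (5 * s z)) + ennreal (C * H x r) * ennreal ((s z / r) powr ?d))"
            using C2 C H0 by (simp add: ennreal_mult ennreal_plus)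
          finally show "(\<integral>\<^sup>+y\<in>ball z (5 * s z). g z y \<partial>lebesgue) \<le>
             ennreal (C2 * r powr \<nu>) * (ennreal (H z (5 * s z)) + ennreal (C * H x r) * ennreal ((s z / r) powr ?d))"
            by (simp add: ennreal_leI)
        qed
        also have "(\<integral>\<^sup>+z. ennreal (H z (5 * s z)) + ennreal (C * H x r) * ennreal ((s z / r) powr ?d) \<partial>count_space J)
          = (\<integral>\<^sup>+z. ennreal (H z (5 * s z)) \<partial>count_space J) + ennreal (C * H x r) * (\<integral>\<^sup>+z. ennreal ((s z / r) powr ?d) \<partial>count_space J)"
          by (simp add: nn_integral_add nn_integral_cmult)
        also have "\<dots> \<le> ennreal (H x r) + ennreal (C * H x r) * 1"
        proof (intro add_mono mult_left_mono sumd)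
          show "(\<integral>\<^sup>+z. ennreal (H z (5 * s z)) \<partial>count_space J) \<le> ennreal (H x r)"
            by (rule order_trans[OF _ sumH]) (simp add: mult_2 add_increasing)
        qed simp
        also have "ennreal (C2 * r powr \<nu>) * (ennreal (H x r) + ennreal (C * H x r) * 1) = ennreal (C2 * r powr \<nu> * (H x r + C * H x r))"
          using C2 C H0 by (simp add: ennreal_mult ennreal_plus)
        finally show ?thesis by (simp add: mult_left_mono)
      qed
      show "\<exists>J s. countable J \<and> (\<forall>z\<in>J. 0 < s z \<and> s z \<le> \<rho> z)
         \<and> (\<forall>N::nat. (\<integral>\<^sup>+y\<in>ball x r. min (F x r y) (of_nat N) \<partial>lebesgue)
                \<le> \<Lambda> x r + (\<integral>\<^sup>+z. (\<integral>\<^sup>+y\<in>ball z (s z). min (F z (s z) y) (of_nat N) \<partial>lebesgue) \<partial>count_space J))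
         \<and> 2 * (\<integral>\<^sup>+z. \<Lambda> z (s z) \<partial>count_space J) \<le> \<Lambda> x r
         \<and> 2 * (\<integral>\<^sup>+z. emeasure lebesgue (ball z (s z)) \<partial>count_space J) \<le> emeasure lebesgue (ball x r)"
      proof (intro exI[of _ J] exI[of _ "\<lambda>z. 5 * s z"] conjI[OF J(1)] conjI allI ballI)
        show "0 < 5 * s z" "5 * s z \<le> \<rho> z" if "z \<in> J" for z using p[OF that] by auto
        have "(\<integral>\<^sup>+z. emeasure lebesgue (ball z (5 * s z)) \<partial>count_space J)
          \<le> ennreal (5 powr ?d) * (\<integral>\<^sup>+z. ennreal (vol (ball z (s z))) \<partial>count_space J)"
          by (rule nn_integral_count_space_cmult_le) (simp only: volp order_refl)
        also have "\<dots> \<le> ennreal (5 powr ?d) * ennreal (e * vol (ball x r))"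
          using vs by (rule mult_left_mono) simp
        finally have "2 * (\<integral>\<^sup>+z. emeasure lebesgue (ball z (5 * s z)) \<partial>count_space J) \<le> 2 * (ennreal (5 powr ?d) * ennreal (e * vol (ball x r)))"
          by (rule mult_left_mono) simp
        also have "\<dots> = ennreal (2 * (5 powr ?d * e) * vol (ball x r))"
          using e vol_ball_pos[OF r(1), of x] by (simp add: mult_ac flip: ennreal_mult'' ennreal_numeral)
        also have "2 * (5 powr ?d * e) * vol (ball x r) \<le> 1 * vol (ball x r)"
          using e5 vol_ball_pos[OF r(1), of x] by (intro mult_right_mono) auto
        finally show "2 * (\<integral>\<^sup>+z. emeasure lebesgue (ball z (5 * s z)) \<partial>count_space J) \<le> emeasure lebesgue (ball x r)"
          using r by (simp add: emeasure_ball_vol ennreal_leI del: emeasure_completion)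
        have "(\<integral>\<^sup>+z. \<Lambda> z (5 * s z) \<partial>count_space J) \<le> ennreal (A * r powr \<nu>) * (\<integral>\<^sup>+z. ennreal (H z (5 * s z)) \<partial>count_space J)"
        proof (rule nn_integral_count_space_cmult_le)
          fix z assume z: "z \<in> J"
          have "A * (5 * s z) powr \<nu> * H z (5 * s z) \<le> A * r powr \<nu> * H z (5 * s z)"
            using p[OF z] A H0 nu_nonneg by (intro mult_right_mono mult_left_mono powr_mono2) auto
          then show "\<Lambda> z (5 * s z) \<le> ennreal (A * r powr \<nu>) * ennreal (H z (5 * s z))"
            unfolding \<Lambda>_def using A H0 by (simp add: ennreal_leI flip: ennreal_mult)
        qed
        then have "2 * (\<integral>\<^sup>+z. \<Lambda> z (5 * s z) \<partial>count_space J) \<le> ennreal (A * r powr \<nu>) * (2 * (\<integral>\<^sup>+z. ennreal (H z (5 * s z)) \<partial>count_space J))"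
          unfolding mult.left_commute[of "ennreal (A * r powr \<nu>)"] by (rule mult_left_mono) simp
        also have "\<dots> \<le> ennreal (A * r powr \<nu>) * ennreal (H x r)" using sumH by (rule mult_left_mono) simp
        also have "\<dots> = \<Lambda> x r" using A H0 by (simp add: \<Lambda>_def ennreal_mult)
        finally show "2 * (\<integral>\<^sup>+z. \<Lambda> z (5 * s z) \<partial>count_space J) \<le> \<Lambda> x r" .
        fix N :: nat
        have rec: "AE y in lebesgue. \<forall>z\<in>J. T (\<lambda>u. (f u - a x r) * indicator (ball z (15 * s z)) u) y
          = T (\<lambda>u. (f u - a z (5 * s z)) * indicator (ball z (15 * s z)) u) y + (a z (5 * s z) - a x r) * T (indicator (ball z (15 * s z))) y"
          using T_recentre[OF fl] by (subst AE_ball_countable[OF J(1)]) auto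
        have "(\<integral>\<^sup>+y\<in>ball x r. min (F x r y) (of_nat N) \<partial>lebesgue) \<le> ennreal (C * H x r * r powr (\<nu> - ?d)) * emeasure lebesgue (ball x r)
           + (\<integral>\<^sup>+z. (\<integral>\<^sup>+y\<in>ball z (5 * s z). g z y \<partial>lebesgue) \<partial>count_space J)
           + (\<integral>\<^sup>+z. (\<integral>\<^sup>+y\<in>ball z (5 * s z). min (F z (5 * s z) y) (of_nat N) \<partial>lebesgue) \<partial>count_space J)"
        proof (rule integrate_step[OF J(1) Fm gm])
          show "AE y in lebesgue. y \<in> ball x r \<longrightarrow> F x r y \<le> ennreal (C * H x r * r powr (\<nu> - ?d)) \<or>
             (\<exists>z\<in>J. y \<in> ball z (5 * s z) \<and> F x r y \<le> F z (5 * s z) y + g z y + ennreal (C * H x r * r powr (\<nu> - ?d)))"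
            using ae rec
          proof eventually_elim
            case (elim y)
            show ?case
            proof
              assume "y \<in> ball x r"
              with elim(1) consider "\<bar>T (\<lambda>u. (f u - a x r) * indicator (ball x (3 * r)) u) y\<bar> \<le> C * H x r * r powr (\<nu> - ?d)"
                | z where "z \<in> J" "y \<in> ball z (5 * s z)" "\<bar>T (\<lambda>u. (f u - a x r) * indicator (ball x (3 * r)) u) y\<bar>
                  \<le> \<bar>T (\<lambda>u. (f u - a x r) * indicator (ball z (15 * s z)) u) y\<bar> + C * H x r * r powr (\<nu> - ?d)"
                by blast
              then show "F x r y \<le> ennreal (C * H x r * r powr (\<nu> - ?d)) \<or>
               (\<exists>z\<in>J. y \<in> ball z (5 * s z) \<and> F x r y \<le> F z (5 * s z) y + g z y + ennreal (C * H x r * r powr (\<nu> - ?d)))"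
              proof cases
                case 1 then show ?thesis unfolding F_def by (simp add: ennreal_leI)
              next
                case (2 z)
                have eq: "ball z (3 * (5 * s z)) = ball z (15 * s z)" by simp
                have "\<bar>T (\<lambda>u. (f u - a x r) * indicator (ball x (3 * r)) u) y\<bar>
                  \<le> \<bar>T (\<lambda>u. (f u - a z (5 * s z)) * indicator (ball z (15 * s z)) u) y\<bar>
                    + \<bar>a z (5 * s z) - a x r\<bar> * \<bar>T (indicator (ball z (15 * s z))) y\<bar> + C * H x r * r powr (\<nu> - ?d)"
                  using 2(3) elim(2)[rule_format, OF 2(1)]
                    abs_triangle_ineq[of "T (\<lambda>u. (f u - a z (5 * s z)) * indicator (ball z (15 * s z)) u) y" "(a z (5 * s z) - a x r) * T (indicator (ball z (15 * s z))) y"]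
                  unfolding abs_mult by linarith
                then have "F x r y \<le> F z (5 * s z) y + g z y + ennreal (C * H x r * r powr (\<nu> - ?d))"
                  unfolding F_def g_def eq using C H0[of x r] by (simp add: ennreal_leI flip: ennreal_plus)
                then show ?thesis using 2 by blast
              qed
            qed
          qed
        qed
        also have "ennreal (C * H x r * r powr (\<nu> - ?d)) * emeasure lebesgue (ball x r) = ennreal (C * V * r powr \<nu> * H x r)"
        proof -
          have "C * H x r * r powr (\<nu> - ?d) * (V * r powr ?d) = C * V * r powr \<nu> * H x r"
            using r by (simp add: powr_diff)
          then show ?thesis using r V_pos C H0[of x r] by (simp add: emeasure_ball_V flip: ennreal_mult del: emeasure_completion)
        qed
        also have "ennreal (C * V * r powr \<nu> * H x r) + (\<integral>\<^sup>+z. (\<integral>\<^sup>+y\<in>ball z (5 * s z). g z y \<partial>lebesgue) \<partial>count_space J)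
            + (\<integral>\<^sup>+z. (\<integral>\<^sup>+y\<in>ball z (5 * s z). min (F z (5 * s z) y) (of_nat N) \<partial>lebesgue) \<partial>count_space J)
           \<le> ennreal (C * V * r powr \<nu> * H x r) + ennreal (C2 * r powr \<nu> * (H x r + C * H x r))
            + (\<integral>\<^sup>+z. (\<integral>\<^sup>+y\<in>ball z (5 * s z). min (F z (5 * s z) y) (of_nat N) \<partial>lebesgue) \<partial>count_space J)"
          by (intro add_mono gint) auto
        also have "ennreal (C * V * r powr \<nu> * H x r) + ennreal (C2 * r powr \<nu> * (H x r + C * H x r)) = \<Lambda> x r"
          using C C2 V_pos H0[of x r] by (simp add: \<Lambda>_def A_def algebra_simps flip: ennreal_plus)
        finally show "(\<integral>\<^sup>+y\<in>ball x r. min (F x r y) (of_nat N) \<partial>lebesgue)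
                \<le> \<Lambda> x r + (\<integral>\<^sup>+z. (\<integral>\<^sup>+y\<in>ball z (5 * s z). min (F z (5 * s z) y) (of_nat N) \<partial>lebesgue) \<partial>count_space J)" .
      qed
    qed (rule Fm)
    also have "2 * \<Lambda> x r = ennreal (2 * (A * r powr \<nu> * H x r))"
      unfolding \<Lambda>_def using A H0[of x r] by (simp flip: ennreal_mult ennreal_numeral)
    also have "2 * (A * r powr \<nu> * H x r) = (2 * A * 3 powr \<alpha> * D) * n * r powr (\<nu> + \<alpha>) * wmeas w (ball x r)"
      by (simp add: H_def W_def powr_add)
    finally show ?thesis unfolding F_def nn_abs_def a_def .
  qed
  show ?thesis
    by (intro exI[of _ "2 * A * 3 powr \<alpha> * D"] conjI allI impI main) (use A D in auto)
qed

end

section \<open>The tail of the operator\<close>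

text \<open>The inequality x \<le> exp x for x = (b m / q) t^m, raised to the power q / m.\<close>

lemma exp_neg_powr_bound:
  fixes b m q :: real
  assumes "0 < b" "0 < m" "0 < q"
  shows "\<exists>C\<ge>0. \<forall>t>0. exp (- b * t powr m) \<le> C * t powr (- q)"
proof (intro exI[of _ "(q / (b * m)) powr (q / m)"] conjI allI impI)
  fix t :: real assume t: "0 < t"
  define x where "x = b * t powr m * (m / q)"
  have x: "0 < x" using assms t by (simp add: x_def)
  have "x \<le> exp x" using exp_ge_add_one_self[of x] by linarith
  then have "x powr (q / m) \<le> exp x powr (q / m)" using x assms by (intro powr_mono2) auto
  also have "\<dots> = exp (b * t powr m)" using assms by (simp add: powr_def x_def)
  finally have 1: "x powr (q / m) \<le> exp (b * t powr m)" .
  have "x powr (q / m) = (b * m / q) powr (q / m) * t powr q"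
  proof -
    have "x = (b * m / q) * t powr m" by (simp add: x_def)
    then show ?thesis using assms t by (simp only: powr_mult) (simp add: powr_powr)
  qed
  then have "(b * m / q) powr (q / m) * t powr q \<le> exp (b * t powr m)" using 1 by simp
  then have "(q / (b * m)) powr (q / m) * ((b * m / q) powr (q / m) * t powr q) \<le> (q / (b * m)) powr (q / m) * exp (b * t powr m)"
    by (rule mult_left_mono) simp
  moreover have "(q / (b * m)) powr (q / m) * (b * m / q) powr (q / m) = 1"
    using assms by (simp flip: powr_mult)
  ultimately have "t powr q \<le> (q / (b * m)) powr (q / m) * exp (b * t powr m)"
    by (simp flip: mult.assoc)
  then show "exp (- b * t powr m) \<le> (q / (b * m)) powr (q / m) * t powr (- q)"
    using t by (simp add: exp_minus powr_minus field_simps)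
qed auto

lemma interpolate_le:
  fixes D A s e \<theta> :: real
  assumes "0 \<le> D" "D \<le> A * s" "D \<le> 2 * A * e" "0 \<le> \<theta>" "\<theta> \<le> 1" "0 < s" "0 < e" "0 \<le> A"
  shows "D \<le> 2 * A * (s powr \<theta> * e powr (1 - \<theta>))"
proof (cases "D = 0")
  case False
  then have D: "0 < D" using assms by simp
  have "D = D powr \<theta> * D powr (1 - \<theta>)" using D by (simp flip: powr_add)
  also have "\<dots> \<le> (A * s) powr \<theta> * (2 * A * e) powr (1 - \<theta>)"
    using assms by (intro mult_mono powr_mono2) auto
  also have "\<dots> = (A powr \<theta> * A powr (1 - \<theta>)) * 2 powr (1 - \<theta>) * (s powr \<theta> * e powr (1 - \<theta>))"
    using assms by (simp add: powr_mult mult_ac)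
  also have "A powr \<theta> * A powr (1 - \<theta>) = A"
    using assms D by (cases "A = 0") (auto simp flip: powr_add)
  also have "A * 2 powr (1 - \<theta>) * (s powr \<theta> * e powr (1 - \<theta>)) \<le> A * 2 * (s powr \<theta> * e powr (1 - \<theta>))"
    using assms powr_mono[of "1 - \<theta>" 1 2] by (intro mult_right_mono mult_left_mono) auto
  finally show ?thesis by (simp add: mult_ac)
qed (use assms in auto)

lemma avg_diff:
  assumes f: "loc_integrable (f::'a::euclidean_space \<Rightarrow> real)" and s: "0 < s"
  shows "ennreal (\<bar>avg f (ball x s) - b\<bar> * vol (ball x s)) \<le> nn_abs (\<lambda>u. f u - b) (ball x s)"
proof -
  let ?B = "ball x s"
  have fi: "set_integrable lebesgue ?B f" by (rule loc_integrable_ball[OF f])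
  have ci: "set_integrable lebesgue ?B (\<lambda>_. b)"
    unfolding set_integrable_def by (simp add: emeasure_ball_vol[of s x, simplified] s less_imp_le)
  have v: "0 < vol ?B" by (rule vol_ball_pos[OF s])
  have di: "set_integrable lebesgue ?B (\<lambda>u. f u - b)" by (rule set_integral_diff(1)[OF fi ci])
  have "(LINT u:?B|lebesgue. f u - b) = (LINT u:?B|lebesgue. f u) - (LINT u:?B|lebesgue. b)"
    by (rule set_integral_diff(2)[OF fi ci])
  also have "(LINT u:?B|lebesgue. b) = b * vol ?B"
    by (simp add: set_lebesgue_integral_def vol_def)
  also have "(LINT u:?B|lebesgue. f u) = avg f ?B * vol ?B"
    using v by (simp add: avg_def)
  finally have "(avg f ?B - b) * vol ?B = (LINT u:?B|lebesgue. f u - b)"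
    by (simp add: algebra_simps)
  then have "\<bar>avg f ?B - b\<bar> * vol ?B = \<bar>LINT u:?B|lebesgue. f u - b\<bar>"
    using v by (metis abs_mult abs_of_pos)
  also have "\<dots> \<le> (LINT u:?B|lebesgue. \<bar>f u - b\<bar>)"
    using set_integral_norm_bound[OF di] by simp
  finally show ?thesis using nn_abs_eq_set_integral[OF di] by (simp add: ennreal_leI)
qed

section \<open>Decay of the kernel off 3B, and its interpolation with smoothness\<close>

context scz
begin

lemma rho_upper:
  assumes "dist x z \<le> a * \<rho> x" "0 \<le> a"
  shows "\<rho> z \<le> C0 * (1 + a) * \<rho> x"
proof -
  have r: "1 \<le> k0" "1 \<le> C0" "\<rho> z \<le> C0 * \<rho> x * (1 + norm (x - z) / \<rho> x) powr (k0 / (k0 + 1))"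
    using rho by (auto simp: critical_radius_def)
  have "(1 + norm (x - z) / \<rho> x) powr (k0 / (k0 + 1)) \<le> (1 + norm (x - z) / \<rho> x) powr 1"
    using r rho_pos[of x] by (intro powr_mono) (auto simp: field_simps)
  also have "\<dots> \<le> 1 + a"
    using assms rho_pos[of x] by (auto simp: dist_norm field_simps powr_one intro!: add_nonneg_nonneg)
  finally have "C0 * \<rho> x * (1 + norm (x - z) / \<rho> x) powr (k0 / (k0 + 1)) \<le> C0 * \<rho> x * (1 + a)"
    using r rho_pos[of x] by (intro mult_left_mono) auto
  then show ?thesis using r(3) by (simp add: mult_ac)
qed

lemma C0_ge1: "1 \<le> C0" using rho by (simp add: critical_radius_def)

text \<open>The constant \<open>4 C\<^sub>0\<close> absorbs both the change of centre in the critical radius and the passage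
  from the inner to the outer radius of a dyadic annulus.\<close>

lemma K_decay:
  assumes r: "0 < r" "8 * r \<le> \<rho> x" and y: "norm (y - x) < r" and u: "2 ^ k * (3 * r) \<le> norm (u - x)"
  shows "\<bar>K y u\<bar> \<le> CK * (2 ^ Suc k * r) powr (\<nu> - real DIM('a))
           * exp (- (c * (4 * C0) powr (- m) * (1 + 2 ^ Suc k * (3 * r) / \<rho> x) powr m))"
proof -
  define X where "X = (2::real) ^ k * r"
  have X: "r \<le> X" using r mult_right_mono[of 1 "2 ^ k" r] by (simp add: X_def)
  have uX: "3 * X \<le> norm (u - x)" using u by (simp add: X_def mult_ac)
  have D: "norm (u - x) - r \<le> norm (y - u)"
    using norm_triangle_ineq4[of "y - x" "y - u"] y by simp
  then have D2: "2 * X \<le> norm (y - u)" using uX X by linarith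
  then have yu: "y \<noteq> u" using X r by auto
  \<comment> \<open>The distance from x to y is below \<rho>(x)/8, so \<open>rho_upper\<close> gives
    the factor 1 + 1/8.\<close>
  have ry: "\<rho> y \<le> C0 * (9/8) * \<rho> x"
    using rho_upper[of x y "1/8"] y r by (simp add: dist_norm norm_minus_commute)
  have px: "0 < \<rho> x" and py: "0 < \<rho> y" by (rule rho_pos)+
  \<comment> \<open>Here 4 C0 * 2X / ((9/8) C0 \<rho>(x)) = (64/9) X / \<rho>(x) \<ge> 6 X /
    \<rho>(x): the factor 4 has enough room for the outer radius 6X of the shell.\<close>
  have "1 + 2 * (3 * X) / \<rho> x \<le> 4 * C0 * (1 + norm (y - u) / \<rho> y)"
  proof -
    have "norm (y - u) / \<rho> y \<ge> 2 * X / (C0 * (9/8) * \<rho> x)"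
      using D2 ry py X r by (intro frac_le) auto
    then have "4 * C0 * (norm (y - u) / \<rho> y) \<ge> 4 * C0 * (2 * X / (C0 * (9/8) * \<rho> x))"
      using C0_ge1 by (intro mult_left_mono) auto
    moreover have "4 * C0 * (2 * X / (C0 * (9/8) * \<rho> x)) \<ge> 2 * (3 * X) / \<rho> x"
      using C0_ge1 px X r by (simp add: field_simps)
    ultimately show ?thesis using C0_ge1 by (simp add: distrib_left)
  qed
  then have "(1 + 2 * (3 * X) / \<rho> x) powr m \<le> (4 * C0 * (1 + norm (y - u) / \<rho> y)) powr m"
    using m_pos px X r by (intro powr_mono2) (auto intro!: add_nonneg_nonneg divide_nonneg_pos)
  also have "\<dots> = (4 * C0) powr m * (1 + norm (y - u) / \<rho> y) powr m"
    using C0_ge1 py by (subst powr_mult) (auto intro!: add_nonneg_nonneg divide_nonneg_pos)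
  finally have "(4 * C0) powr (- m) * (1 + 2 * (3 * X) / \<rho> x) powr m \<le> (4 * C0) powr (- m) * ((4 * C0) powr m * (1 + norm (y - u) / \<rho> y) powr m)"
    by (rule mult_left_mono) simp
  also have "\<dots> = (1 + norm (y - u) / \<rho> y) powr m"
    using C0_ge1 by (simp add: powr_minus field_simps)
  finally have "c * ((4 * C0) powr (- m) * (1 + 2 * (3 * X) / \<rho> x) powr m) \<le> c * (1 + norm (y - u) / \<rho> y) powr m"
    using c_pos by (intro mult_left_mono) auto
  then have ex: "exp (- c * (1 + norm (y - u) / \<rho> y) powr m) \<le> exp (- (c * (4 * C0) powr (- m) * (1 + 2 ^ Suc k * (3 * r) / \<rho> x) powr m))"
    by (simp add: X_def mult_ac)
  have "\<bar>K y u\<bar> \<le> CK / norm (y - u) powr (real DIM('a) - \<nu>) * exp (- c * (1 + norm (y - u) / \<rho> y) powr m)"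
    by (rule K_size[OF yu])
  also have "\<dots> \<le> (CK / (2 * X) powr (real DIM('a) - \<nu>)) * exp (- (c * (4 * C0) powr (- m) * (1 + 2 ^ Suc k * (3 * r) / \<rho> x) powr m))"
    using D2 X r CK_nonneg nu_less_DIM yu ex
    by (intro mult_mono divide_left_mono powr_mono2 mult_pos_pos) auto
  also have "CK / (2 * X) powr (real DIM('a) - \<nu>) = CK * (2 ^ Suc k * r) powr (\<nu> - real DIM('a))"
    using X r powr_minus_divide[of "2 * X" "real DIM('a) - \<nu>"] by (simp add: X_def mult_ac)
  finally show ?thesis .
qed

text \<open>The geometric mean of the smoothness bound and the decay bound. The parameter \<theta>
  trades the power of 2^(k+1) against the exponential rate and will be tuned to
  \<open>c3\<close>.\<close>

lemma K_smooth_decay: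
  assumes r: "0 < r" "8 * r \<le> \<rho> x" and y: "norm (y - x) < r" and u: "2 ^ k * (3 * r) \<le> norm (u - x)"
    and th: "0 \<le> \<theta>" "\<theta> \<le> 1"
  shows "\<bar>K y u - K x u\<bar> \<le> 2 * (CK * (2 ^ Suc k * r) powr (\<nu> - real DIM('a))) * ((2 ^ Suc k) powr (- (\<delta> * \<theta>))
           * exp (- ((1 - \<theta>) * c * (4 * C0) powr (- m) * (1 + 2 ^ Suc k * (3 * r) / \<rho> x) powr m)))"
proof -
  define A where "A = CK * (2 ^ Suc k * r) powr (\<nu> - real DIM('a))"
  define E where "E = c * (4 * C0) powr (- m) * (1 + 2 ^ Suc k * (3 * r) / \<rho> x) powr m"
  have A: "0 \<le> A" using CK_nonneg by (simp add: A_def)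
  have 1: "\<bar>K y u - K x u\<bar> \<le> A * (1 / 2 ^ Suc k) powr \<delta>"
    unfolding A_def by (rule K_smooth_annulus[OF r(1) y u])
  have "\<bar>K y u\<bar> \<le> A * exp (- E)" unfolding A_def E_def by (rule K_decay[OF r y u])
  moreover have "\<bar>K x u\<bar> \<le> A * exp (- E)" unfolding A_def E_def by (rule K_decay[OF r _ u]) (use r in simp)
  ultimately have 2: "\<bar>K y u - K x u\<bar> \<le> 2 * A * exp (- E)" by linarith
  have "\<bar>K y u - K x u\<bar> \<le> 2 * A * (((1 / 2 ^ Suc k) powr \<delta>) powr \<theta> * exp (- E) powr (1 - \<theta>))"
    by (rule interpolate_le[OF _ 1 2 th _ _ A]) auto
  also have "((1 / 2 ^ Suc k) powr \<delta>) powr \<theta> = (2 ^ Suc k) powr (- (\<delta> * \<theta>))"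
    by (simp add: powr_powr powr_divide powr_minus_divide)
  also have "exp (- E) powr (1 - \<theta>) = exp (- ((1 - \<theta>) * E))" by (simp add: powr_def)
  finally show ?thesis unfolding A_def E_def by (simp add: mult.assoc)
qed

end

lemma suminf_ennreal_le:
  fixes f :: "nat \<Rightarrow> real"
  assumes "f sums s" "\<And>k. 0 \<le> f k" "0 \<le> c" 
  shows "(\<Sum>k. ennreal (c * f k)) = ennreal (c * s)"
proof -
  have "(\<lambda>k. c * f k) sums (c * s)" using assms(1) by (rule sums_mult)
  then show ?thesis using assms by (intro suminf_ennreal_eq) auto
qed

text \<open>Fixes the data on which constants may depend: the exponents, the doubling data
  \<open>c3\<close> and \<open>CD\<close>, and the modulus \<phi>. The lemmas inside quantify over
  all weights sharing these data.\<close>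

locale scz_bmo = scz \<rho> k0 C0 \<nu> \<delta> c m T K CT CK
  for \<rho> :: "'a::euclidean_space \<Rightarrow> real" and k0 C0 \<nu> \<delta> c m T K CT CK +
  fixes \<alpha> \<kappa> c3 CD :: real and \<phi> :: "real \<Rightarrow> real"
  assumes alpha_nonneg: "0 \<le> \<alpha>" and kappa_ge1: "1 \<le> \<kappa>"
    and exponents: "\<alpha> + real DIM('a) * (\<kappa> - 1) + \<nu> < \<delta>"
    and c3_nonneg: "0 \<le> c3"
    and c3_small: "c3 < c * (1 - (real DIM('a) * (\<kappa> - 1) + \<alpha> + \<nu>) / \<delta>) * (4 * C0) powr (- m)"
    and CD_nonneg: "0 \<le> CD" and phi_pos: "\<And>e. 0 < e \<Longrightarrow> 0 < \<phi> e"
begin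

definition "\<gamma> = \<alpha> + real DIM('a) * (\<kappa> - 1)"

text \<open>At t = \<rho>/r this is the size of the sum of 2^(i \<gamma>) over the dyadic scales
  between r and \<rho>: a geometric sum if \<gamma> > 0, the number of scales if \<gamma> = 0. Its
  reciprocal is the right side of condition (i).\<close>

definition "Theta t = (if 0 < \<gamma> then t powr \<gamma> else ln t)"

lemma gamma_nonneg: "0 \<le> \<gamma>"
  using alpha_nonneg kappa_ge1 by (simp add: \<gamma>_def)

lemma level_bound:
  assumes w: "dbl \<kappa> c3 CD w" and n: "0 \<le> n" and r: "0 < r" "r \<le> R"
  shows "n * R powr \<alpha> * wmeas w (ball x R)
     \<le> n * CD * R powr (\<alpha> + real DIM('a) * \<kappa>) * r powr (- real DIM('a) * \<kappa>) * exp (c3 * (1 + R / \<rho> x) powr m) * wmeas w (ball x r)"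
proof -
  have "wmeas w (ball x R) \<le> CD * (R / r) powr (real DIM('a) * \<kappa>) * exp (c3 * (1 + R / \<rho> x) powr m) * wmeas w (ball x r)"
    using w r by (simp add: dbl_def)
  then have "n * R powr \<alpha> * wmeas w (ball x R)
     \<le> n * R powr \<alpha> * (CD * (R / r) powr (real DIM('a) * \<kappa>) * exp (c3 * (1 + R / \<rho> x) powr m) * wmeas w (ball x r))"
    using n by (intro mult_left_mono) auto
  also have "(R / r) powr (real DIM('a) * \<kappa>) = R powr (real DIM('a) * \<kappa>) * r powr (- real DIM('a) * \<kappa>)"
    using r by (simp add: powr_divide powr_minus_divide)
  finally show ?thesis by (simp add: powr_add mult_ac)
qed

text \<open>The origin of \<gamma>: dividing the oscillation bound (2R)^\<alpha> w(B(x,2R)) by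
  |B(x,R)| and comparing w with w(B(x,r)) leaves the power \<alpha> + d \<kappa> - d = \<gamma> of
  the radius.\<close>

lemma avg_step:
  assumes w: "dbl \<kappa> c3 CD w" and f: "bmo \<alpha> w f n" and r: "0 < r" "r \<le> R"
  shows "\<bar>avg f (ball x R) - avg f (ball x (2 * R))\<bar>
     \<le> 2 powr real DIM('a) / V * n * CD * (2 * R) powr \<gamma> * r powr (- real DIM('a) * \<kappa>) * exp (c3 * (1 + 2 * R / \<rho> x) powr m) * wmeas w (ball x r)"
    (is "?L \<le> _")
proof -
  have fl: "loc_integrable f" and n: "0 \<le> n" using f by (auto simp: bmo_def)
  have wt: "weight w" using w by (simp add: dbl_def)
  have R: "0 < R" using r by simp
  have "ennreal (?L * vol (ball x R)) \<le> nn_abs (\<lambda>u. f u - avg f (ball x (2 * R))) (ball x R)"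
    by (rule avg_diff[OF fl R])
  also have "\<dots> \<le> nn_abs (\<lambda>u. f u - avg f (ball x (2 * R))) (ball x (2 * R))"
    by (rule nn_abs_mono) (use R in auto)
  also have "\<dots> \<le> ennreal (n * (2 * R) powr \<alpha> * wmeas w (ball x (2 * R)))"
    using f R by (simp add: bmo_def)
  finally have "?L * vol (ball x R) \<le> n * (2 * R) powr \<alpha> * wmeas w (ball x (2 * R))"
    using n wmeas_nonneg[OF wt] by (subst (asm) ennreal_le_iff) auto
  also have "\<dots> \<le> n * CD * (2 * R) powr (\<alpha> + real DIM('a) * \<kappa>) * r powr (- real DIM('a) * \<kappa>) * exp (c3 * (1 + 2 * R / \<rho> x) powr m) * wmeas w (ball x r)"
    using level_bound[OF w n r(1), of "2 * R" x] r by simp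
  also have "(2 * R) powr (\<alpha> + real DIM('a) * \<kappa>) = (2 * R) powr \<gamma> * (2 powr real DIM('a) * R powr real DIM('a))"
  proof -
    have "(2 * R) powr (\<alpha> + real DIM('a) * \<kappa>) = (2 * R) powr (\<gamma> + real DIM('a))"
      by (simp add: \<gamma>_def algebra_simps)
    then show ?thesis using R by (simp add: powr_add powr_mult)
  qed
  finally have "?L * (V * R powr real DIM('a)) \<le>
    (2 powr real DIM('a) / V * n * CD * (2 * R) powr \<gamma> * r powr (- real DIM('a) * \<kappa>) * exp (c3 * (1 + 2 * R / \<rho> x) powr m) * wmeas w (ball x r)) * (V * R powr real DIM('a))"
    using R V_pos by (simp add: vol_V field_simps)
  then show ?thesis by (rule mult_right_le_imp_le) (use R V_pos in simp)
qed

lemma avg_chain: "\<bar>a (0::nat) - b\<bar> \<le> \<bar>a k - b\<bar> + (\<Sum>i<k. \<bar>a i - a (Suc i)\<bar>)" for a :: "nat \<Rightarrow> real"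
  by (induction k) auto

text \<open>The means telescope over k dyadic steps, each bounded by the bound for the last one. The
  resulting factor \<open>Suc k\<close> is coarse but harmless next to a geometric decay, and it
  avoids a case distinction on \<gamma>.\<close>

lemma growth:
  assumes w: "dbl \<kappa> c3 CD w" and f: "bmo \<alpha> w f n" and r: "0 < r"
  shows "nn_abs (\<lambda>u. f u - avg f (ball x (3 * r))) (ball x (2 ^ k * (3 * r)))
     \<le> ennreal (2 powr real DIM('a) * CD * n * real (Suc k) * (2 ^ k * (3 * r)) powr (\<alpha> + real DIM('a) * \<kappa>)
         * r powr (- real DIM('a) * \<kappa>) * exp (c3 * (1 + 2 ^ k * (3 * r) / \<rho> x) powr m) * wmeas w (ball x r))"
proof -
  let ?d = "real DIM('a)"
  have fl: "loc_integrable f" and n: "0 \<le> n" using f by (auto simp: bmo_def)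
  have [measurable]: "f \<in> borel_measurable lebesgue" by (rule loc_integrable_measurable[OF fl])
  have wt: "weight w" using w by (simp add: dbl_def)
  define R where "R i = (2::real) ^ i * (3 * r)" for i
  have R: "r \<le> R i" "0 < R i" "R (Suc i) = 2 * R i" for i
  proof -
    have "1 * (3 * r) \<le> 2 ^ i * (3 * r)" using r by (intro mult_right_mono) auto
    then show "r \<le> R i" unfolding R_def using r by linarith
  qed (use r in \<open>auto simp: R_def\<close>)
  have Rmono: "R i \<le> R j" if "i \<le> j" for i j
    unfolding R_def using r that by (intro mult_right_mono power_increasing) auto
  define a where "a i = avg f (ball x (R i))" for i
  define E where "E = exp (c3 * (1 + R k / \<rho> x) powr m)"
  define Q where "Q = n * CD * r powr (- ?d * \<kappa>) * E * wmeas w (ball x r)"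
  have Q0: "0 \<le> Q" using n CD_nonneg wmeas_nonneg[OF wt] by (simp add: Q_def E_def)
  have step: "\<bar>a i - a (Suc i)\<bar> \<le> 2 powr ?d / V * R k powr \<gamma> * Q" if i: "i < k" for i
  proof -
    have "\<bar>a i - a (Suc i)\<bar> \<le> 2 powr ?d / V * n * CD * R (Suc i) powr \<gamma> * r powr (- ?d * \<kappa>) * exp (c3 * (1 + R (Suc i) / \<rho> x) powr m) * wmeas w (ball x r)"
      using avg_step[OF w f r R(1), of x i] unfolding a_def R(3) .
    also have "\<dots> \<le> 2 powr ?d / V * n * CD * R k powr \<gamma> * r powr (- ?d * \<kappa>) * E * wmeas w (ball x r)"
    proof -
      have "R (Suc i) \<le> R k" using Rmono i by simp
      then have "R (Suc i) / \<rho> x \<le> R k / \<rho> x" using rho_pos[of x] by (simp add: divide_right_mono)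
      then have "(1 + R (Suc i) / \<rho> x) powr m \<le> (1 + R k / \<rho> x) powr m"
      proof (intro powr_mono2)
        have "0 \<le> R (Suc i) / \<rho> x" using R(2)[of "Suc i"] rho_pos[of x] by (intro divide_nonneg_pos) auto
        then show "0 \<le> 1 + R (Suc i) / \<rho> x" by simp
      qed (use m_pos in auto)
      then have "exp (c3 * (1 + R (Suc i) / \<rho> x) powr m) \<le> E"
        unfolding E_def using c3_nonneg by (simp add: mult_left_mono)
      moreover have "R (Suc i) powr \<gamma> \<le> R k powr \<gamma>"
        using \<open>R (Suc i) \<le> R k\<close> R(2)[of "Suc i"] gamma_nonneg by (intro powr_mono2) auto
      ultimately show ?thesis
        using n CD_nonneg V_pos wmeas_nonneg[OF wt] by (intro mult_right_mono mult_mono mult_nonneg_nonneg) auto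
    qed
    finally show ?thesis by (simp add: Q_def mult_ac)
  qed
  have "\<bar>a 0 - a k\<bar> \<le> (\<Sum>i<k. \<bar>a i - a (Suc i)\<bar>)" using avg_chain[of a "a k" k] by simp
  also have "\<dots> \<le> (\<Sum>i<k. 2 powr ?d / V * R k powr \<gamma> * Q)" by (intro sum_mono step) auto
  finally have ak: "\<bar>a 0 - a k\<bar> \<le> real k * (2 powr ?d / V * R k powr \<gamma> * Q)" by simp
  have Rk: "R k powr (\<alpha> + ?d * \<kappa>) = R k powr \<gamma> * R k powr ?d"
    using R by (simp add: \<gamma>_def algebra_simps flip: powr_add)
  have "nn_abs (\<lambda>u. f u - a 0) (ball x (R k)) = nn_abs (\<lambda>u. (f u - a k) + (a k - a 0)) (ball x (R k))" by simp
  also have "\<dots> \<le> nn_abs (\<lambda>u. f u - a k) (ball x (R k)) + nn_abs (\<lambda>u. a k - a 0) (ball x (R k))"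
    by (rule nn_abs_add) measurable
  also have "nn_abs (\<lambda>u. f u - a k) (ball x (R k)) \<le> ennreal (n * R k powr \<alpha> * wmeas w (ball x (R k)))"
    using f R unfolding a_def bmo_def by simp
  also have "n * R k powr \<alpha> * wmeas w (ball x (R k)) \<le> R k powr (\<alpha> + ?d * \<kappa>) * Q"
    using level_bound[OF w n r R(1)[of k], of x] by (simp add: Q_def E_def mult_ac)
  also have "nn_abs (\<lambda>u. a k - a 0) (ball x (R k)) = ennreal (\<bar>a 0 - a k\<bar> * (V * R k powr ?d))"
    using R(2)[of k] V_pos by (simp add: nn_abs_const emeasure_ball_V abs_minus_commute ennreal_mult del: emeasure_completion)
  also have "\<bar>a 0 - a k\<bar> * (V * R k powr ?d) \<le> real k * (2 powr ?d / V * R k powr \<gamma> * Q) * (V * R k powr ?d)"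
    using ak V_pos by (intro mult_right_mono) auto
  also have "\<dots> = real k * (2 powr ?d * R k powr (\<alpha> + ?d * \<kappa>) * Q)"
    unfolding Rk using V_pos by simp
  finally have "nn_abs (\<lambda>u. f u - a 0) (ball x (R k)) \<le> ennreal (R k powr (\<alpha> + ?d * \<kappa>) * Q) + ennreal (real k * (2 powr ?d * R k powr (\<alpha> + ?d * \<kappa>) * Q))"
    by (simp add: add_mono ennreal_leI)
  also have "\<dots> = ennreal (R k powr (\<alpha> + ?d * \<kappa>) * Q + real k * (2 powr ?d * R k powr (\<alpha> + ?d * \<kappa>) * Q))"
    using Q0 by (simp flip: ennreal_plus)
  also have "\<dots> \<le> ennreal (2 powr ?d * R k powr (\<alpha> + ?d * \<kappa>) * Q + real k * (2 powr ?d * R k powr (\<alpha> + ?d * \<kappa>) * Q))"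
  proof (intro ennreal_leI add_right_mono)
    have "1 * (R k powr (\<alpha> + ?d * \<kappa>) * Q) \<le> 2 powr ?d * (R k powr (\<alpha> + ?d * \<kappa>) * Q)"
      using Q0 by (intro mult_right_mono) (auto simp: ge_one_powr_ge_zero)
    then show "R k powr (\<alpha> + ?d * \<kappa>) * Q \<le> 2 powr ?d * R k powr (\<alpha> + ?d * \<kappa>) * Q" by (simp add: mult.assoc)
  qed
  also have "2 powr ?d * R k powr (\<alpha> + ?d * \<kappa>) * Q + real k * (2 powr ?d * R k powr (\<alpha> + ?d * \<kappa>) * Q)
      = 2 powr ?d * CD * n * real (Suc k) * (R k) powr (\<alpha> + ?d * \<kappa>) * r powr (- ?d * \<kappa>) * E * wmeas w (ball x r)"
    by (simp add: Q_def algebra_simps)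
  finally show ?thesis unfolding a_def E_def R_def by simp
qed

text \<open>On a shell the growth of f costs the exponential of the doubling condition and the
  powers collected in \<gamma> + \<nu>. \<open>K_smooth_decay\<close> and \<open>growth\<close>
  refer to the same radius 2^(k+1) * 3r, so that the exponentials can cancel exactly.\<close>

lemma tail_osc:
  "\<exists>A\<ge>0. \<forall>w f n x r y. dbl \<kappa> c3 CD w \<longrightarrow> bmo \<alpha> w f n \<longrightarrow> 0 < r \<longrightarrow> 8 * r \<le> \<rho> x \<longrightarrow> y \<in> ball x r \<longrightarrow>
     (\<integral>\<^sup>+u\<in>- ball x (3 * r). ennreal \<bar>K y u - K x u\<bar> * ennreal \<bar>f u - avg f (ball x (3 * r))\<bar> \<partial>lebesgue)
       \<le> ennreal (A * n * r powr (\<nu> + \<alpha> - real DIM('a)) * wmeas w (ball x r))"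
proof -
  let ?d = "real DIM('a)"
  \<comment> \<open>The solution of (1 - \<theta>) c (4 C0)^(-m) = c3, for which the decay of the
    kernel cancels the exponential of the doubling condition. \<open>c3_small\<close> says precisely
    that (\<gamma> + \<nu>)/\<delta> < \<theta>, that is, that the remaining powers are
    summable.\<close>
  define \<theta> where "\<theta> = 1 - c3 * (4 * C0) powr m / c"
  have C4: "(4 * C0) powr (- m) * (4 * C0) powr m = 1" "0 < (4 * C0) powr m"
    using C0_ge1 by (auto simp flip: powr_add)
  have gd: "0 \<le> (\<gamma> + \<nu>) / \<delta>" using gamma_nonneg nu_nonneg delta_pos by simp
  have th: "\<theta> \<le> 1" "(\<gamma> + \<nu>) / \<delta> < \<theta>"
  proof -
    show "\<theta> \<le> 1" using c3_nonneg c_pos by (simp add: \<theta>_def)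
    have "c3 * (4 * C0) powr m < c * (1 - (\<gamma> + \<nu>) / \<delta>) * (4 * C0) powr (- m) * (4 * C0) powr m"
      using c3_small C4(2) unfolding \<gamma>_def by (intro mult_strict_right_mono) (auto simp: add.commute)
    also have "\<dots> = c * (1 - (\<gamma> + \<nu>) / \<delta>)" using C4(1) by (simp add: mult.assoc)
    finally have "c3 * (4 * C0) powr m / c < 1 - (\<gamma> + \<nu>) / \<delta>" using c_pos by (simp add: field_simps)
    then show "(\<gamma> + \<nu>) / \<delta> < \<theta>" by (simp add: \<theta>_def)
  qed
  have th0: "0 \<le> \<theta>" using th gd by linarith
  have thc: "(1 - \<theta>) * c * (4 * C0) powr (- m) = c3"
  proof -
    have "(1 - \<theta>) * c = c3 * (4 * C0) powr m" using c_pos by (simp add: \<theta>_def)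
    then show ?thesis using C4(1) by (simp add: mult_ac)
  qed
  define \<sigma> where "\<sigma> = \<delta> * \<theta> - \<nu> - \<gamma>"
  have sig: "0 < \<sigma>" using th(2) delta_pos by (simp add: \<sigma>_def field_simps)
  define q where "q = (2::real) powr (- \<sigma>)"
  have q: "0 < q" "q < 1" using sig by (auto simp: q_def powr_less_one)
  define B where "B = 2 * CK * 2 powr ?d * CD * 3 powr (\<alpha> + ?d * \<kappa>)"
  have B: "0 \<le> B" using CK_nonneg CD_nonneg by (simp add: B_def)
  \<comment> \<open>The sum of (k+1) q^k is 1/(1-q)^2. The factor 2 comes from k + 2 \<le> 2 (k +
    1), as \<open>growth\<close> is applied with \<open>Suc k\<close>; the factor q from the
    exponent \<open>Suc k\<close>.\<close>
  define S where "S = 2 * q * (1 / (1 - q)\<^sup>2)"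
  have S: "(\<lambda>k. 2 * q * (real (Suc k) * q ^ k)) sums S"
    unfolding S_def by (rule sums_mult) (use geometric_deriv_sums[of q] q in simp)
  have S0: "0 \<le> S" using q by (simp add: S_def)
  show ?thesis
  proof (intro exI[of _ "B * S"] conjI allI impI)
    show "0 \<le> B * S" using B S0 by simp
    fix w f n x r y
    assume w: "dbl \<kappa> c3 CD w" and f: "bmo \<alpha> w f n" and r: "0 < r" "8 * r \<le> \<rho> x" and y: "y \<in> ball x r"
    have fl: "loc_integrable f" and n: "0 \<le> n" using f by (auto simp: bmo_def)
    have fm [measurable]: "f \<in> borel_measurable lebesgue" by (rule loc_integrable_measurable[OF fl])
    have wt: "weight w" using w by (simp add: dbl_def)
    note W0 = wmeas_nonneg[OF wt, of "ball x r"]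
    have yx: "norm (y - x) < r" using y by (simp add: dist_norm norm_minus_commute)
    define E where "E k = c3 * (1 + 2 ^ Suc k * (3 * r) / \<rho> x) powr m" for k :: nat
    define g where "g k = 2 * (CK * (2 ^ Suc k * r) powr (\<nu> - ?d)) * ((2 ^ Suc k) powr (- (\<delta> * \<theta>)) * exp (- E k))" for k :: nat
    have g0: "0 \<le> g k" for k using CK_nonneg by (simp add: g_def)
    let ?h = "\<lambda>u. f u - avg f (ball x (3 * r))"
    have "(\<integral>\<^sup>+u\<in>- ball x (3 * r). ennreal \<bar>K y u - K x u\<bar> * ennreal \<bar>?h u\<bar> \<partial>lebesgue)
       \<le> (\<Sum>k. ennreal (g k) * nn_abs ?h (ball x (2 ^ Suc k * (3 * r))))"
    proof (rule nn_integral_annuli)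
      fix k u assume "2 ^ k * (3 * r) \<le> norm (u - x)"
      from K_smooth_decay[OF r yx this th0 th(1)] show "ennreal \<bar>K y u - K x u\<bar> \<le> ennreal (g k)"
        unfolding g_def E_def thc by (rule ennreal_leI)
    qed (use r in auto)
    also have "\<dots> \<le> (\<Sum>k. ennreal (B * n * r powr (\<nu> + \<alpha> - ?d) * wmeas w (ball x r) * (2 * q * (real (Suc k) * q ^ k))))"
    proof (rule suminf_le)
      fix k
      define t :: real where "t = 2 ^ Suc k"
      have t: "0 < t" by (simp add: t_def)
      have "ennreal (g k) * nn_abs ?h (ball x (2 ^ Suc k * (3 * r)))
        \<le> ennreal (g k) * ennreal (2 powr ?d * CD * n * real (Suc (Suc k)) * (t * (3 * r)) powr (\<alpha> + ?d * \<kappa>)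
         * r powr (- ?d * \<kappa>) * exp (E k) * wmeas w (ball x r))"
        using growth[OF w f r(1), of x "Suc k"] unfolding t_def E_def by (rule mult_left_mono) simp
      also have "\<dots> = ennreal (g k * (2 powr ?d * CD * n * real (Suc (Suc k)) * (t * (3 * r)) powr (\<alpha> + ?d * \<kappa>)
         * r powr (- ?d * \<kappa>) * exp (E k) * wmeas w (ball x r)))"
        using g0 CD_nonneg n W0 by (simp add: ennreal_mult)
      also have "g k * (2 powr ?d * CD * n * real (Suc (Suc k)) * (t * (3 * r)) powr (\<alpha> + ?d * \<kappa>)
         * r powr (- ?d * \<kappa>) * exp (E k) * wmeas w (ball x r))
         = B * n * wmeas w (ball x r) * real (Suc (Suc k)) * ((t * r) powr (\<nu> - ?d) * t powr (- (\<delta> * \<theta>)) * (t * r) powr (\<alpha> + ?d * \<kappa>) * r powr (- ?d * \<kappa>))"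
      proof -
        have "exp (- E k) * exp (E k) = 1" by (simp flip: exp_add)
        moreover have "(t * (3 * r)) powr (\<alpha> + ?d * \<kappa>) = 3 powr (\<alpha> + ?d * \<kappa>) * (t * r) powr (\<alpha> + ?d * \<kappa>)"
          using t r by (simp add: powr_mult mult_ac)
        moreover have "g k = 2 * (CK * (t * r) powr (\<nu> - ?d)) * (t powr (- (\<delta> * \<theta>)) * exp (- E k))"
          by (simp add: g_def t_def)
        ultimately show ?thesis unfolding B_def by (simp add: mult_ac)
      qed
      also have "(t * r) powr (\<nu> - ?d) * t powr (- (\<delta> * \<theta>)) * (t * r) powr (\<alpha> + ?d * \<kappa>) * r powr (- ?d * \<kappa>)
        = t powr (- \<sigma>) * r powr (\<nu> + \<alpha> - ?d)"
      proof -
        have "(t * r) powr (\<nu> - ?d) * t powr (- (\<delta> * \<theta>)) * (t * r) powr (\<alpha> + ?d * \<kappa>) * r powr (- ?d * \<kappa>)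
          = (t powr (\<nu> - ?d) * t powr (- (\<delta> * \<theta>)) * t powr (\<alpha> + ?d * \<kappa>)) * (r powr (\<nu> - ?d) * r powr (\<alpha> + ?d * \<kappa>) * r powr (- ?d * \<kappa>))"
          using t r by (simp only: powr_mult) (simp add: mult_ac)
        also have "\<dots> = t powr ((\<nu> - ?d) + - (\<delta> * \<theta>) + (\<alpha> + ?d * \<kappa>)) * r powr ((\<nu> - ?d) + (\<alpha> + ?d * \<kappa>) + - ?d * \<kappa>)"
          by (simp only: powr_add)
        also have "(\<nu> - ?d) + - (\<delta> * \<theta>) + (\<alpha> + ?d * \<kappa>) = - \<sigma>" by (simp add: \<sigma>_def \<gamma>_def algebra_simps)
        also have "(\<nu> - ?d) + (\<alpha> + ?d * \<kappa>) + - ?d * \<kappa> = \<nu> + \<alpha> - ?d" by simp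
        finally show ?thesis .
      qed
      also have "t powr (- \<sigma>) = q ^ Suc k"
        unfolding q_def t_def by (simp add: powr_power powr_realpow[symmetric] powr_powr del: power_Suc) (simp add: mult.commute)
      also have "B * n * wmeas w (ball x r) * real (Suc (Suc k)) * (q ^ Suc k * r powr (\<nu> + \<alpha> - ?d))
        \<le> B * n * wmeas w (ball x r) * (2 * real (Suc k)) * (q ^ Suc k * r powr (\<nu> + \<alpha> - ?d))"
        using B n W0 q by (intro mult_right_mono mult_left_mono) auto
      also have "\<dots> = B * n * r powr (\<nu> + \<alpha> - ?d) * wmeas w (ball x r) * (2 * q * (real (Suc k) * q ^ k))" by simp
      finally show "ennreal (g k) * nn_abs ?h (ball x (2 ^ Suc k * (3 * r)))
        \<le> ennreal (B * n * r powr (\<nu> + \<alpha> - ?d) * wmeas w (ball x r) * (2 * q * (real (Suc k) * q ^ k)))"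
        by (simp add: ennreal_leI)
    qed auto
    also have "\<dots> = ennreal (B * n * r powr (\<nu> + \<alpha> - ?d) * wmeas w (ball x r) * S)"
      by (rule suminf_ennreal_le[OF S]) (use q B n W0 in auto)
    finally show "(\<integral>\<^sup>+u\<in>- ball x (3 * r). ennreal \<bar>K y u - K x u\<bar> * ennreal \<bar>?h u\<bar> \<partial>lebesgue)
       \<le> ennreal (B * S * n * r powr (\<nu> + \<alpha> - ?d) * wmeas w (ball x r))"
      by (simp add: mult_ac)
  qed
qed

text \<open>In the logarithmic case there are K + 1 terms; t \<ge> 8 > e gives ln t \<ge> 1, which
  absorbs the 1.\<close>

lemma geometric_sum_gamma:
  "\<exists>C\<ge>0. \<forall>K t. 8 \<le> t \<longrightarrow> 2 ^ K \<le> t \<longrightarrow> (\<Sum>i\<le>K. ((2::real) ^ i) powr \<gamma>) \<le> C * Theta t"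
proof (cases "0 < \<gamma>")
  case True
  define x where "x = (2::real) powr \<gamma>"
  have x: "1 < x" using True by (simp add: x_def)
  show ?thesis
  proof (intro exI[of _ "x / (x - 1)"] conjI allI impI)
    show "0 \<le> x / (x - 1)" using x by simp
    fix K :: nat and t :: real assume t: "8 \<le> t" "2 ^ K \<le> t"
    have p: "((2::real) ^ i) powr \<gamma> = x ^ i" for i
      by (simp add: x_def powr_realpow[symmetric] powr_powr mult.commute)
    have "(\<Sum>i\<le>K. ((2::real) ^ i) powr \<gamma>) = (x ^ Suc K - 1) / (x - 1)"
      unfolding p using x geometric_sum[of x "Suc K"] by (simp add: lessThan_Suc_atMost)
    also have "\<dots> \<le> x ^ Suc K / (x - 1)" using x by (intro divide_right_mono) auto
    also have "\<dots> = x / (x - 1) * ((2::real) ^ K) powr \<gamma>" by (simp add: p)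
    also have "\<dots> \<le> x / (x - 1) * t powr \<gamma>"
      using t x True by (intro mult_left_mono powr_mono2) auto
    finally show "(\<Sum>i\<le>K. ((2::real) ^ i) powr \<gamma>) \<le> x / (x - 1) * Theta t"
      using True by (simp add: Theta_def)
  qed
next
  case False
  then have g: "\<gamma> = 0" using gamma_nonneg by simp
  show ?thesis
  proof (intro exI[of _ "1 + 1 / ln 2"] conjI allI impI)
    show "0 \<le> 1 + 1 / ln (2::real)" by simp
    fix K :: nat and t :: real assume t: "8 \<le> t" "2 ^ K \<le> t"
    have "ln ((2::real) ^ K) \<le> ln t" using t by (subst ln_le_cancel_iff) auto
    then have K: "real K * ln 2 \<le> ln t" by (simp add: ln_realpow)
    have "exp 1 \<le> t" using exp_le t by linarith
    then have l1: "1 \<le> ln t" using t by (subst ln_ge_iff) auto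
    have "(\<Sum>i\<le>K. ((2::real) ^ i) powr \<gamma>) = real K + 1" by (simp add: g)
    also have "\<dots> \<le> ln t / ln 2 + ln t"
    proof -
      have "real K \<le> ln t / ln 2" using K by (simp add: field_simps)
      then show ?thesis using l1 by linarith
    qed
    also have "\<dots> = (1 + 1 / ln 2) * Theta t" by (simp add: Theta_def g algebra_simps)
    finally show "(\<Sum>i\<le>K. ((2::real) ^ i) powr \<gamma>) \<le> (1 + 1 / ln 2) * Theta t" .
  qed
qed

text \<open>The means telescope from 3r up to the first dyadic multiple of 3r that is at least
  \<rho>(x), where the second BMO condition bounds the mean itself. All radii stay below 2
  \<rho>(x), so the exponential factors are bounded.\<close>

lemma avg_bound:
  "\<exists>A\<ge>0. \<forall>w f n x r. dbl \<kappa> c3 CD w \<longrightarrow> bmo \<alpha> w f n \<longrightarrow> 0 < r \<longrightarrow> 8 * r \<le> \<rho> x \<longrightarrow>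
     \<bar>avg f (ball x (3 * r))\<bar> \<le> A * n * r powr (\<alpha> - real DIM('a)) * Theta (\<rho> x / r) * wmeas w (ball x r)"
proof -
  let ?d = "real DIM('a)"
  obtain C where C: "0 \<le> C" "\<And>K t. 8 \<le> t \<Longrightarrow> 2 ^ K \<le> t \<Longrightarrow> (\<Sum>i\<le>K. ((2::real) ^ i) powr \<gamma>) \<le> C * Theta t"
    using geometric_sum_gamma by blast
  define E where "E = exp (c3 * 3 powr m)"
  define B where "B = 2 powr ?d / V * CD * E * 3 powr \<gamma>"
  have B: "0 \<le> B" using V_pos CD_nonneg by (simp add: B_def E_def)
  show ?thesis
  proof (intro exI[of _ "2 * B * C"] conjI allI impI)
    show "0 \<le> 2 * B * C" using B C by simp
    fix w f n x r
    assume w: "dbl \<kappa> c3 CD w" and f: "bmo \<alpha> w f n" and r: "0 < r" "8 * r \<le> \<rho> x"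
    have fl: "loc_integrable f" and n: "0 \<le> n" using f by (auto simp: bmo_def)
    have wt: "weight w" using w by (simp add: dbl_def)
    note W0 = wmeas_nonneg[OF wt, of "ball x r"]
    define R where "R i = (2::real) ^ i * (3 * r)" for i
    have R: "r \<le> R i" "0 < R i" "R (Suc i) = 2 * R i" for i
    proof -
      have "1 * (3 * r) \<le> 2 ^ i * (3 * r)" using r by (intro mult_right_mono) auto
      then show "r \<le> R i" unfolding R_def using r by linarith
    qed (use r in \<open>auto simp: R_def\<close>)
    have Rmono: "R i \<le> R j" if "i \<le> j" for i j
      unfolding R_def using r that by (intro mult_right_mono power_increasing) auto
    have ex: "\<exists>K. \<rho> x \<le> R K"
    proof -
      obtain K where "\<rho> x / (3 * r) < 2 ^ K" using real_arch_pow[of 2] by auto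
      then show ?thesis using r by (intro exI[of _ K]) (simp add: R_def field_simps)
    qed
    define K where "K = (LEAST K. \<rho> x \<le> R K)"
    have K1: "\<rho> x \<le> R K" unfolding K_def using ex by (rule LeastI_ex)
    have "K \<noteq> 0" using K1 r by (auto simp: R_def intro!: gr0I)
    then obtain K' where K': "K = Suc K'" by (cases K) auto
    have "\<not> \<rho> x \<le> R K'" using not_less_Least[of K' "\<lambda>K. \<rho> x \<le> R K"] K' K_def by auto
    then have K2: "R K \<le> 2 * \<rho> x" using R(3)[of K'] K' by simp
    define a where "a i = avg f (ball x (R i))" for i
    define Q where "Q = 2 powr ?d / V * n * CD * r powr (- ?d * \<kappa>) * E * wmeas w (ball x r)"
    have Q0: "0 \<le> Q" using n CD_nonneg W0 V_pos by (simp add: Q_def E_def)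
    have Ele: "exp (c3 * (1 + R i / \<rho> x) powr m) \<le> E" if "i \<le> K" for i
    proof -
      have "R i / \<rho> x \<le> 2" using Rmono[OF that] K2 rho_pos[of x] by (simp add: field_simps)
      moreover have "0 \<le> R i / \<rho> x" using R(2)[of i] rho_pos[of x] by (intro divide_nonneg_pos) auto
      ultimately have "(1 + R i / \<rho> x) powr m \<le> 3 powr m" using m_pos by (intro powr_mono2) auto
      then show ?thesis unfolding E_def using c3_nonneg by (simp add: mult_left_mono)
    qed
    have step: "\<bar>a i - a (Suc i)\<bar> \<le> R (Suc i) powr \<gamma> * Q" if i: "i < K" for i
    proof -
      have "\<bar>a i - a (Suc i)\<bar> \<le> 2 powr ?d / V * n * CD * R (Suc i) powr \<gamma> * r powr (- ?d * \<kappa>) * exp (c3 * (1 + R (Suc i) / \<rho> x) powr m) * wmeas w (ball x r)"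
        using avg_step[OF w f r(1) R(1), of x i] unfolding a_def R(3) .
      also have "\<dots> \<le> 2 powr ?d / V * n * CD * R (Suc i) powr \<gamma> * r powr (- ?d * \<kappa>) * E * wmeas w (ball x r)"
        using n CD_nonneg V_pos W0 i by (intro mult_right_mono mult_left_mono Ele) auto
      finally show ?thesis by (simp add: Q_def mult_ac)
    qed
    have top: "\<bar>a K - 0\<bar> \<le> R K powr \<gamma> * Q"
    proof -
      have "ennreal (\<bar>a K - 0\<bar> * vol (ball x (R K))) \<le> nn_abs f (ball x (R K))"
        using avg_diff[OF fl R(2), of x K 0] by (simp add: a_def)
      also have "\<dots> \<le> ennreal (n * R K powr \<alpha> * wmeas w (ball x (R K)))" using f K1 by (simp add: bmo_def)
      finally have "\<bar>a K - 0\<bar> * vol (ball x (R K)) \<le> n * R K powr \<alpha> * wmeas w (ball x (R K))"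
        using n wmeas_nonneg[OF wt] by (subst (asm) ennreal_le_iff) auto
      also have "\<dots> \<le> n * CD * R K powr (\<alpha> + ?d * \<kappa>) * r powr (- ?d * \<kappa>) * exp (c3 * (1 + R K / \<rho> x) powr m) * wmeas w (ball x r)"
        by (rule level_bound[OF w n r(1) R(1)])
      also have "\<dots> \<le> n * CD * R K powr (\<alpha> + ?d * \<kappa>) * r powr (- ?d * \<kappa>) * E * wmeas w (ball x r)"
        using n CD_nonneg W0 by (intro mult_right_mono mult_left_mono Ele) auto
      also have "R K powr (\<alpha> + ?d * \<kappa>) = R K powr \<gamma> * R K powr ?d"
        using R(2)[of K] by (simp add: \<gamma>_def algebra_simps flip: powr_add)
      also have "n * CD * (R K powr \<gamma> * R K powr ?d) * r powr (- ?d * \<kappa>) * E * wmeas w (ball x r)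
         \<le> 2 powr ?d * (n * CD * (R K powr \<gamma> * R K powr ?d) * r powr (- ?d * \<kappa>) * E * wmeas w (ball x r))"
      proof -
        have "0 \<le> n * CD * (R K powr \<gamma> * R K powr ?d) * r powr (- ?d * \<kappa>) * E * wmeas w (ball x r)"
          using n CD_nonneg W0 by (simp add: E_def)
        moreover have "1 \<le> 2 powr ?d" by (rule ge_one_powr_ge_zero) auto
        ultimately show ?thesis using mult_right_mono[of 1 "2 powr ?d"] by fastforce
      qed
      finally have "\<bar>a K - 0\<bar> * (V * R K powr ?d) \<le> R K powr \<gamma> * Q * (V * R K powr ?d)"
        using V_pos R(2)[of K] by (simp add: vol_V Q_def mult_ac)
      then show ?thesis by (rule mult_right_le_imp_le) (use V_pos R(2)[of K] in auto)
    qed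
    have "\<bar>a 0 - 0\<bar> \<le> \<bar>a K - 0\<bar> + (\<Sum>i<K. \<bar>a i - a (Suc i)\<bar>)" by (rule avg_chain)
    also have "\<dots> \<le> R K powr \<gamma> * Q + (\<Sum>i<K. R (Suc i) powr \<gamma> * Q)"
      by (intro add_mono top sum_mono step) auto
    also have "(\<Sum>i<K. R (Suc i) powr \<gamma> * Q) = (\<Sum>i<K'. R (Suc i) powr \<gamma> * Q) + R K powr \<gamma> * Q"
      by (simp add: K')
    also have "R K powr \<gamma> * Q + ((\<Sum>i<K'. R (Suc i) powr \<gamma> * Q) + R K powr \<gamma> * Q) \<le> 2 * (\<Sum>i\<le>K. R i powr \<gamma> * Q)"
    proof -
      have "(\<Sum>i<K'. R (Suc i) powr \<gamma> * Q) \<le> (\<Sum>i\<le>K'. R i powr \<gamma> * Q)"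
        using Q0 sum.atMost_shift[of "\<lambda>i. R i powr \<gamma> * Q" K'] by (simp add: lessThan_Suc_atMost)
      moreover have "0 \<le> (\<Sum>i\<le>K'. R i powr \<gamma> * Q)" using Q0 by (intro sum_nonneg) auto
      ultimately show ?thesis by (simp add: K')
    qed
    also have "(\<Sum>i\<le>K. R i powr \<gamma> * Q) = (3 * r) powr \<gamma> * Q * (\<Sum>i\<le>K. ((2::real) ^ i) powr \<gamma>)"
      using r by (simp add: R_def powr_mult sum_distrib_left mult_ac)
    finally have a0: "\<bar>a 0\<bar> \<le> 2 * ((3 * r) powr \<gamma> * Q * (\<Sum>i\<le>K. ((2::real) ^ i) powr \<gamma>))" by simp
    have t8: "8 \<le> \<rho> x / r" using r by (simp add: field_simps)
    have "2 ^ K * 3 * r \<le> 2 * \<rho> x" using K2 by (simp add: R_def)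
    then have K3: "2 ^ K \<le> \<rho> x / r" using r rho_pos[of x] by (simp add: field_simps)
    have "\<bar>a 0\<bar> \<le> 2 * ((3 * r) powr \<gamma> * Q * (C * Theta (\<rho> x / r)))"
      using a0 C(2)[OF t8 K3] Q0 by (meson mult_left_mono order_trans mult_nonneg_nonneg powr_ge_zero zero_le_numeral)
    also have "\<dots> = 2 * B * C * n * (r powr \<gamma> * r powr (- ?d * \<kappa>)) * Theta (\<rho> x / r) * wmeas w (ball x r)"
      using r by (simp add: Q_def B_def powr_mult mult_ac)
    also have "r powr \<gamma> * r powr (- ?d * \<kappa>) = r powr (\<alpha> - ?d)"
      by (simp add: \<gamma>_def algebra_simps flip: powr_add)
    finally show "\<bar>avg f (ball x (3 * r))\<bar> \<le> 2 * B * C * n * r powr (\<alpha> - ?d) * Theta (\<rho> x / r) * wmeas w (ball x r)"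
      by (simp add: a_def R_def)
  qed
qed

text \<open>At the critical scale f is not recentred and K enters without differences. Its full
  decay beats the exponential factor of the doubling condition with a rate left over, which is
  exchanged for a negative power of the shell radius.\<close>

lemma tail_size:
  "\<exists>A\<ge>0. \<forall>w f n x r y. dbl \<kappa> c3 CD w \<longrightarrow> bmo \<alpha> w f n \<longrightarrow> r = \<rho> x / 8 \<longrightarrow> y \<in> ball x r \<longrightarrow>
     (\<integral>\<^sup>+u\<in>- ball x (3 * r). ennreal \<bar>K y u\<bar> * ennreal \<bar>f u\<bar> \<partial>lebesgue)
       \<le> ennreal (A * n * r powr (\<nu> + \<alpha> - real DIM('a)) * wmeas w (ball x r))"
proof -
  let ?d = "real DIM('a)"
  \<comment> \<open>The rate left over; it is positive because \<open>c3_small\<close> is stronger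
    than c3 < c (4 C0)^(-m).\<close>
  define b where "b = c * (4 * C0) powr (- m) - c3"
  have b: "0 < b"
  proof -
    have "0 \<le> (?d * (\<kappa> - 1) + \<alpha> + \<nu>) / \<delta>"
      using delta_pos alpha_nonneg kappa_ge1 nu_nonneg by simp
    then have "c * (1 - (?d * (\<kappa> - 1) + \<alpha> + \<nu>) / \<delta>) * (4 * C0) powr (- m) \<le> c * 1 * (4 * C0) powr (- m)"
      using c_pos by (intro mult_right_mono mult_left_mono) auto
    then show ?thesis using c3_small by (simp add: b_def)
  qed
  \<comment> \<open>The surplus 1 leaves t^(-1) = 2^(-k-1) after the growth t^(\<nu> + \<gamma>) has
    been paid.\<close>
  define q where "q = \<nu> + \<gamma> + 1"
  have q: "0 < q" using nu_nonneg gamma_nonneg by (simp add: q_def)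
  obtain C where C: "0 \<le> C" "\<And>t. 0 < t \<Longrightarrow> exp (- b * t powr m) \<le> C * t powr (- q)"
    using exp_neg_powr_bound[OF b m_pos q] by blast
  define E where "E = exp (c3 * 2 powr m)"
  define B where "B = CK * CD * E * 6 powr (\<alpha> + ?d * \<kappa>) * C * (8/3) powr q"
  have B: "0 \<le> B" using CK_nonneg CD_nonneg C by (simp add: B_def E_def)
  have S: "(\<lambda>k. (1/2::real) ^ Suc k) sums 1" by (rule power_half_series)
  show ?thesis
  proof (intro exI[of _ B] conjI allI impI B)
    fix w f n x r y
    assume w: "dbl \<kappa> c3 CD w" and f: "bmo \<alpha> w f n" and r8: "r = \<rho> x / 8" and y: "y \<in> ball x r"
    have r: "0 < r" "8 * r \<le> \<rho> x" using r8 rho_pos[of x] by auto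
    have fl: "loc_integrable f" and n: "0 \<le> n" using f by (auto simp: bmo_def)
    have fm [measurable]: "f \<in> borel_measurable lebesgue" by (rule loc_integrable_measurable[OF fl])
    have wt: "weight w" using w by (simp add: dbl_def)
    note W0 = wmeas_nonneg[OF wt, of "ball x r"]
    have yx: "norm (y - x) < r" using y by (simp add: dist_norm norm_minus_commute)
    define X where "X k = (1 + 2 ^ Suc k * (3 * r) / \<rho> x) powr m" for k :: nat
    define g where "g k = CK * (2 ^ Suc k * r) powr (\<nu> - ?d) * exp (- (c * (4 * C0) powr (- m) * X k))" for k :: nat
    have g0: "0 \<le> g k" for k using CK_nonneg by (simp add: g_def)
    have "(\<integral>\<^sup>+u\<in>- ball x (3 * r). ennreal \<bar>K y u\<bar> * ennreal \<bar>f u\<bar> \<partial>lebesgue)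
       \<le> (\<Sum>k. ennreal (g k) * nn_abs f (ball x (2 ^ Suc k * (3 * r))))"
    proof (rule nn_integral_annuli)
      fix k u assume "2 ^ k * (3 * r) \<le> norm (u - x)"
      from K_decay[OF r yx this] show "ennreal \<bar>K y u\<bar> \<le> ennreal (g k)"
        unfolding g_def X_def by (rule ennreal_leI)
    qed (use r in auto)
    also have "\<dots> \<le> (\<Sum>k. ennreal (B * n * r powr (\<nu> + \<alpha> - ?d) * wmeas w (ball x r) * (1/2) ^ Suc k))"
    proof (rule suminf_le)
      fix k
      define t :: real where "t = 2 ^ Suc k"
      have t: "2 \<le> t" using one_le_power[of "2::real" k] by (simp add: t_def)
      \<comment> \<open>The size condition on f needs a radius of at least \<rho>(x), which the
        first shell does not reach. Since t \<ge> 2 and \<rho>(x) = 8r, still R \<le> 6 t r.\<close>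
      define R where "R = max (t * (3 * r)) (\<rho> x)"
      have tr: "0 < t * r" using t r by simp
      have t2: "2 * r \<le> t * r" using t r by (intro mult_right_mono) auto
      have R: "\<rho> x \<le> R" "t * (3 * r) \<le> R" "R \<le> t * (6 * r)" "r \<le> R" "0 < R"
      proof -
        have 1: "t * (3 * r) = 3 * (t * r)" "t * (6 * r) = 6 * (t * r)" by auto
        have 2: "\<rho> x = 8 * r" using r8 by simp
        show "\<rho> x \<le> R" "t * (3 * r) \<le> R" by (auto simp: R_def)
        show "R \<le> t * (6 * r)" unfolding R_def 1 2 using t2 r by simp
        show "r \<le> R" "0 < R" using r t2 unfolding R_def 1 2 by auto
      qed
      have expE: "exp (c3 * (1 + R / \<rho> x) powr m) \<le> E * exp (c3 * X k)"
      proof (cases "t * (3 * r) \<le> \<rho> x")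
        case True
        then have "R / \<rho> x = 1" using rho_pos[of x] by (simp add: R_def max_def)
        moreover have "1 \<le> exp (c3 * X k)" using c3_nonneg by (simp add: X_def)
        ultimately show ?thesis unfolding E_def by simp
      next
        case False
        then have "R = t * (3 * r)" by (simp add: R_def)
        then have "exp (c3 * (1 + R / \<rho> x) powr m) = exp (c3 * X k)" by (simp add: X_def t_def)
        moreover have "1 \<le> E" using c3_nonneg by (simp add: E_def)
        then have 2: "1 * exp (c3 * X k) \<le> E * exp (c3 * X k)" by (rule mult_right_mono) simp
        ultimately show ?thesis by (simp only: mult_1)
      qed
      have "nn_abs f (ball x (2 ^ Suc k * (3 * r))) \<le> nn_abs f (ball x R)"
        by (rule nn_abs_mono) (use R in \<open>auto simp: t_def\<close>)
      also have "\<dots> \<le> ennreal (n * R powr \<alpha> * wmeas w (ball x R))" using f R by (simp add: bmo_def)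
      also have "n * R powr \<alpha> * wmeas w (ball x R) \<le> n * CD * R powr (\<alpha> + ?d * \<kappa>) * r powr (- ?d * \<kappa>) * exp (c3 * (1 + R / \<rho> x) powr m) * wmeas w (ball x r)"
        by (rule level_bound[OF w n r(1) R(4)])
      also have "\<dots> \<le> n * CD * (t * (6 * r)) powr (\<alpha> + ?d * \<kappa>) * r powr (- ?d * \<kappa>) * (E * exp (c3 * X k)) * wmeas w (ball x r)"
        using n CD_nonneg W0 R r alpha_nonneg kappa_ge1
        by (intro mult_right_mono mult_mono powr_mono2 expE mult_nonneg_nonneg) auto
      finally have "ennreal (g k) * nn_abs f (ball x (2 ^ Suc k * (3 * r)))
        \<le> ennreal (g k) * ennreal (n * CD * (t * (6 * r)) powr (\<alpha> + ?d * \<kappa>) * r powr (- ?d * \<kappa>) * (E * exp (c3 * X k)) * wmeas w (ball x r))"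
        by (simp add: mult_left_mono ennreal_leI)
      also have "\<dots> = ennreal (g k * (n * CD * (t * (6 * r)) powr (\<alpha> + ?d * \<kappa>) * r powr (- ?d * \<kappa>) * (E * exp (c3 * X k)) * wmeas w (ball x r)))"
        using g0 n CD_nonneg W0 by (simp add: ennreal_mult E_def)
      also have "g k * (n * CD * (t * (6 * r)) powr (\<alpha> + ?d * \<kappa>) * r powr (- ?d * \<kappa>) * (E * exp (c3 * X k)) * wmeas w (ball x r))
        = CK * CD * E * 6 powr (\<alpha> + ?d * \<kappa>) * n * wmeas w (ball x r) * exp (- b * X k) * ((t * r) powr (\<nu> - ?d) * (t * r) powr (\<alpha> + ?d * \<kappa>) * r powr (- ?d * \<kappa>))"
      proof -
        have "exp (- (c * (4 * C0) powr (- m) * X k)) * exp (c3 * X k) = exp (- b * X k)"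
          by (simp add: b_def algebra_simps flip: exp_add)
        moreover have "(t * (6 * r)) powr (\<alpha> + ?d * \<kappa>) = 6 powr (\<alpha> + ?d * \<kappa>) * (t * r) powr (\<alpha> + ?d * \<kappa>)"
          using t r by (simp add: powr_mult mult_ac)
        moreover have "g k = CK * (t * r) powr (\<nu> - ?d) * exp (- (c * (4 * C0) powr (- m) * X k))"
          by (simp add: g_def t_def)
        ultimately show ?thesis by (simp add: mult_ac)
      qed
      also have "(t * r) powr (\<nu> - ?d) * (t * r) powr (\<alpha> + ?d * \<kappa>) * r powr (- ?d * \<kappa>)
        = t powr (\<nu> + \<gamma>) * r powr (\<nu> + \<alpha> - ?d)"
      proof -
        have "(t * r) powr (\<nu> - ?d) * (t * r) powr (\<alpha> + ?d * \<kappa>) * r powr (- ?d * \<kappa>)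
          = (t powr (\<nu> - ?d) * t powr (\<alpha> + ?d * \<kappa>)) * (r powr (\<nu> - ?d) * r powr (\<alpha> + ?d * \<kappa>) * r powr (- ?d * \<kappa>))"
          using t r by (simp only: powr_mult) (simp add: mult_ac)
        also have "\<dots> = t powr ((\<nu> - ?d) + (\<alpha> + ?d * \<kappa>)) * r powr ((\<nu> - ?d) + (\<alpha> + ?d * \<kappa>) + - ?d * \<kappa>)"
          by (simp only: powr_add)
        also have "(\<nu> - ?d) + (\<alpha> + ?d * \<kappa>) = \<nu> + \<gamma>" by (simp add: \<gamma>_def algebra_simps)
        also have "\<nu> + \<gamma> + - ?d * \<kappa> = \<nu> + \<alpha> - ?d" by (simp add: \<gamma>_def algebra_simps)
        finally show ?thesis .
      qed
      also have "CK * CD * E * 6 powr (\<alpha> + ?d * \<kappa>) * n * wmeas w (ball x r) * exp (- b * X k) * (t powr (\<nu> + \<gamma>) * r powr (\<nu> + \<alpha> - ?d))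
        \<le> CK * CD * E * 6 powr (\<alpha> + ?d * \<kappa>) * n * wmeas w (ball x r) * (C * (8/3) powr q * t powr (- q)) * (t powr (\<nu> + \<gamma>) * r powr (\<nu> + \<alpha> - ?d))"
      proof -
        have "exp (- b * X k) \<le> C * (1 + 2 ^ Suc k * (3 * r) / \<rho> x) powr (- q)"
          unfolding X_def by (rule C(2)) (use r rho_pos[of x] in \<open>auto intro!: add_pos_nonneg divide_nonneg_pos\<close>)
        also have "\<dots> \<le> C * (3/8 * t) powr (- q)"
        proof -
          have "2 ^ Suc k * (3 * r) / \<rho> x = 3/8 * t" using r8 rho_pos[of x] by (simp add: t_def field_simps)
          then show ?thesis using C(1) t q by (intro mult_left_mono powr_mono2') auto
        qed
        also have "(3/8 * t) powr (- q) = (8/3) powr q * t powr (- q)"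
          using t by (simp add: powr_mult powr_minus_divide powr_divide)
        finally have "exp (- b * X k) \<le> C * (8/3) powr q * t powr (- q)" by simp
        then show ?thesis
          using CK_nonneg CD_nonneg n W0 by (intro mult_right_mono mult_left_mono) (auto simp: E_def)
      qed
      also have "\<dots> = B * n * r powr (\<nu> + \<alpha> - ?d) * wmeas w (ball x r) * (t powr (- q) * t powr (\<nu> + \<gamma>))"
        by (simp add: B_def mult_ac)
      also have "t powr (- q) * t powr (\<nu> + \<gamma>) = (1/2) ^ Suc k"
        using t by (simp add: q_def powr_minus_divide t_def power_divide flip: powr_add)
      finally show "ennreal (g k) * nn_abs f (ball x (2 ^ Suc k * (3 * r)))
        \<le> ennreal (B * n * r powr (\<nu> + \<alpha> - ?d) * wmeas w (ball x r) * (1/2) ^ Suc k)"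
        by (simp add: ennreal_leI)
    qed auto
    also have "\<dots> = ennreal (B * n * r powr (\<nu> + \<alpha> - ?d) * wmeas w (ball x r) * 1)"
      by (rule suminf_ennreal_le[OF S]) (use B n W0 in auto)
    finally show "(\<integral>\<^sup>+u\<in>- ball x (3 * r). ennreal \<bar>K y u\<bar> * ennreal \<bar>f u\<bar> \<partial>lebesgue)
       \<le> ennreal (B * n * r powr (\<nu> + \<alpha> - ?d) * wmeas w (ball x r))"
      by simp
  qed
qed

end

section \<open>The operator on BMO functions\<close>

lemma loc_integrable_const: "loc_integrable (\<lambda>_::'a::euclidean_space. b::real)"
  unfolding loc_integrable_def
proof (intro allI impI)
  fix S :: "'a set" assume "compact S"
  then have "S \<in> lmeasurable" by (rule lmeasurable_compact)
  then have "integrable lebesgue (indicator S :: 'a \<Rightarrow> real)"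
    by (intro integrable_real_indicator) (auto simp: fmeasurable_def)
  then show "set_integrable lebesgue S (\<lambda>_. b)" by (simp add: set_integrable_def)
qed

section \<open>Extension of T to functions that are not integrable\<close>

context scz
begin

text \<open>Required at every point x, not only almost everywhere, because kernel integrals are
  later evaluated at centres of balls.\<close>

definition tail_fin :: "('a \<Rightarrow> real) \<Rightarrow> bool" where
  "tail_fin f \<longleftrightarrow> (\<forall>x t. 0 < t \<longrightarrow> (\<integral>\<^sup>+u\<in>- ball x t. ennreal \<bar>K x u\<bar> * ennreal \<bar>f u\<bar> \<partial>lebesgue) < \<infinity>)"

lemma Compl_ball_sets [measurable]: "- ball (x::'a) t \<in> sets lebesgue"
  by (simp add: Compl_in_sets_lebesgue)

lemma tail_fin_integrable:
  assumes "tail_fin f" "f \<in> borel_measurable lebesgue" "0 < t"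
  shows "set_integrable lebesgue (- ball x t) (\<lambda>u. K x u * f u)"
proof (rule set_integrable_nn_abs)
  note [measurable] = assms(2)
  show "(\<lambda>u. K x u * f u) \<in> borel_measurable lebesgue" by measurable
  show "nn_abs (\<lambda>u. K x u * f u) (- ball x t) < \<infinity>"
    using assms(1,3) by (simp add: tail_fin_def nn_abs_def abs_mult ennreal_mult)
qed (rule Compl_ball_sets)

text \<open>One global representative: exhausting space by balls about the origin avoids a choice of
  x0 and R, and measurability comes with the limit. Where the sequence diverges, the value is
  arbitrary.\<close>

definition ext :: "('a \<Rightarrow> real) \<Rightarrow> 'a \<Rightarrow> real" where
  "ext f y = lim (\<lambda>N. T (\<lambda>u. f u * indicator (ball 0 (real N)) u) y)"

lemma loc_integrable_mult_indicator:
  assumes "loc_integrable (f::'a \<Rightarrow> real)" "bounded A" "A \<in> sets lebesgue"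
  shows "integrable lebesgue (\<lambda>u. f u * indicator A u)"
  using loc_integrable_bounded[OF assms] by (simp add: set_integrable_def mult.commute)

lemma ext_measurable:
  assumes "loc_integrable (f::'a \<Rightarrow> real)"
  shows "ext f \<in> borel_measurable lebesgue"
  unfolding ext_def
  by (rule borel_measurable_lim_metric, rule T_measurable, rule loc_integrable_mult_indicator[OF assms]) auto

text \<open>For x in B(x0,R) and large N the truncation of f splits into f on B(x0,2R) and a
  function vanishing there, on which T is given by the kernel; these kernel integrals converge by
  domination. Since the limit does not mention x0 and R, one function serves all of them.\<close>

lemma ext_is_value:
  assumes f: "loc_integrable f" and fin: "tail_fin f"
  shows "is_extended_value \<rho> T K f (ext f)"
  unfolding is_extended_value_def
proof (intro allI impI)
  fix x0 :: 'a and R assume R: "\<rho> x0 \<le> R"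
  have R0: "0 < R" using R rho_pos[of x0] by linarith
  note fm [measurable] = loc_integrable_measurable[OF f]
  let ?B = "ball x0 (2 * R)"
  define h where "h N = (\<lambda>u. f u * indicator (ball 0 (real N) - ?B) u)" for N :: nat
  have hi: "integrable lebesgue (h N)" for N
    unfolding h_def by (rule loc_integrable_mult_indicator[OF f]) auto
  have fBi: "integrable lebesgue (\<lambda>u. f u * indicator ?B u)"
    by (rule loc_integrable_mult_indicator[OF f]) auto
  obtain N0 :: nat where N0: "norm x0 + 2 * R \<le> real N0" using real_arch_simple by blast
  have sub: "?B \<subseteq> ball 0 (real N)" if "N0 \<le> N" for N
  proof
    fix u assume "u \<in> ?B"
    then have "norm (x0 - u) < 2 * R" by (simp add: dist_norm)
    moreover have "norm u \<le> norm x0 + norm (x0 - u)" using norm_triangle_ineq4[of x0 "x0 - u"] by simp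
    moreover have "real N0 \<le> real N" using that by simp
    ultimately show "u \<in> ball 0 (real N)" using N0 by simp
  qed
  have 1: "AE y in lebesgue. T (\<lambda>u. f u * indicator (ball 0 (real N)) u) y = T (\<lambda>u. f u * indicator ?B u) y + T (h N) y" if "N0 \<le> N" for N
  proof -
    have "(\<lambda>u. f u * indicator ?B u + h N u) = (\<lambda>u. f u * indicator (ball 0 (real N)) u)"
      using sub[OF that] by (auto simp: h_def fun_eq_iff indicator_def)
    then show ?thesis using T_add[OF fBi hi[of N]] by simp
  qed
  then have 1: "AE y in lebesgue. \<forall>N. N0 \<le> N \<longrightarrow> T (\<lambda>u. f u * indicator (ball 0 (real N)) u) y = T (\<lambda>u. f u * indicator ?B u) y + T (h N) y"
    unfolding AE_all_countable by auto
  have "AE y in lebesgue. y \<in> ?B \<longrightarrow> T (h N) y = (LINT u|lebesgue. K y u * h N u)" for N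
    by (rule T_off_open[OF hi]) (auto simp: h_def)
  then have 2: "AE y in lebesgue. \<forall>N. y \<in> ?B \<longrightarrow> T (h N) y = (LINT u|lebesgue. K y u * h N u)"
    unfolding AE_all_countable by auto
  show "AE x in lebesgue. x \<in> ball x0 R \<longrightarrow> set_integrable lebesgue (- ?B) (\<lambda>y. K x y * f y) \<and>
     ext f x = T (\<lambda>y. f y * indicator ?B y) x + (LINT y:- ?B|lebesgue. K x y * f y)"
    using 1 2
  proof eventually_elim
    case (elim x)
    show ?case
    proof
      assume x: "x \<in> ball x0 R"
      have sb: "ball x R \<subseteq> ?B"
      proof
        fix u assume "u \<in> ball x R"
        then show "u \<in> ?B" using x dist_triangle[of x0 u x] by simp
      qed
      have int: "set_integrable lebesgue (- ?B) (\<lambda>y. K x y * f y)"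
        by (rule set_integrable_subset[OF tail_fin_integrable[OF fin fm R0, of x] Compl_ball_sets])
           (use sb in blast)
      have xB: "x \<in> ?B" using x R0 by simp
      have "(\<lambda>N. LINT u|lebesgue. K x u * h N u) \<longlonglongrightarrow> (LINT u|lebesgue. indicator (- ?B) u *\<^sub>R (K x u * f u))"
      proof (rule integral_dominated_convergence[where w = "\<lambda>u. norm (indicator (- ?B) u *\<^sub>R (K x u * f u))"])
        show "(\<lambda>u. indicat_real (- ?B) u *\<^sub>R (K x u * f u)) \<in> borel_measurable lebesgue" by measurable
        show "(\<lambda>u. K x u * h N u) \<in> borel_measurable lebesgue" for N unfolding h_def by measurable
        show "integrable lebesgue (\<lambda>u. norm (indicator (- ?B) u *\<^sub>R (K x u * f u)))"
          using int unfolding set_integrable_def by (rule integrable_norm)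
        show "AE u in lebesgue. (\<lambda>N. K x u * h N u) \<longlonglongrightarrow> indicat_real (- ?B) u *\<^sub>R (K x u * f u)"
        proof (rule AE_I2, rule tendsto_eventually)
          fix u :: 'a
          obtain M :: nat where M: "norm u + 1 \<le> real M" using real_arch_simple by blast
          have "K x u * h N u = indicat_real (- ?B) u *\<^sub>R (K x u * f u)" if "M \<le> N" for N
          proof -
            have "real M \<le> real N" using that by simp
            then have "u \<in> ball 0 (real N)" using M by simp
            then show ?thesis by (auto simp: h_def indicator_def)
          qed
          then show "\<forall>\<^sub>F N in sequentially. K x u * h N u = indicat_real (- ?B) u *\<^sub>R (K x u * f u)"
            unfolding eventually_sequentially by blast
        qed
        show "AE u in lebesgue. norm (K x u * h N u) \<le> norm (indicat_real (- ?B) u *\<^sub>R (K x u * f u))" for N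
          by (rule AE_I2) (auto simp: h_def indicator_def)
      qed
      then have "(\<lambda>N. T (\<lambda>u. f u * indicator ?B u) x + (LINT u|lebesgue. K x u * h N u))
         \<longlonglongrightarrow> T (\<lambda>u. f u * indicator ?B u) x + (LINT y:- ?B|lebesgue. K x y * f y)"
        unfolding set_lebesgue_integral_def by (intro tendsto_intros)
      moreover have "\<forall>\<^sub>F N in sequentially. T (\<lambda>u. f u * indicator ?B u) x + (LINT u|lebesgue. K x u * h N u) = T (\<lambda>u. f u * indicator (ball 0 (real N)) u) x"
        unfolding eventually_sequentially using elim xB by (intro exI[of _ N0]) auto
      ultimately have "(\<lambda>N. T (\<lambda>u. f u * indicator (ball 0 (real N)) u) x) \<longlonglongrightarrow> T (\<lambda>u. f u * indicator ?B u) x + (LINT y:- ?B|lebesgue. K x y * f y)"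
        by (rule Lim_transform_eventually)
      from limI[OF this] int show "set_integrable lebesgue (- ?B) (\<lambda>y. K x y * f y) \<and>
        ext f x = T (\<lambda>y. f y * indicator ?B y) x + (LINT y:- ?B|lebesgue. K x y * f y)"
        by (simp add: ext_def)
    qed
  qed
qed

text \<open>The definition of the extension only uses balls of radius at least 2 \<rho>(x). The part
  of f between the radii 3r and 2 \<rho>(x) is supported away from B(x,r) and can be moved from T
  into the kernel integral.\<close>

lemma local_rep:
  assumes f: "loc_integrable f" and g: "is_extended_value \<rho> T K f g" and r: "0 < r" "3 * r \<le> 2 * \<rho> x"
  shows "AE y in lebesgue. y \<in> ball x r \<longrightarrow> set_integrable lebesgue (- ball x (3 * r)) (\<lambda>u. K y u * f u)
     \<and> g y = T (\<lambda>u. f u * indicator (ball x (3 * r)) u) y + (LINT u:- ball x (3 * r)|lebesgue. K y u * f u)"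
proof -
  let ?B = "ball x (2 * \<rho> x)" and ?Q = "ball x (3 * r)"
  have QB: "?Q \<subseteq> ?B" using r by auto
  define h where "h = (\<lambda>u. f u * indicator (?B - ?Q) u)"
  have hi: "integrable lebesgue h"
    unfolding h_def by (rule loc_integrable_mult_indicator[OF f]) auto
  have fQ: "integrable lebesgue (\<lambda>u. f u * indicator ?Q u)"
    by (rule loc_integrable_mult_indicator[OF f]) auto
  have "(\<lambda>u. f u * indicator ?Q u + h u) = (\<lambda>u. f u * indicator ?B u)"
    using QB by (auto simp: h_def fun_eq_iff indicator_def)
  then have 1: "AE y in lebesgue. T (\<lambda>u. f u * indicator ?B u) y = T (\<lambda>u. f u * indicator ?Q u) y + T h y"
    using T_add[OF fQ hi] by simp
  have 2: "AE y in lebesgue. y \<in> ?Q \<longrightarrow> T h y = (LINT u|lebesgue. K y u * h u)"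
    by (rule T_off_open[OF hi]) (auto simp: h_def)
  have 3: "AE y in lebesgue. y \<in> ball x (\<rho> x) \<longrightarrow> set_integrable lebesgue (- ?B) (\<lambda>u. K y u * f u) \<and>
     g y = T (\<lambda>u. f u * indicator ?B u) y + (LINT u:- ?B|lebesgue. K y u * f u)"
    using g unfolding is_extended_value_def by blast
  show ?thesis using 1 2 3
  proof eventually_elim
    case (elim y)
    show ?case
    proof
      assume y: "y \<in> ball x r"
      have yQ: "y \<in> ?Q" and yR: "y \<in> ball x (\<rho> x)" using y r by auto
      have i1: "integrable lebesgue (\<lambda>u. K y u * h u)"
      proof (rule K_mult_integrable[OF hi, of "2 * r"])
        fix u assume "norm (y - u) < 2 * r"
        then have "u \<in> ?Q" using y dist_triangle[of x u y] by (simp add: dist_norm)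
        then show "h u = 0" by (simp add: h_def)
      qed (use r in simp)
      have i2: "integrable lebesgue (\<lambda>u. indicator (- ?B) u *\<^sub>R (K y u * f u))"
        using elim(3) yR by (simp add: set_integrable_def)
      have eq: "(\<lambda>u. K y u * h u + indicator (- ?B) u *\<^sub>R (K y u * f u)) = (\<lambda>u. indicator (- ?Q) u *\<^sub>R (K y u * f u))"
        using QB by (auto simp: h_def fun_eq_iff indicator_def)
      have "set_integrable lebesgue (- ?Q) (\<lambda>u. K y u * f u)"
        using Bochner_Integration.integrable_add[OF i1 i2] unfolding eq set_integrable_def .
      moreover have "(LINT u:- ?Q|lebesgue. K y u * f u) = (LINT u|lebesgue. K y u * h u) + (LINT u:- ?B|lebesgue. K y u * f u)"
        using Bochner_Integration.integral_add[OF i1 i2] unfolding eq set_lebesgue_integral_def .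
      ultimately show "set_integrable lebesgue (- ?Q) (\<lambda>u. K y u * f u)
         \<and> g y = T (\<lambda>u. f u * indicator ?Q u) y + (LINT u:- ?Q|lebesgue. K y u * f u)"
        using elim yQ yR by simp
    qed
  qed
qed

text \<open>This is how T1 enters: subtracting a times the representation of T1 replaces f by f - a
  in the local and in the far term.\<close>

lemma recentred_rep:
  assumes f: "loc_integrable f" and g: "is_extended_value \<rho> T K f g" and g1: "is_extended_value \<rho> T K (\<lambda>_. 1) g1"
    and r: "0 < r" "3 * r \<le> 2 * \<rho> x"
  shows "AE y in lebesgue. y \<in> ball x r \<longrightarrow> set_integrable lebesgue (- ball x (3 * r)) (\<lambda>u. K y u * (f u - a))
     \<and> g y - a * g1 y = T (\<lambda>u. (f u - a) * indicator (ball x (3 * r)) u) y + (LINT u:- ball x (3 * r)|lebesgue. K y u * (f u - a))"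
proof -
  let ?Q = "ball x (3 * r)"
  note 1 = loc_integrable_const[of 1]
  have T0: "AE y in lebesgue. T (\<lambda>u. f u * indicator ?Q u) y = T (\<lambda>u. (f u - a) * indicator ?Q u) y + a * T (indicator ?Q) y"
    using T_recentre[OF f, of 0 x "3 * r" a] by simp
  show ?thesis using local_rep[OF f g r] local_rep[OF 1 g1 r] T0
  proof eventually_elim
    case (elim y)
    show ?case
    proof
      assume y: "y \<in> ball x r"
      from elim y have i: "set_integrable lebesgue (- ?Q) (\<lambda>u. K y u * f u)" "set_integrable lebesgue (- ?Q) (\<lambda>u. a * (K y u * 1))"
        by auto
      have eq: "(\<lambda>u. K y u * f u - a * (K y u * 1)) = (\<lambda>u. K y u * (f u - a))" by (auto simp: algebra_simps)
      have "(LINT u:- ?Q|lebesgue. K y u * (f u - a)) = (LINT u:- ?Q|lebesgue. K y u * f u) - a * (LINT u:- ?Q|lebesgue. K y u * 1)"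
        using set_integral_diff(2)[OF i] unfolding eq by simp
      with elim y set_integral_diff(1)[OF i] show "set_integrable lebesgue (- ?Q) (\<lambda>u. K y u * (f u - a))
         \<and> g y - a * g1 y = T (\<lambda>u. (f u - a) * indicator ?Q u) y + (LINT u:- ?Q|lebesgue. K y u * (f u - a))"
        unfolding eq by (simp add: algebra_simps)
    qed
  qed
qed

end

section \<open>Oscillation of the extended operator\<close>

context scz_bmo
begin

text \<open>The far part is \<open>tail_size\<close> with y = x; between the radii t and 3r the
  kernel is bounded and f is integrable.\<close>

lemma tail_fin_bmo:
  assumes w: "dbl \<kappa> c3 CD w" and f: "bmo \<alpha> w f n"
  shows "tail_fin f"
  unfolding tail_fin_def
proof (intro allI impI)
  fix x :: 'a and t :: real assume t: "0 < t"
  have fl: "loc_integrable f" using f by (auto simp: bmo_def)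
  have [measurable]: "f \<in> borel_measurable lebesgue" by (rule loc_integrable_measurable[OF fl])
  define r where "r = \<rho> x / 8"
  have r: "0 < r" using rho_pos[of x] by (simp add: r_def)
  let ?I = "\<lambda>A. (\<integral>\<^sup>+u\<in>A. ennreal \<bar>K x u\<bar> * ennreal \<bar>f u\<bar> \<partial>lebesgue)"
  from tail_size obtain A where "0 \<le> A \<and> (\<forall>w f n x r y. dbl \<kappa> c3 CD w \<longrightarrow> bmo \<alpha> w f n \<longrightarrow> r = \<rho> x / 8 \<longrightarrow> y \<in> ball x r \<longrightarrow>
     (\<integral>\<^sup>+u\<in>- ball x (3 * r). ennreal \<bar>K y u\<bar> * ennreal \<bar>f u\<bar> \<partial>lebesgue)
       \<le> ennreal (A * n * r powr (\<nu> + \<alpha> - real DIM('a)) * wmeas w (ball x r)))" ..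
  note A = this[THEN conjunct2, rule_format, OF w f r_def]
  have "?I (- ball x (3 * r)) \<le> ennreal (A * n * r powr (\<nu> + \<alpha> - real DIM('a)) * wmeas w (ball x r))"
    by (rule A) (use r in simp)
  then have 1: "?I (- ball x (3 * r)) < \<infinity>" by (rule order_le_less_trans) simp
  let ?c = "ennreal (CK * t powr (\<nu> - real DIM('a)))"
  have "?I (- ball x t) \<le> (\<integral>\<^sup>+u. ennreal \<bar>K x u\<bar> * ennreal \<bar>f u\<bar> * indicator (- ball x (3 * r)) u
        + ?c * (ennreal \<bar>f u\<bar> * indicator (ball x (3 * r)) u) \<partial>lebesgue)"
  proof (rule nn_integral_mono)
    fix u
    show "ennreal \<bar>K x u\<bar> * ennreal \<bar>f u\<bar> * indicator (- ball x t) u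
      \<le> ennreal \<bar>K x u\<bar> * ennreal \<bar>f u\<bar> * indicator (- ball x (3 * r)) u + ?c * (ennreal \<bar>f u\<bar> * indicator (ball x (3 * r)) u)"
    proof (cases "u \<in> - ball x t \<and> u \<in> ball x (3 * r)")
      case True
      then have "\<bar>K x u\<bar> \<le> CK * t powr (\<nu> - real DIM('a))"
        using t by (intro K_bdd) (auto simp: dist_norm)
      then show ?thesis using True by (auto intro!: mult_right_mono ennreal_leI)
    qed (auto split: split_indicator)
  qed
  also have "\<dots> = ?I (- ball x (3 * r)) + ?c * nn_abs f (ball x (3 * r))"
    unfolding nn_abs_def by (subst nn_integral_add) (simp_all add: nn_integral_cmult)
  also have "\<dots> < \<infinity>"
    using 1 nn_abs_eq_set_integral[OF loc_integrable_ball[OF fl, of x "3 * r"]]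
    by (simp add: ennreal_mult_less_top)
  finally show "?I (- ball x t) < \<infinity>" .
qed

text \<open>What remains of T f after subtracting a T1 consists of the local term, handled by
  \<open>local_bound\<close>, and the far term, whose deviation from its value k at the centre is
  handled by \<open>tail_osc\<close>.\<close>

lemma osc_decomposition:
  "\<exists>A\<ge>0. \<forall>w f n x r g g1. dbl \<kappa> c3 CD w \<longrightarrow> ainf \<phi> w \<longrightarrow> bmo \<alpha> w f n \<longrightarrow> is_extended_value \<rho> T K f g \<longrightarrow>
     is_extended_value \<rho> T K (\<lambda>_. 1) g1 \<longrightarrow> tail_fin (\<lambda>_. 1) \<longrightarrow> 0 < r \<longrightarrow> 8 * r \<le> \<rho> x \<longrightarrow>
     (\<exists>k. nn_abs (\<lambda>y. g y - avg f (ball x (3 * r)) * g1 y - k) (ball x r) \<le> ennreal (A * n * r powr (\<nu> + \<alpha>) * wmeas w (ball x r)))"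
proof -
  let ?d = "real DIM('a)"
  have ka: "0 \<le> \<kappa>" using kappa_ge1 by simp
  have "\<exists>A\<ge>0. \<forall>w f n x r. dbl \<kappa> c3 CD w \<longrightarrow> ainf \<phi> w \<longrightarrow> bmo \<alpha> w f n \<longrightarrow> 0 < r \<longrightarrow> r \<le> \<rho> x \<longrightarrow>
    nn_abs (T (\<lambda>u. (f u - avg f (ball x (3 * r))) * indicator (ball x (3 * r)) u)) (ball x r)
      \<le> ennreal (A * n * r powr (\<nu> + \<alpha>) * wmeas w (ball x r))"
    by (rule local_bound[OF CD_nonneg c3_nonneg ka alpha_nonneg]) (rule phi_pos)
  then obtain A1 where "0 \<le> A1 \<and> (\<forall>w f n x r. dbl \<kappa> c3 CD w \<longrightarrow> ainf \<phi> w \<longrightarrow> bmo \<alpha> w f n \<longrightarrow> 0 < r \<longrightarrow> r \<le> \<rho> x \<longrightarrow>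
    nn_abs (T (\<lambda>u. (f u - avg f (ball x (3 * r))) * indicator (ball x (3 * r)) u)) (ball x r)
      \<le> ennreal (A1 * n * r powr (\<nu> + \<alpha>) * wmeas w (ball x r)))" ..
  note A1 = this[THEN conjunct1] this[THEN conjunct2, rule_format]
  from tail_osc obtain A2 where "0 \<le> A2 \<and> (\<forall>w f n x r y. dbl \<kappa> c3 CD w \<longrightarrow> bmo \<alpha> w f n \<longrightarrow> 0 < r \<longrightarrow> 8 * r \<le> \<rho> x \<longrightarrow> y \<in> ball x r \<longrightarrow>
     (\<integral>\<^sup>+u\<in>- ball x (3 * r). ennreal \<bar>K y u - K x u\<bar> * ennreal \<bar>f u - avg f (ball x (3 * r))\<bar> \<partial>lebesgue)
       \<le> ennreal (A2 * n * r powr (\<nu> + \<alpha> - ?d) * wmeas w (ball x r)))" ..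
  note A2 = this[THEN conjunct1] this[THEN conjunct2, rule_format]
  show ?thesis
  proof (rule exI[of _ "A1 + A2 * V"], intro conjI allI impI)
    show "0 \<le> A1 + A2 * V" using A1 A2 V_pos by simp
    fix w f n x r g g1
    assume w: "dbl \<kappa> c3 CD w" "ainf \<phi> w" and f: "bmo \<alpha> w f n" and g: "is_extended_value \<rho> T K f g"
      "is_extended_value \<rho> T K (\<lambda>_. 1) g1" and fin1: "tail_fin (\<lambda>_. 1)" and r: "0 < r" "8 * r \<le> \<rho> x"
    have fl: "loc_integrable f" and n: "0 \<le> n" using f by (auto simp: bmo_def)
    have [measurable]: "f \<in> borel_measurable lebesgue" by (rule loc_integrable_measurable[OF fl])
    have wt: "weight w" using w by (simp add: dbl_def)
    note W0 = wmeas_nonneg[OF wt, of "ball x r"]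
    let ?Q = "ball x (3 * r)"
    define a where "a = avg f ?Q"
    define k where "k = (LINT u:- ?Q|lebesgue. K x u * (f u - a))"
    define h where "h = T (\<lambda>u. (f u - a) * indicator ?Q u)"
    have [measurable]: "h \<in> borel_measurable lebesgue"
      unfolding h_def by (rule T_measurable[OF loc_integrable_diff_const[OF fl]])
    define e where "e = A2 * n * r powr (\<nu> + \<alpha> - ?d) * wmeas w (ball x r)"
    have e0: "0 \<le> e" using A2 n W0 by (simp add: e_def)
    have r3: "0 < 3 * r" using r by simp
    \<comment> \<open>The representation of T f holds only almost everywhere, so integrability at
      the centre x itself has to come from \<open>tail_fin\<close>.\<close>
    have ix: "set_integrable lebesgue (- ?Q) (\<lambda>u. K x u * (f u - a))"
    proof -
      have "set_integrable lebesgue (- ?Q) (\<lambda>u. a * (K x u * 1))"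
        using tail_fin_integrable[OF fin1 _ r3, of x] by simp
      with tail_fin_integrable[OF tail_fin_bmo[OF w(1) f] _ r3, of x]
      have "set_integrable lebesgue (- ?Q) (\<lambda>u. K x u * f u - a * (K x u * 1))"
        by (intro set_integral_diff(1)) auto
      then show ?thesis by (simp add: algebra_simps)
    qed
    have rep: "AE y in lebesgue. y \<in> ball x r \<longrightarrow> \<bar>g y - a * g1 y - k\<bar> \<le> \<bar>h y\<bar> + e"
    proof (rule eventually_mono[OF recentred_rep[OF fl g r(1), of x a]])
      show "3 * r \<le> 2 * \<rho> x" using r by simp
      fix y assume y: "y \<in> ball x r \<longrightarrow> set_integrable lebesgue (- ?Q) (\<lambda>u. K y u * (f u - a))
        \<and> g y - a * g1 y = T (\<lambda>u. (f u - a) * indicator ?Q u) y + (LINT u:- ?Q|lebesgue. K y u * (f u - a))"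
      show "y \<in> ball x r \<longrightarrow> \<bar>g y - a * g1 y - k\<bar> \<le> \<bar>h y\<bar> + e"
      proof
        assume yB: "y \<in> ball x r"
        have "(LINT u:- ?Q|lebesgue. K y u * (f u - a)) - k = (LINT u:- ?Q|lebesgue. K y u * (f u - a) - K x u * (f u - a))"
          unfolding k_def using y yB ix by (intro set_integral_diff(2)[symmetric]) auto
        also have "(\<lambda>u. K y u * (f u - a) - K x u * (f u - a)) = (\<lambda>u. (K y u - K x u) * (f u - a))" by (auto simp: algebra_simps)
        finally have eq: "(LINT u:- ?Q|lebesgue. K y u * (f u - a)) - k = (LINT u:- ?Q|lebesgue. (K y u - K x u) * (f u - a))" .
        have "nn_abs (\<lambda>u. (K y u - K x u) * (f u - a)) (- ?Q) \<le> ennreal e"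
          using A2(2)[OF w(1) f r yB] unfolding nn_abs_def e_def a_def by (simp add: abs_mult ennreal_mult)
        from abs_set_integral_le_nn_abs[OF this e0]
        show "\<bar>g y - a * g1 y - k\<bar> \<le> \<bar>h y\<bar> + e"
          using y yB eq unfolding h_def by linarith
      qed
    qed
    have "nn_abs (\<lambda>y. g y - a * g1 y - k) (ball x r) \<le> nn_abs (\<lambda>y. \<bar>h y\<bar> + e) (ball x r)"
      unfolding nn_abs_def
    proof (rule nn_integral_mono_AE, rule eventually_mono[OF rep])
      fix y assume "y \<in> ball x r \<longrightarrow> \<bar>g y - a * g1 y - k\<bar> \<le> \<bar>h y\<bar> + e"
      then show "ennreal \<bar>g y - a * g1 y - k\<bar> * indicator (ball x r) y \<le> ennreal \<bar>\<bar>h y\<bar> + e\<bar> * indicator (ball x r) y"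
        using e0 by (auto split: split_indicator intro!: ennreal_leI simp flip: ennreal_plus)
    qed
    also have "\<dots> \<le> nn_abs (\<lambda>y. \<bar>h y\<bar>) (ball x r) + nn_abs (\<lambda>_. e) (ball x r)" by (rule nn_abs_add) measurable
    also have "nn_abs (\<lambda>y. \<bar>h y\<bar>) (ball x r) = nn_abs h (ball x r)" by (simp add: nn_abs_def)
    also have "nn_abs h (ball x r) \<le> ennreal (A1 * n * r powr (\<nu> + \<alpha>) * wmeas w (ball x r))"
      unfolding h_def a_def by (rule A1(2)[OF w f r(1)]) (use r in simp)
    also have "nn_abs (\<lambda>_. e) (ball x r) = ennreal (A2 * V * n * r powr (\<nu> + \<alpha>) * wmeas w (ball x r))"
    proof -
      have "e * (V * r powr ?d) = A2 * V * n * r powr (\<nu> + \<alpha>) * wmeas w (ball x r)"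
        using r by (simp add: e_def powr_diff)
      moreover have "nn_abs (\<lambda>_. e) (ball x r) = ennreal (e * (V * r powr ?d))"
        using r e0 V_pos by (simp add: nn_abs_const emeasure_ball_V flip: ennreal_mult del: emeasure_completion)
      ultimately show ?thesis by (simp only:)
    qed
    also have "ennreal (A1 * n * r powr (\<nu> + \<alpha>) * wmeas w (ball x r)) + ennreal (A2 * V * n * r powr (\<nu> + \<alpha>) * wmeas w (ball x r))
       = ennreal ((A1 + A2 * V) * n * r powr (\<nu> + \<alpha>) * wmeas w (ball x r))"
      using A1 A2 V_pos n W0 by (simp add: algebra_simps flip: ennreal_plus)
    finally have "nn_abs (\<lambda>y. g y - a * g1 y - k) (ball x r) \<le> ennreal ((A1 + A2 * V) * n * r powr (\<nu> + \<alpha>) * wmeas w (ball x r))"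
      by (simp add: add_mono)
    then show "\<exists>k. nn_abs (\<lambda>y. g y - avg f (ball x (3 * r)) * g1 y - k) (ball x r) \<le> ennreal ((A1 + A2 * V) * n * r powr (\<nu> + \<alpha>) * wmeas w (ball x r))"
      unfolding a_def by blast
  qed
qed

end

lemma nn_abs_UN_le:
  assumes J: "countable J" and [measurable]: "h \<in> borel_measurable lebesgue" "\<And>j. j \<in> J \<Longrightarrow> X j \<in> sets lebesgue"
    and sub: "A \<subseteq> (\<Union>j\<in>J. X j)"
  shows "nn_abs h A \<le> (\<integral>\<^sup>+j. nn_abs h (X j) \<partial>count_space J)"
proof -
  have "nn_abs h A \<le> (\<integral>\<^sup>+y. (\<integral>\<^sup>+j. ennreal \<bar>h y\<bar> * indicator (X j) y \<partial>count_space J) \<partial>lebesgue)"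
    unfolding nn_abs_def
  proof (rule nn_integral_mono)
    fix y
    show "ennreal \<bar>h y\<bar> * indicator A y \<le> (\<integral>\<^sup>+j. ennreal \<bar>h y\<bar> * indicator (X j) y \<partial>count_space J)"
    proof (cases "y \<in> A")
      case True
      then obtain j where j: "j \<in> J" "y \<in> X j" using sub by blast
      show ?thesis
        using nn_integral_ge_point[OF j(1), of "\<lambda>j. ennreal \<bar>h y\<bar> * indicator (X j) y"] j True by simp
    qed simp
  qed
  also have "\<dots> = (\<integral>\<^sup>+j. nn_abs h (X j) \<partial>count_space J)"
    unfolding nn_abs_def by (rule nn_integral_count_space_nn_integral[OF J]) measurable
  finally show ?thesis .
qed

lemma osc_le_twice:
  assumes g: "loc_integrable (g::'a::euclidean_space \<Rightarrow> real)" and r: "0 < r"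
  shows "nn_abs (\<lambda>y. g y - avg g (ball x r)) (ball x r) \<le> 2 * nn_abs (\<lambda>y. g y - b) (ball x r)"
proof -
  let ?B = "ball x r"
  have [measurable]: "g \<in> borel_measurable lebesgue" by (rule loc_integrable_measurable[OF g])
  have "nn_abs (\<lambda>y. g y - avg g ?B) ?B = nn_abs (\<lambda>y. (g y - b) + (b - avg g ?B)) ?B" by simp
  also have "\<dots> \<le> nn_abs (\<lambda>y. g y - b) ?B + nn_abs (\<lambda>_. b - avg g ?B) ?B" by (rule nn_abs_add) measurable
  also have "nn_abs (\<lambda>_. b - avg g ?B) ?B = ennreal (\<bar>avg g ?B - b\<bar> * vol ?B)"
    using r vol_ball_pos[OF r, of x]
    by (simp add: nn_abs_const emeasure_ball_vol abs_minus_commute ennreal_mult del: emeasure_completion)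
  also have "\<dots> \<le> nn_abs (\<lambda>y. g y - b) ?B" by (rule avg_diff[OF g r])
  finally show ?thesis by (simp add: mult_2 add_left_mono)
qed

section \<open>The function 1 as an admissible BMO function\<close>

context scz
begin

lemma wmeas_one: "0 \<le> r \<Longrightarrow> wmeas (\<lambda>_. 1) (ball (x::'a) r) = V * r powr real DIM('a)"
  by (simp add: wmeas_def set_lebesgue_integral_def vol_def[symmetric] vol_V)

lemma weight_one: "weight (\<lambda>_::'a. 1)"
  by (simp add: weight_def loc_integrable_const)

text \<open>For w = 1, \<alpha> = 0, \<kappa> = 1 and c3 = 0 the function 1 belongs to the BMO
  space, so the general estimates apply to T1 itself. The condition on the exponents becomes \<nu> <
  \<delta>.\<close>

lemma one_bmo: "scz_bmo \<rho> k0 C0 \<nu> \<delta> c m T K CT CK 0 1 0 1 (\<lambda>e. e)"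
proof
  show "0 < c * (1 - (real DIM('a) * (1 - 1) + 0 + \<nu>) / \<delta>) * (4 * C0) powr (- m)"
    using c_pos nu_less_delta delta_pos C0_ge1 by (intro mult_pos_pos) (auto simp: field_simps)
qed (use nu_less_delta in auto)

lemma one_adm: "dbl 1 0 1 (\<lambda>_. 1)" "ainf (\<lambda>e. e) (\<lambda>_. 1)" "bmo 0 (\<lambda>_. 1) (\<lambda>_. 1) 1"
proof -
  show "dbl 1 0 1 (\<lambda>_. 1)"
    unfolding dbl_def using V_pos by (auto simp: weight_one wmeas_one powr_divide)
  show "ainf (\<lambda>e. e) (\<lambda>_. 1)"
    unfolding ainf_def by (auto simp: nn_abs_const wmeas_one vol_V simp del: emeasure_completion)
  have avg1: "avg (\<lambda>_. 1) (ball x r) = 1" if "0 < r" for x :: 'a and r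
    using vol_ball_pos[OF that, of x] by (simp add: avg_def set_lebesgue_integral_def vol_def[symmetric])
  have r0: "0 < r" if "\<rho> x \<le> r" for x r using that rho_pos[of x] by linarith
  show "bmo 0 (\<lambda>_. 1) (\<lambda>_. 1) 1"
    unfolding bmo_def using r0
    by (auto simp: loc_integrable_const avg1 nn_abs_const wmeas_one emeasure_ball_V less_imp_le simp del: emeasure_completion)
qed

lemma tail_fin_one: "tail_fin (\<lambda>_. 1)"
proof -
  interpret one: scz_bmo \<rho> k0 C0 \<nu> \<delta> c m T K CT CK 0 1 0 1 "\<lambda>e. e" by (rule one_bmo)
  show ?thesis by (rule one.tail_fin_bmo[OF one_adm(1,3)])
qed

end

section \<open>Size on balls of at least an eighth of the critical radius\<close>

context scz_bmo
begin

text \<open>At r = \<rho>(x)/8 the mean of f over the 3-fold ball is bounded through the size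
  condition at radius 8r = \<rho>(x). So T f splits into the centred local part, this mean times T
  of an indicator, and the far part of \<open>tail_size\<close>.\<close>

lemma size_critical:
  "\<exists>A\<ge>0. \<forall>w f n x g. dbl \<kappa> c3 CD w \<longrightarrow> ainf \<phi> w \<longrightarrow> bmo \<alpha> w f n \<longrightarrow> is_extended_value \<rho> T K f g \<longrightarrow>
     nn_abs g (ball x (\<rho> x / 8)) \<le> ennreal (A * n * (\<rho> x / 8) powr (\<nu> + \<alpha>) * wmeas w (ball x (\<rho> x / 8)))"
proof -
  let ?d = "real DIM('a)"
  have ka: "0 \<le> \<kappa>" using kappa_ge1 by simp
  have "\<exists>A\<ge>0. \<forall>w f n x r. dbl \<kappa> c3 CD w \<longrightarrow> ainf \<phi> w \<longrightarrow> bmo \<alpha> w f n \<longrightarrow> 0 < r \<longrightarrow> r \<le> \<rho> x \<longrightarrow>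
    nn_abs (T (\<lambda>u. (f u - avg f (ball x (3 * r))) * indicator (ball x (3 * r)) u)) (ball x r)
      \<le> ennreal (A * n * r powr (\<nu> + \<alpha>) * wmeas w (ball x r))"
    by (rule local_bound[OF CD_nonneg c3_nonneg ka alpha_nonneg]) (rule phi_pos)
  then obtain A1 where "0 \<le> A1 \<and> (\<forall>w f n x r. dbl \<kappa> c3 CD w \<longrightarrow> ainf \<phi> w \<longrightarrow> bmo \<alpha> w f n \<longrightarrow> 0 < r \<longrightarrow> r \<le> \<rho> x \<longrightarrow>
    nn_abs (T (\<lambda>u. (f u - avg f (ball x (3 * r))) * indicator (ball x (3 * r)) u)) (ball x r)
      \<le> ennreal (A1 * n * r powr (\<nu> + \<alpha>) * wmeas w (ball x r)))" ..
  note A1 = this[THEN conjunct1] this[THEN conjunct2, rule_format]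
  from tail_size obtain A2 where "0 \<le> A2 \<and> (\<forall>w f n x r y. dbl \<kappa> c3 CD w \<longrightarrow> bmo \<alpha> w f n \<longrightarrow> r = \<rho> x / 8 \<longrightarrow> y \<in> ball x r \<longrightarrow>
     (\<integral>\<^sup>+u\<in>- ball x (3 * r). ennreal \<bar>K y u\<bar> * ennreal \<bar>f u\<bar> \<partial>lebesgue)
       \<le> ennreal (A2 * n * r powr (\<nu> + \<alpha> - ?d) * wmeas w (ball x r)))" ..
  note A2 = this[THEN conjunct1] this[THEN conjunct2, rule_format]
  from T_indicator_bound obtain C2 where "0 \<le> C2 \<and> (\<forall>x r. 0 < r \<longrightarrow> nn_abs (T (indicator (ball x (3 * r)))) (ball x r) \<le> ennreal (C2 * r powr \<nu> * (V * r powr ?d)))" ..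
  note C2 = this[THEN conjunct1] this[THEN conjunct2, rule_format]
  define D where "D = CD * 8 powr (?d * \<kappa>) * exp (c3 * (1 + 1) powr m)"
  have D: "0 \<le> D" using CD_nonneg by (simp add: D_def)
  show ?thesis
  proof (rule exI[of _ "A1 + C2 * 8 powr \<alpha> * D + A2 * V"], intro conjI allI impI)
    show "0 \<le> A1 + C2 * 8 powr \<alpha> * D + A2 * V" using A1(1) A2(1) C2(1) D V_pos by simp
    fix w f n x g
    assume w: "dbl \<kappa> c3 CD w" "ainf \<phi> w" and f: "bmo \<alpha> w f n" and g: "is_extended_value \<rho> T K f g"
    have fl: "loc_integrable f" and n: "0 \<le> n" using f by (auto simp: bmo_def)
    have [measurable]: "f \<in> borel_measurable lebesgue" by (rule loc_integrable_measurable[OF fl])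
    have wt: "weight w" using w by (simp add: dbl_def)
    define r where "r = \<rho> x / 8"
    have r: "0 < r" "3 * r \<le> 2 * \<rho> x" "8 * r = \<rho> x" using rho_pos[of x] by (auto simp: r_def)
    define W where "W = wmeas w (ball x r)"
    have W0: "0 \<le> W" unfolding W_def by (rule wmeas_nonneg[OF wt])
    let ?Q = "ball x (3 * r)"
    define a where "a = avg f ?Q"
    define h where "h = T (\<lambda>u. (f u - a) * indicator ?Q u)"
    define t where "t = T (indicator ?Q)"
    have [measurable]: "h \<in> borel_measurable lebesgue" "t \<in> borel_measurable lebesgue"
      unfolding h_def t_def by (rule T_measurable[OF loc_integrable_diff_const[OF fl]], rule T_measurable[OF indicator_integrable])
    define e where "e = A2 * n * r powr (\<nu> + \<alpha> - ?d) * W"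
    have e0: "0 \<le> e" using A2(1) n W0 by (simp add: e_def)
    have T0: "AE y in lebesgue. T (\<lambda>u. f u * indicator ?Q u) y = h y + a * t y"
      using T_recentre[OF fl, of 0 x "3 * r" a] by (simp add: h_def t_def)
    have rep: "AE y in lebesgue. y \<in> ball x r \<longrightarrow> \<bar>g y\<bar> \<le> \<bar>h y\<bar> + \<bar>a * t y\<bar> + e"
      using T0 local_rep[OF fl g r(1,2)]
    proof eventually_elim
      case (elim y)
      show ?case
      proof
        assume yB: "y \<in> ball x r"
        have "nn_abs (\<lambda>u. K y u * f u) (- ?Q) \<le> ennreal e"
          using A2(2)[OF w(1) f r_def yB] unfolding nn_abs_def e_def W_def by (simp add: abs_mult ennreal_mult)
        from abs_set_integral_le_nn_abs[OF this e0] show "\<bar>g y\<bar> \<le> \<bar>h y\<bar> + \<bar>a * t y\<bar> + e"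
          using elim yB by linarith
      qed
    qed
    have "nn_abs g (ball x r) \<le> nn_abs (\<lambda>y. (\<bar>h y\<bar> + \<bar>a * t y\<bar>) + e) (ball x r)"
      unfolding nn_abs_def
    proof (rule nn_integral_mono_AE, rule eventually_mono[OF rep])
      fix y assume "y \<in> ball x r \<longrightarrow> \<bar>g y\<bar> \<le> \<bar>h y\<bar> + \<bar>a * t y\<bar> + e"
      then show "ennreal \<bar>g y\<bar> * indicator (ball x r) y \<le> ennreal \<bar>\<bar>h y\<bar> + \<bar>a * t y\<bar> + e\<bar> * indicator (ball x r) y"
        using e0 by (auto split: split_indicator intro!: ennreal_leI simp del: ennreal_plus)
    qed
    also have "\<dots> \<le> nn_abs (\<lambda>y. \<bar>h y\<bar> + \<bar>a * t y\<bar>) (ball x r) + nn_abs (\<lambda>_. e) (ball x r)" by (rule nn_abs_add) measurable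
    also have "nn_abs (\<lambda>y. \<bar>h y\<bar> + \<bar>a * t y\<bar>) (ball x r) \<le> nn_abs (\<lambda>y. \<bar>h y\<bar>) (ball x r) + nn_abs (\<lambda>y. \<bar>a * t y\<bar>) (ball x r)"
      by (rule nn_abs_add) measurable
    also have "nn_abs (\<lambda>y. \<bar>h y\<bar>) (ball x r) = nn_abs h (ball x r)" by (simp add: nn_abs_def)
    also have "nn_abs h (ball x r) \<le> ennreal (A1 * n * r powr (\<nu> + \<alpha>) * W)"
      unfolding h_def a_def W_def by (rule A1(2)[OF w f r(1)]) (use r in simp)
    also have "nn_abs (\<lambda>y. \<bar>a * t y\<bar>) (ball x r) \<le> ennreal (C2 * 8 powr \<alpha> * D * n * r powr (\<nu> + \<alpha>) * W)"
    proof -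
      have "ennreal (\<bar>a\<bar> * vol ?Q) \<le> nn_abs f ?Q"
        using avg_diff[OF fl, of "3 * r" x 0] r by (simp add: a_def)
      also have "\<dots> \<le> nn_abs f (ball x (8 * r))" by (rule nn_abs_mono) (use r in auto)
      also have "\<dots> \<le> ennreal (n * (8 * r) powr \<alpha> * wmeas w (ball x (8 * r)))"
        using f r by (simp add: bmo_def)
      also have "n * (8 * r) powr \<alpha> * wmeas w (ball x (8 * r)) \<le> n * (8 * r) powr \<alpha> * (D * W)"
        unfolding D_def W_def using n r
        by (intro mult_left_mono dbl_bounded[OF w(1) CD_nonneg c3_nonneg ka]) auto
      finally have "ennreal (\<bar>a\<bar> * vol ?Q) \<le> ennreal (n * (8 * r) powr \<alpha> * (D * W))" by (simp add: ennreal_leI)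
      then have aQ: "\<bar>a\<bar> * vol ?Q \<le> n * (8 * r) powr \<alpha> * (D * W)"
        using n D W0 by (subst (asm) ennreal_le_iff) auto
      have "nn_abs (\<lambda>y. \<bar>a * t y\<bar>) (ball x r) \<le> ennreal \<bar>a\<bar> * nn_abs t (ball x r)"
        by (rule nn_abs_le_cmult) (auto simp: abs_mult)
      also have "\<dots> \<le> ennreal \<bar>a\<bar> * ennreal (C2 * r powr \<nu> * (V * r powr ?d))"
        unfolding t_def by (rule mult_left_mono[OF C2(2)[OF r(1)]]) simp
      also have "\<dots> = ennreal (C2 * r powr \<nu> * (\<bar>a\<bar> * (V * r powr ?d)))"
        using C2(1) V_pos by (simp add: mult_ac flip: ennreal_mult)
      also have "C2 * r powr \<nu> * (\<bar>a\<bar> * (V * r powr ?d)) \<le> C2 * r powr \<nu> * (\<bar>a\<bar> * vol ?Q)"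
        using C2(1) V_pos r by (intro mult_left_mono) (auto simp: vol_V intro!: powr_mono2 mult_left_mono)
      also have "\<dots> \<le> C2 * r powr \<nu> * (n * (8 * r) powr \<alpha> * (D * W))"
        using aQ C2(1) by (intro mult_left_mono) auto
      also have "\<dots> = C2 * 8 powr \<alpha> * D * n * r powr (\<nu> + \<alpha>) * W"
        using r(1) by (simp add: powr_mult powr_add)
      finally show ?thesis by (simp add: ennreal_leI)
    qed
    also have "nn_abs (\<lambda>_. e) (ball x r) = ennreal (A2 * V * n * r powr (\<nu> + \<alpha>) * W)"
    proof -
      have "e * (V * r powr ?d) = A2 * V * n * r powr (\<nu> + \<alpha>) * W"
        using r by (simp add: e_def powr_diff)
      moreover have "nn_abs (\<lambda>_. e) (ball x r) = ennreal (e * (V * r powr ?d))"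
        using r e0 V_pos by (simp add: nn_abs_const emeasure_ball_V flip: ennreal_mult del: emeasure_completion)
      ultimately show ?thesis by (simp only:)
    qed
    finally have "nn_abs g (ball x r) \<le> ennreal (A1 * n * r powr (\<nu> + \<alpha>) * W) + ennreal (C2 * 8 powr \<alpha> * D * n * r powr (\<nu> + \<alpha>) * W)
       + ennreal (A2 * V * n * r powr (\<nu> + \<alpha>) * W)"
      by (simp add: add_mono)
    also have "\<dots> = ennreal ((A1 + C2 * 8 powr \<alpha> * D + A2 * V) * n * r powr (\<nu> + \<alpha>) * W)"
      using A1(1) A2(1) C2(1) D V_pos n W0 by (simp add: algebra_simps flip: ennreal_plus)
    finally show "nn_abs g (ball x (\<rho> x / 8)) \<le> ennreal ((A1 + C2 * 8 powr \<alpha> * D + A2 * V) * n * (\<rho> x / 8) powr (\<nu> + \<alpha>) * wmeas w (ball x (\<rho> x / 8)))"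
      unfolding r_def W_def .
  qed
qed

text \<open>Doubling on a large ball would cost an exponential factor. Instead the ball is covered
  at the local critical scale by dilates of disjoint balls lying inside it. Doubling is used only
  from \<rho>/8 down to these small radii, and the weights of the disjoint balls add up to at most
  w(B).\<close>

lemma size_all:
  "\<exists>A\<ge>0. \<forall>w f n x r g. dbl \<kappa> c3 CD w \<longrightarrow> ainf \<phi> w \<longrightarrow> bmo \<alpha> w f n \<longrightarrow> is_extended_value \<rho> T K f g \<longrightarrow>
     g \<in> borel_measurable lebesgue \<longrightarrow> \<rho> x \<le> 8 * r \<longrightarrow> nn_abs g (ball x r) \<le> ennreal (A * n * r powr (\<nu> + \<alpha>) * wmeas w (ball x r))"
proof -
  let ?d = "real DIM('a)"
  have ka: "0 \<le> \<kappa>" using kappa_ge1 by simp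
  have k0: "1 \<le> k0" and C01: "1 \<le> C0" using rho by (auto simp: critical_radius_def)
  from size_critical obtain A1 where "0 \<le> A1 \<and> (\<forall>w f n x g. dbl \<kappa> c3 CD w \<longrightarrow> ainf \<phi> w \<longrightarrow> bmo \<alpha> w f n \<longrightarrow> is_extended_value \<rho> T K f g \<longrightarrow>
     nn_abs g (ball x (\<rho> x / 8)) \<le> ennreal (A1 * n * (\<rho> x / 8) powr (\<nu> + \<alpha>) * wmeas w (ball x (\<rho> x / 8))))" ..
  note A1 = this[THEN conjunct1] this[THEN conjunct2, rule_format]
  define c1 where "c1 = inverse C0 * 2 powr (- k0)"
  \<comment> \<open>The first bound gives 5 \<sigma> \<le> \<rho>(z)/8, so that
    \<open>size_critical\<close> covers the dilated balls; the second gives \<sigma> \<le> r, as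
    \<rho>(y) \<le> 9 C0 r on B.\<close>
  define \<epsilon> where "\<epsilon> = min (c1 / 40) (1 / (9 * C0))"
  have eps: "0 < \<epsilon>" "40 * \<epsilon> \<le> c1" "\<epsilon> * (9 * C0) \<le> 1" "\<epsilon> < 1"
  proof -
    have "0 < c1" using C01 by (simp add: c1_def)
    then show "0 < \<epsilon>" using C01 by (simp add: \<epsilon>_def)
    show "40 * \<epsilon> \<le> c1" by (auto simp: \<epsilon>_def min_def)
    have "\<epsilon> \<le> 1 / (9 * C0)" by (simp add: \<epsilon>_def)
    then show "\<epsilon> * (9 * C0) \<le> 1" using C01 by (simp add: field_simps)
    moreover have "\<epsilon> * 9 \<le> \<epsilon> * (9 * C0)" using \<open>0 < \<epsilon>\<close> C01 by (intro mult_left_mono) auto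
    ultimately show "\<epsilon> < 1" using \<open>0 < \<epsilon>\<close> by linarith
  qed
  define b where "b = C0 / (4 * \<epsilon>)"
  define D where "D = CD * b powr (?d * \<kappa>) * exp (c3 * (1 + 1) powr m)"
  have D: "0 \<le> D" using CD_nonneg by (simp add: D_def)
  define M where "M = (9 * C0 * C0) powr (\<nu> + \<alpha>)"
  show ?thesis
  proof (rule exI[of _ "A1 * M * D"], intro conjI allI impI)
    show "0 \<le> A1 * M * D" using A1(1) D by (simp add: M_def)
    fix w f n x r g
    assume w: "dbl \<kappa> c3 CD w" "ainf \<phi> w" and f: "bmo \<alpha> w f n" and g: "is_extended_value \<rho> T K f g"
      and gm [measurable]: "g \<in> borel_measurable lebesgue" and xr: "\<rho> x \<le> 8 * r"
    have n: "0 \<le> n" using f by (auto simp: bmo_def)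
    have wt: "weight w" using w by (simp add: dbl_def)
    have r: "0 < r" using xr rho_pos[of x] by linarith
    define \<sigma> where "\<sigma> y = \<epsilon> * \<rho> y" for y
    \<comment> \<open>The centre is pulled from y towards x, just enough for B(z,\<sigma>) to stay
      inside B(x,r) while still containing y.\<close>
    define z where "z y = x + (1 - \<sigma> y / r) *\<^sub>R (y - x)" for y
    have ry: "\<rho> y \<le> 9 * C0 * r" if "y \<in> ball x r" for y
    proof -
      have "dist x y \<le> (r / \<rho> x) * \<rho> x" using that rho_pos[of x] by simp
      from rho_upper[OF this] have "\<rho> y \<le> C0 * (1 + r / \<rho> x) * \<rho> x" using r rho_pos[of x] by simp
      also have "\<dots> = C0 * (\<rho> x + r)" using rho_pos[of x] by (simp add: field_simps)
      also have "\<dots> \<le> C0 * (9 * r)" using xr C01 by (intro mult_left_mono) auto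
      finally show ?thesis by simp
    qed
    have sig: "0 < \<sigma> y" "\<sigma> y \<le> r" if "y \<in> ball x r" for y
    proof -
      show "0 < \<sigma> y" using eps rho_pos[of y] by (simp add: \<sigma>_def)
      have "\<epsilon> * \<rho> y \<le> \<epsilon> * (9 * C0 * r)" using ry[OF that] eps by (intro mult_left_mono) auto
      also have "\<dots> = (\<epsilon> * (9 * C0)) * r" by simp
      also have "\<dots> \<le> 1 * r" using eps r by (intro mult_right_mono) auto
      finally show "\<sigma> y \<le> r" by (simp add: \<sigma>_def)
    qed
    have zy: "dist (z y) y < \<sigma> y" if "y \<in> ball x r" for y
    proof -
      have "z y - y = - ((\<sigma> y / r) *\<^sub>R (y - x))" by (simp add: z_def algebra_simps)
      then have "dist (z y) y = (\<sigma> y / r) * norm (y - x)" using sig[OF that] r by (simp add: dist_norm)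
      also have "\<dots> < (\<sigma> y / r) * r"
        using that sig[OF that] r by (intro mult_strict_left_mono) (auto simp: dist_norm norm_minus_commute)
      finally show ?thesis using r by simp
    qed
    have zsub: "ball (z y) (\<sigma> y) \<subseteq> ball x r" if "y \<in> ball x r" for y
    proof
      fix u assume "u \<in> ball (z y) (\<sigma> y)"
      then have "dist (z y) u < \<sigma> y" by simp
      moreover have "dist x (z y) \<le> (1 - \<sigma> y / r) * r"
      proof -
        have "dist x (z y) = (1 - \<sigma> y / r) * norm (y - x)"
          using sig[OF that] r by (simp add: z_def dist_norm)
        also have "\<dots> \<le> (1 - \<sigma> y / r) * r"
          using that sig[OF that] r by (intro mult_left_mono) (auto simp: dist_norm norm_minus_commute)
        finally show ?thesis .
      qed
      moreover have "(1 - \<sigma> y / r) * r = r - \<sigma> y" using r by (simp add: left_diff_distrib)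
      ultimately show "u \<in> ball x r" using dist_triangle[of x u "z y"] by (auto simp del: mult_eq_0_iff)
    qed
    have cov: "ball x r \<subseteq> (\<Union>y\<in>ball x r. ball (z y) (\<sigma> y))" using zy by auto
    have sig2: "0 < \<sigma> y \<and> \<sigma> y \<le> r" if "y \<in> ball x r" for y using sig[OF that] by simp
    obtain J where J: "countable J" "J \<subseteq> ball x r"
      "pairwise (\<lambda>i j. disjnt (ball (z i) (\<sigma> i)) (ball (z j) (\<sigma> j))) J"
      "ball x r \<subseteq> (\<Union>i\<in>J. ball (z i) (5 * \<sigma> i))"
      using Vitali_covering_lemma_balls[OF cov sig2] by blast
    have rz: "c1 * \<rho> y \<le> \<rho> (z y)" "\<rho> (z y) \<le> 2 * C0 * \<rho> y" if "y \<in> ball x r" for y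
    proof -
      have "\<sigma> y \<le> 1 * \<rho> y" unfolding \<sigma>_def using eps rho_pos[of y] by (intro mult_right_mono) auto
      then have d: "dist y (z y) \<le> 1 * \<rho> y" using zy[OF that] by (simp add: dist_commute)
      show "c1 * \<rho> y \<le> \<rho> (z y)" using rho_lower[OF d] by (simp add: c1_def)
      show "\<rho> (z y) \<le> 2 * C0 * \<rho> y" using rho_upper[OF d] by (simp add: mult_ac)
    qed
    have s5: "5 * \<sigma> y \<le> \<rho> (z y) / 8" if "y \<in> ball x r" for y
    proof -
      have "40 * \<epsilon> * \<rho> y \<le> c1 * \<rho> y" using eps rho_pos[of y] by (intro mult_right_mono) auto
      then show ?thesis using rz(1)[OF that] by (simp add: \<sigma>_def)
    qed
    have "nn_abs g (ball x r) \<le> (\<integral>\<^sup>+y. nn_abs g (ball (z y) (5 * \<sigma> y)) \<partial>count_space J)"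
      by (rule nn_abs_UN_le[OF J(1) gm _ J(4)]) simp
    also have "\<dots> \<le> ennreal (A1 * n * M * r powr (\<nu> + \<alpha>) * D) * (\<integral>\<^sup>+y. nn_abs w (ball (z y) (\<sigma> y)) \<partial>count_space J)"
    proof (rule nn_integral_count_space_cmult_le)
      fix y assume "y \<in> J"
      then have y: "y \<in> ball x r" using J(2) by blast
      have "nn_abs g (ball (z y) (5 * \<sigma> y)) \<le> nn_abs g (ball (z y) (\<rho> (z y) / 8))"
        by (rule nn_abs_mono) (use s5[OF y] in auto)
      also have "\<dots> \<le> ennreal (A1 * n * (\<rho> (z y) / 8) powr (\<nu> + \<alpha>) * wmeas w (ball (z y) (\<rho> (z y) / 8)))"
        by (rule A1(2)[OF w f g])
      also have "A1 * n * (\<rho> (z y) / 8) powr (\<nu> + \<alpha>) * wmeas w (ball (z y) (\<rho> (z y) / 8))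
         \<le> A1 * n * (M * r powr (\<nu> + \<alpha>)) * (D * wmeas w (ball (z y) (\<sigma> y)))"
      proof (intro mult_mono mult_left_mono)
        have "\<rho> (z y) / 8 \<le> 9 * C0 * C0 * r"
        proof -
          have "2 * C0 * \<rho> y \<le> 2 * C0 * (9 * C0 * r)" using ry[OF y] C01 by (intro mult_left_mono) auto
          then have "\<rho> (z y) \<le> 18 * (C0 * C0 * r)" using rz(2)[OF y] by simp
          moreover have "0 \<le> C0 * C0 * r" using C01 r by simp
          ultimately show ?thesis by linarith
        qed
        then have "(\<rho> (z y) / 8) powr (\<nu> + \<alpha>) \<le> (9 * C0 * C0 * r) powr (\<nu> + \<alpha>)"
          using rho_pos[of "z y"] nu_nonneg alpha_nonneg by (intro powr_mono2) auto
        then show "(\<rho> (z y) / 8) powr (\<nu> + \<alpha>) \<le> M * r powr (\<nu> + \<alpha>)"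
          using C01 r by (simp add: M_def powr_mult)
        show "wmeas w (ball (z y) (\<rho> (z y) / 8)) \<le> D * wmeas w (ball (z y) (\<sigma> y))"
          unfolding D_def
        proof (rule dbl_bounded[OF w(1) CD_nonneg c3_nonneg ka])
          show "0 < \<sigma> y" by (rule sig(1)[OF y])
          show "\<sigma> y \<le> \<rho> (z y) / 8" using s5[OF y] sig(1)[OF y] by linarith
          have "b * \<sigma> y = C0 * \<rho> y / 4" using eps by (simp add: b_def \<sigma>_def)
          then show "\<rho> (z y) / 8 \<le> b * \<sigma> y" using rz(2)[OF y] by simp
          show "\<rho> (z y) / 8 \<le> 1 * \<rho> (z y)" using rho_pos[of "z y"] by simp
        qed
      qed (use A1(1) n wmeas_nonneg[OF wt] in \<open>auto simp: M_def\<close>)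
      also have "ennreal (A1 * n * (M * r powr (\<nu> + \<alpha>)) * (D * wmeas w (ball (z y) (\<sigma> y))))
         = ennreal (A1 * n * M * r powr (\<nu> + \<alpha>) * D) * nn_abs w (ball (z y) (\<sigma> y))"
        using A1(1) n D wmeas_nonneg[OF wt] by (simp add: weight_nn_abs[OF wt] M_def mult_ac flip: ennreal_mult)
      finally show "nn_abs g (ball (z y) (5 * \<sigma> y)) \<le> ennreal (A1 * n * M * r powr (\<nu> + \<alpha>) * D) * nn_abs w (ball (z y) (\<sigma> y))"
        by (simp add: ennreal_leI)
    qed
    also have "(\<integral>\<^sup>+y. nn_abs w (ball (z y) (\<sigma> y)) \<partial>count_space J) = nn_abs w (\<Union>y\<in>J. ball (z y) (\<sigma> y))"
      by (rule nn_abs_disjoint_UN[OF J(1)])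
         (use wt J(3) in \<open>auto simp: weight_def loc_integrable_measurable disjoint_family_on_def pairwise_def disjnt_def\<close>)
    also have "\<dots> \<le> nn_abs w (ball x r)" by (rule nn_abs_mono) (use zsub J(2) in blast)
    also have "ennreal (A1 * n * M * r powr (\<nu> + \<alpha>) * D) * nn_abs w (ball x r) = ennreal (A1 * M * D * n * r powr (\<nu> + \<alpha>) * wmeas w (ball x r))"
      using A1(1) n D wmeas_nonneg[OF wt] by (simp add: weight_nn_abs[OF wt] M_def mult_ac flip: ennreal_mult)
    finally show "nn_abs g (ball x r) \<le> ennreal (A1 * M * D * n * r powr (\<nu> + \<alpha>) * wmeas w (ball x r))"
      by (simp add: mult_left_mono)
  qed
qed

end

text \<open>Completeness of Lebesgue measure. \<open>is_extended_value\<close> determines a function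
  only almost everywhere, and in this way every such function inherits the measurability of
  \<open>ext\<close>.\<close>

lemma AE_eq_measurable_lebesgue:
  fixes g g' :: "'a::euclidean_space \<Rightarrow> real"
  assumes g': "g' \<in> borel_measurable lebesgue" and ae: "AE y in lebesgue. g y = g' y"
  shows "g \<in> borel_measurable lebesgue"
proof (rule borel_measurableI)
  fix S :: "real set" assume S: "open S"
  obtain N where N: "{y \<in> space lebesgue. g y \<noteq> g' y} \<subseteq> N" "N \<in> null_sets lebesgue"
    using AE_E[OF ae] by (metis null_setsI)
  have 1: "g' -` S \<inter> space lebesgue \<in> sets lebesgue" by (rule measurable_sets[OF g']) (simp add: S)
  have 2: "{y. g y \<in> S} \<inter> N \<in> sets lebesgue" "{y. g' y \<in> S} \<inter> N \<in> sets lebesgue"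
    using null_sets_completion_subset[OF Int_lower2 N(2)] by (auto simp: null_sets_def)
  have "g -` S \<inter> space lebesgue = ((g' -` S \<inter> space lebesgue) - ({y. g' y \<in> S} \<inter> N)) \<union> ({y. g y \<in> S} \<inter> N)"
    using N(1) by auto
  then show "g -` S \<inter> space lebesgue \<in> sets lebesgue" using 1 2 by auto
qed

context scz
begin

lemma ext_unique:
  assumes g: "is_extended_value \<rho> T K f g" "is_extended_value \<rho> T K f g'"
  shows "AE y in lebesgue. g y = g' y"
proof -
  have "AE y in lebesgue. y \<in> ball 0 (\<rho> 0 + real n) \<longrightarrow> g y = g' y" for n
  proof -
    have R: "\<rho> 0 \<le> \<rho> 0 + real n" by simp
    show ?thesis
      using g[unfolded is_extended_value_def, rule_format, OF R] by eventually_elim auto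
  qed
  then have "AE y in lebesgue. \<forall>n::nat. y \<in> ball 0 (\<rho> 0 + real n) \<longrightarrow> g y = g' y"
    unfolding AE_all_countable by auto
  then show ?thesis
  proof (rule eventually_mono)
    fix y assume *: "\<forall>n::nat. y \<in> ball 0 (\<rho> 0 + real n) \<longrightarrow> g y = g' y"
    obtain n :: nat where "norm y \<le> real n" using real_arch_simple by blast
    then have "y \<in> ball 0 (\<rho> 0 + real n)" using rho_pos[of 0] by simp
    with * show "g y = g' y" by blast
  qed
qed

lemma extended_value_measurable:
  assumes f: "loc_integrable f" "tail_fin f" and g: "is_extended_value \<rho> T K f g"
  shows "g \<in> borel_measurable lebesgue"
  by (rule AE_eq_measurable_lebesgue[OF ext_measurable[OF f(1)] ext_unique[OF g ext_is_value[OF f]]])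

lemma T1_measurable: "is_extended_value \<rho> T K (\<lambda>_. 1) g \<Longrightarrow> g \<in> borel_measurable lebesgue"
  by (rule extended_value_measurable[OF loc_integrable_const tail_fin_one])

lemma T1_size:
  "\<exists>A\<ge>0. \<forall>g x r. is_extended_value \<rho> T K (\<lambda>_. 1) g \<longrightarrow> \<rho> x \<le> 8 * r \<longrightarrow> nn_abs g (ball x r) \<le> ennreal (A * r powr (real DIM('a) + \<nu>))"
proof -
  interpret one: scz_bmo \<rho> k0 C0 \<nu> \<delta> c m T K CT CK 0 1 0 1 "\<lambda>e. e" by (rule one_bmo)
  from one.size_all obtain A where "0 \<le> A \<and> (\<forall>w f n x r g. dbl 1 0 1 w \<longrightarrow> ainf (\<lambda>e. e) w \<longrightarrow> bmo 0 w f n \<longrightarrow> is_extended_value \<rho> T K f g \<longrightarrow>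
     g \<in> borel_measurable lebesgue \<longrightarrow> \<rho> x \<le> 8 * r \<longrightarrow> nn_abs g (ball x r) \<le> ennreal (A * n * r powr (\<nu> + 0) * wmeas w (ball x r)))" ..
  note A = this[THEN conjunct1] this[THEN conjunct2, rule_format]
  show ?thesis
  proof (rule exI[of _ "A * V"], intro conjI allI impI)
    show "0 \<le> A * V" using A(1) V_pos by simp
    fix g x r assume g: "is_extended_value \<rho> T K (\<lambda>_. 1) g" and r: "\<rho> x \<le> 8 * r"
    have r0: "0 < r" using r rho_pos[of x] by linarith
    have "nn_abs g (ball x r) \<le> ennreal (A * 1 * r powr (\<nu> + 0) * wmeas (\<lambda>_. 1) (ball x r))"
      by (rule A(2)[OF one_adm g T1_measurable[OF g] r])
    also have "A * 1 * r powr (\<nu> + 0) * wmeas (\<lambda>_. 1) (ball x r) = A * V * r powr (real DIM('a) + \<nu>)"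
      using r0 by (simp add: wmeas_one powr_add)
    finally show "nn_abs g (ball x r) \<le> ennreal (A * V * r powr (real DIM('a) + \<nu>))" .
  qed
qed

lemma loc_integrable_large_balls:
  assumes "g \<in> borel_measurable lebesgue" "\<And>r. \<rho> 0 \<le> 8 * r \<Longrightarrow> nn_abs g (ball 0 r) < \<infinity>"
  shows "loc_integrable (g :: 'a \<Rightarrow> real)"
proof (rule loc_integrable_nn_abs[OF assms(1)])
  fix n :: nat
  have "nn_abs g (ball 0 (real n)) \<le> nn_abs g (ball 0 (max (\<rho> 0) (real n)))"
    by (rule nn_abs_mono) auto
  also have "\<dots> < \<infinity>" by (rule assms(2)) (use rho_pos[of 0] in \<open>auto simp: max_def\<close>)
  finally show "nn_abs g (ball 0 (real n)) < \<infinity>" .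
qed

lemma T1_loc_integrable:
  assumes "is_extended_value \<rho> T K (\<lambda>_. 1) g" shows "loc_integrable g"
proof (rule loc_integrable_large_balls[OF T1_measurable[OF assms]])
  fix r assume r: "\<rho> 0 \<le> 8 * r"
  from T1_size obtain A where "nn_abs g (ball 0 r) \<le> ennreal (A * r powr (real DIM('a) + \<nu>))"
    using assms r by blast
  then show "nn_abs g (ball 0 r) < \<infinity>" by (rule order_le_less_trans) simp
qed

end

section \<open>From the oscillation of T1 to boundedness, and the reverse inequality\<close>

context scz_bmo
begin

lemma Theta_pos: "8 \<le> t \<Longrightarrow> 0 < Theta t"
  by (simp add: Theta_def)

text \<open>For 8r \<le> \<rho>(x) the mean of f may grow like \<open>Theta\<close> while the
  oscillation of T1 decays like its reciprocal; the product has the wanted size r^(\<nu> + \<alpha>)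
  w(B). For larger balls \<open>size_all\<close> gives both BMO conditions.\<close>

lemma main_bound:
  assumes g1: "is_extended_value \<rho> T K (\<lambda>_. 1) g1" and C1: "0 \<le> C1"
    and T1: "\<And>x r. 0 < r \<Longrightarrow> 8 * r \<le> \<rho> x \<Longrightarrow>
       nn_abs (\<lambda>y. g1 y - avg g1 (ball x r)) (ball x r) \<le> ennreal (C1 * r powr (real DIM('a) + \<nu>) / Theta (\<rho> x / r))"
  shows "\<exists>A\<ge>0. \<forall>w f n. dbl \<kappa> c3 CD w \<longrightarrow> ainf \<phi> w \<longrightarrow> bmo \<alpha> w f n \<longrightarrow>
     (\<exists>g. is_extended_value \<rho> T K f g \<and> bmo (\<alpha> + \<nu>) w g (A * n))"
proof -
  let ?d = "real DIM('a)"
  from osc_decomposition obtain A1 where "0 \<le> A1 \<and> (\<forall>w f n x r g g1. dbl \<kappa> c3 CD w \<longrightarrow> ainf \<phi> w \<longrightarrow> bmo \<alpha> w f n \<longrightarrow> is_extended_value \<rho> T K f g \<longrightarrow>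
     is_extended_value \<rho> T K (\<lambda>_. 1) g1 \<longrightarrow> tail_fin (\<lambda>_. 1) \<longrightarrow> 0 < r \<longrightarrow> 8 * r \<le> \<rho> x \<longrightarrow>
     (\<exists>k. nn_abs (\<lambda>y. g y - avg f (ball x (3 * r)) * g1 y - k) (ball x r) \<le> ennreal (A1 * n * r powr (\<nu> + \<alpha>) * wmeas w (ball x r))))" ..
  note A1 = this[THEN conjunct1] this[THEN conjunct2, rule_format]
  from size_all obtain A2 where "0 \<le> A2 \<and> (\<forall>w f n x r g. dbl \<kappa> c3 CD w \<longrightarrow> ainf \<phi> w \<longrightarrow> bmo \<alpha> w f n \<longrightarrow> is_extended_value \<rho> T K f g \<longrightarrow>
     g \<in> borel_measurable lebesgue \<longrightarrow> \<rho> x \<le> 8 * r \<longrightarrow> nn_abs g (ball x r) \<le> ennreal (A2 * n * r powr (\<nu> + \<alpha>) * wmeas w (ball x r)))" ..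
  note A2 = this[THEN conjunct1] this[THEN conjunct2, rule_format]
  from avg_bound obtain A3 where "0 \<le> A3 \<and> (\<forall>w f n x r. dbl \<kappa> c3 CD w \<longrightarrow> bmo \<alpha> w f n \<longrightarrow> 0 < r \<longrightarrow> 8 * r \<le> \<rho> x \<longrightarrow>
     \<bar>avg f (ball x (3 * r))\<bar> \<le> A3 * n * r powr (\<alpha> - ?d) * Theta (\<rho> x / r) * wmeas w (ball x r))" ..
  note A3 = this[THEN conjunct1] this[THEN conjunct2, rule_format]
  have g1l: "loc_integrable g1" by (rule T1_loc_integrable[OF g1])
  have [measurable]: "g1 \<in> borel_measurable lebesgue" by (rule T1_measurable[OF g1])
  show ?thesis
  proof (rule exI[of _ "2 * (A1 + A3 * C1 + A2)"], intro conjI allI impI)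
    show "0 \<le> 2 * (A1 + A3 * C1 + A2)" using A1(1) A2(1) A3(1) C1 by simp
    fix w f n assume w: "dbl \<kappa> c3 CD w" "ainf \<phi> w" and f: "bmo \<alpha> w f n"
    have fl: "loc_integrable f" and n: "0 \<le> n" using f by (auto simp: bmo_def)
    have wt: "weight w" using w by (simp add: dbl_def)
    note W0 = wmeas_nonneg[OF wt]
    define g where "g = ext f"
    have g: "is_extended_value \<rho> T K f g"
      unfolding g_def by (rule ext_is_value[OF fl tail_fin_bmo[OF w(1) f]])
    have gm [measurable]: "g \<in> borel_measurable lebesgue" unfolding g_def by (rule ext_measurable[OF fl])
    have size: "nn_abs g (ball x r) \<le> ennreal (A2 * n * r powr (\<nu> + \<alpha>) * wmeas w (ball x r))" if "\<rho> x \<le> 8 * r" for x r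
      by (rule A2(2)[OF w f g gm that])
    have gl: "loc_integrable g"
    proof (rule loc_integrable_large_balls[OF gm])
      fix r assume "\<rho> 0 \<le> 8 * r"
      from size[OF this] show "nn_abs g (ball 0 r) < \<infinity>" by (rule order_le_less_trans) simp
    qed
    have osc: "\<exists>b. nn_abs (\<lambda>y. g y - b) (ball x r) \<le> ennreal ((A1 + A3 * C1 + A2) * n * r powr (\<nu> + \<alpha>) * wmeas w (ball x r))" if r: "0 < r" for x r
    proof (cases "\<rho> x \<le> 8 * r")
      case True
      have "A2 * n * r powr (\<nu> + \<alpha>) * wmeas w (ball x r) \<le> (A1 + A3 * C1 + A2) * n * r powr (\<nu> + \<alpha>) * wmeas w (ball x r)"
        using A1(1) A3(1) C1 n W0 by (intro mult_right_mono) auto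
      then show ?thesis using size[OF True] by (intro exI[of _ 0]) (simp, meson ennreal_leI order_trans)
    next
      case False
      then have r8: "8 * r \<le> \<rho> x" by simp
      define a where "a = avg f (ball x (3 * r))"
      from A1(2)[OF w f g g1 tail_fin_one r r8] obtain k where
        k: "nn_abs (\<lambda>y. g y - a * g1 y - k) (ball x r) \<le> ennreal (A1 * n * r powr (\<nu> + \<alpha>) * wmeas w (ball x r))"
        unfolding a_def by blast
      define th where "th = Theta (\<rho> x / r)"
      have th: "0 < th" unfolding th_def by (rule Theta_pos) (use r r8 in \<open>simp add: field_simps\<close>)
      have a: "\<bar>a\<bar> \<le> A3 * n * r powr (\<alpha> - ?d) * th * wmeas w (ball x r)"
        unfolding a_def th_def by (rule A3(2)[OF w(1) f r r8])
      \<comment> \<open>The subtracted constant combines the far integral k with a times the mean of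
        T1.\<close>
      have "nn_abs (\<lambda>y. g y - (k + a * avg g1 (ball x r))) (ball x r)
         = nn_abs (\<lambda>y. (g y - a * g1 y - k) + a * (g1 y - avg g1 (ball x r))) (ball x r)"
        by (simp add: algebra_simps)
      also have "\<dots> \<le> nn_abs (\<lambda>y. g y - a * g1 y - k) (ball x r) + nn_abs (\<lambda>y. a * (g1 y - avg g1 (ball x r))) (ball x r)"
        by (rule nn_abs_add) measurable
      also have "nn_abs (\<lambda>y. a * (g1 y - avg g1 (ball x r))) (ball x r) \<le> ennreal \<bar>a\<bar> * nn_abs (\<lambda>y. g1 y - avg g1 (ball x r)) (ball x r)"
        by (rule nn_abs_le_cmult) (auto simp: abs_mult)
      also have "\<dots> \<le> ennreal (A3 * n * r powr (\<alpha> - ?d) * th * wmeas w (ball x r)) * ennreal (C1 * r powr (?d + \<nu>) / th)"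
        by (intro mult_mono ennreal_leI a) (use T1[OF r r8] in \<open>auto simp: th_def\<close>)
      also have "\<dots> = ennreal (A3 * C1 * n * r powr (\<nu> + \<alpha>) * wmeas w (ball x r))"
      proof -
        have "A3 * n * r powr (\<alpha> - ?d) * th * wmeas w (ball x r) * (C1 * r powr (?d + \<nu>) / th)
          = A3 * C1 * n * (r powr (\<alpha> - ?d) * r powr (?d + \<nu>)) * wmeas w (ball x r)"
          using th by simp
        also have "r powr (\<alpha> - ?d) * r powr (?d + \<nu>) = r powr (\<nu> + \<alpha>)" by (simp add: add.commute flip: powr_add)
        finally show ?thesis using th A3(1) n W0 C1 by (subst ennreal_mult[symmetric]) auto
      qed
      also note k
      finally have "nn_abs (\<lambda>y. g y - (k + a * avg g1 (ball x r))) (ball x r) \<le>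
         ennreal (A1 * n * r powr (\<nu> + \<alpha>) * wmeas w (ball x r)) + ennreal (A3 * C1 * n * r powr (\<nu> + \<alpha>) * wmeas w (ball x r))"
        by (simp add: add_mono)
      also have "\<dots> = ennreal ((A1 + A3 * C1) * n * r powr (\<nu> + \<alpha>) * wmeas w (ball x r))"
        using A1(1) A3(1) n W0 C1 by (simp add: algebra_simps flip: ennreal_plus)
      also have "\<dots> \<le> ennreal ((A1 + A3 * C1 + A2) * n * r powr (\<nu> + \<alpha>) * wmeas w (ball x r))"
        using A2(1) n W0 by (intro ennreal_leI mult_right_mono) auto
      finally show ?thesis by blast
    qed
    have "bmo (\<alpha> + \<nu>) w g (2 * (A1 + A3 * C1 + A2) * n)"
      unfolding bmo_def
    proof (intro conjI allI impI gl)
      show "0 \<le> 2 * (A1 + A3 * C1 + A2) * n" using A1(1) A2(1) A3(1) C1 n by simp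
      fix x :: 'a and r :: real assume r: "0 < r"
      from osc[OF r, of x] obtain b where b: "nn_abs (\<lambda>y. g y - b) (ball x r) \<le> ennreal ((A1 + A3 * C1 + A2) * n * r powr (\<nu> + \<alpha>) * wmeas w (ball x r))"
        by blast
      have "nn_abs (\<lambda>y. g y - avg g (ball x r)) (ball x r) \<le> 2 * nn_abs (\<lambda>y. g y - b) (ball x r)"
        by (rule osc_le_twice[OF gl r])
      also have "\<dots> \<le> 2 * ennreal ((A1 + A3 * C1 + A2) * n * r powr (\<nu> + \<alpha>) * wmeas w (ball x r))"
        using b by (rule mult_left_mono) simp
      also have "\<dots> = ennreal (2 * ((A1 + A3 * C1 + A2) * n * r powr (\<nu> + \<alpha>) * wmeas w (ball x r)))"
        using A1(1) A2(1) A3(1) C1 n W0 by (simp flip: ennreal_mult ennreal_numeral)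
      finally show "nn_abs (\<lambda>y. g y - avg g (ball x r)) (ball x r) \<le> ennreal (2 * (A1 + A3 * C1 + A2) * n * r powr (\<alpha> + \<nu>) * wmeas w (ball x r))"
        by (simp only: mult.assoc add.commute[of \<nu> \<alpha>])
    next
      fix x :: 'a and r :: real assume r: "\<rho> x \<le> r"
      then have "\<rho> x \<le> 8 * r" using rho_pos[of x] by linarith
      from size[OF this] have "nn_abs g (ball x r) \<le> ennreal (A2 * n * r powr (\<alpha> + \<nu>) * wmeas w (ball x r))"
        by (simp add: add.commute)
      also have "\<dots> \<le> ennreal (2 * (A1 + A3 * C1 + A2) * n * r powr (\<alpha> + \<nu>) * wmeas w (ball x r))"
        using A1(1) A2(1) A3(1) n W0 C1 by (intro ennreal_leI mult_right_mono) auto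
      finally show "nn_abs g (ball x r) \<le> ennreal (2 * (A1 + A3 * C1 + A2) * n * r powr (\<alpha> + \<nu>) * wmeas w (ball x r))" .
    qed
    then show "\<exists>g. is_extended_value \<rho> T K f g \<and> bmo (\<alpha> + \<nu>) w g (2 * (A1 + A3 * C1 + A2) * n)" using g by blast
  qed
qed

text \<open>The decomposition read backwards: up to constants a T1 differs from T f by a controlled
  term, so if T f has controlled oscillation, a large mean a of f forces T1 to oscillate
  little.\<close>

lemma reverse_bound:
  "\<exists>A\<ge>0. \<forall>w f n g ng g1 x r. dbl \<kappa> c3 CD w \<longrightarrow> ainf \<phi> w \<longrightarrow> bmo \<alpha> w f n \<longrightarrow> is_extended_value \<rho> T K f g \<longrightarrow>
     bmo (\<alpha> + \<nu>) w g ng \<longrightarrow> is_extended_value \<rho> T K (\<lambda>_. 1) g1 \<longrightarrow> 0 < r \<longrightarrow> 8 * r \<le> \<rho> x \<longrightarrow>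
     ennreal \<bar>avg f (ball x (3 * r))\<bar> * nn_abs (\<lambda>y. g1 y - avg g1 (ball x r)) (ball x r)
       \<le> ennreal (A * (n + ng) * r powr (\<nu> + \<alpha>) * wmeas w (ball x r))"
proof -
  from osc_decomposition obtain A1 where "0 \<le> A1 \<and> (\<forall>w f n x r g g1. dbl \<kappa> c3 CD w \<longrightarrow> ainf \<phi> w \<longrightarrow> bmo \<alpha> w f n \<longrightarrow> is_extended_value \<rho> T K f g \<longrightarrow>
     is_extended_value \<rho> T K (\<lambda>_. 1) g1 \<longrightarrow> tail_fin (\<lambda>_. 1) \<longrightarrow> 0 < r \<longrightarrow> 8 * r \<le> \<rho> x \<longrightarrow>
     (\<exists>k. nn_abs (\<lambda>y. g y - avg f (ball x (3 * r)) * g1 y - k) (ball x r) \<le> ennreal (A1 * n * r powr (\<nu> + \<alpha>) * wmeas w (ball x r))))" ..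
  note A1 = this[THEN conjunct1] this[THEN conjunct2, rule_format]
  show ?thesis
  proof (rule exI[of _ "2 * (A1 + 1)"], intro conjI allI impI)
    show "0 \<le> 2 * (A1 + 1)" using A1(1) by simp
    fix w f n g ng g1 x r
    assume w: "dbl \<kappa> c3 CD w" "ainf \<phi> w" and f: "bmo \<alpha> w f n" and g: "is_extended_value \<rho> T K f g"
      and gb: "bmo (\<alpha> + \<nu>) w g ng" and g1: "is_extended_value \<rho> T K (\<lambda>_. 1) g1" and r: "0 < r" "8 * r \<le> \<rho> x"
    have n: "0 \<le> n" "0 \<le> ng" and gl: "loc_integrable g" using f gb by (auto simp: bmo_def)
    have g1l: "loc_integrable g1" by (rule T1_loc_integrable[OF g1])
    have [measurable]: "g1 \<in> borel_measurable lebesgue" "g \<in> borel_measurable lebesgue"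
      using g1l gl by (auto intro: loc_integrable_measurable)
    have wt: "weight w" using w by (simp add: dbl_def)
    let ?B = "ball x r"
    define W where "W = wmeas w ?B"
    have W0: "0 \<le> W" unfolding W_def by (rule wmeas_nonneg[OF wt])
    define a where "a = avg f (ball x (3 * r))"
    show "ennreal \<bar>avg f (ball x (3 * r))\<bar> * nn_abs (\<lambda>y. g1 y - avg g1 ?B) ?B
       \<le> ennreal (2 * (A1 + 1) * (n + ng) * r powr (\<nu> + \<alpha>) * wmeas w ?B)"
    proof (cases "a = 0")
      case True then show ?thesis by (simp add: a_def)
    next
      case False
      from A1(2)[OF w f g g1 tail_fin_one r] obtain k where
        k: "nn_abs (\<lambda>y. g y - a * g1 y - k) ?B \<le> ennreal (A1 * n * r powr (\<nu> + \<alpha>) * W)"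
        unfolding a_def W_def by blast
      \<comment> \<open>The constant for which a (g1 - b) becomes g minus its mean, minus the
        controlled term of the decomposition.\<close>
      define b where "b = (avg g ?B - k) / a"
      have "a * b = avg g ?B - k" using False by (simp add: b_def)
      then have ab: "a * (g1 y - b) = (- 1) * (g y - a * g1 y - k) + (g y - avg g ?B)" for y
        by (simp add: algebra_simps)
      have "ennreal \<bar>a\<bar> * nn_abs (\<lambda>y. g1 y - avg g1 ?B) ?B \<le> ennreal \<bar>a\<bar> * (2 * nn_abs (\<lambda>y. g1 y - b) ?B)"
        by (rule mult_left_mono[OF osc_le_twice[OF g1l r(1)]]) simp
      also have "\<dots> = 2 * (ennreal \<bar>a\<bar> * nn_abs (\<lambda>y. g1 y - b) ?B)" by (simp add: mult_ac)
      also have "ennreal \<bar>a\<bar> * nn_abs (\<lambda>y. g1 y - b) ?B = nn_abs (\<lambda>y. a * (g1 y - b)) ?B"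
        unfolding nn_abs_def by (subst nn_integral_cmult[symmetric]) (auto simp: abs_mult ennreal_mult mult_ac)
      also have "nn_abs (\<lambda>y. a * (g1 y - b)) ?B \<le> nn_abs (\<lambda>y. (- 1) * (g y - a * g1 y - k)) ?B + nn_abs (\<lambda>y. g y - avg g ?B) ?B"
        unfolding ab by (rule nn_abs_add) measurable
      also have "nn_abs (\<lambda>y. (- 1) * (g y - a * g1 y - k)) ?B = nn_abs (\<lambda>y. g y - a * g1 y - k) ?B"
        by (simp add: nn_abs_def abs_minus_commute algebra_simps)
      also note k
      also have "nn_abs (\<lambda>y. g y - avg g ?B) ?B \<le> ennreal (ng * r powr (\<nu> + \<alpha>) * W)"
        using gb r unfolding bmo_def W_def by (simp add: add.commute)
      finally have "ennreal \<bar>a\<bar> * nn_abs (\<lambda>y. g1 y - avg g1 ?B) ?B \<le> 2 * (ennreal (A1 * n * r powr (\<nu> + \<alpha>) * W) + ennreal (ng * r powr (\<nu> + \<alpha>) * W))"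
        by (simp add: add_mono mult_left_mono)
      also have "\<dots> = ennreal (2 * ((A1 * n + ng) * r powr (\<nu> + \<alpha>) * W))"
        using A1(1) n W0 by (simp add: algebra_simps flip: ennreal_plus ennreal_mult ennreal_numeral)
      also have "\<dots> \<le> ennreal (2 * (((A1 + 1) * (n + ng)) * r powr (\<nu> + \<alpha>) * W))"
        using A1(1) n W0 by (intro ennreal_leI mult_left_mono mult_right_mono) (auto simp: algebra_simps)
      finally show ?thesis unfolding a_def W_def by (simp only: mult.assoc)
    qed
  qed
qed

end

section \<open>Weight classes and norms\<close>

lemma powr_split_le:
  fixes w t \<eta> :: real
  assumes "0 \<le> w" "0 < t" "1 < \<eta>"
  shows "w \<le> t + t powr (1 - \<eta>) * w powr \<eta>"
proof (cases "w \<le> t")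
  case False
  then have "0 < w" using assms by simp
  then have "w = w powr (1 - \<eta>) * w powr \<eta>" by (simp flip: powr_add)
  also have "\<dots> \<le> t powr (1 - \<eta>) * w powr \<eta>"
    using assms False by (intro mult_right_mono powr_mono2') auto
  finally show ?thesis using assms by simp
qed (use assms in \<open>auto intro: add_increasing2\<close>)

lemma set_integral_eq_0_nn_abs:
  assumes "nn_abs w A = 0" "E \<subseteq> A" shows "nn_abs w E = 0"
  using nn_abs_mono[OF assms(2), of w] assms(1) by simp

text \<open>Truncating \<open>w\<close> at a multiple of its average replaces Hoelder's inequality.\<close>

lemma reverse_Holder_absolutely_continuous:
  fixes w :: "'a::euclidean_space \<Rightarrow> real"
  assumes w: "weight w" and wi: "loc_integrable (\<lambda>y. w y powr \<eta>)" and eta: "1 < \<eta>" and C: "0 \<le> C" and e: "0 < e" and r: "0 < r"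
    and RH: "avg (\<lambda>y. w y powr \<eta>) (ball x r) powr (1 / \<eta>) \<le> C * avg w (ball x r)"
    and E: "E \<in> sets lebesgue" "E \<subseteq> ball x r"
    and small: "emeasure lebesgue E \<le> ennreal (e / (2 * (2 * C powr \<eta> / e + 1) powr (1 / (\<eta> - 1))) * vol (ball x r))"
  shows "nn_abs w E \<le> ennreal (e * wmeas w (ball x r))"
proof -
  let ?B = "ball x r"
  \<comment> \<open>Since \<tau>^(1 - \<eta>) = 1/S, this choice makes the part of w above the
    truncation level contribute at most (e/2) w(B); the assumed smallness of E bounds the other part
    by the same amount.\<close>
  define S where "S = 2 * C powr \<eta> / e + 1"
  have S: "1 \<le> S" using e by (simp add: S_def)
  define \<tau> where "\<tau> = S powr (1 / (\<eta> - 1))"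
  have tau: "0 < \<tau>" using S by (simp add: \<tau>_def)
  have v: "0 < vol ?B" by (rule vol_ball_pos[OF r])
  have W: "wmeas w ?B = avg w ?B * vol ?B" using v by (simp add: avg_def wmeas_def)
  have W0: "0 \<le> wmeas w ?B" by (rule wmeas_nonneg[OF w])
  have wm [measurable]: "w \<in> borel_measurable lebesgue" using w by (simp add: weight_def loc_integrable_measurable)
  have w0: "0 \<le> w y" for y using w by (simp add: weight_def)
  show ?thesis
  proof (cases "wmeas w ?B = 0")
    case True
    then show ?thesis using set_integral_eq_0_nn_abs[of w ?B E] E(2) by (simp add: weight_nn_abs[OF w])
  next
    case False
    then have a: "0 < avg w ?B" using W W0 v by (metis less_eq_real_def mult_zero_left zero_less_mult_pos2)
    define t where "t = \<tau> * avg w ?B"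
    have t: "0 < t" using tau a by (simp add: t_def)
    define I where "I = wmeas (\<lambda>y. w y powr \<eta>) ?B"
    have wpw: "weight (\<lambda>y. w y powr \<eta>)" using wi by (simp add: weight_def)
    have I0: "0 \<le> I" unfolding I_def by (rule wmeas_nonneg[OF wpw])
    have avI: "avg (\<lambda>y. w y powr \<eta>) ?B = I / vol ?B" by (simp add: avg_def I_def wmeas_def)
    have "I / vol ?B \<le> (C * avg w ?B) powr \<eta>"
    proof -
      have "((I / vol ?B) powr (1 / \<eta>)) powr \<eta> \<le> (C * avg w ?B) powr \<eta>"
        using RH eta unfolding avI by (intro powr_mono2) auto
      then show ?thesis using I0 v eta by (simp add: powr_powr)
    qed
    then have I: "I \<le> C powr \<eta> * avg w ?B powr \<eta> * vol ?B"
      using v C a by (simp add: powr_mult field_simps)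
    have "nn_abs w E \<le> nn_abs (\<lambda>y. t + t powr (1 - \<eta>) * w y powr \<eta>) E"
      by (rule nn_abs_mono_fun) (use powr_split_le[OF w0 t eta] w0 t in \<open>auto intro!: order_trans[OF _ abs_ge_self]\<close>)
    also have "\<dots> \<le> nn_abs (\<lambda>_. t) E + nn_abs (\<lambda>y. t powr (1 - \<eta>) * w y powr \<eta>) E"
      by (rule nn_abs_add) (use E in measurable)
    also have "nn_abs (\<lambda>y. t powr (1 - \<eta>) * w y powr \<eta>) E \<le> nn_abs (\<lambda>y. t powr (1 - \<eta>) * w y powr \<eta>) ?B"
      by (rule nn_abs_mono[OF E(2)])
    also have "\<dots> \<le> ennreal (t powr (1 - \<eta>)) * nn_abs (\<lambda>y. w y powr \<eta>) ?B"
      by (rule nn_abs_le_cmult) auto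
    also have "nn_abs (\<lambda>y. w y powr \<eta>) ?B = ennreal I" unfolding I_def by (rule weight_nn_abs[OF wpw])
    also have "ennreal (t powr (1 - \<eta>)) * ennreal I = ennreal (t powr (1 - \<eta>) * I)"
      using I0 by (simp add: ennreal_mult)
    also have "t powr (1 - \<eta>) * I \<le> e / 2 * wmeas w ?B"
    proof -
      have "t powr (1 - \<eta>) * I \<le> t powr (1 - \<eta>) * (C powr \<eta> * avg w ?B powr \<eta> * vol ?B)"
        using I by (rule mult_left_mono) simp
      also have "\<dots> = \<tau> powr (1 - \<eta>) * C powr \<eta> * (avg w ?B powr (1 - \<eta>) * avg w ?B powr \<eta>) * vol ?B"
        using tau a by (simp add: t_def powr_mult)
      also have "avg w ?B powr (1 - \<eta>) * avg w ?B powr \<eta> = avg w ?B" using a by (simp flip: powr_add)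
      also have "\<tau> powr (1 - \<eta>) = 1 / S"
      proof -
        have "1 / (\<eta> - 1) * (1 - \<eta>) = - 1" using eta by (simp add: field_simps)
        then show ?thesis using S by (simp add: \<tau>_def powr_powr powr_minus_divide)
      qed
      also have "1 / S * C powr \<eta> * avg w ?B * vol ?B \<le> e / 2 * avg w ?B * vol ?B"
      proof -
        have "C powr \<eta> \<le> e / 2 * S" using e by (simp add: S_def distrib_left)
        then have "1 / S * C powr \<eta> \<le> e / 2" using S by (simp add: pos_divide_le_eq)
        then show ?thesis using a v by (intro mult_right_mono) auto
      qed
      finally show ?thesis by (simp add: W)
    qed
    also have "nn_abs (\<lambda>_. t) E \<le> ennreal (e / 2 * wmeas w ?B)"
    proof -
      have "nn_abs (\<lambda>_. t) E \<le> ennreal t * ennreal (e / (2 * \<tau>) * vol ?B)"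
        using small t E(1) unfolding S_def[symmetric] \<tau>_def[symmetric] by (simp add: nn_abs_const mult_left_mono del: emeasure_completion)
      also have "\<dots> = ennreal (e / 2 * wmeas w ?B)"
      proof -
        have "t * (e / (2 * \<tau>) * vol ?B) = e / 2 * wmeas w ?B" using tau by (simp add: W t_def)
        moreover have "ennreal t * ennreal (e / (2 * \<tau>) * vol ?B) = ennreal (t * (e / (2 * \<tau>) * vol ?B))"
          by (rule ennreal_mult[symmetric]) (use t e tau v in auto)
        ultimately show ?thesis by (simp only:)
      qed
      finally show ?thesis .
    qed
    finally have "nn_abs w E \<le> ennreal (e / 2 * wmeas w ?B) + ennreal (e / 2 * wmeas w ?B)"
      by (simp add: add_mono ennreal_leI)
    also have "\<dots> = ennreal (e * wmeas w ?B)" using e W0 by (simp flip: ennreal_plus)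
    finally show ?thesis .
  qed
qed

section \<open>Passage between the norms of the definitions and \<open>bmo\<close>\<close>

context scz
begin

lemma RH_ainf:
  assumes w: "weight w" and wi: "loc_integrable (\<lambda>y. w y powr \<eta>)" and eta: "1 < \<eta>" and C: "0 \<le> C"
    and RH: "\<And>x r. 0 < r \<Longrightarrow> r \<le> 2 * \<rho> x \<Longrightarrow> avg (\<lambda>y. w y powr \<eta>) (ball x r) powr (1 / \<eta>) \<le> C * avg w (ball x r)"
  shows "ainf (\<lambda>e. e / (2 * (2 * C powr \<eta> / e + 1) powr (1 / (\<eta> - 1)))) w"
  unfolding ainf_def
proof (intro allI impI)
  fix x r E and e :: real
  assume "0 < r" "r \<le> 2 * \<rho> x" "0 < e" "E \<in> sets lebesgue" "E \<subseteq> ball x r"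
    "emeasure lebesgue E \<le> ennreal (e / (2 * (2 * C powr \<eta> / e + 1) powr (1 / (\<eta> - 1))) * vol (ball x r))"
  then show "nn_abs w E \<le> ennreal (e * wmeas w (ball x r))"
    by (intro reverse_Holder_absolutely_continuous[OF w wi eta C _ _ RH]) auto
qed

lemma vol_powr: "0 < r \<Longrightarrow> vol (ball (x::'a) r) powr (\<alpha> / real DIM('a)) = V powr (\<alpha> / real DIM('a)) * r powr \<alpha>"
  using V_pos by (simp add: vol_V powr_mult powr_powr)

lemma loc_integrable_diff: "loc_integrable (f::'a \<Rightarrow> real) \<Longrightarrow> set_integrable lebesgue (ball x r) (\<lambda>y. f y - b)"
  by (intro set_integral_diff(1) loc_integrable_ball loc_integrable_const)

lemma BMO_bound_imp_bmo:
  assumes f: "loc_integrable f" and w: "weight w" and C: "0 \<le> C" and b: "BMO_bound \<rho> \<alpha> w f C"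
  shows "bmo \<alpha> w f (C * V powr (\<alpha> / real DIM('a)))"
  unfolding bmo_def
proof (intro conjI allI impI f)
  show "0 \<le> C * V powr (\<alpha> / real DIM('a))" using C by simp
  fix x :: 'a and r :: real
  show "nn_abs (\<lambda>y. f y - avg f (ball x r)) (ball x r) \<le> ennreal (C * V powr (\<alpha> / real DIM('a)) * r powr \<alpha> * wmeas w (ball x r))" if "0 < r"
    using b that unfolding BMO_bound_def nn_abs_eq_set_integral[OF loc_integrable_diff[OF f]]
    by (auto intro!: ennreal_leI simp: vol_powr mult.assoc)
  show "nn_abs f (ball x r) \<le> ennreal (C * V powr (\<alpha> / real DIM('a)) * r powr \<alpha> * wmeas w (ball x r))" if "\<rho> x \<le> r"
  proof -
    have "0 < r" using that rho_pos[of x] by linarith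
    moreover have "(LINT y:ball x r|lebesgue. \<bar>f y\<bar>) \<le> C * vol (ball x r) powr (\<alpha> / real DIM('a)) * wmeas w (ball x r)"
      using b that unfolding BMO_bound_def by blast
    ultimately show ?thesis
      unfolding nn_abs_eq_set_integral[OF loc_integrable_ball[OF f]]
      by (intro ennreal_leI) (simp add: vol_powr mult.assoc)
  qed
qed

lemma bmo_imp_BMO_bound:
  assumes b: "bmo \<alpha> w f n" and w: "weight w"
  shows "BMO_bound \<rho> \<alpha> w f (n * V powr (- \<alpha> / real DIM('a)))"
proof -
  have f: "loc_integrable f" and n: "0 \<le> n" using b by (auto simp: bmo_def)
  have eq: "n * V powr (- \<alpha> / real DIM('a)) * vol (ball x r) powr (\<alpha> / real DIM('a)) * wmeas w (ball x r)
     = n * r powr \<alpha> * wmeas w (ball x r)" if "0 < r" for x :: 'a and r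
  proof -
    have "V powr (- \<alpha> / real DIM('a)) * V powr (\<alpha> / real DIM('a)) = 1" using V_pos by (simp flip: powr_add)
    then show ?thesis using that by (simp add: vol_powr)
  qed
  show ?thesis
    unfolding BMO_bound_def
  proof (intro conjI allI impI)
    fix x :: 'a and r :: real assume r: "0 < r"
    have "nn_abs (\<lambda>y. f y - avg f (ball x r)) (ball x r) \<le> ennreal (n * r powr \<alpha> * wmeas w (ball x r))"
      using b r by (simp add: bmo_def)
    then show "(LINT y:ball x r|lebesgue. \<bar>f y - avg f (ball x r)\<bar>)
      \<le> n * V powr (- \<alpha> / real DIM('a)) * vol (ball x r) powr (\<alpha> / real DIM('a)) * wmeas w (ball x r)"
      unfolding eq[OF r] using n wmeas_nonneg[OF w] by (intro set_integral_abs_le_nn_abs) auto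
  next
    fix x :: 'a and r :: real assume x: "\<rho> x \<le> r"
    have r: "0 < r" using x rho_pos[of x] by linarith
    have "nn_abs f (ball x r) \<le> ennreal (n * r powr \<alpha> * wmeas w (ball x r))"
      using b x by (simp add: bmo_def)
    then show "(LINT y:ball x r|lebesgue. \<bar>f y\<bar>)
      \<le> n * V powr (- \<alpha> / real DIM('a)) * vol (ball x r) powr (\<alpha> / real DIM('a)) * wmeas w (ball x r)"
      unfolding eq[OF r] using n wmeas_nonneg[OF w] by (intro set_integral_abs_le_nn_abs) auto
  qed
qed

text \<open>The infimum is attained: the conditions are linear in the constant and pass to the
  limit. Where the coefficient of the constant vanishes, any single admissible constant gives the
  inequality.\<close>

lemma BMO_norm_props:
  assumes f: "f \<in> BMO \<rho> \<alpha> w" and w: "weight w"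
  shows "0 \<le> BMO_norm \<rho> \<alpha> w f" "BMO_bound \<rho> \<alpha> w f (BMO_norm \<rho> \<alpha> w f)"
proof -
  let ?S = "{C. 0 \<le> C \<and> BMO_bound \<rho> \<alpha> w f C}"
  have ne: "?S \<noteq> {}" using f by (auto simp: BMO_def)
  then show "0 \<le> BMO_norm \<rho> \<alpha> w f" unfolding BMO_norm_def by (intro cInf_greatest) auto
  have lim: "a \<le> BMO_norm \<rho> \<alpha> w f * b * c" if "\<And>C. C \<in> ?S \<Longrightarrow> a \<le> C * b * c" "0 \<le> b" "0 \<le> c" for a b c :: real
  proof (cases "b * c = 0")
    case True then show ?thesis using that(1) ne by (auto simp: mult.assoc)
  next
    case False
    then have bc: "0 < b * c" using that by (simp add: less_le)
    have "a / (b * c) \<le> BMO_norm \<rho> \<alpha> w f"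
      unfolding BMO_norm_def
    proof (rule cInf_greatest[OF ne])
      fix C assume "C \<in> ?S"
      from that(1)[OF this] show "a / (b * c) \<le> C" using bc by (simp add: pos_divide_le_eq mult.assoc)
    qed
    then show ?thesis using bc by (simp add: pos_divide_le_eq mult.assoc)
  qed
  show "BMO_bound \<rho> \<alpha> w f (BMO_norm \<rho> \<alpha> w f)"
    unfolding BMO_bound_def
    by (intro conjI allI impI lim wmeas_nonneg[OF w]) (auto simp: BMO_bound_def)
qed

lemma BMO_norm_le: "0 \<le> C \<Longrightarrow> BMO_bound \<rho> \<alpha> w f C \<Longrightarrow> BMO_norm \<rho> \<alpha> w f \<le> C"
  unfolding BMO_norm_def by (intro cInf_lower bdd_belowI[of _ 0]) auto

lemma bounded_byI:
  assumes w: "weight w" and A: "0 \<le> A"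
    and b: "\<And>f n. bmo \<alpha> w f n \<Longrightarrow> \<exists>g. is_extended_value \<rho> T K f g \<and> bmo \<beta> w g (A * n)"
  shows "BMO_bounded_by \<rho> T K \<alpha> \<beta> w (A * V powr (\<alpha> / real DIM('a)) * V powr (- \<beta> / real DIM('a)))"
  unfolding BMO_bounded_by_def
proof
  fix f assume f: "f \<in> BMO \<rho> \<alpha> w"
  note N = BMO_norm_props[OF f w]
  have fl: "loc_integrable f" using f by (simp add: BMO_def)
  obtain g where g: "is_extended_value \<rho> T K f g" "bmo \<beta> w g (A * (BMO_norm \<rho> \<alpha> w f * V powr (\<alpha> / real DIM('a))))"
    using b[OF BMO_bound_imp_bmo[OF fl w N]] by blast
  let ?C = "A * (BMO_norm \<rho> \<alpha> w f * V powr (\<alpha> / real DIM('a))) * V powr (- \<beta> / real DIM('a))"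
  have bd: "BMO_bound \<rho> \<beta> w g ?C" by (rule bmo_imp_BMO_bound[OF g(2) w])
  have C0: "0 \<le> ?C" using A N by simp
  have "loc_integrable g" using g(2) by (simp add: bmo_def)
  then have "g \<in> BMO \<rho> \<beta> w" unfolding BMO_def using bd C0 by blast
  moreover have "BMO_norm \<rho> \<beta> w g \<le> A * V powr (\<alpha> / real DIM('a)) * V powr (- \<beta> / real DIM('a)) * BMO_norm \<rho> \<alpha> w f"
    using BMO_norm_le[OF C0 bd] by (simp add: mult_ac)
  ultimately show "\<exists>g. is_extended_value \<rho> T K f g \<and> g \<in> BMO \<rho> \<beta> w \<and>
      BMO_norm \<rho> \<beta> w g \<le> A * V powr (\<alpha> / real DIM('a)) * V powr (- \<beta> / real DIM('a)) * BMO_norm \<rho> \<alpha> w f"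
    using g(1) by blast
qed

text \<open>\<open>BMO_bounded_by\<close> puts no sign on \<open>A\<close>, hence the absolute
  value. The powers of \<open>V\<close> convert |B|^(\<alpha>/d) into r^\<alpha> in the source and
  the corresponding factor in the target.\<close>

lemma bounded_byD:
  assumes w: "weight w" and b: "BMO_bounded_by \<rho> T K \<alpha> \<beta> w A" and f: "bmo \<alpha> w f n"
  shows "\<exists>g. is_extended_value \<rho> T K f g \<and> bmo \<beta> w g (\<bar>A\<bar> * V powr (- \<alpha> / real DIM('a)) * V powr (\<beta> / real DIM('a)) * n)"
proof -
  have fl: "loc_integrable f" and n: "0 \<le> n" using f by (auto simp: bmo_def)
  note bd = bmo_imp_BMO_bound[OF f w]
  have n0: "0 \<le> n * V powr (- \<alpha> / real DIM('a))" using n by simp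
  have fB: "f \<in> BMO \<rho> \<alpha> w" using fl bd n0 by (auto simp: BMO_def)
  then obtain g where g: "is_extended_value \<rho> T K f g" "g \<in> BMO \<rho> \<beta> w" "BMO_norm \<rho> \<beta> w g \<le> A * BMO_norm \<rho> \<alpha> w f"
    using b by (auto simp: BMO_bounded_by_def)
  have gl: "loc_integrable g" using g(2) by (simp add: BMO_def)
  note N = BMO_norm_props[OF g(2) w]
  let ?v = "V powr (\<beta> / real DIM('a))"
  have "bmo \<beta> w g (BMO_norm \<rho> \<beta> w g * ?v)" by (rule BMO_bound_imp_bmo[OF gl w N])
  moreover have "BMO_norm \<rho> \<beta> w g * ?v \<le> \<bar>A\<bar> * V powr (- \<alpha> / real DIM('a)) * ?v * n"
  proof -
    have "BMO_norm \<rho> \<beta> w g \<le> \<bar>A\<bar> * BMO_norm \<rho> \<alpha> w f"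
      using g(3) BMO_norm_props(1)[OF fB w] by (meson abs_ge_self mult_right_mono order_trans)
    also have "\<dots> \<le> \<bar>A\<bar> * (n * V powr (- \<alpha> / real DIM('a)))"
      using BMO_norm_le[OF n0 bd] by (rule mult_left_mono) simp
    finally have "BMO_norm \<rho> \<beta> w g * ?v \<le> \<bar>A\<bar> * (n * V powr (- \<alpha> / real DIM('a))) * ?v"
      by (rule mult_right_mono) simp
    then show ?thesis by (simp add: mult_ac)
  qed
  moreover have "bmo \<beta> w g n'" if "bmo \<beta> w g n1" "n1 \<le> n'" for n1 n'
  proof -
    have le: "ennreal (n1 * r powr \<beta> * wmeas w (ball x r)) \<le> ennreal (n' * r powr \<beta> * wmeas w (ball x r))" for x r
      using that(2) wmeas_nonneg[OF w] by (intro ennreal_leI mult_right_mono) auto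
    show ?thesis using that unfolding bmo_def by (auto intro: order_trans[OF _ le])
  qed
  ultimately show ?thesis using g(1) by blast
qed

end

section \<open>Powers of the distance to a lacunary set\<close>

text \<open>On dyadic shells the k-th contribution is a multiple of (2^(-k) R)^(d - 1/2); d \<ge> 1
  makes the ratio at most 1 / sqrt 2, and the geometric series sums to at most 4.\<close>

lemma singular_ball_integral:
  fixes p :: "'a::euclidean_space"
  assumes R: "0 < R"
  shows "nn_abs (\<lambda>y. norm (y - p) powr (-1/2)) (ball p R) \<le> ennreal (8 * unit_vol TYPE('a) * R powr (real DIM('a) - 1/2))"
proof -
  let ?d = "real DIM('a)" and ?V = "unit_vol TYPE('a)"
  have d1: "1 \<le> ?d" using DIM_positive[where 'a='a] by linarith
  define s where "s k = R / 2 ^ k" for k :: nat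
  have s: "0 < s k" "s (Suc k) = s k / 2" for k using R by (auto simp: s_def)
  have ex: "\<exists>k. norm (y - p) < s k \<and> s (Suc k) \<le> norm (y - p)" if "norm (y - p) < R" "y \<noteq> p" for y
  proof -
    have y0: "0 < norm (y - p)" using that by simp
    obtain n where "R / norm (y - p) < 2 ^ n" using real_arch_pow[of 2] by auto
    then have n: "s n \<le> norm (y - p)" using y0 by (simp add: s_def field_simps)
    define k where "k = (LEAST n. s n \<le> norm (y - p))"
    have k1: "s k \<le> norm (y - p)" unfolding k_def by (rule LeastI[of "\<lambda>n. s n \<le> norm (y - p)", OF n])
    have "k \<noteq> 0" using k1 that by (auto simp: s_def intro!: gr0I)
    then obtain j where j: "k = Suc j" by (cases k) auto
    have "\<not> s j \<le> norm (y - p)" using not_less_Least[of j "\<lambda>n. s n \<le> norm (y - p)"] j k_def by auto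
    then show ?thesis using k1 j by (intro exI[of _ j]) auto
  qed
  have "nn_abs (\<lambda>y. norm (y - p) powr (-1/2)) (ball p R)
     \<le> (\<integral>\<^sup>+y. (\<Sum>k. ennreal (s (Suc k) powr (-1/2)) * indicator (ball p (s k)) y) \<partial>lebesgue)"
    unfolding nn_abs_def
  proof (rule nn_integral_mono)
    fix y
    show "ennreal \<bar>norm (y - p) powr (-1/2)\<bar> * indicator (ball p R) y \<le> (\<Sum>k. ennreal (s (Suc k) powr (-1/2)) * indicator (ball p (s k)) y)"
    \<comment> \<open>At y = p the integrand is 0, by the convention
      \<open>0 powr t = 0\<close>.\<close>
    proof (cases "y \<in> ball p R \<and> y \<noteq> p")
      case True
      then obtain k where k: "norm (y - p) < s k" "s (Suc k) \<le> norm (y - p)"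
        using ex[of y] by (auto simp: dist_norm norm_minus_commute)
      have "norm (y - p) powr (-1/2) \<le> s (Suc k) powr (-1/2)"
        using k s(1)[of "Suc k"] by (intro powr_mono2') auto
      then have "ennreal \<bar>norm (y - p) powr (-1/2)\<bar> * indicator (ball p R) y \<le> ennreal (s (Suc k) powr (-1/2)) * indicator (ball p (s k)) y"
        using k by (auto simp: dist_norm norm_minus_commute ennreal_leI indicator_def)
      also have "\<dots> \<le> (\<Sum>k. ennreal (s (Suc k) powr (-1/2)) * indicator (ball p (s k)) y)"
      proof -
        have "F k \<le> suminf F" for F :: "nat \<Rightarrow> ennreal" using sum_le_suminf[of F "{k}"] by simp
        then show ?thesis .
      qed
      finally show ?thesis .
    qed auto
  qed
  also have "\<dots> = (\<Sum>k. ennreal (s (Suc k) powr (-1/2)) * emeasure lebesgue (ball p (s k)))"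
    by (subst nn_integral_suminf) (simp_all add: nn_integral_cmult_indicator del: emeasure_completion)
  also have "\<dots> \<le> (\<Sum>k. ennreal (2 * ?V * R powr (?d - 1/2) * ((1 / sqrt 2) ^ k)))"
  proof (rule suminf_le)
    fix k
    have "ennreal (s (Suc k) powr (-1/2)) * emeasure lebesgue (ball p (s k)) = ennreal (s (Suc k) powr (-1/2) * (?V * s k powr ?d))"
      using s(1)[of k] by (simp add: emeasure_ball_lebesgue ennreal_mult del: emeasure_completion)
    also have "s (Suc k) powr (-1/2) * (?V * s k powr ?d) = 2 powr (1/2) * ?V * (s k powr (?d - 1/2))"
    proof -
      have "s (Suc k) powr (-1/2) = 2 powr (1/2) * s k powr (-1/2)"
        using s(1)[of k] by (simp add: s(2) powr_divide powr_minus_divide)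
      moreover have "s k powr (-1/2) * s k powr ?d = s k powr (?d - 1/2)" by (simp flip: powr_add)
      ultimately show ?thesis by (simp add: mult_ac)
    qed
    also have "s k powr (?d - 1/2) = R powr (?d - 1/2) * (1 / 2 ^ k) powr (?d - 1/2)"
      using R by (simp add: s_def powr_divide)
    also have "2 powr (1/2) * ?V * (R powr (?d - 1/2) * (1 / 2 ^ k) powr (?d - 1/2)) \<le> 2 * ?V * (R powr (?d - 1/2) * (1 / sqrt 2) ^ k)"
    proof (intro mult_mono mult_left_mono)
      show "2 powr (1/2) \<le> (2::real)" using powr_mono[of "1/2" 1 "2::real"] by simp
      have "((1::real) / 2 ^ k) powr (?d - 1/2) \<le> (1 / 2 ^ k) powr (1/2)"
        using d1 by (intro powr_mono') auto
      also have "\<dots> = (1 / sqrt 2) ^ k" by (simp add: powr_half_sqrt real_sqrt_divide real_sqrt_power power_divide)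
      finally show "((1::real) / 2 ^ k) powr (?d - 1/2) \<le> (1 / sqrt 2) ^ k" .
    qed auto
    finally show "ennreal (s (Suc k) powr (-1/2)) * emeasure lebesgue (ball p (s k)) \<le> ennreal (2 * ?V * R powr (?d - 1/2) * ((1 / sqrt 2) ^ k))"
      by (simp add: ennreal_leI mult.assoc)
  qed auto
  also have "\<dots> = ennreal (2 * ?V * R powr (?d - 1/2) * (1 / (1 - 1 / sqrt 2)))"
    by (rule suminf_ennreal_le, rule geometric_sums) (auto simp: field_simps)
  also have "\<dots> \<le> ennreal (2 * ?V * R powr (?d - 1/2) * 4)"
  proof (intro ennreal_leI mult_left_mono)
    have "4/3 \<le> sqrt 2" by (rule real_le_rsqrt) (simp add: power2_eq_square)
    then have "1 / sqrt 2 \<le> 3/4" by (simp add: field_simps)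
    then show "1 / (1 - 1 / sqrt 2) \<le> 4" by (simp add: field_simps)
  qed auto
  finally show ?thesis by (simp add: mult.assoc)
qed

lemma inverse_sqrt_nn_abs_far:
  fixes u :: "'a::euclidean_space \<Rightarrow> real"
  assumes "0 < b" "0 < r" "\<And>y. y \<in> ball x r \<Longrightarrow> b \<le> u y"
  shows "nn_abs (\<lambda>y. u y powr (-1/2)) (ball x r) \<le> ennreal (b powr (-1/2) * (unit_vol TYPE('a) * r powr real DIM('a)))"
proof -
  have "nn_abs (\<lambda>y. u y powr (-1/2)) (ball x r) \<le> nn_abs (\<lambda>y. b powr (-1/2)) (ball x r)"
    by (rule nn_abs_mono_fun) (use assms in \<open>auto intro!: powr_mono2'\<close>)
  also have "\<dots> = ennreal (b powr (-1/2) * (unit_vol TYPE('a) * r powr real DIM('a)))"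
    using assms by (simp add: nn_abs_const emeasure_ball_lebesgue ennreal_mult del: emeasure_completion)
  finally show ?thesis .
qed

text \<open>The balls \<open>B(s, |s - p|/2)\<close> being disjoint, near \<open>s\<close> only \<open>s\<close> itself is closer than a third of the distance to \<open>p\<close>.\<close>

definition lacunary :: "'a::euclidean_space \<Rightarrow> 'a set \<Rightarrow> bool" where
  "lacunary p X \<longleftrightarrow> countable X \<and> p \<notin> X \<and> disjoint_family_on (\<lambda>s. ball s (norm (s - p) / 2)) X"

lemma infdist_lower:
  assumes "\<And>s. s \<in> S \<Longrightarrow> b \<le> dist y s" "S \<noteq> {}" shows "b \<le> infdist y S"
  unfolding infdist_def using assms by (auto intro: cINF_greatest)

text \<open>If y is outside B(s,|s - p|/2), then |s - p| \<le> 2 |y - s| and hence |y - p| \<le> 3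
  |y - s|. By disjointness at most one s escapes this.\<close>

lemma lacunary_infdist:
  assumes L: "lacunary p X"
  shows "i \<in> X \<Longrightarrow> y \<in> ball i (norm (i - p) / 2) \<Longrightarrow> min (norm (y - p) / 3) (norm (y - i)) \<le> infdist y (insert p X)"
    and "(\<And>i. i \<in> X \<Longrightarrow> y \<notin> ball i (norm (i - p) / 2)) \<Longrightarrow> norm (y - p) / 3 \<le> infdist y (insert p X)"
proof -
  have far: "norm (y - p) / 3 \<le> dist y s" if "s \<in> X" "y \<notin> ball s (norm (s - p) / 2)" for s
  proof -
    have "norm (s - p) / 2 \<le> norm (y - s)" using that(2) by (simp add: dist_norm norm_minus_commute)
    moreover have "norm (y - p) \<le> norm (y - s) + norm (s - p)" using norm_triangle_ineq[of "y - s" "s - p"] by simp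
    ultimately show ?thesis by (simp add: dist_norm)
  qed
  have p: "norm (y - p) / 3 \<le> dist y p" by (simp add: dist_norm)
  show "norm (y - p) / 3 \<le> infdist y (insert p X)" if "\<And>i. i \<in> X \<Longrightarrow> y \<notin> ball i (norm (i - p) / 2)"
    by (rule infdist_lower) (use far p that in auto)
  assume i: "i \<in> X" "y \<in> ball i (norm (i - p) / 2)"
  show "min (norm (y - p) / 3) (norm (y - i)) \<le> infdist y (insert p X)"
  proof (rule infdist_lower)
    fix s assume "s \<in> insert p X"
    then consider "s = p" | "s = i" | "s \<in> X" "s \<noteq> i" by blast
    then show "min (norm (y - p) / 3) (norm (y - i)) \<le> dist y s"
    proof cases
      case 1 then show ?thesis using p by (simp add: min.coboundedI1)
    next
      case 2 then show ?thesis by (simp add: dist_norm)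
    next
      case 3
      then have "y \<notin> ball s (norm (s - p) / 2)"
        using L i unfolding lacunary_def disjoint_family_on_def by blast
      from far[OF 3(1) this] show ?thesis by (simp add: min.coboundedI1)
    qed
  qed simp
qed

text \<open>Each point is charged either to p, with constant sqrt 3 \<le> 2, or to the only s whose
  ball contains it. The sum over s therefore has at most one nonzero term at a given point.\<close>

lemma lacunary_pointwise:
  assumes L: "lacunary p X"
  shows "ennreal (infdist y (insert p X) powr (-1/2))
     \<le> ennreal (2 * norm (y - p) powr (-1/2)) + (\<integral>\<^sup>+i. ennreal (norm (y - i) powr (-1/2)) * indicator (ball i (norm (i - p) / 2)) y \<partial>count_space X)"
    (is "ennreal (?u powr _) \<le> ?A + ?I")
proof (cases "y \<in> insert p X")
  case True
  then have "?u = 0" by (simp add: infdist_zero)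
  then show ?thesis by simp
next
  case False
  then have yp: "0 < norm (y - p)" by auto
  have third: "(norm (y - p) / 3) powr (-1/2) \<le> 2 * norm (y - p) powr (-1/2)"
  proof -
    have "(norm (y - p) / 3) powr (-1/2) = 3 powr (1/2) * norm (y - p) powr (-1/2)"
      using yp by (simp add: powr_divide powr_minus_divide)
    also have "3 powr (1/2) \<le> (2::real)" by (simp add: powr_half_sqrt real_le_lsqrt)
    finally show ?thesis by (simp add: mult_right_mono)
  qed
  show ?thesis
  proof (cases "\<exists>i\<in>X. y \<in> ball i (norm (i - p) / 2)")
    case True
    then obtain i where i: "i \<in> X" "y \<in> ball i (norm (i - p) / 2)" by blast
    have yi: "0 < norm (y - i)" using False i by auto
    from lacunary_infdist(1)[OF L i] have m: "min (norm (y - p) / 3) (norm (y - i)) \<le> ?u" .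
    have I: "ennreal (norm (y - i) powr (-1/2)) \<le> ?I"
      using nn_integral_ge_point[OF i(1), of "\<lambda>i. ennreal (norm (y - i) powr (-1/2)) * indicator (ball i (norm (i - p) / 2)) y"] i(2) by simp
    show ?thesis
    proof (cases "norm (y - p) / 3 \<le> norm (y - i)")
      case True
      then have "?u powr (-1/2) \<le> (norm (y - p) / 3) powr (-1/2)"
        using m yp by (intro powr_mono2') auto
      then have "ennreal (?u powr (-1/2)) \<le> ?A" using third by (intro ennreal_leI) linarith
      then show ?thesis by (simp add: add_increasing2)
    next
      case False
      then have "?u powr (-1/2) \<le> norm (y - i) powr (-1/2)"
        using m yi by (intro powr_mono2') auto
      then have "ennreal (?u powr (-1/2)) \<le> ?I" using I by (meson ennreal_leI order_trans)
      then show ?thesis by (simp add: add_increasing)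
    qed
  next
    case False
    from lacunary_infdist(2)[OF L, of y] False have "norm (y - p) / 3 \<le> ?u" by blast
    then have "?u powr (-1/2) \<le> (norm (y - p) / 3) powr (-1/2)" using yp by (intro powr_mono2') auto
    then have "ennreal (?u powr (-1/2)) \<le> ?A" using third by (intro ennreal_leI) linarith
    then show ?thesis by (simp add: add_increasing2)
  qed
qed

lemma measurable_infdist_lebesgue [measurable]: "(\<lambda>y::'a::euclidean_space. infdist y S) \<in> borel_measurable lebesgue"
proof -
  have "(\<lambda>y::'a. infdist y S) \<in> borel_measurable borel"
    by (intro borel_measurable_continuous_onI continuous_intros)
  then show ?thesis by (intro measurable_completion) simp
qed

lemma measurable_norm_diff_lebesgue [measurable]: "(\<lambda>y::'a::euclidean_space. norm (y - p)) \<in> borel_measurable lebesgue"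
proof -
  have "(\<lambda>y::'a. norm (y - p)) \<in> borel_measurable borel"
    by (intro borel_measurable_continuous_onI continuous_intros)
  then show ?thesis by (intro measurable_completion) simp
qed

text \<open>On this ball |y - p| is at most three times the radius, so |y - p|^(-1/2) has at least a
  fixed part of the integral of the singularity at i. A sum over the disjoint balls thereby becomes
  one integral of |y - p|^(-1/2).\<close>

lemma lacunary_ball_compare:
  fixes i p :: "'a::euclidean_space"
  assumes ip: "i \<noteq> p"
  defines "B \<equiv> ball i (norm (i - p) / 2)"
  shows "nn_abs (\<lambda>y. norm (y - i) powr (-1/2)) B \<le> 16 * nn_abs (\<lambda>y. norm (y - p) powr (-1/2)) B"
proof -
  let ?V = "unit_vol TYPE('a)" and ?d = "real DIM('a)"
  define D where "D = norm (i - p) / 2"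
  have D: "0 < D" using ip by (simp add: D_def)
  have up: "norm (y - p) \<le> 3 * D" "0 < norm (y - p)" if "y \<in> B" for y
  proof -
    have yi: "norm (y - i) < D" using that by (simp add: B_def D_def dist_norm norm_minus_commute)
    show "norm (y - p) \<le> 3 * D" using norm_triangle_ineq[of "y - i" "i - p"] yi by (simp add: D_def)
    show "0 < norm (y - p)"
    proof (rule ccontr)
      assume "\<not> 0 < norm (y - p)"
      then have "y = p" by simp
      then show False using yi D by (simp add: D_def norm_minus_commute)
    qed
  qed
  have "nn_abs (\<lambda>y. (3 * D) powr (-1/2)) B \<le> nn_abs (\<lambda>y. norm (y - p) powr (-1/2)) B"
    by (rule nn_abs_mono_fun) (use up in \<open>auto intro!: powr_mono2'\<close>)
  moreover have "nn_abs (\<lambda>y. (3 * D) powr (-1/2)) B = ennreal ((3 * D) powr (-1/2) * (?V * D powr ?d))"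
    using D unfolding B_def D_def[symmetric] by (simp add: nn_abs_const emeasure_ball_lebesgue ennreal_mult del: emeasure_completion)
  ultimately have low: "ennreal ((3 * D) powr (-1/2) * (?V * D powr ?d)) \<le> nn_abs (\<lambda>y. norm (y - p) powr (-1/2)) B" by simp
  have "nn_abs (\<lambda>y. norm (y - i) powr (-1/2)) B \<le> ennreal (8 * ?V * D powr (?d - 1/2))"
    unfolding B_def D_def[symmetric] by (rule singular_ball_integral[OF D])
  also have "8 * ?V * D powr (?d - 1/2) \<le> 16 * ((3 * D) powr (-1/2) * (?V * D powr ?d))"
  proof -
    have "D powr (?d - 1/2) = D powr (-1/2) * D powr ?d" by (simp flip: powr_add)
    also have "D powr (-1/2) = 3 powr (1/2) * (3 * D) powr (-1/2)"
      using D by (simp add: powr_mult powr_minus_divide)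
    also have "3 powr (1/2) * (3 * D) powr (-1/2) * D powr ?d \<le> 2 * (3 * D) powr (-1/2) * D powr ?d"
      by (intro mult_right_mono) (auto simp: powr_half_sqrt real_le_lsqrt)
    finally have "8 * ?V * D powr (?d - 1/2) \<le> 8 * ?V * (2 * (3 * D) powr (-1/2) * D powr ?d)"
      by (intro mult_left_mono) auto
    then show ?thesis by (simp add: mult_ac)
  qed
  also have "ennreal (16 * ((3 * D) powr (-1/2) * (?V * D powr ?d))) = 16 * ennreal ((3 * D) powr (-1/2) * (?V * D powr ?d))"
    by (simp add: ennreal_mult'' flip: ennreal_numeral)
  also have "\<dots> \<le> 16 * nn_abs (\<lambda>y. norm (y - p) powr (-1/2)) B" using low by (rule mult_left_mono) simp
  finally show ?thesis by (simp add: ennreal_leI)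
qed

text \<open>A ball of the family that meets B(p,t) has its centre within 2t of p and lies in
  B(p,3t), so by \<open>lacunary_ball_compare\<close> all of them together are paid for by one
  integral over B(p,3t). The constant is (2 + 16) * 8 = 144.\<close>

lemma lacunary_centre_bound:
  fixes p :: "'a::euclidean_space"
  assumes L: "lacunary p X" and t: "0 < t"
  shows "nn_abs (\<lambda>y. infdist y (insert p X) powr (-1/2)) (ball p t)
     \<le> ennreal (144 * unit_vol TYPE('a) * (3 * t) powr (real DIM('a) - 1/2))"
proof -
  let ?V = "unit_vol TYPE('a)" and ?d = "real DIM('a)"
  have X: "countable X" "p \<notin> X" using L by (auto simp: lacunary_def)
  define B where "B i = ball i (norm (i - p) / 2)" for i
  have Bs [measurable]: "B i \<in> sets lebesgue" for i by (simp add: B_def)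
  let ?g = "\<lambda>i y. ennreal (norm (y - i) powr (-1/2)) * indicator (B i) y"
  have [measurable]: "(\<lambda>y. \<integral>\<^sup>+i. ?g i y \<partial>count_space X) \<in> borel_measurable lebesgue"
    by (rule borel_measurable_nn_integral_count_space[OF X(1)]) measurable
  have "nn_abs (\<lambda>y. infdist y (insert p X) powr (-1/2)) (ball p t)
    \<le> (\<integral>\<^sup>+y. ennreal (2 * norm (y - p) powr (-1/2)) * indicator (ball p t) y + (\<integral>\<^sup>+i. ?g i y \<partial>count_space X) * indicator (ball p t) y \<partial>lebesgue)"
    unfolding nn_abs_def
  proof (rule nn_integral_mono)
    fix y
    show "ennreal \<bar>infdist y (insert p X) powr (-1/2)\<bar> * indicator (ball p t) y
      \<le> ennreal (2 * norm (y - p) powr (-1/2)) * indicator (ball p t) y + (\<integral>\<^sup>+i. ?g i y \<partial>count_space X) * indicator (ball p t) y"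
      using lacunary_pointwise[OF L, of y] unfolding B_def by (auto split: split_indicator)
  qed
  also have "\<dots> = (\<integral>\<^sup>+y. ennreal (2 * norm (y - p) powr (-1/2)) * indicator (ball p t) y \<partial>lebesgue)
     + (\<integral>\<^sup>+y. (\<integral>\<^sup>+i. ?g i y \<partial>count_space X) * indicator (ball p t) y \<partial>lebesgue)"
    by (rule nn_integral_add) measurable
  also have "(\<integral>\<^sup>+y. ennreal (2 * norm (y - p) powr (-1/2)) * indicator (ball p t) y \<partial>lebesgue) = 2 * nn_abs (\<lambda>y. norm (y - p) powr (-1/2)) (ball p t)"
    unfolding nn_abs_def by (subst nn_integral_cmult[symmetric]) (auto simp: ennreal_mult mult_ac)
  also have "(\<integral>\<^sup>+y. (\<integral>\<^sup>+i. ?g i y \<partial>count_space X) * indicator (ball p t) y \<partial>lebesgue)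
     = (\<integral>\<^sup>+i. (\<integral>\<^sup>+y. ?g i y * indicator (ball p t) y \<partial>lebesgue) \<partial>count_space X)"
    by (subst nn_integral_count_space_nn_integral[OF X(1), symmetric]) (auto simp: nn_integral_multc)
  also have "\<dots> \<le> 16 * (\<integral>\<^sup>+i. nn_abs (\<lambda>y. norm (y - p) powr (-1/2)) (B i \<inter> ball p (3 * t)) \<partial>count_space X)"
  proof (rule nn_integral_count_space_cmult_le)
    fix i assume i: "i \<in> X"
    have eq: "(\<integral>\<^sup>+y. ?g i y * indicator (ball p t) y \<partial>lebesgue) = nn_abs (\<lambda>y. norm (y - i) powr (-1/2)) (B i \<inter> ball p t)"
      unfolding nn_abs_def by (intro nn_integral_cong) (auto split: split_indicator)
    show "(\<integral>\<^sup>+y. ?g i y * indicator (ball p t) y \<partial>lebesgue) \<le> 16 * nn_abs (\<lambda>y. norm (y - p) powr (-1/2)) (B i \<inter> ball p (3 * t))"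
    proof (cases "B i \<inter> ball p t = {}")
      case True then show ?thesis unfolding eq by (simp add: nn_abs_def)
    next
      case False
      then obtain y where y: "norm (y - i) < norm (i - p) / 2" "norm (y - p) < t"
        by (auto simp: B_def dist_norm norm_minus_commute)
      have "norm (i - p) \<le> norm (y - i) + norm (y - p)"
        using norm_triangle_ineq4[of "y - p" "y - i"] by simp
      then have D: "norm (i - p) < 2 * t" using y by linarith
      have sub: "B i \<subseteq> ball p (3 * t)"
      proof
        fix u assume "u \<in> B i"
        then have "norm (u - i) < norm (i - p) / 2" by (simp add: B_def dist_norm norm_minus_commute)
        moreover have "norm (u - p) \<le> norm (u - i) + norm (i - p)" using norm_triangle_ineq[of "u - i" "i - p"] by simp
        ultimately show "u \<in> ball p (3 * t)" using D by (simp add: dist_norm norm_minus_commute)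
      qed
      have "nn_abs (\<lambda>y. norm (y - i) powr (-1/2)) (B i \<inter> ball p t) \<le> nn_abs (\<lambda>y. norm (y - i) powr (-1/2)) (B i)"
        by (rule nn_abs_mono) simp
      also have "\<dots> \<le> 16 * nn_abs (\<lambda>y. norm (y - p) powr (-1/2)) (B i)"
        unfolding B_def by (rule lacunary_ball_compare) (use i X in auto)
      finally show ?thesis using sub unfolding eq by (simp add: Int_absorb2)
    qed
  qed
  also have "(\<integral>\<^sup>+i. nn_abs (\<lambda>y. norm (y - p) powr (-1/2)) (B i \<inter> ball p (3 * t)) \<partial>count_space X)
     = nn_abs (\<lambda>y. norm (y - p) powr (-1/2)) (\<Union>i\<in>X. B i \<inter> ball p (3 * t))"
    by (rule nn_abs_disjoint_UN[OF X(1)]) (use L in \<open>auto simp: lacunary_def disjoint_family_on_def B_def\<close>)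
  also have "\<dots> \<le> nn_abs (\<lambda>y. norm (y - p) powr (-1/2)) (ball p (3 * t))" by (rule nn_abs_mono) auto
  also have "\<dots> \<le> ennreal (8 * ?V * (3 * t) powr (?d - 1/2))" by (rule singular_ball_integral) (use t in simp)
  also have "nn_abs (\<lambda>y. norm (y - p) powr (-1/2)) (ball p t) \<le> ennreal (8 * ?V * (3 * t) powr (?d - 1/2))"
    by (rule order_trans[OF nn_abs_mono singular_ball_integral]) (use t in auto)
  finally have "nn_abs (\<lambda>y. infdist y (insert p X) powr (-1/2)) (ball p t)
    \<le> 2 * ennreal (8 * ?V * (3 * t) powr (?d - 1/2)) + 16 * ennreal (8 * ?V * (3 * t) powr (?d - 1/2))"
    by (simp add: add_mono mult_left_mono)
  also have "\<dots> = ennreal (144 * ?V * (3 * t) powr (?d - 1/2))"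
    by (simp flip: ennreal_mult'' ennreal_plus ennreal_numeral)
  finally show ?thesis .
qed

text \<open>An A_1-type bound for the power -1/2 of the distance, uniform over all lacunary sets.
  Far from the set the distance is nearly constant on the ball; near the set the ball is compared
  with one centred at a point of the set.\<close>

lemma lacunary_porous:
  "\<exists>C\<ge>0. \<forall>p X x R. lacunary p X \<longrightarrow> 0 < R \<longrightarrow> nn_abs (\<lambda>y. infdist y (insert p X) powr (-1/2)) (ball (x::'a::euclidean_space) R)
     \<le> ennreal (C * R powr real DIM('a) * max R (infdist x (insert p X)) powr (-1/2))"
proof -
  let ?V = "unit_vol TYPE('a)" and ?d = "real DIM('a)"
  have d1: "1 \<le> ?d" using DIM_positive[where 'a='a] by linarith
  have dh: "0 \<le> ?d - 1/2" using d1 by linarith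
  define C where "C = 2 * (144 * ?V * 45 powr ?d)"
  have C45: "45 powr (?d - 1/2) \<le> 45 powr ?d" by (rule powr_mono) auto
  have one: "1 \<le> 45 powr ?d" by (rule ge_one_powr_ge_zero) auto
  have main: "nn_abs (\<lambda>y. infdist y (insert p X) powr (-1/2)) (ball x R) \<le> ennreal (C * R powr ?d * max R (infdist x (insert p X)) powr (-1/2))"
    if L: "lacunary p X" and R: "0 < R" for p X and x :: 'a and R
  proof -
    define u where "u y = infdist y (insert p X)" for y
    have u0: "0 \<le> u y" for y by (simp add: u_def infdist_nonneg)
    have lip: "u x \<le> u y + dist x y" for x y unfolding u_def by (rule infdist_triangle)
    show ?thesis
    proof (cases "2 * R \<le> u x")
      case True
      have "nn_abs (\<lambda>y. u y powr (-1/2)) (ball x R) \<le> ennreal ((u x / 2) powr (-1/2) * (?V * R powr ?d))"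
      proof (rule inverse_sqrt_nn_abs_far)
        show "0 < u x / 2" using True R by simp
        fix y assume "y \<in> ball x R"
        then have "dist x y < R" by simp
        then show "u x / 2 \<le> u y" using lip[of x y] True by linarith
      qed fact
      also have "(u x / 2) powr (-1/2) * (?V * R powr ?d) \<le> C * R powr ?d * u x powr (-1/2)"
      proof -
        have "(u x / 2) powr (-1/2) = 2 powr (1/2) * u x powr (-1/2)"
          using True R by (simp add: powr_divide powr_minus_divide)
        also have "\<dots> \<le> 2 * u x powr (-1/2)" by (intro mult_right_mono) (auto simp: powr_half_sqrt real_le_lsqrt)
        finally have "(u x / 2) powr (-1/2) * (?V * R powr ?d) \<le> 2 * u x powr (-1/2) * (?V * R powr ?d)"
          by (intro mult_right_mono) auto
        also have "\<dots> = 2 * ?V * (R powr ?d * u x powr (-1/2))" by simp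
        also have "\<dots> \<le> C * (R powr ?d * u x powr (-1/2))"
        proof (rule mult_right_mono)
          have "?V * 1 \<le> ?V * (144 * 45 powr ?d)" using one by (intro mult_left_mono) auto
          then show "2 * ?V \<le> C" by (simp add: C_def)
        qed simp
        finally show ?thesis by simp
      qed
      also have "u x = max R (u x)" using True R by simp
      finally show ?thesis unfolding u_def by (simp add: ennreal_leI)
    next
      case False
      then have "\<exists>s\<in>insert p X. dist x s < 2 * R"
        using infdist_lower[of "insert p X" "2 * R" x] by (force simp: u_def not_less)
      then obtain s where s: "s \<in> insert p X" "dist x s < 2 * R" by blast
      have sub: "ball x R \<subseteq> ball s (3 * R)"
      proof
        fix y assume "y \<in> ball x R"
        then show "y \<in> ball s (3 * R)" using s(2) dist_triangle[of s y x] by (simp add: dist_commute)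
      qed
      have "nn_abs (\<lambda>y. u y powr (-1/2)) (ball s (3 * R)) \<le> ennreal (144 * ?V * (45 * R) powr (?d - 1/2))"
      \<comment> \<open>For |s - p| > 12 R one has |y - p|/3 \<ge> 3R > |y - s| on B(s,3R), so the
        distance to the set is at least |y - s| there. Otherwise B(s,3R) lies in B(p,15R), and 3 *
        15 = 45.\<close>
      proof (cases "norm (s - p) \<le> 12 * R")
        case True
        have "ball s (3 * R) \<subseteq> ball p (15 * R)"
        proof
          fix y assume "y \<in> ball s (3 * R)"
          then show "y \<in> ball p (15 * R)" using True dist_triangle[of p y s] by (simp add: dist_norm norm_minus_commute)
        qed
        then have "nn_abs (\<lambda>y. u y powr (-1/2)) (ball s (3 * R)) \<le> nn_abs (\<lambda>y. u y powr (-1/2)) (ball p (15 * R))"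
          by (rule nn_abs_mono)
        also have "\<dots> \<le> ennreal (144 * ?V * (3 * (15 * R)) powr (?d - 1/2))"
          unfolding u_def by (rule lacunary_centre_bound[OF L]) (use R in simp)
        finally show ?thesis by simp
      next
        case False
        then have sX: "s \<in> X" using s R by auto
        have "nn_abs (\<lambda>y. u y powr (-1/2)) (ball s (3 * R)) \<le> nn_abs (\<lambda>y. norm (y - s) powr (-1/2)) (ball s (3 * R))"
        proof (rule nn_abs_mono_fun)
          fix y assume y: "y \<in> ball s (3 * R)"
          show "\<bar>u y powr (-1/2)\<bar> \<le> \<bar>norm (y - s) powr (-1/2)\<bar>"
          proof (cases "y = s")
            case True
            then show ?thesis using sX by (simp add: u_def infdist_zero)
          next
            case neq: False
            have ys: "norm (y - s) < 3 * R" using y by (simp add: dist_norm norm_minus_commute)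
            have "norm (s - p) \<le> norm (y - s) + norm (y - p)" using norm_triangle_ineq4[of "y - p" "y - s"] by simp
            then have "9 * R \<le> norm (y - p)" using False ys by linarith
            moreover have "y \<in> ball s (norm (s - p) / 2)" using ys False R by (simp add: dist_norm norm_minus_commute)
            from lacunary_infdist(1)[OF L sX this] have "min (norm (y - p) / 3) (norm (y - s)) \<le> u y" by (simp add: u_def)
            ultimately have "norm (y - s) \<le> u y" using ys by linarith
            then show ?thesis using neq by (auto intro!: powr_mono2')
          qed
        qed
        also have "\<dots> \<le> ennreal (8 * ?V * (3 * R) powr (?d - 1/2))" by (rule singular_ball_integral) (use R in simp)
        also have "\<dots> \<le> ennreal (144 * ?V * (45 * R) powr (?d - 1/2))"
          using R dh by (intro ennreal_leI mult_mono powr_mono2) auto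
        finally show ?thesis .
      qed
      then have 1: "nn_abs (\<lambda>y. u y powr (-1/2)) (ball x R) \<le> ennreal (144 * ?V * (45 * R) powr (?d - 1/2))"
        using nn_abs_mono[OF sub] order_trans by blast
      have "(45 * R) powr (?d - 1/2) = 45 powr (?d - 1/2) * (R powr ?d * R powr (-1/2))"
        using R by (simp add: powr_mult flip: powr_add)
      also have "\<dots> \<le> 45 powr ?d * (R powr ?d * (2 * max R (u x) powr (-1/2)))"
      proof (intro mult_mono mult_left_mono C45)
        have "R powr (-1/2) = 2 powr (1/2) * (2 * R) powr (-1/2)" using R by (simp add: powr_mult powr_minus_divide)
        also have "\<dots> \<le> 2 * max R (u x) powr (-1/2)"
          using False R by (intro mult_mono powr_mono2') (auto simp: powr_half_sqrt real_le_lsqrt)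
        finally show "R powr (-1/2) \<le> 2 * max R (u x) powr (-1/2)" .
      qed auto
      finally have "144 * ?V * (45 * R) powr (?d - 1/2) \<le> 144 * ?V * (45 powr ?d * (R powr ?d * (2 * max R (u x) powr (-1/2))))"
        by (intro mult_left_mono) auto
      also have "\<dots> = C * R powr ?d * max R (u x) powr (-1/2)" by (simp add: C_def)
      finally show ?thesis using 1 unfolding u_def by (meson ennreal_leI order_trans)
    qed
  qed
  show ?thesis by (rule exI[of _ C], intro conjI allI impI main) (auto simp: C_def)
qed

lemma infdist_le_double:
  assumes "y \<in> ball x r" shows "infdist y S \<le> 2 * max r (infdist x S)"
  using infdist_triangle[of y S x] assms by (auto simp: dist_commute)

lemma infdist_powr_nn_abs:
  fixes x :: "'a::euclidean_space"
  assumes "0 \<le> b" "0 < r"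
  shows "nn_abs (\<lambda>y. infdist y S powr b) (ball x r) \<le> ennreal ((2 * max r (infdist x S)) powr b * (unit_vol TYPE('a) * r powr real DIM('a)))"
proof -
  let ?M = "2 * max r (infdist x S)"
  have "nn_abs (\<lambda>y. infdist y S powr b) (ball x r) \<le> nn_abs (\<lambda>_. ?M powr b) (ball x r)"
    by (rule nn_abs_mono_fun) (use assms infdist_le_double in \<open>auto intro!: powr_mono2 simp: infdist_nonneg\<close>)
  also have "\<dots> = ennreal (?M powr b * (unit_vol TYPE('a) * r powr real DIM('a)))"
    using assms by (simp add: nn_abs_const emeasure_ball_lebesgue ennreal_mult del: emeasure_completion)
  finally show ?thesis .
qed

lemma infdist_powr_loc_integrable:
  assumes "0 \<le> b" shows "loc_integrable (\<lambda>y::'a::euclidean_space. infdist y S powr b)"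
proof (rule loc_integrable_nn_abs)
  fix n :: nat
  have "nn_abs (\<lambda>y. infdist y S powr b) (ball (0::'a) (real n)) \<le> nn_abs (\<lambda>y. infdist y S powr b) (ball (0::'a) (real n + 1))"
    by (rule nn_abs_mono) auto
  also have "\<dots> < \<infinity>"
    by (rule order_le_less_trans[OF infdist_powr_nn_abs[OF assms]]) auto
  finally show "nn_abs (\<lambda>y. infdist y S powr b) (ball (0::'a) (real n)) < \<infinity>" .
qed measurable

lemma infdist_powr_weight: "0 \<le> b \<Longrightarrow> weight (\<lambda>y::'a::euclidean_space. infdist y S powr b)"
  by (simp add: weight_def infdist_powr_loc_integrable)

lemma lacunary_infdist_pos:
  assumes L: "lacunary p X" shows "AE y in lebesgue. 0 < infdist y (insert p X)"
proof -
  have "countable (insert p X)" using L by (simp add: lacunary_def)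
  then have "insert p X \<in> null_sets lebesgue"
    by (intro null_sets_completionI countable_imp_null_set_lborel)
  from AE_not_in[OF this] show ?thesis
  proof (rule eventually_mono)
    fix y assume y: "y \<notin> insert p X"
    show "0 < infdist y (insert p X)"
    proof (cases "\<exists>i\<in>X. y \<in> ball i (norm (i - p) / 2)")
      case True
      then obtain i where i: "i \<in> X" "y \<in> ball i (norm (i - p) / 2)" by blast
      have "0 < min (norm (y - p) / 3) (norm (y - i))" using y i by auto
      with lacunary_infdist(1)[OF L i] show ?thesis by linarith
    next
      case False
      then have "norm (y - p) / 3 \<le> infdist y (insert p X)" by (intro lacunary_infdist(2)[OF L]) blast
      moreover have "0 < norm (y - p) / 3" using y by simp
      ultimately show ?thesis by linarith
    qed
  qed
qed

lemma nn_abs_mono_AE: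
  assumes "AE y in lebesgue. y \<in> A \<longrightarrow> \<bar>f y\<bar> \<le> \<bar>g y\<bar>"
  shows "nn_abs f A \<le> nn_abs g A"
  unfolding nn_abs_def using assms
  by (intro nn_integral_mono_AE) (auto elim!: eventually_mono split: split_indicator intro!: ennreal_leI)

text \<open>The upper bound is pointwise. For the lower bound the set where u is small must be
  small: integrating 1 \<le> t^(-a) u^a + t^(1/2) u^(-1/2) and estimating the last term by
  \<open>lacunary_porous\<close> leaves half of the volume to be carried by the weight.\<close>

lemma lacunary_weight_bounds:
  "\<exists>c0>0. \<exists>c1\<ge>0. \<forall>a p X x r. 0 \<le> a \<longrightarrow> a \<le> 1 \<longrightarrow> lacunary p X \<longrightarrow> 0 < r \<longrightarrow>
     c0 * r powr real DIM('a) * max r (infdist x (insert p X)) powr a \<le> wmeas (\<lambda>y. infdist y (insert p X) powr a) (ball (x::'a::euclidean_space) r)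
   \<and> wmeas (\<lambda>y. infdist y (insert p X) powr a) (ball x r) \<le> c1 * r powr real DIM('a) * max r (infdist x (insert p X)) powr a"
proof -
  let ?V = "unit_vol TYPE('a)" and ?d = "real DIM('a)"
  from lacunary_porous[where 'a='a] obtain C where "0 \<le> C \<and> (\<forall>p X x R. lacunary p X \<longrightarrow> 0 < R \<longrightarrow> nn_abs (\<lambda>y. infdist y (insert p X) powr (-1/2)) (ball (x::'a) R)
     \<le> ennreal (C * R powr ?d * max R (infdist x (insert p X)) powr (-1/2)))" ..
  note C = this[THEN conjunct1] this[THEN conjunct2, rule_format]
  define q where "q = min 1 (?V / (2 * (C + 1)))"
  have V: "0 < ?V" by simp
  have q: "0 < q" "q \<le> 1" "q * C \<le> ?V / 2"
  proof -
    show "0 < q" using V C(1) by (simp add: q_def)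
    show "q \<le> 1" by (simp add: q_def)
    have "q * C \<le> ?V / (2 * (C + 1)) * (C + 1)" using V C(1) by (intro mult_mono) (auto simp: q_def)
    also have "\<dots> = ?V / 2" using C(1) by (simp add: field_simps)
    finally show "q * C \<le> ?V / 2" .
  qed
  have main: "?V / 2 * q\<^sup>2 * r powr ?d * max r (infdist x (insert p X)) powr a \<le> wmeas (\<lambda>y. infdist y (insert p X) powr a) (ball x r)
   \<and> wmeas (\<lambda>y. infdist y (insert p X) powr a) (ball x r) \<le> 2 * ?V * r powr ?d * max r (infdist x (insert p X)) powr a"
    if a: "0 \<le> a" "a \<le> 1" and L: "lacunary p X" and r: "0 < r" for a p X and x :: 'a and r
  proof -
    define u where "u y = infdist y (insert p X)" for y
    have [measurable]: "u \<in> borel_measurable lebesgue" unfolding u_def by measurable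
    define w where "w = (\<lambda>y. u y powr a)"
    have wt: "weight w" unfolding w_def u_def by (rule infdist_powr_weight[OF a(1)])
    define M where "M = max r (u x)"
    have M: "0 < M" using r by (simp add: M_def)
    define W where "W = wmeas w (ball x r)"
    have W0: "0 \<le> W" unfolding W_def by (rule wmeas_nonneg[OF wt])
    have "ennreal W \<le> ennreal ((2 * M) powr a * (?V * r powr ?d))"
    proof -
      have "ennreal W = nn_abs w (ball x r)" unfolding W_def by (rule weight_nn_abs[OF wt, symmetric])
      then show ?thesis
        using infdist_powr_nn_abs[OF a(1) r, of "insert p X" x] unfolding w_def u_def M_def by (simp only:)
    qed
    then have "W \<le> (2 * M) powr a * (?V * r powr ?d)" by (subst (asm) ennreal_le_iff) auto
    also have "(2 * M) powr a = 2 powr a * M powr a" using M by (simp add: powr_mult)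
    also have "2 powr a * M powr a * (?V * r powr ?d) \<le> 2 * M powr a * (?V * r powr ?d)"
      using a powr_mono[of a 1 "2::real"] by (intro mult_right_mono) auto
    finally have up: "W \<le> 2 * ?V * r powr ?d * M powr a" by (simp add: mult_ac)
    \<comment> \<open>The level is a fixed fraction of M, chosen so that the term with u^(-1/2)
      takes at most half of |B|; this is the inequality q C \<le> V/2.\<close>
    define t where "t = q\<^sup>2 * M"
    have t: "0 < t" using q M by (simp add: t_def)
    have tq: "t powr (1/2) = q * M powr (1/2)"
      using q M by (simp add: t_def powr_half_sqrt real_sqrt_mult)
    have pt: "1 \<le> t powr (-a) * v powr a + t powr (1/2) * v powr (-1/2)" if v: "0 < v" for v
    proof (cases "t \<le> v")
      case True
      have "1 = t powr (-a) * t powr a" using t by (simp flip: powr_add)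
      also have "\<dots> \<le> t powr (-a) * v powr a" using True t a by (intro mult_left_mono powr_mono2) auto
      finally show ?thesis by (simp add: add_increasing2)
    next
      case False
      have "1 = t powr (1/2) * t powr (-1/2)" using t by (simp flip: powr_add)
      also have "\<dots> \<le> t powr (1/2) * v powr (-1/2)" using False v by (intro mult_left_mono powr_mono2') auto
      finally show ?thesis by (simp add: add_increasing)
    qed
    have "ennreal (?V * r powr ?d) = nn_abs (\<lambda>_. 1) (ball x r)"
      using r by (simp add: nn_abs_const emeasure_ball_lebesgue del: emeasure_completion)
    also have "\<dots> \<le> nn_abs (\<lambda>y. t powr (-a) * w y + t powr (1/2) * u y powr (-1/2)) (ball x r)"
      by (rule nn_abs_mono_AE, rule eventually_mono[OF lacunary_infdist_pos[OF L]])
         (use pt in \<open>auto simp: u_def w_def intro!: order_trans[OF _ abs_ge_self]\<close>)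
    also have "\<dots> \<le> nn_abs (\<lambda>y. t powr (-a) * w y) (ball x r) + nn_abs (\<lambda>y. t powr (1/2) * u y powr (-1/2)) (ball x r)"
      by (rule nn_abs_add) (simp_all add: w_def)
    also have "nn_abs (\<lambda>y. t powr (-a) * w y) (ball x r) \<le> ennreal (t powr (-a)) * nn_abs w (ball x r)"
      by (rule nn_abs_le_cmult) (auto simp: w_def)
    also have "nn_abs w (ball x r) = ennreal W" unfolding W_def by (rule weight_nn_abs[OF wt])
    also have "nn_abs (\<lambda>y. t powr (1/2) * u y powr (-1/2)) (ball x r) \<le> ennreal (t powr (1/2)) * nn_abs (\<lambda>y. u y powr (-1/2)) (ball x r)"
      by (rule nn_abs_le_cmult) auto
    also have "nn_abs (\<lambda>y. u y powr (-1/2)) (ball x r) \<le> ennreal (C * r powr ?d * M powr (-1/2))"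
      unfolding u_def M_def by (rule C(2)[OF L r])
    also have "ennreal (t powr (1/2)) * ennreal (C * r powr ?d * M powr (-1/2)) = ennreal (q * C * r powr ?d)"
    proof -
      have "M powr (1/2) * M powr (-1/2) = 1" using M by (simp flip: powr_add)
      then have "t powr (1/2) * (C * r powr ?d * M powr (-1/2)) = q * C * r powr ?d"
        unfolding tq by (simp add: mult_ac)
      moreover have "ennreal (t powr (1/2)) * ennreal (C * r powr ?d * M powr (-1/2)) = ennreal (t powr (1/2) * (C * r powr ?d * M powr (-1/2)))"
        by (rule ennreal_mult[symmetric]) (use C(1) in auto)
      ultimately show ?thesis by (simp only:)
    qed
    also have "q * C * r powr ?d \<le> ?V / 2 * r powr ?d" using q by (intro mult_right_mono) auto
    finally have "ennreal (?V * r powr ?d) \<le> ennreal (t powr (-a)) * ennreal W + ennreal (?V / 2 * r powr ?d)"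
      by (simp add: add_mono mult_left_mono ennreal_leI)
    also have "\<dots> = ennreal (t powr (-a) * W + ?V / 2 * r powr ?d)" using W0 by (simp add: ennreal_mult ennreal_plus)
    finally have "?V * r powr ?d \<le> t powr (-a) * W + ?V / 2 * r powr ?d"
      using W0 by (subst (asm) ennreal_le_iff) auto
    then have "t powr a * (?V / 2 * r powr ?d) \<le> t powr a * (t powr (-a) * W)" by (intro mult_left_mono) auto
    also have "t powr a * (t powr (-a) * W) = W" using t by (simp flip: mult.assoc powr_add)
    finally have 1: "t powr a * (?V / 2 * r powr ?d) \<le> W" .
    have "q\<^sup>2 * M powr a \<le> t powr a"
    proof -
      have "q\<^sup>2 = (q\<^sup>2) powr 1" using q by simp
      also have "\<dots> \<le> (q\<^sup>2) powr a" using q a by (intro powr_mono') (auto simp: power_le_one)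
      finally have "q\<^sup>2 * M powr a \<le> (q\<^sup>2) powr a * M powr a" by (rule mult_right_mono) simp
      then show ?thesis using q M by (simp add: t_def powr_mult)
    qed
    then have "q\<^sup>2 * M powr a * (?V / 2 * r powr ?d) \<le> t powr a * (?V / 2 * r powr ?d)" by (intro mult_right_mono) auto
    with 1 have "q\<^sup>2 * M powr a * (?V / 2 * r powr ?d) \<le> W" by linarith
    then have "?V / 2 * q\<^sup>2 * r powr ?d * M powr a \<le> W" by (simp add: mult_ac)
    then show ?thesis using up unfolding W_def w_def u_def M_def by simp
  qed
  have pos: "0 < ?V / 2 * q\<^sup>2" using q by simp
  show ?thesis
    by (rule exI[of _ "?V / 2 * q\<^sup>2"], rule conjI[OF pos], rule exI[of _ "2 * ?V"], rule conjI)
      (simp, intro allI impI main)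
qed

text \<open>Since w(B) is comparable to r^d max(r,u)^a, doubling with exponent d + a follows from
  max(R,u) \<le> (R/r) max(r,u), and the reverse Hoelder inequality from the pointwise upper bound
  for u^(2a).\<close>

lemma lacunary_weight_regular:
  "\<exists>CD\<ge>0. \<exists>CR\<ge>0. \<forall>a p X. 0 \<le> a \<longrightarrow> a \<le> 1 \<longrightarrow> lacunary p X \<longrightarrow>
    (\<forall>(x::'a::euclidean_space) r R. 0 < r \<longrightarrow> r \<le> R \<longrightarrow>
       wmeas (\<lambda>y. infdist y (insert p X) powr a) (ball x R) \<le> CD * (R / r) powr (real DIM('a) + a) * wmeas (\<lambda>y. infdist y (insert p X) powr a) (ball x r))
  \<and> (\<forall>(x::'a) r. 0 < r \<longrightarrow>
       avg (\<lambda>y. (infdist y (insert p X) powr a) powr 2) (ball x r) powr (1/2) \<le> CR * avg (\<lambda>y. infdist y (insert p X) powr a) (ball x r))"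
proof -
  let ?V = "unit_vol TYPE('a)" and ?d = "real DIM('a)"
  obtain c0 c1 where c: "0 < c0" "0 \<le> c1"
    and lo: "\<And>a p X x r. 0 \<le> a \<Longrightarrow> a \<le> 1 \<Longrightarrow> lacunary p X \<Longrightarrow> 0 < r \<Longrightarrow>
     c0 * r powr ?d * max r (infdist x (insert p X)) powr a \<le> wmeas (\<lambda>y. infdist y (insert p X) powr a) (ball (x::'a) r)"
    and up: "\<And>a p X x r. 0 \<le> a \<Longrightarrow> a \<le> 1 \<Longrightarrow> lacunary p X \<Longrightarrow> 0 < r \<Longrightarrow>
      wmeas (\<lambda>y. infdist y (insert p X) powr a) (ball (x::'a) r) \<le> c1 * r powr ?d * max r (infdist x (insert p X)) powr a"
    using lacunary_weight_bounds[where 'a='a] by metis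
  show ?thesis
  proof (rule exI[of _ "c1 / c0"], intro conjI, simp add: c less_imp_le, rule exI[of _ "2 * ?V / c0"], intro conjI allI impI, simp add: c less_imp_le)
    fix a :: real and p :: 'a and X and x :: 'a and r R :: real
    assume a: "0 \<le> a" "a \<le> 1" and L: "lacunary p X" and r: "0 < r" "r \<le> R"
    define u where "u = infdist x (insert p X)"
    have u0: "0 \<le> u" by (simp add: u_def infdist_nonneg)
    have Rr: "1 \<le> R / r" using r by simp
    have "max R u \<le> R / r * max r u"
    proof -
      have "R = R / r * r" using r by simp
      also have "\<dots> \<le> R / r * max r u" using Rr by (intro mult_left_mono) auto
      finally have 1: "R \<le> R / r * max r u" .
      have "1 * u \<le> R / r * max r u" using Rr u0 by (intro mult_mono) auto
      with 1 show ?thesis by simp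
    qed
    then have "max R u powr a \<le> (R / r * max r u) powr a" using r a by (intro powr_mono2) auto
    also have "\<dots> = (R / r) powr a * max r u powr a" using r by (subst powr_mult) auto
    finally have m: "max R u powr a \<le> (R / r) powr a * max r u powr a" .
    have "wmeas (\<lambda>y. infdist y (insert p X) powr a) (ball x R) \<le> c1 * R powr ?d * max R u powr a"
      unfolding u_def by (rule up[OF a L]) (use r in simp)
    also have "\<dots> \<le> c1 * R powr ?d * ((R / r) powr a * max r u powr a)" using m c by (intro mult_left_mono) auto
    also have "R powr ?d = (R / r) powr ?d * r powr ?d" using r by (simp add: powr_divide)
    also have "c1 * ((R / r) powr ?d * r powr ?d) * ((R / r) powr a * max r u powr a)
      = c1 / c0 * (R / r) powr (?d + a) * (c0 * r powr ?d * max r u powr a)"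
      using c by (simp add: powr_add)
    also have "\<dots> \<le> c1 / c0 * (R / r) powr (?d + a) * wmeas (\<lambda>y. infdist y (insert p X) powr a) (ball x r)"
      unfolding u_def using c by (intro mult_left_mono lo a L r) auto
    finally show "wmeas (\<lambda>y. infdist y (insert p X) powr a) (ball x R) \<le> c1 / c0 * (R / r) powr (?d + a) * wmeas (\<lambda>y. infdist y (insert p X) powr a) (ball x r)" .
  next
    fix a :: real and p :: 'a and X and x :: 'a and r :: real
    assume a: "0 \<le> a" "a \<le> 1" and L: "lacunary p X" and r: "0 < r"
    define M where "M = max r (infdist x (insert p X))"
    have M: "0 < M" using r by (simp add: M_def)
    have v: "vol (ball x r) = ?V * r powr ?d" "0 < vol (ball x r)" using r by (simp_all add: vol_ball)
    have eq: "(infdist y (insert p X) powr a) powr 2 = infdist y (insert p X) powr (2 * a)" for y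
      by (simp add: powr_powr mult.commute)
    have wt2: "weight (\<lambda>y::'a. infdist y (insert p X) powr (2 * a))" by (rule infdist_powr_weight) (use a in simp)
    have "ennreal (wmeas (\<lambda>y. infdist y (insert p X) powr (2 * a)) (ball x r)) \<le> ennreal ((2 * M) powr (2 * a) * (?V * r powr ?d))"
      unfolding weight_nn_abs[OF wt2, symmetric] M_def by (rule infdist_powr_nn_abs) (use a r in auto)
    then have "wmeas (\<lambda>y. infdist y (insert p X) powr (2 * a)) (ball x r) \<le> (2 * M) powr (2 * a) * (?V * r powr ?d)"
      by (subst (asm) ennreal_le_iff) auto
    then have "avg (\<lambda>y. infdist y (insert p X) powr (2 * a)) (ball x r) \<le> (2 * M) powr (2 * a)"
      using v by (simp add: avg_def wmeas_def pos_divide_le_eq)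
    moreover have "0 \<le> avg (\<lambda>y. infdist y (insert p X) powr (2 * a)) (ball x r)"
      using wmeas_nonneg[OF wt2, of "ball x r"] v by (simp add: avg_def wmeas_def)
    ultimately have "avg (\<lambda>y. infdist y (insert p X) powr (2 * a)) (ball x r) powr (1/2) \<le> ((2 * M) powr (2 * a)) powr (1/2)"
      by (intro powr_mono2) auto
    also have "\<dots> = 2 powr a * M powr a" using M by (simp add: powr_powr powr_mult)
    also have "\<dots> \<le> 2 * M powr a" using a powr_mono[of a 1 "2::real"] by (intro mult_right_mono) auto
    also have "\<dots> = 2 * ?V / c0 * (c0 * r powr ?d * M powr a / vol (ball x r))"
    proof -
      have "0 < ?V" by simp
      then have "?V \<noteq> 0" by linarith
      then show ?thesis using c v r by (simp add: field_simps)
    qed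
    also have "\<dots> \<le> 2 * ?V / c0 * avg (\<lambda>y. infdist y (insert p X) powr a) (ball x r)"
      using lo[OF a L r, of x] v c unfolding avg_def wmeas_def M_def by (intro mult_left_mono divide_right_mono) auto
    finally show "avg (\<lambda>y. (infdist y (insert p X) powr a) powr 2) (ball x r) powr (1/2) \<le> 2 * ?V / c0 * avg (\<lambda>y. infdist y (insert p X) powr a) (ball x r)"
      unfolding eq .
  qed
qed

lemma powr_negative_interpolate:
  fixes u M a :: real
  assumes "0 \<le> u" "0 < M" "0 \<le> a" "a \<le> 1"
  shows "u powr (- a / 2) \<le> M powr (- a / 2) * (1 + M powr (1/2) * u powr (-1/2))"
proof (cases "u = 0")
  case False
  then have u: "0 < u" using assms by simp
  show ?thesis
  proof (cases "M \<le> u")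
    case True
    then have "u powr (- a / 2) \<le> M powr (- a / 2) * 1" using assms by (auto intro: powr_mono2')
    also have "\<dots> \<le> M powr (- a / 2) * (1 + M powr (1/2) * u powr (-1/2))" by (intro mult_left_mono) auto
    finally show ?thesis .
  next
    case False
    have "u powr (- a / 2) = M powr (- a / 2) * (u / M) powr (- a / 2)" using u assms by (simp add: powr_divide)
    also have "\<dots> \<le> M powr (- a / 2) * (u / M) powr (-1/2)"
      using False u assms by (intro mult_left_mono powr_mono') auto
    also have "(u / M) powr (-1/2) = M powr (1/2) * u powr (-1/2)" using u assms by (simp add: powr_divide powr_minus_divide)
    finally show ?thesis by (simp add: distrib_left add_increasing)
  qed
qed simp

text \<open>The outer exponent is -1/(p-1) for p = 3, the H class used below. Because a \<le> 1, the
  power -a/2 is no more singular than -1/2, and \<open>lacunary_porous\<close> applies after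
  interpolation.\<close>

lemma lacunary_weight_negative_power:
  "\<exists>C\<ge>0. \<forall>a p X x r. 0 \<le> a \<longrightarrow> a \<le> 1 \<longrightarrow> lacunary p X \<longrightarrow> 0 < r \<longrightarrow>
     nn_abs (\<lambda>y. (infdist y (insert p X) powr a) powr (- 1 / 2)) (ball (x::'a::euclidean_space) r)
       \<le> ennreal (C * r powr real DIM('a) * max r (infdist x (insert p X)) powr (- a / 2))"
proof -
  let ?V = "unit_vol TYPE('a)" and ?d = "real DIM('a)"
  from lacunary_porous[where 'a='a] obtain C where "0 \<le> C \<and> (\<forall>p X x R. lacunary p X \<longrightarrow> 0 < R \<longrightarrow> nn_abs (\<lambda>y. infdist y (insert p X) powr (-1/2)) (ball (x::'a) R)
     \<le> ennreal (C * R powr ?d * max R (infdist x (insert p X)) powr (-1/2)))" ..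
  note C = this[THEN conjunct1] this[THEN conjunct2, rule_format]
  have main: "nn_abs (\<lambda>y. (infdist y (insert p X) powr a) powr (- 1 / 2)) (ball x r)
       \<le> ennreal ((?V + C) * r powr ?d * max r (infdist x (insert p X)) powr (- a / 2))"
    if a: "0 \<le> a" "a \<le> 1" and L: "lacunary p X" and r: "0 < r" for a p X and x :: 'a and r
  proof -
    define u where "u y = infdist y (insert p X)" for y
    have [measurable]: "u \<in> borel_measurable lebesgue" unfolding u_def by measurable
    define M where "M = max r (u x)"
    have M: "0 < M" using r by (simp add: M_def)
    have "nn_abs (\<lambda>y. (u y powr a) powr (- 1 / 2)) (ball x r) \<le> nn_abs (\<lambda>y. M powr (- a / 2) + M powr (- a / 2) * M powr (1/2) * u y powr (-1/2)) (ball x r)"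
    proof (rule nn_abs_mono_fun)
      fix y
      have "0 \<le> u y" by (simp add: u_def infdist_nonneg)
      from powr_negative_interpolate[OF this M a]
      show "\<bar>(u y powr a) powr (- 1 / 2)\<bar> \<le> \<bar>M powr (- a / 2) + M powr (- a / 2) * M powr (1/2) * u y powr (-1/2)\<bar>"
        by (simp add: powr_powr distrib_left mult.assoc)
    qed
    also have "\<dots> \<le> nn_abs (\<lambda>y. M powr (- a / 2)) (ball x r) + nn_abs (\<lambda>y. M powr (- a / 2) * M powr (1/2) * u y powr (-1/2)) (ball x r)"
      by (rule nn_abs_add) measurable
    also have "nn_abs (\<lambda>y. M powr (- a / 2)) (ball x r) = ennreal (M powr (- a / 2) * (?V * r powr ?d))"
      using r by (simp add: nn_abs_const emeasure_ball_lebesgue ennreal_mult del: emeasure_completion)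
    also have "nn_abs (\<lambda>y. M powr (- a / 2) * M powr (1/2) * u y powr (-1/2)) (ball x r) \<le> ennreal (M powr (- a / 2) * M powr (1/2)) * nn_abs (\<lambda>y. u y powr (-1/2)) (ball x r)"
      by (rule nn_abs_le_cmult) (auto simp: abs_mult)
    also have "nn_abs (\<lambda>y. u y powr (-1/2)) (ball x r) \<le> ennreal (C * r powr ?d * M powr (-1/2))"
      unfolding u_def M_def by (rule C(2)[OF L r])
    also have "ennreal (M powr (- a / 2) * M powr (1/2)) * ennreal (C * r powr ?d * M powr (-1/2)) = ennreal (M powr (- a / 2) * (C * r powr ?d))"
    proof -
      have "M powr (1/2) * M powr (-1/2) = 1" using M by (simp flip: powr_add)
      then have "M powr (- a / 2) * M powr (1/2) * (C * r powr ?d * M powr (-1/2)) = M powr (- a / 2) * (C * r powr ?d)"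
        by (simp add: mult_ac)
      moreover have "ennreal (M powr (- a / 2) * M powr (1/2)) * ennreal (C * r powr ?d * M powr (-1/2)) = ennreal (M powr (- a / 2) * M powr (1/2) * (C * r powr ?d * M powr (-1/2)))"
        by (rule ennreal_mult[symmetric]) (use C(1) in auto)
      ultimately show ?thesis by (simp only:)
    qed
    finally have "nn_abs (\<lambda>y. (u y powr a) powr (- 1 / 2)) (ball x r) \<le> ennreal (M powr (- a / 2) * (?V * r powr ?d)) + ennreal (M powr (- a / 2) * (C * r powr ?d))"
      by (simp add: add_mono mult_left_mono)
    also have "\<dots> = ennreal ((?V + C) * r powr ?d * M powr (- a / 2))"
      using C(1) by (simp add: algebra_simps flip: ennreal_plus)
    finally show ?thesis unfolding u_def M_def .
  qed
  show ?thesis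
    by (rule exI[of _ "?V + C"], rule conjI) (use C(1) in simp, intro allI impI main)
qed

text \<open>All bounds for these weights are free of exponential factors, so the rates are 0, and
  the doubling exponent d + a is d \<kappa>. These are the weights on which the hypothesis about
  admissible weights will be tested.\<close>

lemma lacunary_weight_classes:
  fixes p :: "'a::euclidean_space"
  assumes a: "0 \<le> a" "a \<le> 1" and L: "lacunary p X" and ka: "real DIM('a) * \<kappa> = real DIM('a) + a"
  shows "(\<lambda>y. infdist y (insert p X) powr a) \<in> E_infty_class \<rho> m 0 0 \<inter> D_class \<rho> m \<kappa> 0"
proof -
  let ?V = "unit_vol TYPE('a)" and ?d = "real DIM('a)"
  define w where "w = (\<lambda>y. infdist y (insert p X) powr a)"
  have wt: "weight w" unfolding w_def by (rule infdist_powr_weight[OF a(1)])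
  have wm [measurable]: "w \<in> borel_measurable lebesgue" unfolding w_def by measurable
  from lacunary_weight_regular[where 'a='a] obtain CD CR where
    D: "\<And>(x::'a) r R. 0 < r \<Longrightarrow> r \<le> R \<Longrightarrow> wmeas w (ball x R) \<le> CD * (R / r) powr (?d + a) * wmeas w (ball x r)"
    and RH: "\<And>(x::'a) r. 0 < r \<Longrightarrow> avg (\<lambda>y. w y powr 2) (ball x r) powr (1/2) \<le> CR * avg w (ball x r)"
    using a L unfolding w_def by blast
  have "w \<in> D_class \<rho> m \<kappa> 0"
    unfolding D_class_def using wt D by (auto simp: ka)
  moreover have "w \<in> E_infty_class \<rho> m 0 0"
  proof -
    have pw: "(\<lambda>y. w y powr 2) = (\<lambda>y. infdist y (insert p X) powr (2 * a))"
      by (simp add: w_def powr_powr mult.commute)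
    have l2: "loc_integrable (\<lambda>y. w y powr 2)" unfolding pw by (rule infdist_powr_loc_integrable) (use a in simp)
    have R: "w \<in> RH_class \<rho> m 2 0"
      unfolding RH_class_def using wt l2 RH by auto
    obtain c0 c1 where c1: "0 \<le> c1" and up: "\<And>(x::'a) r. 0 < r \<Longrightarrow> wmeas w (ball x r) \<le> c1 * r powr ?d * max r (infdist x (insert p X)) powr a"
      using lacunary_weight_bounds[where 'a='a] a L unfolding w_def by blast
    obtain C where C: "0 \<le> C" and neg: "\<And>(x::'a) r. 0 < r \<Longrightarrow> nn_abs (\<lambda>y. w y powr (- 1 / 2)) (ball x r) \<le> ennreal (C * r powr ?d * max r (infdist x (insert p X)) powr (- a / 2))"
      using lacunary_weight_negative_power[where 'a='a] a L unfolding w_def by blast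
    have ln: "loc_integrable (\<lambda>y. w y powr (- 1 / 2))"
    proof (rule loc_integrable_nn_abs)
      fix n :: nat
      have "nn_abs (\<lambda>y. w y powr (- 1 / 2)) (ball 0 (real n)) \<le> nn_abs (\<lambda>y. w y powr (- 1 / 2)) (ball 0 (real n + 1))"
        by (rule nn_abs_mono) auto
      also have "\<dots> < \<infinity>" by (rule order_le_less_trans[OF neg]) auto
      finally show "nn_abs (\<lambda>y. w y powr (- 1 / 2)) (ball 0 (real n)) < \<infinity>" .
    qed measurable
    have wtn: "weight (\<lambda>y. w y powr (- 1 / 2))" using ln by (simp add: weight_def)
    have pos: "AE x in lebesgue. 0 < w x"
      using lacunary_infdist_pos[OF L] by (rule eventually_mono) (simp add: w_def)
    define B where "B = c1 powr (1/3) * C powr (2/3) / ?V"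
    have V0: "?V \<noteq> 0" using unit_ball_vol_pos[of ?d] by (metis less_irrefl of_nat_0_le_iff)
    have "wmeas w (ball x r) powr (1/3) * (LINT y:ball x r|lebesgue. w y powr (- 1 / 2)) powr (2/3) \<le> B * vol (ball x r)" if r: "0 < r" for x :: 'a and r
    proof -
      define M where "M = max r (infdist x (insert p X))"
      have M: "0 < M" using r by (simp add: M_def)
      have I: "(LINT y:ball x r|lebesgue. w y powr (- 1 / 2)) \<le> C * r powr ?d * M powr (- a / 2)"
        using neg[OF r, of x] C unfolding weight_nn_abs[OF wtn] wmeas_def M_def by (subst (asm) ennreal_le_iff) auto
      have I0: "0 \<le> (LINT y:ball x r|lebesgue. w y powr (- 1 / 2))" using wmeas_nonneg[OF wtn] by (simp add: wmeas_def)
      have "wmeas w (ball x r) powr (1/3) * (LINT y:ball x r|lebesgue. w y powr (- 1 / 2)) powr (2/3)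
        \<le> (c1 * r powr ?d * M powr a) powr (1/3) * (C * r powr ?d * M powr (- a / 2)) powr (2/3)"
        using up[OF r, of x] I I0 wmeas_nonneg[OF wt] unfolding M_def by (intro mult_mono powr_mono2) auto
      also have "\<dots> = c1 powr (1/3) * C powr (2/3) * (r powr (?d * (1/3)) * r powr (?d * (2/3))) * (M powr (a * (1/3)) * M powr ((- a / 2) * (2/3)))"
        using c1 C by (simp add: powr_mult powr_powr mult_ac)
      also have "M powr (a * (1/3)) * M powr ((- a / 2) * (2/3)) = 1" using M by (simp flip: powr_add)
      also have "r powr (?d * (1/3)) * r powr (?d * (2/3)) = r powr ?d" by (simp flip: powr_add)
      finally show ?thesis using r V0 by (simp add: B_def vol_ball)
    qed
    then have H: "w \<in> H_class \<rho> m 3 0"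
      unfolding H_class_def using wt pos ln by auto
    \<comment> \<open>Bookkeeping of exponents: for s = 6 and \<eta> = 2 one has s' = 6/5 < \<eta>,
      \<eta>' = 2 and s/\<eta>' = 3.\<close>
    have "w \<in> E_class \<rho> m 6 0 0"
      unfolding E_class_def using R H by (intro UN_I[of 2]) (auto simp: conj_exponent_def)
    then show ?thesis unfolding E_infty_class_def by (intro UN_I[of 6]) auto
  qed
  ultimately show ?thesis unfolding w_def by blast
qed

section \<open>Doubling and A_infinity data of the weights\<close>

context scz
begin

text \<open>The modulus delivered by \<open>RH_ainf\<close>. It depends only on the exponent and the
  constant of the reverse Hoelder inequality, hence not on the particular lacunary set.\<close>

definition phi_RH :: "real \<Rightarrow> real \<Rightarrow> real \<Rightarrow> real" where
  "phi_RH \<eta> C e = e / (2 * (2 * C powr \<eta> / e + 1) powr (1 / (\<eta> - 1)))"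

lemma phi_RH_pos: "0 < e \<Longrightarrow> 0 < phi_RH \<eta> C e"
proof -
  assume e: "0 < e"
  have "0 < 2 * C powr \<eta> / e + 1" using e by (intro add_nonneg_pos) auto
  then have "0 < (2 * C powr \<eta> / e + 1) powr (1 / (\<eta> - 1))" by simp
  then show ?thesis unfolding phi_RH_def using e by (intro divide_pos_pos) auto
qed

lemma lacunary_weight_adm:
  "\<exists>CD\<ge>0. \<exists>CR. \<forall>a p X \<kappa>. 0 \<le> a \<longrightarrow> a \<le> 1 \<longrightarrow> lacunary p X \<longrightarrow> real DIM('a) * \<kappa> = real DIM('a) + a \<longrightarrow>
     dbl \<kappa> 0 CD (\<lambda>y::'a. infdist y (insert p X) powr a) \<and> ainf (phi_RH 2 CR) (\<lambda>y. infdist y (insert p X) powr a)"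
proof -
  obtain CD CR where c: "0 \<le> CD" "0 \<le> CR"
    and D: "\<And>a p X (x::'a) r R. 0 \<le> a \<Longrightarrow> a \<le> 1 \<Longrightarrow> lacunary p X \<Longrightarrow> 0 < r \<Longrightarrow> r \<le> R \<Longrightarrow>
       wmeas (\<lambda>y. infdist y (insert p X) powr a) (ball x R) \<le> CD * (R / r) powr (real DIM('a) + a) * wmeas (\<lambda>y. infdist y (insert p X) powr a) (ball x r)"
    and RH: "\<And>a p X (x::'a) r. 0 \<le> a \<Longrightarrow> a \<le> 1 \<Longrightarrow> lacunary p X \<Longrightarrow> 0 < r \<Longrightarrow>
       avg (\<lambda>y. (infdist y (insert p X) powr a) powr 2) (ball x r) powr (1/2) \<le> CR * avg (\<lambda>y. infdist y (insert p X) powr a) (ball x r)"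
    using lacunary_weight_regular[where 'a='a] by metis
  have main: "dbl \<kappa> 0 CD (\<lambda>y::'a. infdist y (insert p X) powr a) \<and> ainf (phi_RH 2 CR) (\<lambda>y. infdist y (insert p X) powr a)"
    if a: "0 \<le> a" "a \<le> 1" and L: "lacunary p X" and ka: "real DIM('a) * \<kappa> = real DIM('a) + a" for a p X \<kappa>
  proof
    have wt: "weight (\<lambda>y::'a. infdist y (insert p X) powr a)" by (rule infdist_powr_weight[OF a(1)])
    show "dbl \<kappa> 0 CD (\<lambda>y::'a. infdist y (insert p X) powr a)"
      unfolding dbl_def using wt D[OF a L] by (simp add: ka)
    have pw: "(\<lambda>y::'a. (infdist y (insert p X) powr a) powr 2) = (\<lambda>y. infdist y (insert p X) powr (2 * a))"
      by (simp add: powr_powr mult.commute)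
    have l2: "loc_integrable (\<lambda>y::'a. (infdist y (insert p X) powr a) powr 2)"
      unfolding pw by (rule infdist_powr_loc_integrable) (use a in simp)
    show "ainf (phi_RH 2 CR) (\<lambda>y. infdist y (insert p X) powr a)"
      unfolding phi_RH_def by (rule RH_ainf[OF wt l2 _ c(2)]) (use RH[OF a L] in auto)
  qed
  show ?thesis
    by (rule exI[of _ CD], rule conjI[OF c(1)], rule exI[of _ CR], intro allI impI main)
qed

text \<open>The constants of the classes are existential and may formally be negative, hence the
  absolute values. On radii up to 2 \<rho>(x) the exponential factor of the reverse Hoelder
  inequality is at most exp (c2 3^m), so a modulus for \<open>ainf\<close> exists.\<close>

lemma admissible_weight:
  assumes w: "w \<in> E_infty_class \<rho> m c1 c2 \<inter> D_class \<rho> m \<kappa> c3" and c2: "0 \<le> c2"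
  shows "\<exists>CD \<phi>. 0 \<le> CD \<and> (\<forall>e>0. 0 < \<phi> e) \<and> dbl \<kappa> c3 CD w \<and> ainf \<phi> w"
proof -
  from w have wt: "weight w" by (auto simp: D_class_def)
  from w obtain C where C: "\<And>x r R. 0 < r \<Longrightarrow> r \<le> R \<Longrightarrow> wmeas w (ball x R)
     \<le> C * (R / r) powr (real DIM('a) * \<kappa>) * exp (c3 * (1 + R / \<rho> x) powr m) * wmeas w (ball x r)"
    by (auto simp: D_class_def)
  have d: "dbl \<kappa> c3 \<bar>C\<bar> w"
    unfolding dbl_def
  proof (intro conjI wt allI impI)
    fix x r R assume r: "0 < r" "r \<le> (R::real)"
    have "C * ((R / r) powr (real DIM('a) * \<kappa>) * exp (c3 * (1 + R / \<rho> x) powr m) * wmeas w (ball x r))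
      \<le> \<bar>C\<bar> * ((R / r) powr (real DIM('a) * \<kappa>) * exp (c3 * (1 + R / \<rho> x) powr m) * wmeas w (ball x r))"
      using wmeas_nonneg[OF wt] by (intro mult_right_mono) auto
    with C[OF r, of x] show "wmeas w (ball x R)
      \<le> \<bar>C\<bar> * (R / r) powr (real DIM('a) * \<kappa>) * exp (c3 * (1 + R / \<rho> x) powr m) * wmeas w (ball x r)"
      by (simp add: mult.assoc)
  qed
  from w obtain s \<eta> where s: "1 < s" "conj_exponent s < \<eta>" "w \<in> RH_class \<rho> m \<eta> c2"
    by (auto simp: E_infty_class_def E_class_def)
  have "1 < conj_exponent s" using s(1) by (simp add: conj_exponent_def)
  then have eta: "1 < \<eta>" using s(2) by simp
  from s(3) obtain B where l: "loc_integrable (\<lambda>y. w y powr \<eta>)"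
    and B: "\<And>x r. 0 < r \<Longrightarrow> avg (\<lambda>y. w y powr \<eta>) (ball x r) powr (1 / \<eta>) \<le> B * exp (c2 * (1 + r / \<rho> x) powr m) * avg w (ball x r)"
    by (auto simp: RH_class_def)
  define D where "D = \<bar>B\<bar> * exp (c2 * 3 powr m)"
  have D: "0 \<le> D" by (simp add: D_def)
  have "ainf (phi_RH \<eta> D) w"
    unfolding phi_RH_def
  proof (rule RH_ainf[OF wt l eta D])
    fix x r assume r: "0 < r" "r \<le> 2 * \<rho> x"
    have a0: "0 \<le> avg w (ball x r)" using wmeas_nonneg[OF wt] vol_ball_pos[OF r(1), of x] by (simp add: avg_def wmeas_def[symmetric])
    have "r / \<rho> x \<le> 2" "0 \<le> r / \<rho> x" using r rho_pos[of x] by (auto simp: field_simps)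
    then have "(1 + r / \<rho> x) powr m \<le> 3 powr m" using m_pos by (intro powr_mono2) auto
    then have "exp (c2 * (1 + r / \<rho> x) powr m) \<le> exp (c2 * 3 powr m)" using c2 by (simp add: mult_left_mono)
    then have "B * exp (c2 * (1 + r / \<rho> x) powr m) * avg w (ball x r) \<le> D * avg w (ball x r)"
      unfolding D_def using a0 by (intro mult_right_mono mult_mono) auto
    with B[OF r(1), of x] show "avg (\<lambda>y. w y powr \<eta>) (ball x r) powr (1 / \<eta>) \<le> D * avg w (ball x r)" by linarith
  qed
  then show ?thesis using d phi_RH_pos by (intro exI[of _ "\<bar>C\<bar>"] exI[of _ "phi_RH \<eta> D"]) auto
qed

end

section \<open>Test functions\<close>

text \<open>Subadditivity of t^\<gamma> for \<gamma> \<le> 1: numbers in [0,1] only increase under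
  the power \<gamma>. It makes the truncated power Hoelder continuous of order \<gamma>.\<close>

lemma powr_diff_le:
  fixes p q \<gamma> :: real
  assumes "0 \<le> q" "q \<le> p" "0 < \<gamma>" "\<gamma> \<le> 1"
  shows "p powr \<gamma> - q powr \<gamma> \<le> (p - q) powr \<gamma>"
proof (cases "p = 0")
  case False
  then have p: "0 < p" using assms by simp
  have "1 = q / p + (p - q) / p" using p by (simp add: field_simps)
  also have "\<dots> \<le> (q / p) powr \<gamma> + ((p - q) / p) powr \<gamma>"
  proof (rule add_mono)
    have "(q / p) powr 1 \<le> (q / p) powr \<gamma>" using assms p by (intro powr_mono') auto
    then show "q / p \<le> (q / p) powr \<gamma>" using assms p by simp
    have "((p - q) / p) powr 1 \<le> ((p - q) / p) powr \<gamma>" using assms p by (intro powr_mono') auto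
    then show "(p - q) / p \<le> ((p - q) / p) powr \<gamma>" using assms p by simp
  qed
  finally have "p powr \<gamma> * 1 \<le> p powr \<gamma> * ((q / p) powr \<gamma> + ((p - q) / p) powr \<gamma>)" by (rule mult_left_mono) simp
  also have "\<dots> = q powr \<gamma> + (p - q) powr \<gamma>" using assms p by (simp add: distrib_left flip: powr_mult)
  finally show ?thesis by simp
qed (use assms in auto)

lemma powr_diff_abs_le:
  fixes p q \<gamma> :: real
  assumes "0 \<le> q" "0 \<le> p" "0 < \<gamma>" "\<gamma> \<le> 1"
  shows "\<bar>p powr \<gamma> - q powr \<gamma>\<bar> \<le> \<bar>p - q\<bar> powr \<gamma>"
proof (cases "q \<le> p")
  case True
  then show ?thesis using powr_diff_le[of q p \<gamma>] powr_mono2[of \<gamma> q p] assms by simp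
next
  case False
  then show ?thesis using powr_diff_le[of p q \<gamma>] powr_mono2[of \<gamma> p q] assms by simp
qed

lemma loc_integrable_continuous_bounded:
  fixes f :: "'a::euclidean_space \<Rightarrow> real"
  assumes "f \<in> borel_measurable lebesgue" "\<And>y. \<bar>f y\<bar> \<le> b"
  shows "loc_integrable f"
proof (rule loc_integrable_nn_abs[OF assms(1)])
  fix n :: nat
  have "nn_abs f (ball 0 (real n)) \<le> nn_abs (\<lambda>_. b) (ball (0::'a) (real n))"
    by (rule nn_abs_mono_fun) (use assms(2) in \<open>auto intro: order_trans[OF _ abs_ge_self]\<close>)
  also have "\<dots> < \<infinity>" by (simp add: nn_abs_const emeasure_ball_lebesgue ennreal_mult_less_top del: emeasure_completion)
  finally show "nn_abs f (ball 0 (real n)) < \<infinity>" .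
qed

lemma avg_ge_const:
  assumes f: "loc_integrable (f::'a::euclidean_space \<Rightarrow> real)" and s: "0 < s" and b: "\<And>y. y \<in> ball x s \<Longrightarrow> b \<le> f y"
  shows "b \<le> avg f (ball x s)"
proof -
  have v: "0 < vol (ball x s)" by (rule vol_ball_pos[OF s])
  have "(LINT u:ball x s|lebesgue. b) \<le> (LINT u:ball x s|lebesgue. f u)"
    by (rule set_integral_mono[OF loc_integrable_ball[OF loc_integrable_const] loc_integrable_ball[OF f]]) (use b in auto)
  moreover have "(LINT u:ball x s|lebesgue. b) = b * vol (ball x s)"
    by (simp add: set_lebesgue_integral_def vol_def)
  ultimately show ?thesis using v by (simp add: avg_def pos_le_divide_eq)
qed

section \<open>The truncated logarithm and the truncated power\<close>

context scz
begin

text \<open>For test functions supported in B(x0,\<rho>(x0)) the size condition matters only on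
  balls B(z,s) with s \<ge> \<rho>(z) that meet the support. Either s \<ge> \<rho>(x0), or z is
  within 2 \<rho>(x0) and \<rho>(z) is comparable to \<rho>(x0).\<close>

lemma support_scale:
  assumes "y \<in> ball z s" "dist x0 y < \<rho> x0" "\<rho> z \<le> s"
  shows "inverse C0 * 3 powr (- k0) * \<rho> x0 \<le> s"
proof (cases "\<rho> x0 \<le> s")
  case True
  have k: "1 \<le> k0" "1 \<le> C0" using rho by (auto simp: critical_radius_def)
  have "inverse C0 * 3 powr (- k0) \<le> 1 * 1"
  proof (rule mult_mono)
    show "inverse C0 \<le> 1" using k by (simp add: inverse_le_1_iff)
    show "3 powr (- k0) \<le> 1" using powr_mono[of "- k0" 0 "3::real"] k by simp
  qed (use k in auto)
  then have "inverse C0 * 3 powr (- k0) * \<rho> x0 \<le> 1 * \<rho> x0" using rho_pos[of x0] by (intro mult_right_mono) auto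
  then show ?thesis using True by simp
next
  case False
  have "dist x0 z \<le> dist x0 y + dist y z" by (rule dist_triangle)
  then have "dist x0 z \<le> 2 * \<rho> x0" using assms False by (simp add: dist_commute)
  from rho_lower[OF this] show ?thesis using assms(3) by simp
qed

definition "c_supp = inverse C0 * 3 powr (- k0)"

lemma c_supp_pos: "0 < c_supp" using C0_ge1 by (simp add: c_supp_def)

text \<open>This is ln (\<rho>/|y - x0|) with the distance clamped to [r, \<rho>]: bounded by ln
  (\<rho>/r), which is its value on B(x0,r), and zero outside the critical ball.\<close>

definition log_test :: "'a \<Rightarrow> real \<Rightarrow> 'a \<Rightarrow> real" where
  "log_test x0 r y = ln (\<rho> x0) - ln (max r (min (\<rho> x0) (norm (y - x0))))"

text \<open>Clamping is nonexpansive on the logarithmic scale.\<close>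

lemma log_clamp_diff:
  fixes r R p q :: real
  assumes "0 < r" "r \<le> R" "0 < q" "q \<le> p"
  shows "\<bar>ln (max r (min R p)) - ln (max r (min R q))\<bar> \<le> ln (p / q)"
proof -
  have "max r (min R p) \<le> p / q * max r (min R q)"
  proof -
    have pq: "1 \<le> p / q" using assms by simp
    have "1 * max r (min R q) \<le> p / q * max r (min R q)" using pq assms by (intro mult_right_mono) auto
    moreover have "p \<le> p / q * max r q" using assms mult_left_mono[of q "max r q" "p / q"] by simp
    ultimately show ?thesis using assms by (auto simp: max_def min_def split: if_splits)
  qed
  then have "ln (max r (min R p)) \<le> ln (p / q * max r (min R q))" using assms by (subst ln_le_cancel_iff) auto
  also have "\<dots> = ln (p / q) + ln (max r (min R q))" using assms by (subst ln_mult) auto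
  finally have "ln (max r (min R p)) - ln (max r (min R q)) \<le> ln (p / q)" by simp
  moreover have "ln (max r (min R q)) \<le> ln (max r (min R p))" using assms by (subst ln_le_cancel_iff) auto
  ultimately show ?thesis by simp
qed

lemma ln_le_two_sqrt: "0 < t \<Longrightarrow> ln (t::real) \<le> 2 * t powr (1/2)"
  using ln_le_minus_one[of "t powr (1/2)"] by (simp add: ln_powr)

lemma log_test_measurable: "log_test x0 r \<in> borel_measurable lebesgue"
  unfolding log_test_def by measurable

lemma log_test_bounds:
  assumes "0 < r" "r \<le> \<rho> x0"
  shows "0 \<le> log_test x0 r y" "log_test x0 r y \<le> ln (\<rho> x0 / r)"
proof -
  have "ln (max r (min (\<rho> x0) (norm (y - x0)))) \<le> ln (\<rho> x0)" using assms by (subst ln_le_cancel_iff) auto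
  then show "0 \<le> log_test x0 r y" by (simp add: log_test_def)
  have "ln r \<le> ln (max r (min (\<rho> x0) (norm (y - x0))))" using assms by (subst ln_le_cancel_iff) auto
  then show "log_test x0 r y \<le> ln (\<rho> x0 / r)" using assms by (simp add: log_test_def ln_div)
qed

lemma log_test_loc_integrable: "0 < r \<Longrightarrow> r \<le> \<rho> x0 \<Longrightarrow> loc_integrable (log_test x0 r)"
  by (rule loc_integrable_continuous_bounded[OF log_test_measurable, of _ _ "ln (\<rho> x0 / r)"]) (use log_test_bounds in auto)

text \<open>As ln s \<le> 2 s^(1/2), the deviation from the value at distance t is at most 2 (t/|y -
  x0|)^(1/2), and \<open>singular_ball_integral\<close> applies. The bound does not involve r; this
  keeps the norm of the test functions bounded while their means grow.\<close>

lemma log_test_central: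
  assumes r: "0 < r" "r \<le> \<rho> x0" and t: "0 < t"
  shows "nn_abs (\<lambda>y. log_test x0 r y - (ln (\<rho> x0) - ln (max r (min (\<rho> x0) t)))) (ball x0 t) \<le> ennreal (16 * V * t powr real DIM('a))"
proof -
  have "{x0} \<in> null_sets lebesgue" by (intro null_sets_completionI) auto
  then have ae: "AE y in lebesgue. y \<noteq> x0" using AE_not_in[of "{x0}" lebesgue] by simp
  have "nn_abs (\<lambda>y. log_test x0 r y - (ln (\<rho> x0) - ln (max r (min (\<rho> x0) t)))) (ball x0 t)
      \<le> nn_abs (\<lambda>y. (2 * t powr (1/2)) * norm (y - x0) powr (-1/2)) (ball x0 t)"
  proof (rule nn_abs_mono_AE, rule eventually_mono[OF ae], rule impI)
    fix y assume y: "y \<noteq> x0" "y \<in> ball x0 t"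
    have n: "0 < norm (y - x0)" "norm (y - x0) \<le> t" using y by (auto simp: dist_norm norm_minus_commute)
    have "\<bar>log_test x0 r y - (ln (\<rho> x0) - ln (max r (min (\<rho> x0) t)))\<bar> = \<bar>ln (max r (min (\<rho> x0) t)) - ln (max r (min (\<rho> x0) (norm (y - x0))))\<bar>"
      by (simp add: log_test_def)
    also have "\<dots> \<le> ln (t / norm (y - x0))" by (rule log_clamp_diff[OF r n])
    also have "\<dots> \<le> 2 * (t / norm (y - x0)) powr (1/2)" by (rule ln_le_two_sqrt) (use n t in simp)
    also have "\<dots> = (2 * t powr (1/2)) * norm (y - x0) powr (-1/2)" using n t by (simp add: powr_divide powr_minus_divide)
    finally show "\<bar>log_test x0 r y - (ln (\<rho> x0) - ln (max r (min (\<rho> x0) t)))\<bar> \<le> \<bar>(2 * t powr (1/2)) * norm (y - x0) powr (-1/2)\<bar>" by simp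
  qed
  also have "\<dots> \<le> ennreal (2 * t powr (1/2)) * nn_abs (\<lambda>y. norm (y - x0) powr (-1/2)) (ball x0 t)"
    by (rule nn_abs_le_cmult) auto
  also have "\<dots> \<le> ennreal (2 * t powr (1/2)) * ennreal (8 * V * t powr (real DIM('a) - 1/2))"
    unfolding V_def by (rule mult_left_mono[OF singular_ball_integral[OF t]]) simp
  also have "\<dots> = ennreal (16 * V * t powr real DIM('a))"
  proof -
    have "t powr (1/2) * t powr (real DIM('a) - 1/2) = t powr real DIM('a)" by (simp flip: powr_add)
    then have "2 * t powr (1/2) * (8 * V * t powr (real DIM('a) - 1/2)) = 16 * V * t powr real DIM('a)" by (simp add: mult_ac)
    moreover have "ennreal (2 * t powr (1/2)) * ennreal (8 * V * t powr (real DIM('a) - 1/2)) = ennreal (2 * t powr (1/2) * (8 * V * t powr (real DIM('a) - 1/2)))"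
      by (rule ennreal_mult[symmetric]) (use V_pos in auto)
    ultimately show ?thesis by (simp only:)
  qed
  finally show ?thesis .
qed

text \<open>A ball close to x0 relative to its radius is compared with a ball about x0; on any other
  ball the logarithm varies by at most ln 2. The weight enters through a lower bound only, so one
  function serves all weights satisfying it.\<close>

lemma log_test_bmo:
  assumes r: "0 < r" "r \<le> \<rho> x0" and c0: "0 < c0" and wt: "weight w"
    and W: "\<And>z s. 0 < s \<Longrightarrow> c0 * s powr real DIM('a) \<le> wmeas w (ball z s)"
  shows "bmo 0 w (log_test x0 r) ((32 * 3 powr real DIM('a) + 16 * (1 / c_supp) powr real DIM('a)) * V / c0)"
proof -
  let ?d = "real DIM('a)" and ?f = "log_test x0 r"
  let ?n = "(32 * 3 powr ?d + 16 * (1 / c_supp) powr ?d) * V / c0"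
  note fl = log_test_loc_integrable[OF r]
  have A: "ennreal (b * V * s powr ?d) \<le> ennreal (?n * s powr 0 * wmeas w (ball z s))"
    if s: "0 < s" and b: "0 \<le> b" "b \<le> 32 * 3 powr ?d + 16 * (1 / c_supp) powr ?d" for b z s
  proof (rule ennreal_leI)
    have "b * V * s powr ?d = b * V / c0 * (c0 * s powr ?d)" using c0 by simp
    also have "\<dots> \<le> ?n * wmeas w (ball z s)"
      using b V_pos c0 W[OF s] c_supp_pos by (intro mult_mono divide_right_mono mult_right_mono) auto
    finally show "b * V * s powr ?d \<le> ?n * s powr 0 * wmeas w (ball z s)" using s by simp
  qed
  have osc: "\<exists>b. nn_abs (\<lambda>y. ?f y - b) (ball z s) \<le> ennreal (16 * 3 powr ?d * V * s powr ?d)" if s: "0 < s" for z s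
  proof (cases "norm (z - x0) < 2 * s")
    case True
    have "ball z s \<subseteq> ball x0 (3 * s)"
    proof
      fix y assume "y \<in> ball z s"
      then show "y \<in> ball x0 (3 * s)" using True dist_triangle[of x0 y z] by (simp add: dist_norm norm_minus_commute)
    qed
    then have "nn_abs (\<lambda>y. ?f y - (ln (\<rho> x0) - ln (max r (min (\<rho> x0) (3 * s))))) (ball z s)
       \<le> nn_abs (\<lambda>y. ?f y - (ln (\<rho> x0) - ln (max r (min (\<rho> x0) (3 * s))))) (ball x0 (3 * s))" by (rule nn_abs_mono)
    also have "\<dots> \<le> ennreal (16 * V * (3 * s) powr ?d)" by (rule log_test_central[OF r]) (use s in simp)
    also have "16 * V * (3 * s) powr ?d = 16 * 3 powr ?d * V * s powr ?d" using s by (simp add: powr_mult)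
    finally show ?thesis by blast
  next
    case False
    have "nn_abs (\<lambda>y. ?f y - ?f z) (ball z s) \<le> nn_abs (\<lambda>_. ln 2) (ball z s)"
    proof (rule nn_abs_mono_fun)
      fix y assume "y \<in> ball z s"
      then have yz: "norm (y - z) < s" by (simp add: dist_norm norm_minus_commute)
      define D where "D = norm (z - x0)"
      define N where "N = norm (y - x0)"
      have "D \<le> norm (y - z) + N" unfolding D_def N_def using norm_triangle_ineq4[of "y - x0" "y - z"] by simp
      moreover have "N \<le> norm (y - z) + D" unfolding D_def N_def using norm_triangle_ineq[of "y - z" "z - x0"] by simp
      moreover have "2 * s \<le> D" using False by (simp add: D_def)
      ultimately have ND: "D \<le> 2 * N" "N \<le> 2 * D" "0 < D" "0 < N" using yz s by linarith+
      have "\<bar>ln (max r (min (\<rho> x0) N)) - ln (max r (min (\<rho> x0) D))\<bar> \<le> ln 2"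
      proof (cases "D \<le> N")
        case True
        have "ln (N / D) \<le> ln 2" using ND by (subst ln_le_cancel_iff) (auto simp: field_simps)
        then show ?thesis using log_clamp_diff[OF r ND(3) True] by linarith
      next
        case f: False
        then have "N \<le> D" by simp
        have "ln (D / N) \<le> ln 2" using ND by (subst ln_le_cancel_iff) (auto simp: field_simps)
        then show ?thesis using log_clamp_diff[OF r ND(4) \<open>N \<le> D\<close>] by linarith
      qed
      then show "\<bar>?f y - ?f z\<bar> \<le> \<bar>ln 2\<bar>" by (simp add: log_test_def N_def D_def abs_minus_commute)
    qed
    also have "\<dots> = ennreal (ln 2 * (V * s powr ?d))"
      using s V_pos by (simp add: nn_abs_const emeasure_ball_V ennreal_mult del: emeasure_completion)
    also have "ln 2 * (V * s powr ?d) \<le> (16 * 3 powr ?d) * (V * s powr ?d)"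
    proof (rule mult_right_mono)
      have "ln 2 \<le> (2::real) - 1" by (rule ln_le_minus_one) simp
      moreover have "1 \<le> 3 powr ?d" by (rule ge_one_powr_ge_zero) auto
      ultimately show "ln 2 \<le> 16 * 3 powr ?d" by linarith
    qed (use V_pos in simp)
    finally show ?thesis by (intro exI[of _ "?f z"]) (simp add: ennreal_leI mult.assoc)
  qed
  show ?thesis
    unfolding bmo_def
  proof (intro conjI allI impI fl)
    show "0 \<le> ?n" using V_pos c0 c_supp_pos by simp
    fix z :: 'a and s :: real assume s: "0 < s"
    from osc[OF s, of z] obtain b where b: "nn_abs (\<lambda>y. ?f y - b) (ball z s) \<le> ennreal (16 * 3 powr ?d * V * s powr ?d)" by blast
    have "nn_abs (\<lambda>y. ?f y - avg ?f (ball z s)) (ball z s) \<le> 2 * nn_abs (\<lambda>y. ?f y - b) (ball z s)" by (rule osc_le_twice[OF fl s])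
    also have "\<dots> \<le> 2 * ennreal (16 * 3 powr ?d * V * s powr ?d)" using b by (rule mult_left_mono) simp
    also have "\<dots> = ennreal ((32 * 3 powr ?d) * V * s powr ?d)" using V_pos by (simp flip: ennreal_mult'' ennreal_numeral)
    also have "\<dots> \<le> ennreal (?n * s powr 0 * wmeas w (ball z s))" by (rule A[OF s]) auto
    finally show "nn_abs (\<lambda>y. ?f y - avg ?f (ball z s)) (ball z s) \<le> ennreal (?n * s powr 0 * wmeas w (ball z s))" .
  next
    fix z :: 'a and s :: real assume zs: "\<rho> z \<le> s"
    have s: "0 < s" using zs rho_pos[of z] by linarith
    have sup: "?f y = 0" if "\<not> dist x0 y < \<rho> x0" for y
      using that r by (simp add: log_test_def dist_norm norm_minus_commute)
    show "nn_abs ?f (ball z s) \<le> ennreal (?n * s powr 0 * wmeas w (ball z s))"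
    proof (cases "\<exists>y\<in>ball z s. dist x0 y < \<rho> x0")
      case False
      then have "nn_abs ?f (ball z s) \<le> nn_abs (\<lambda>_. 0) (ball z s)" by (intro nn_abs_mono_fun) (use sup in auto)
      then show ?thesis by (simp add: nn_abs_def)
    next
      case True
      then have cs: "c_supp * \<rho> x0 \<le> s" unfolding c_supp_def using support_scale[OF _ _ zs] by blast
      then have rs: "\<rho> x0 \<le> 1 / c_supp * s" using c_supp_pos by (simp add: field_simps)
      have "nn_abs ?f (ball z s) = nn_abs ?f (ball z s \<inter> ball x0 (\<rho> x0))"
        unfolding nn_abs_def using sup by (intro nn_integral_cong) (auto split: split_indicator)
      also have "\<dots> \<le> nn_abs ?f (ball x0 (\<rho> x0))" by (rule nn_abs_mono) auto
      also have "\<dots> \<le> ennreal (16 * V * \<rho> x0 powr ?d)"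
        using log_test_central[OF r rho_pos[of x0]] r by (simp add: max_def)
      also have "\<dots> \<le> ennreal (16 * V * (1 / c_supp * s) powr ?d)"
        using rs rho_pos[of x0] V_pos by (intro ennreal_leI mult_left_mono powr_mono2) auto
      also have "16 * V * (1 / c_supp * s) powr ?d = (16 * (1 / c_supp) powr ?d) * V * s powr ?d"
        using s c_supp_pos by (subst powr_mult) auto
      also have "ennreal \<dots> \<le> ennreal (?n * s powr 0 * wmeas w (ball z s))" by (rule A[OF s]) auto
      finally show ?thesis .
    qed
  qed
qed

lemma log_test_avg:
  assumes r: "0 < r" "8 * r \<le> \<rho> x0"
  shows "1/3 * ln (\<rho> x0 / r) \<le> avg (log_test x0 r) (ball x0 (3 * r))"
proof (rule avg_ge_const)
  show "loc_integrable (log_test x0 r)" by (rule log_test_loc_integrable) (use r in auto)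
  fix y assume "y \<in> ball x0 (3 * r)"
  then have "norm (y - x0) \<le> 3 * r" by (simp add: dist_norm norm_minus_commute)
  then have "max r (min (\<rho> x0) (norm (y - x0))) \<le> 3 * r" using r by auto
  then have "ln (max r (min (\<rho> x0) (norm (y - x0)))) \<le> ln (3 * r)" using r by (subst ln_le_cancel_iff) auto
  then have 1: "ln (\<rho> x0) - ln (3 * r) \<le> log_test x0 r y" by (simp add: log_test_def)
  define t where "t = \<rho> x0 / r"
  have t: "8 \<le> t" using r by (simp add: t_def field_simps)
  \<comment> \<open>This says t \<le> (t/3)^3: passing from \<rho>/r to \<rho>/(3r) costs at most a
    factor 3 in the logarithm.\<close>
  have "27 * t \<le> t * t * t"
  proof -
    have "8 * 8 \<le> t * t" using t by (intro mult_mono) auto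
    then have "27 * t \<le> (t * t) * t" using t by (intro mult_right_mono) auto
    then show ?thesis .
  qed
  then have "t \<le> (t / 3) ^ 3" by (simp add: power3_eq_cube)
  then have "ln t \<le> ln ((t / 3) ^ 3)" using t by (subst ln_le_cancel_iff) auto
  also have "\<dots> = 3 * ln (t / 3)" using t by (simp add: ln_realpow)
  also have "ln (t / 3) = ln (\<rho> x0) - ln (3 * r)" using r rho_pos[of x0] by (simp add: t_def ln_div ln_mult)
  finally have 2: "ln t \<le> 3 * (ln (\<rho> x0) - ln (3 * r))" .
  define D where "D = ln (\<rho> x0) - ln (3 * r)"
  have "1/3 * ln t \<le> D" "D \<le> log_test x0 r y" using 1 2 unfolding D_def[symmetric] by auto
  then show "1/3 * ln (\<rho> x0 / r) \<le> log_test x0 r y" unfolding t_def by (rule order_trans)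
qed (use r in simp)

definition power_test :: "real \<Rightarrow> 'a \<Rightarrow> 'a \<Rightarrow> real" where
  "power_test \<gamma> x0 y = max 0 (\<rho> x0 powr \<gamma> - norm (y - x0) powr \<gamma>)"

lemma power_test_bounds: "0 \<le> power_test \<gamma> x0 y" "power_test \<gamma> x0 y \<le> \<rho> x0 powr \<gamma>"
  by (auto simp: power_test_def)

lemma power_test_loc_integrable: "loc_integrable (power_test \<gamma> x0)"
proof (rule loc_integrable_continuous_bounded)
  show "power_test \<gamma> x0 \<in> borel_measurable lebesgue" unfolding power_test_def by measurable
  show "\<bar>power_test \<gamma> x0 y\<bar> \<le> \<rho> x0 powr \<gamma>" for y using power_test_bounds[of \<gamma> x0 y] by simp
qed

text \<open>Hoelder continuity of order \<gamma> bounds the oscillation by s^\<gamma> |B|, and the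
  lower bound on w turns s^\<gamma> s^d = s^\<alpha> s^(d + \<gamma> - \<alpha>) into s^\<alpha>
  w(B).\<close>

lemma power_test_bmo:
  assumes ga: "0 < \<gamma>" "\<gamma> \<le> 1" and c0: "0 < c0" and wt: "weight w"
    and W: "\<And>z s. 0 < s \<Longrightarrow> c0 * s powr (real DIM('a) + \<gamma> - \<alpha>) \<le> wmeas w (ball z s)"
  shows "bmo \<alpha> w (power_test \<gamma> x0) ((2 + (1 / c_supp) powr \<gamma>) * V / c0)"
proof -
  let ?d = "real DIM('a)" and ?f = "power_test \<gamma> x0"
  let ?n = "(2 + (1 / c_supp) powr \<gamma>) * V / c0"
  note fl = power_test_loc_integrable[of \<gamma> x0]
  have A: "ennreal (b * s powr \<gamma> * (V * s powr ?d)) \<le> ennreal (?n * s powr \<alpha> * wmeas w (ball z s))"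
    if s: "0 < s" and b: "0 \<le> b" "b \<le> 2 + (1 / c_supp) powr \<gamma>" for b z s
  proof (rule ennreal_leI)
    have "s powr \<gamma> * s powr ?d = s powr \<alpha> * s powr (?d + \<gamma> - \<alpha>)" by (simp add: add.commute flip: powr_add)
    then have "b * s powr \<gamma> * (V * s powr ?d) = b * V / c0 * s powr \<alpha> * (c0 * s powr (?d + \<gamma> - \<alpha>))" using c0 by (simp add: mult_ac)
    also have "\<dots> \<le> ?n * s powr \<alpha> * wmeas w (ball z s)"
      using b V_pos c0 W[OF s] by (intro mult_mono divide_right_mono mult_right_mono) auto
    finally show "b * s powr \<gamma> * (V * s powr ?d) \<le> ?n * s powr \<alpha> * wmeas w (ball z s)" .
  qed
  show ?thesis
    unfolding bmo_def
  proof (intro conjI allI impI fl)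
    show "0 \<le> ?n" using V_pos c0 by simp
    fix z :: 'a and s :: real assume s: "0 < s"
    have "nn_abs (\<lambda>y. ?f y - avg ?f (ball z s)) (ball z s) \<le> 2 * nn_abs (\<lambda>y. ?f y - ?f z) (ball z s)" by (rule osc_le_twice[OF fl s])
    also have "nn_abs (\<lambda>y. ?f y - ?f z) (ball z s) \<le> nn_abs (\<lambda>_. s powr \<gamma>) (ball z s)"
    proof (rule nn_abs_mono_fun)
      fix y assume y: "y \<in> ball z s"
      have "\<bar>?f y - ?f z\<bar> \<le> \<bar>norm (y - x0) powr \<gamma> - norm (z - x0) powr \<gamma>\<bar>" by (simp add: power_test_def)
      also have "\<dots> \<le> \<bar>norm (y - x0) - norm (z - x0)\<bar> powr \<gamma>" by (rule powr_diff_abs_le) (use ga in auto)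
      also have "\<dots> \<le> s powr \<gamma>"
        using y norm_triangle_ineq3[of "y - x0" "z - x0"] ga by (intro powr_mono2) (auto simp: dist_norm norm_minus_commute)
      finally show "\<bar>?f y - ?f z\<bar> \<le> \<bar>s powr \<gamma>\<bar>" by simp
    qed
    also have "\<dots> = ennreal (s powr \<gamma> * (V * s powr ?d))"
      using s V_pos by (simp add: nn_abs_const emeasure_ball_V ennreal_mult del: emeasure_completion)
    finally have "nn_abs (\<lambda>y. ?f y - avg ?f (ball z s)) (ball z s) \<le> 2 * ennreal (s powr \<gamma> * (V * s powr ?d))"
      by (simp add: mult_left_mono)
    also have "\<dots> = ennreal (2 * s powr \<gamma> * (V * s powr ?d))" using V_pos by (simp add: mult.assoc flip: ennreal_mult'' ennreal_numeral)
    also have "\<dots> \<le> ennreal (?n * s powr \<alpha> * wmeas w (ball z s))" by (rule A[OF s]) auto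
    finally show "nn_abs (\<lambda>y. ?f y - avg ?f (ball z s)) (ball z s) \<le> ennreal (?n * s powr \<alpha> * wmeas w (ball z s))" .
  next
    fix z :: 'a and s :: real assume zs: "\<rho> z \<le> s"
    have s: "0 < s" using zs rho_pos[of z] by linarith
    have sup: "?f y = 0" if "\<not> dist x0 y < \<rho> x0" for y
    proof -
      have "\<rho> x0 powr \<gamma> \<le> norm (y - x0) powr \<gamma>"
        using that ga rho_pos[of x0] by (intro powr_mono2) (auto simp: dist_norm norm_minus_commute)
      then show ?thesis by (simp add: power_test_def)
    qed
    show "nn_abs ?f (ball z s) \<le> ennreal (?n * s powr \<alpha> * wmeas w (ball z s))"
    proof (cases "\<exists>y\<in>ball z s. dist x0 y < \<rho> x0")
      case False
      then have "nn_abs ?f (ball z s) \<le> nn_abs (\<lambda>_. 0) (ball z s)" by (intro nn_abs_mono_fun) (use sup in auto)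
      then show ?thesis by (simp add: nn_abs_def)
    next
      case True
      then have cs: "c_supp * \<rho> x0 \<le> s" unfolding c_supp_def using support_scale[OF _ _ zs] by blast
      then have rs: "\<rho> x0 \<le> 1 / c_supp * s" using c_supp_pos by (simp add: field_simps)
      have "\<rho> x0 powr \<gamma> \<le> (1 / c_supp * s) powr \<gamma>" using rs rho_pos[of x0] ga by (intro powr_mono2) auto
      also have "\<dots> = (1 / c_supp) powr \<gamma> * s powr \<gamma>" using s c_supp_pos by (subst powr_mult) auto
      finally have b: "\<rho> x0 powr \<gamma> \<le> (1 / c_supp) powr \<gamma> * s powr \<gamma>" .
      have "nn_abs ?f (ball z s) \<le> nn_abs (\<lambda>_. (1 / c_supp) powr \<gamma> * s powr \<gamma>) (ball z s)"
        by (rule nn_abs_mono_fun) (use power_test_bounds[of \<gamma> x0] b in \<open>auto intro: order_trans\<close>)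
      also have "\<dots> = ennreal ((1 / c_supp) powr \<gamma> * s powr \<gamma> * (V * s powr ?d))"
        using s V_pos by (simp add: nn_abs_const emeasure_ball_V ennreal_mult del: emeasure_completion)
      also have "\<dots> \<le> ennreal (?n * s powr \<alpha> * wmeas w (ball z s))" by (rule A[OF s]) auto
      finally show ?thesis .
    qed
  qed
qed

lemma power_test_avg:
  assumes ga: "0 < \<gamma>" and r: "0 < r" "8 * r \<le> \<rho> x0"
  shows "(1 - (3/8) powr \<gamma>) * \<rho> x0 powr \<gamma> \<le> avg (power_test \<gamma> x0) (ball x0 (3 * r))"
proof (rule avg_ge_const[OF power_test_loc_integrable])
  fix y assume "y \<in> ball x0 (3 * r)"
  then have "norm (y - x0) \<le> 3/8 * \<rho> x0" using r by (simp add: dist_norm norm_minus_commute)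
  then have "norm (y - x0) powr \<gamma> \<le> (3/8 * \<rho> x0) powr \<gamma>" using ga by (intro powr_mono2) auto
  also have "\<dots> = (3/8) powr \<gamma> * \<rho> x0 powr \<gamma>" using rho_pos[of x0] by (subst powr_mult) auto
  finally show "(1 - (3/8) powr \<gamma>) * \<rho> x0 powr \<gamma> \<le> power_test \<gamma> x0 y" by (simp add: power_test_def left_diff_distrib)
qed (use r in simp)

end

lemma ennreal_mult_le_cancel:
  assumes "0 < p" "0 \<le> q" "ennreal p * X \<le> ennreal q" shows "X \<le> ennreal (q / p)"
proof -
  have "X = ennreal (1 / p) * (ennreal p * X)"
    using assms(1) by (simp flip: mult.assoc ennreal_mult)
  also have "\<dots> \<le> ennreal (1 / p) * ennreal q" using assms(3) by (rule mult_left_mono) simp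
  also have "\<dots> = ennreal (q / p)" using assms by (simp flip: ennreal_mult)
  finally show ?thesis .
qed

section \<open>Lacunary sequences of centres and the gliding hump\<close>

lemma lacunaryI:
  fixes x :: "nat \<Rightarrow> 'a::euclidean_space"
  assumes pos: "\<And>i. 0 < norm (x i - p)"
    and sep: "\<And>i j. i < j \<Longrightarrow> 4 * norm (x i - p) < norm (x j - p) \<or> 4 * norm (x j - p) < norm (x i - p)"
  shows "lacunary p (range x)"
proof -
  \<comment> \<open>If the balls met, the larger distance to p would be less than 3 times the
    smaller one.\<close>
  have disj: "ball (x i) (norm (x i - p) / 2) \<inter> ball (x j) (norm (x j - p) / 2) = {}"
    if "4 * norm (x j - p) < norm (x i - p)" for i j
  proof (rule ccontr)
    assume "\<not> ?thesis"
    then obtain y where y: "norm (y - x i) < norm (x i - p) / 2" "norm (y - x j) < norm (x j - p) / 2"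
      by (auto simp: dist_norm norm_minus_commute)
    have "norm (x i - p) \<le> norm (y - x i) + norm (y - p)" using norm_triangle_ineq4[of "y - p" "y - x i"] by simp
    moreover have "norm (y - p) \<le> norm (y - x j) + norm (x j - p)" using norm_triangle_ineq[of "y - x j" "x j - p"] by simp
    ultimately show False using y that pos[of i] by linarith
  qed
  have "ball s (norm (s - p) / 2) \<inter> ball t (norm (t - p) / 2) = {}" if "s \<in> range x" "t \<in> range x" "s \<noteq> t" for s t
  proof -
    from \<open>s \<in> range x\<close> obtain i where i: "s = x i" by blast
    from \<open>t \<in> range x\<close> obtain j where j: "t = x j" by blast
    note ij = i j
    then have "i \<noteq> j" using that by auto
    then have "4 * norm (x i - p) < norm (x j - p) \<or> 4 * norm (x j - p) < norm (x i - p)"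
      using sep[of i j] sep[of j i] by (cases "i < j") auto
    then show ?thesis using disj[of i j] disj[of j i] ij by blast
  qed
  moreover have "p \<notin> range x"
  proof
    assume "p \<in> range x"
    then obtain i where "p = x i" by blast
    then show False using pos[of i] by simp
  qed
  ultimately show ?thesis by (simp add: lacunary_def disjoint_family_on_def)
qed

lemma lacunary_empty: "lacunary p {}"
  by (simp add: lacunary_def disjoint_family_on_def)

text \<open>A gliding hump: points at which the bound fails worse and worse either accumulate or escape to
  infinity, and in both cases they contain a lacunary sequence.\<close>

lemma lacunary_uniform:
  fixes P :: "'a::euclidean_space \<Rightarrow> real \<Rightarrow> bool"
  assumes mono: "\<And>x C C'. P x C \<Longrightarrow> C \<le> C' \<Longrightarrow> P x C'"
    and lac: "\<And>p X. lacunary p X \<Longrightarrow> \<exists>C. \<forall>x\<in>insert p X. P x C"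
  shows "\<exists>C. \<forall>x. P x C"
proof (rule ccontr)
  assume no: "\<not> ?thesis"
  define F where "F n = {x. \<not> P x (real n)}" for n
  have ne: "\<exists>x. x \<in> F n" for n using no by (auto simp: F_def)
  have Fdec: "F n \<subseteq> F k" if "k \<le> n" for k n using that mono by (auto simp: F_def)
  \<comment> \<open>A lacunary sequence whose n-th term is bad for the constant n is impossible,
    because one constant serves the whole sequence.\<close>
  have contra: False if x: "\<And>n. x n \<in> F n" and L: "lacunary p (range x)" for x p
  proof -
    obtain C where C: "\<forall>y\<in>insert p (range x). P y C" using lac[OF L] by blast
    obtain n :: nat where "C \<le> real n" using real_arch_simple by blast
    then have "P (x n) (real n)" using C mono by blast
    then show False using x[of n] by (simp add: F_def)
  qed
  \<comment> \<open>The empty set is lacunary, so the hypothesis contains a bound at each single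
    point.\<close>
  have fin: "\<exists>n. p \<notin> F n" for p
  proof -
    obtain C where C: "P p C" using lac[OF lacunary_empty[of p]] by blast
    obtain n :: nat where "C \<le> real n" using real_arch_simple by blast
    then have "P p (real n)" using C mono by blast
    then show ?thesis by (auto simp: F_def)
  qed
  show False
  proof (cases "\<exists>N R. F N \<subseteq> cball 0 R")
    case True
    then obtain N R where NR: "F N \<subseteq> cball 0 R" by blast
    have "\<forall>n. \<exists>x. x \<in> F (N + n)" using ne by blast
    then obtain z where "\<forall>n. z n \<in> F (N + n)" using choice[of "\<lambda>n x. x \<in> F (N + n)"] by blast
    then have z: "z n \<in> F (N + n)" for n by blast
    have "z n \<in> cball 0 R" for n using z[of n] Fdec[of N "N + n"] NR by auto
    then obtain p r where r: "strict_mono r" "(z \<circ> r) \<longlonglongrightarrow> p"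
      using compact_cball[of 0 R] unfolding compact_def by blast
    have near: "\<exists>y. y \<in> F n \<and> 0 < norm (y - p) \<and> norm (y - p) < e" if e: "0 < e" for n e
    proof -
      \<comment> \<open>Terms far out in the sequence belong to F n0, which omits p; hence they
        differ from p, as a lacunary sequence about p requires.\<close>
      obtain n0 where n0: "p \<notin> F n0" using fin by blast
      have "\<forall>\<^sub>F k in sequentially. dist ((z \<circ> r) k) p < e" using r(2) e by (rule tendstoD)
      then obtain k0 where k0: "\<And>k. k0 \<le> k \<Longrightarrow> dist (z (r k)) p < e" by (auto simp: eventually_sequentially)
      define k where "k = max k0 (max n n0)"
      have "k \<le> r k" by (rule seq_suble[OF r(1)])
      then have k: "n \<le> N + r k" "n0 \<le> N + r k" "k0 \<le> k" by (auto simp: k_def)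
      have "z (r k) \<in> F n" "z (r k) \<in> F n0" using z[of "r k"] Fdec k by blast+
      moreover have "z (r k) \<noteq> p" using calculation n0 by auto
      ultimately show ?thesis using k0[OF k(3)] by (intro exI[of _ "z (r k)"]) (auto simp: dist_norm)
    qed
    have "\<exists>x. \<forall>n. (x n \<in> F n \<and> 0 < norm (x n - p)) \<and> 4 * norm (x (Suc n) - p) < norm (x n - p)"
    proof (rule dependent_nat_choice)
      show "\<exists>x. x \<in> F 0 \<and> 0 < norm (x - p)" using near[of 1 0] by auto
      fix x n assume "x \<in> F n \<and> 0 < norm (x - p)"
      then show "\<exists>y. (y \<in> F (Suc n) \<and> 0 < norm (y - p)) \<and> 4 * norm (y - p) < norm (x - p)"
        using near[of "norm (x - p) / 4" "Suc n"] by auto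
    qed
    then obtain x where x: "\<And>n. x n \<in> F n" "\<And>n. 0 < norm (x n - p)" "\<And>n. 4 * norm (x (Suc n) - p) < norm (x n - p)" by blast
    have "4 * norm (x j - p) < norm (x i - p)" if "i < j" for i j
      using that
    proof (induction j)
      case (Suc j)
      show ?case
      proof (cases "i = j")
        case False
        then have "4 * norm (x j - p) < norm (x i - p)" using Suc by simp
        then show ?thesis using x(3)[of j] x(2)[of j] by linarith
      qed (use x(3) in simp)
    qed simp
    then have "lacunary p (range x)" by (intro lacunaryI x(2)) blast
    then show False by (rule contra[OF x(1)])
  next
    case False
    \<comment> \<open>Every F n is unbounded, so bad points can be chosen with rapidly growing
      norms; the origin then plays the part of p.\<close>
    have far: "\<exists>y. y \<in> F n \<and> R < norm y" for n R using False by (auto simp: subset_iff not_le)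
    have "\<exists>x. \<forall>n. (x n \<in> F n \<and> 0 < norm (x n - 0)) \<and> 4 * norm (x n - 0) < norm (x (Suc n) - 0)"
    proof (rule dependent_nat_choice)
      show "\<exists>x. x \<in> F 0 \<and> 0 < norm (x - 0)" using far[of 0 0] by auto
      fix x n assume "x \<in> F n \<and> 0 < norm (x - 0)"
      obtain y where "y \<in> F (Suc n)" "4 * norm x < norm y" using far by blast
      moreover have "0 < norm y" using \<open>4 * norm x < norm y\<close> norm_ge_zero[of x] by linarith
      ultimately show "\<exists>y. (y \<in> F (Suc n) \<and> 0 < norm (y - 0)) \<and> 4 * norm (x - 0) < norm (y - 0)"
        by (intro exI[of _ y]) (simp only: diff_zero simp_thms)
    qed
    then obtain x where x: "\<And>n. x n \<in> F n" "\<And>n. 0 < norm (x n - 0)" "\<And>n. 4 * norm (x n - 0) < norm (x (Suc n) - 0)" by blast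
    have "4 * norm (x i - 0) < norm (x j - 0)" if "i < j" for i j
      using that
    proof (induction j)
      case (Suc j)
      show ?case
      proof (cases "i = j")
        case False
        then have "4 * norm (x i - 0) < norm (x j - 0)" using Suc by simp
        then show ?thesis using x(3)[of j] x(2)[of j] by linarith
      qed (use x(3) in simp)
    qed simp
    then have "lacunary 0 (range x)" by (intro lacunaryI x(2)) blast
    then show False by (rule contra[OF x(1)])
  qed
qed

section \<open>Condition (i) at a single centre, from boundedness and back\<close>

context scz_bmo
begin

lemma gamma_le1: "\<gamma> \<le> 1"
  using exponents nu_nonneg delta_le1 by (simp add: \<gamma>_def)

text \<open>The exponent d + \<gamma> - \<alpha> is d \<kappa>. The point is the order of
  quantifiers: the bound n and the constant c4 are fixed before the weight, x0 and r, while the mean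
  grows like \<open>Theta\<close>. So the upper estimate \<open>avg_bound\<close> has the right
  order of growth.\<close>

lemma test_function:
  assumes c0: "0 < c0"
  shows "\<exists>n c4. 0 \<le> n \<and> 0 < c4 \<and> (\<forall>(w::'a \<Rightarrow> real) x0 r. weight w \<longrightarrow> (\<forall>z s. 0 < s \<longrightarrow> c0 * s powr (real DIM('a) + \<gamma> - \<alpha>) \<le> wmeas w (ball z s)) \<longrightarrow>
     0 < r \<longrightarrow> 8 * r \<le> \<rho> x0 \<longrightarrow> (\<exists>f. bmo \<alpha> w f n \<and> c4 * Theta (\<rho> x0 / r) * r powr \<gamma> \<le> avg f (ball x0 (3 * r))))"
proof (cases "0 < \<gamma>")
  case True
  show ?thesis
  proof (rule exI[of _ "(2 + (1 / c_supp) powr \<gamma>) * V / c0"], rule exI[of _ "1 - (3/8) powr \<gamma>"], rule conjI, rule_tac [2] conjI, rule_tac [3] allI, rule_tac [3] allI, rule_tac [3] allI, rule_tac [3] impI, rule_tac [3] impI, rule_tac [3] impI, rule_tac [3] impI)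
    show "0 \<le> (2 + (1 / c_supp) powr \<gamma>) * V / c0" using V_pos c0 by simp
    have "(3/8) powr \<gamma> < (3/8::real) powr 0" using True by (intro powr_less_mono') auto
    then show "0 < 1 - (3/8::real) powr \<gamma>" by simp
    fix w :: "'a \<Rightarrow> real" and x0 :: 'a and r :: real
    assume w: "weight w" "\<forall>z s. 0 < s \<longrightarrow> c0 * s powr (real DIM('a) + \<gamma> - \<alpha>) \<le> wmeas w (ball z s)" and r: "0 < r" "8 * r \<le> \<rho> x0"
    have "bmo \<alpha> w (power_test \<gamma> x0) ((2 + (1 / c_supp) powr \<gamma>) * V / c0)"
      by (rule power_test_bmo[OF True gamma_le1 c0 w(1)]) (use w(2) in blast)
    moreover have "Theta (\<rho> x0 / r) * r powr \<gamma> = \<rho> x0 powr \<gamma>"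
      using True r rho_pos[of x0] by (simp add: Theta_def powr_divide)
    ultimately show "\<exists>f. bmo \<alpha> w f ((2 + (1 / c_supp) powr \<gamma>) * V / c0) \<and> (1 - (3/8) powr \<gamma>) * Theta (\<rho> x0 / r) * r powr \<gamma> \<le> avg f (ball x0 (3 * r))"
      using power_test_avg[OF True r] by (intro exI[of _ "power_test \<gamma> x0"]) (simp add: mult.assoc)
  qed
next
  case False
  then have g: "\<gamma> = 0" using gamma_nonneg by simp
  then have al: "\<alpha> = 0" using alpha_nonneg kappa_ge1 by (simp add: \<gamma>_def add_nonneg_eq_0_iff)
  let ?n = "(32 * 3 powr real DIM('a) + 16 * (1 / c_supp) powr real DIM('a)) * V / c0"
  show ?thesis
  proof (rule exI[of _ ?n], rule exI[of _ "1/3"], rule conjI, rule_tac [2] conjI, rule_tac [3] allI, rule_tac [3] allI, rule_tac [3] allI, rule_tac [3] impI, rule_tac [3] impI, rule_tac [3] impI, rule_tac [3] impI)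
    show "0 \<le> ?n" using V_pos c0 by simp
    show "0 < (1/3::real)" by simp
    fix w :: "'a \<Rightarrow> real" and x0 :: 'a and r :: real
    assume w: "weight w" "\<forall>z s. 0 < s \<longrightarrow> c0 * s powr (real DIM('a) + \<gamma> - \<alpha>) \<le> wmeas w (ball z s)" and r: "0 < r" "8 * r \<le> \<rho> x0"
    have "bmo 0 w (log_test x0 r) ?n"
      by (rule log_test_bmo[OF r(1) _ c0 w(1)]) (use w(2) r g al in auto)
    then have b: "bmo \<alpha> w (log_test x0 r) ?n" by (simp only: al)
    have "1/3 * Theta (\<rho> x0 / r) * r powr \<gamma> = 1/3 * ln (\<rho> x0 / r)"
      using r(1) by (simp add: Theta_def g)
    then have "1/3 * Theta (\<rho> x0 / r) * r powr \<gamma> \<le> avg (log_test x0 r) (ball x0 (3 * r))"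
      using log_test_avg[OF r] by linarith
    with b show "\<exists>f. bmo \<alpha> w f ?n \<and> 1/3 * Theta (\<rho> x0 / r) * r powr \<gamma> \<le> avg f (ball x0 (3 * r))" by blast
  qed
qed

text \<open>Condition (i) at one centre, for the fixed representative \<open>ext\<close>, so that
  the gliding hump can treat centres one at a time. The range of radii is that of the oscillation
  estimates.\<close>

definition T1_at :: "'a \<Rightarrow> real \<Rightarrow> bool" where
  "T1_at x C \<longleftrightarrow> (\<forall>r. 0 < r \<longrightarrow> 8 * r \<le> \<rho> x \<longrightarrow>
     nn_abs (\<lambda>y. ext (\<lambda>_. 1) y - avg (ext (\<lambda>_. 1)) (ball x r)) (ball x r) \<le> ennreal (C * r powr (real DIM('a) + \<nu>) / Theta (\<rho> x / r)))"

lemma Theta_arg: "0 < r \<Longrightarrow> 8 * r \<le> \<rho> x \<Longrightarrow> 0 < Theta (\<rho> x / r)"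
  by (rule Theta_pos) (simp add: field_simps)

lemma T1_at_mono: "T1_at x C \<Longrightarrow> C \<le> C' \<Longrightarrow> T1_at x C'"
  unfolding T1_at_def
proof (intro allI impI)
  fix r assume a: "\<forall>r. 0 < r \<longrightarrow> 8 * r \<le> \<rho> x \<longrightarrow>
     nn_abs (\<lambda>y. ext (\<lambda>_. 1) y - avg (ext (\<lambda>_. 1)) (ball x r)) (ball x r) \<le> ennreal (C * r powr (real DIM('a) + \<nu>) / Theta (\<rho> x / r))"
    and C: "C \<le> C'" and r: "0 < r" "8 * r \<le> \<rho> x"
  have "C * r powr (real DIM('a) + \<nu>) / Theta (\<rho> x / r) \<le> C' * r powr (real DIM('a) + \<nu>) / Theta (\<rho> x / r)"
    using C Theta_arg[OF r] by (intro divide_right_mono mult_right_mono) auto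
  then show "nn_abs (\<lambda>y. ext (\<lambda>_. 1) y - avg (ext (\<lambda>_. 1)) (ball x r)) (ball x r) \<le> ennreal (C' * r powr (real DIM('a) + \<nu>) / Theta (\<rho> x / r))"
    using a r by (meson ennreal_leI order_trans)
qed

lemma ext_one: "is_extended_value \<rho> T K (\<lambda>_. 1) (ext (\<lambda>_. 1))"
  by (rule ext_is_value[OF loc_integrable_const tail_fin_one])

text \<open>Dividing \<open>reverse_bound\<close> by the large mean of a test function gives (i) at
  x0. The lower bound on w is used on all balls, for the norm of the test function; the upper bound
  only on balls about x0, which is why the bad centres are placed in the set from which distances
  are taken.\<close>

lemma T1_at_of_bounded:
  assumes c0: "0 < c0" and c1: "0 \<le> c1" and B: "0 \<le> B"
  shows "\<exists>C. \<forall>w x0. dbl \<kappa> c3 CD w \<longrightarrow> ainf \<phi> w \<longrightarrow> (\<forall>z s. 0 < s \<longrightarrow> c0 * s powr (real DIM('a) + \<gamma> - \<alpha>) \<le> wmeas w (ball z s)) \<longrightarrow>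
     (\<forall>s. 0 < s \<longrightarrow> wmeas w (ball x0 s) \<le> c1 * s powr (real DIM('a) + \<gamma> - \<alpha>)) \<longrightarrow>
     (\<forall>f n. bmo \<alpha> w f n \<longrightarrow> (\<exists>g. is_extended_value \<rho> T K f g \<and> bmo (\<alpha> + \<nu>) w g (B * n))) \<longrightarrow> T1_at x0 C"
proof -
  from reverse_bound obtain A where "0 \<le> A \<and> (\<forall>w f n g ng g1 x r. dbl \<kappa> c3 CD w \<longrightarrow> ainf \<phi> w \<longrightarrow> bmo \<alpha> w f n \<longrightarrow> is_extended_value \<rho> T K f g \<longrightarrow>
     bmo (\<alpha> + \<nu>) w g ng \<longrightarrow> is_extended_value \<rho> T K (\<lambda>_. 1) g1 \<longrightarrow> 0 < r \<longrightarrow> 8 * r \<le> \<rho> x \<longrightarrow>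
     ennreal \<bar>avg f (ball x (3 * r))\<bar> * nn_abs (\<lambda>y. g1 y - avg g1 (ball x r)) (ball x r)
       \<le> ennreal (A * (n + ng) * r powr (\<nu> + \<alpha>) * wmeas w (ball x r)))" ..
  note A = this[THEN conjunct1] this[THEN conjunct2, rule_format]
  from test_function[OF c0] obtain n c4 where n: "0 \<le> n" "0 < c4"
    and tf: "\<And>w x0 r. weight w \<Longrightarrow> (\<forall>z s. 0 < s \<longrightarrow> c0 * s powr (real DIM('a) + \<gamma> - \<alpha>) \<le> wmeas w (ball z s)) \<Longrightarrow>
     0 < r \<Longrightarrow> 8 * r \<le> \<rho> x0 \<Longrightarrow> (\<exists>f. bmo \<alpha> w f n \<and> c4 * Theta (\<rho> x0 / r) * r powr \<gamma> \<le> avg f (ball x0 (3 * r)))"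
    by blast
  define C where "C = A * (n + B * n) * c1 / c4"
  show ?thesis
  proof (rule exI[of _ C], intro allI impI)
    fix w x0 assume w: "dbl \<kappa> c3 CD w" "ainf \<phi> w" and lo: "\<forall>z s. 0 < s \<longrightarrow> c0 * s powr (real DIM('a) + \<gamma> - \<alpha>) \<le> wmeas w (ball z s)"
      and up: "\<forall>s. 0 < s \<longrightarrow> wmeas w (ball x0 s) \<le> c1 * s powr (real DIM('a) + \<gamma> - \<alpha>)"
      and bd: "\<forall>f n. bmo \<alpha> w f n \<longrightarrow> (\<exists>g. is_extended_value \<rho> T K f g \<and> bmo (\<alpha> + \<nu>) w g (B * n))"
    have wt: "weight w" using w by (simp add: dbl_def)
    show "T1_at x0 C"
      unfolding T1_at_def
    proof (intro allI impI)
      fix r assume r: "0 < r" "8 * r \<le> \<rho> x0"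
      let ?g1 = "ext (\<lambda>_. 1)"
      from tf[OF wt lo r] obtain f where f: "bmo \<alpha> w f n" "c4 * Theta (\<rho> x0 / r) * r powr \<gamma> \<le> avg f (ball x0 (3 * r))" by blast
      from bd f(1) obtain g where g: "is_extended_value \<rho> T K f g" "bmo (\<alpha> + \<nu>) w g (B * n)" by blast
      let ?O = "nn_abs (\<lambda>y. ?g1 y - avg ?g1 (ball x0 r)) (ball x0 r)"
      define p where "p = c4 * Theta (\<rho> x0 / r) * r powr \<gamma>"
      have th: "0 < Theta (\<rho> x0 / r)" by (rule Theta_arg[OF r])
      have p: "0 < p" using n th r by (simp add: p_def)
      have nB: "0 \<le> A * (n + B * n)" using A(1) n B by simp
      have "ennreal p * ?O \<le> ennreal \<bar>avg f (ball x0 (3 * r))\<bar> * ?O"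
        using f(2) by (intro mult_right_mono ennreal_leI) (auto simp: p_def)
      also have "\<dots> \<le> ennreal (A * (n + B * n) * r powr (\<nu> + \<alpha>) * wmeas w (ball x0 r))"
        by (rule A(2)[OF w f(1) g ext_one r])
      also have "\<dots> \<le> ennreal (A * (n + B * n) * r powr (\<nu> + \<alpha>) * (c1 * r powr (real DIM('a) + \<gamma> - \<alpha>)))"
        using up r nB by (intro ennreal_leI mult_left_mono) auto
      finally have "?O \<le> ennreal (A * (n + B * n) * r powr (\<nu> + \<alpha>) * (c1 * r powr (real DIM('a) + \<gamma> - \<alpha>)) / p)"
        by (intro ennreal_mult_le_cancel[OF p]) (use nB c1 in auto)
      also have "A * (n + B * n) * r powr (\<nu> + \<alpha>) * (c1 * r powr (real DIM('a) + \<gamma> - \<alpha>)) / p = C * r powr (real DIM('a) + \<nu>) / Theta (\<rho> x0 / r)"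
      proof -
        have "r powr (\<nu> + \<alpha>) * r powr (real DIM('a) + \<gamma> - \<alpha>) = r powr (real DIM('a) + \<nu>) * r powr \<gamma>"
          by (simp add: algebra_simps flip: powr_add)
        then have "A * (n + B * n) * r powr (\<nu> + \<alpha>) * (c1 * r powr (real DIM('a) + \<gamma> - \<alpha>)) = A * (n + B * n) * c1 * (r powr (real DIM('a) + \<nu>) * r powr \<gamma>)"
          by (simp add: mult_ac)
        moreover have "q * (x * y) / (c4 * t * y) = q / c4 * x / t" if "y \<noteq> 0" for q x y t :: real
          using that by (simp add: field_simps)
        moreover have "A * (n + B * n) * c1 / c4 * r powr (real DIM('a) + \<nu>) / Theta (\<rho> x0 / r) = C * r powr (real DIM('a) + \<nu>) / Theta (\<rho> x0 / r)"
          by (simp add: C_def)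
        moreover have "r powr \<gamma> \<noteq> 0" using r by simp
        ultimately show ?thesis unfolding p_def by metis
      qed
      finally show "?O \<le> ennreal (C * r powr (real DIM('a) + \<nu>) / Theta (\<rho> x0 / r))" .
    qed
  qed
qed

lemma T1_rhs: "0 < r \<Longrightarrow> (if \<alpha> > 0 \<or> \<kappa> > 1 then (r / \<rho> x) powr (\<alpha> + real DIM('a) * (\<kappa> - 1)) else inverse (ln (\<rho> x / r))) = 1 / Theta (\<rho> x / r)"
proof -
  assume r: "0 < r"
  have iff: "(\<alpha> > 0 \<or> \<kappa> > 1) \<longleftrightarrow> 0 < \<gamma>"
  proof (cases "\<kappa> > 1")
    case True
    then have "0 < real DIM('a) * (\<kappa> - 1)" by simp
    then have "0 < \<gamma>" using alpha_nonneg unfolding \<gamma>_def by linarith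
    then show ?thesis using True by blast
  next
    case False
    then have "\<kappa> = 1" using kappa_ge1 by simp
    then have "\<gamma> = \<alpha>" unfolding \<gamma>_def by simp
    then show ?thesis using False by simp
  qed
  show ?thesis
    unfolding iff using r rho_pos[of x] by (auto simp: Theta_def \<gamma>_def[symmetric] powr_divide inverse_eq_divide)
qed

lemma vol_powr_nu: "0 < r \<Longrightarrow> vol (ball (x::'a) r) powr (1 + \<nu> / real DIM('a)) = V powr (1 + \<nu> / real DIM('a)) * r powr (real DIM('a) + \<nu>)"
proof -
  have "real DIM('a) * (1 + \<nu> / real DIM('a)) = real DIM('a) + \<nu>" by (simp add: distrib_left)
  then show "0 < r \<Longrightarrow> ?thesis" using V_pos by (simp add: vol_V powr_mult powr_powr)
qed

lemma T1_conditionI: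
  assumes "\<And>x. T1_at x C" shows "T1_condition \<rho> T K \<nu> \<alpha> \<kappa>"
proof -
  let ?g = "ext (\<lambda>_. 1)" and ?d = "real DIM('a)"
  have gl: "loc_integrable ?g" by (rule T1_loc_integrable[OF ext_one])
  from T1_size obtain A where "0 \<le> A \<and> (\<forall>g x r. is_extended_value \<rho> T K (\<lambda>_. 1) g \<longrightarrow> \<rho> x \<le> 8 * r \<longrightarrow> nn_abs g (ball x r) \<le> ennreal (A * r powr (?d + \<nu>)))" ..
  note A = this[THEN conjunct1] this[THEN conjunct2, rule_format, OF ext_one]
  define B where "B = \<bar>C\<bar> + 2 * A * Theta 8"
  have t8: "0 < Theta 8" by (rule Theta_pos) simp
  have B: "0 \<le> B" "\<bar>C\<bar> \<le> B" "2 * A * Theta 8 \<le> B" using A(1) t8 by (auto simp: B_def)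
  have osc: "(LINT y:ball x r|lebesgue. \<bar>?g y - avg ?g (ball x r)\<bar>) \<le> B * r powr (?d + \<nu>) / Theta (\<rho> x / r)"
    if r: "0 < r" "r \<le> \<rho> x / 2" for x r
  proof -
    have t: "2 \<le> \<rho> x / r" using r by (simp add: field_simps)
    then have th: "0 < Theta (\<rho> x / r)" by (auto simp: Theta_def)
    have "nn_abs (\<lambda>y. ?g y - avg ?g (ball x r)) (ball x r) \<le> ennreal (B * r powr (?d + \<nu>) / Theta (\<rho> x / r))"
    proof (cases "8 * r \<le> \<rho> x")
      case True
      have "T1_at x B" by (rule T1_at_mono[OF assms]) (use B in simp)
      then show ?thesis using True r by (simp add: T1_at_def)
    next
      \<comment> \<open>Between \<rho>/8 and \<rho>/2 the size of T1 replaces its oscillation. There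
        \<rho>/r lies between 2 and 8, so that \<open>Theta\<close> is positive and at most Theta
        8.\<close>
      case False
      have "nn_abs (\<lambda>y. ?g y - avg ?g (ball x r)) (ball x r) \<le> 2 * nn_abs (\<lambda>y. ?g y - 0) (ball x r)" by (rule osc_le_twice[OF gl r(1)])
      also have "\<dots> \<le> 2 * ennreal (A * r powr (?d + \<nu>))"
        using A(2)[of x r] False by (intro mult_left_mono) auto
      also have "\<dots> = ennreal (2 * A * Theta 8 * r powr (?d + \<nu>) / Theta 8)"
        using A(1) t8 by (simp flip: ennreal_mult'' ennreal_numeral)
      also have "\<dots> \<le> ennreal (B * r powr (?d + \<nu>) / Theta (\<rho> x / r))"
      proof (intro ennreal_leI frac_le mult_right_mono)
        have "\<rho> x / r \<le> 8" using False r by (simp add: field_simps)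
        then show "Theta (\<rho> x / r) \<le> Theta 8" using t by (auto simp: Theta_def intro!: powr_mono2)
      qed (use B th in auto)
      finally show ?thesis .
    qed
    then show ?thesis using B th by (intro set_integral_abs_le_nn_abs) auto
  qed
  show ?thesis
    unfolding T1_condition_def
  proof (rule exI[of _ ?g], rule conjI[OF ext_one], rule exI[of _ "B / V powr (1 + \<nu> / ?d)"], intro allI impI conjI)
    fix x r assume r: "0 < r" "r \<le> \<rho> x / 2"
    show "set_integrable lebesgue (ball x r) ?g" by (rule loc_integrable_ball[OF gl])
    have "(LINT y:ball x r|lebesgue. \<bar>?g y - avg ?g (ball x r)\<bar>) / vol (ball x r) powr (1 + \<nu> / ?d)
       \<le> B * r powr (?d + \<nu>) / Theta (\<rho> x / r) / vol (ball x r) powr (1 + \<nu> / ?d)"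
      using osc[OF r] by (rule divide_right_mono) simp
    also have "\<dots> = B / V powr (1 + \<nu> / ?d) * (1 / Theta (\<rho> x / r))"
      using r V_pos unfolding vol_powr_nu[OF r(1)] by simp
    finally show "(LINT y:ball x r|lebesgue. \<bar>?g y - avg ?g (ball x r)\<bar>) / vol (ball x r) powr (1 + \<nu> / ?d)
       \<le> B / V powr (1 + \<nu> / ?d) * (if \<alpha> > 0 \<or> \<kappa> > 1 then (r / \<rho> x) powr (\<alpha> + ?d * (\<kappa> - 1)) else inverse (ln (\<rho> x / r)))"
      unfolding T1_rhs[OF r(1)] .
  qed
qed

text \<open>The bound \<open>A\<close> comes before the weight; this is the uniformity in x0 that
  condition (iii) asks for.\<close>

lemma T1_condition_bounded:
  assumes "T1_condition \<rho> T K \<nu> \<alpha> \<kappa>"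
  shows "\<exists>A. \<forall>w. dbl \<kappa> c3 CD w \<longrightarrow> ainf \<phi> w \<longrightarrow> BMO_bounded_by \<rho> T K \<alpha> (\<alpha> + \<nu>) w A"
proof -
  let ?d = "real DIM('a)"
  from assms obtain g C where g: "is_extended_value \<rho> T K (\<lambda>_. 1) g"
    and C: "\<And>x r. 0 < r \<Longrightarrow> r \<le> \<rho> x / 2 \<Longrightarrow> (LINT y:ball x r|lebesgue. \<bar>g y - avg g (ball x r)\<bar>) / vol (ball x r) powr (1 + \<nu> / ?d)
       \<le> C * (if \<alpha> > 0 \<or> \<kappa> > 1 then (r / \<rho> x) powr (\<alpha> + ?d * (\<kappa> - 1)) else inverse (ln (\<rho> x / r)))"
    unfolding T1_condition_def by blast
  have gl: "loc_integrable g" by (rule T1_loc_integrable[OF g])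
  define D where "D = \<bar>C\<bar> * V powr (1 + \<nu> / ?d)"
  have D: "0 \<le> D" by (simp add: D_def)
  have T1: "nn_abs (\<lambda>y. g y - avg g (ball x r)) (ball x r) \<le> ennreal (D * r powr (?d + \<nu>) / Theta (\<rho> x / r))"
    if r: "0 < r" "8 * r \<le> \<rho> x" for x r
  proof -
    have th: "0 < Theta (\<rho> x / r)" by (rule Theta_arg[OF r])
    let ?I = "LINT y:ball x r|lebesgue. \<bar>g y - avg g (ball x r)\<bar>"
    have vp: "0 < vol (ball x r) powr (1 + \<nu> / ?d)" using vol_ball_pos[OF r(1), of x] by simp
    have "?I / vol (ball x r) powr (1 + \<nu> / ?d) \<le> C * (1 / Theta (\<rho> x / r))"
      using C[OF r(1), of x] r unfolding T1_rhs[OF r(1)] by simp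
    also have "\<dots> \<le> \<bar>C\<bar> * (1 / Theta (\<rho> x / r))" using th by (intro mult_right_mono) auto
    finally have "?I \<le> \<bar>C\<bar> * (1 / Theta (\<rho> x / r)) * vol (ball x r) powr (1 + \<nu> / ?d)"
      using vp by (simp add: pos_divide_le_eq)
    also have "\<dots> = D * r powr (?d + \<nu>) / Theta (\<rho> x / r)"
      unfolding vol_powr_nu[OF r(1)] D_def by simp
    finally show ?thesis
      unfolding nn_abs_eq_set_integral[OF loc_integrable_diff[OF gl]] by (rule ennreal_leI)
  qed
  from main_bound[OF g D T1] obtain A where A: "0 \<le> A"
    "\<forall>w f n. dbl \<kappa> c3 CD w \<longrightarrow> ainf \<phi> w \<longrightarrow> bmo \<alpha> w f n \<longrightarrow> (\<exists>g. is_extended_value \<rho> T K f g \<and> bmo (\<alpha> + \<nu>) w g (A * n))"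
    by blast
  show ?thesis
  proof (rule exI, intro allI impI)
    fix w assume w: "dbl \<kappa> c3 CD w" "ainf \<phi> w"
    then have "weight w" by (simp add: dbl_def)
    then show "BMO_bounded_by \<rho> T K \<alpha> (\<alpha> + \<nu>) w (A * V powr (\<alpha> / ?d) * V powr (- (\<alpha> + \<nu>) / ?d))"
      by (rule bounded_byI[OF _ A(1)]) (use A(2) w in blast)
  qed
qed

end

section \<open>The equivalences\<close>

theorem corollary1p8:
  fixes \<rho> :: "'a::euclidean_space \<Rightarrow> real"
    and k0 C0 \<nu> \<delta> c m \<alpha> \<kappa> :: real
    and T :: "('a \<Rightarrow> real) \<Rightarrow> 'a \<Rightarrow> real"
    and K :: "'a \<Rightarrow> 'a \<Rightarrow> real"
  assumes "critical_radius k0 C0 \<rho>"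
    and "0 < c" "0 < m"
    and "0 \<le> \<nu>" "\<nu> < real DIM('a)"
    and "0 < \<delta>" "\<delta> \<le> 1"
    and "exp_SCZ_operator \<rho> \<nu> \<delta> c m T K"
    and "0 \<le> \<alpha>" "\<alpha> < \<delta>"
    and "1 \<le> \<kappa>" "\<kappa> < (\<delta> - \<alpha> - \<nu>) / real DIM('a) + 1"
  shows "(bounded_for_admissible_weights \<rho> C0 T K \<nu> \<delta> c m \<alpha> \<kappa>
            \<longleftrightarrow> T1_condition \<rho> T K \<nu> \<alpha> \<kappa>) \<and>
         (bounded_for_admissible_weights \<rho> C0 T K \<nu> \<delta> c m \<alpha> \<kappa>
            \<longleftrightarrow> bounded_for_power_weights \<rho> T K \<nu> \<alpha> \<kappa>)"
proof -
  let ?d = "real DIM('a)"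
  define a where "a = ?d * (\<kappa> - 1)"
  have a0: "0 \<le> a" using assms(11) by (simp add: a_def)
  have "(\<kappa> - 1) * ?d < \<delta> - \<alpha> - \<nu>" using assms(12) by (simp flip: pos_less_divide_eq)
  then have ex: "\<alpha> + a + \<nu> < \<delta>" by (simp add: a_def mult.commute)
  have a1: "a \<le> 1" and nd: "\<nu> < \<delta>" using ex a0 assms(4,7,9) by auto
  have ka: "?d * \<kappa> = ?d + a" by (simp add: a_def right_diff_distrib)
  obtain CT where CT: "0 \<le> CT" "\<And>f t. integrable lebesgue f \<Longrightarrow> 0 < t \<Longrightarrow> emeasure lebesgue {x. t < \<bar>T f x\<bar>}
      \<le> ennreal ((CT * (LINT y|lebesgue. \<bar>f y\<bar>) / t) powr (?d / (?d - \<nu>)))"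
    using assms(8) unfolding exp_SCZ_operator_def weak_type_1_def by blast
  obtain CK where CK: "\<And>x y. x \<noteq> y \<Longrightarrow> \<bar>K x y\<bar> \<le> CK / norm (x - y) powr (?d - \<nu>) * exp (- c * (1 + norm (x - y) / \<rho> x) powr m)"
      "\<And>x x0 y. norm (x - y) > 2 * norm (x - x0) \<Longrightarrow>
           \<bar>K x y - K x0 y\<bar> \<le> CK / norm (x - y) powr (?d - \<nu>) * (norm (x - x0) / norm (x - y)) powr \<delta>"
    using assms(8) unfolding exp_SCZ_operator_def by blast
  \<comment> \<open>The kernel constant in the definition of the operator carries no sign, hence
    |CK|.\<close>
  interpret scz \<rho> k0 C0 \<nu> \<delta> c m T K CT "\<bar>CK\<bar>"
  proof
    show "critical_radius k0 C0 \<rho>" "0 < c" "0 < m" "0 \<le> \<nu>" "\<nu> < ?d" "0 < \<delta>" "\<delta> \<le> 1" "\<nu> < \<delta>" "0 \<le> CT" "0 \<le> \<bar>CK\<bar>"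
      using assms CT nd by auto
    show "linear_on_L1 T" "K x \<in> borel_measurable lebesgue" for x
      using assms(8) by (auto simp: exp_SCZ_operator_def)
    show "T f \<in> borel_measurable lebesgue" if "integrable lebesgue f" for f
      using assms(8) that by (auto simp: exp_SCZ_operator_def weak_type_1_def)
    show "AE x in lebesgue. x \<notin> closure {y. f y \<noteq> 0} \<longrightarrow> T f x = (LINT y|lebesgue. K x y * f y)"
      if "integrable lebesgue f" for f
      using assms(8) that by (auto simp: exp_SCZ_operator_def)
    show "emeasure lebesgue {x. t < \<bar>T f x\<bar>} \<le> ennreal ((CT * (LINT y|lebesgue. \<bar>f y\<bar>) / t) powr (?d / (?d - \<nu>)))"
      if "integrable lebesgue f" "0 < t" for f t using CT(2) that .
    show "\<bar>K x y\<bar> \<le> \<bar>CK\<bar> / norm (x - y) powr (?d - \<nu>) * exp (- c * (1 + norm (x - y) / \<rho> x) powr m)" if "x \<noteq> y" for x y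
      by (rule order_trans[OF CK(1)[OF that]], intro mult_right_mono divide_right_mono) auto
    show "\<bar>K x y - K x0 y\<bar> \<le> \<bar>CK\<bar> / norm (x - y) powr (?d - \<nu>) * (norm (x - x0) / norm (x - y)) powr \<delta>"
      if "norm (x - y) > 2 * norm (x - x0)" for x y x0
      by (rule order_trans[OF CK(2)[OF that]], intro mult_right_mono divide_right_mono) auto
  qed
  have "(a + \<alpha> + \<nu>) / \<delta> < 1" using ex assms(6) by simp
  moreover have "1 \<le> C0" using assms(1) by (simp add: critical_radius_def)
  ultimately have pos: "0 < c * (1 - (a + \<alpha> + \<nu>) / \<delta>) * (4 * C0) powr (- m)"
    using assms(2) by simp
  obtain CD0 CR where CD0: "0 \<le> CD0"
    and adm: "\<And>p X. lacunary p X \<Longrightarrow> dbl \<kappa> 0 CD0 (\<lambda>y::'a. infdist y (insert p X) powr a) \<and> ainf (phi_RH 2 CR) (\<lambda>y. infdist y (insert p X) powr a)"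
    using lacunary_weight_adm a0 a1 ka by blast
  \<comment> \<open>One instance serves the powers of the distance to all lacunary sets, as
    \<open>CD0\<close> and \<open>CR\<close> do not depend on the set. Single points, with
    \<open>X\<close> empty, are included.\<close>
  interpret I: scz_bmo \<rho> k0 C0 \<nu> \<delta> c m T K CT "\<bar>CK\<bar>" \<alpha> \<kappa> 0 CD0 "phi_RH 2 CR"
  proof
    show "\<alpha> + ?d * (\<kappa> - 1) + \<nu> < \<delta>" "0 < c * (1 - (?d * (\<kappa> - 1) + \<alpha> + \<nu>) / \<delta>) * (4 * C0) powr (- m)"
      using ex pos by (simp_all add: a_def)
    show "0 < phi_RH 2 CR e" if "0 < e" for e using that by (intro phi_RH_pos) auto
  qed (use assms CD0 in auto)
  have ga: "?d + I.\<gamma> - \<alpha> = ?d + a" by (simp add: I.\<gamma>_def a_def)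
  obtain c0 c1 where c0: "0 < c0" and c1: "0 \<le> c1"
    and lo: "\<And>p X x r. lacunary p X \<Longrightarrow> 0 < r \<Longrightarrow>
      c0 * r powr ?d * max r (infdist x (insert p X)) powr a \<le> wmeas (\<lambda>y. infdist y (insert p X) powr a) (ball (x::'a) r)"
    and up: "\<And>p X x r. lacunary p X \<Longrightarrow> 0 < r \<Longrightarrow>
      wmeas (\<lambda>y. infdist y (insert p X) powr a) (ball (x::'a) r) \<le> c1 * r powr ?d * max r (infdist x (insert p X)) powr a"
    using lacunary_weight_bounds a0 a1 by blast
  have lower: "\<forall>z s. 0 < s \<longrightarrow> c0 * s powr (?d + I.\<gamma> - \<alpha>) \<le> wmeas (\<lambda>y::'a. infdist y (insert p X) powr a) (ball z s)"
    if L: "lacunary p X" for p X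
  proof (intro allI impI)
    fix z :: 'a and s :: real assume s: "0 < s"
    have "c0 * s powr (?d + I.\<gamma> - \<alpha>) = c0 * s powr ?d * s powr a" by (simp add: ga powr_add)
    also have "\<dots> \<le> c0 * s powr ?d * max s (infdist z (insert p X)) powr a"
      using c0 s a0 by (intro mult_left_mono powr_mono2) auto
    also note lo[OF L s]
    finally show "c0 * s powr (?d + I.\<gamma> - \<alpha>) \<le> wmeas (\<lambda>y::'a. infdist y (insert p X) powr a) (ball z s)" .
  qed
  have upper: "\<forall>s. 0 < s \<longrightarrow> wmeas (\<lambda>y::'a. infdist y (insert p X) powr a) (ball x s) \<le> c1 * s powr (?d + I.\<gamma> - \<alpha>)"
    if L: "lacunary p X" and x: "x \<in> insert p X" for p X x
  proof (intro allI impI)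
    fix s :: real assume s: "0 < s"
    have "infdist x (insert p X) = 0" using x by simp
    then show "wmeas (\<lambda>y::'a. infdist y (insert p X) powr a) (ball x s) \<le> c1 * s powr (?d + I.\<gamma> - \<alpha>)"
      using up[OF L s, of x] s by (simp add: ga powr_add)
  qed
  \<comment> \<open>For a given operator bound \<open>A\<close> the constant is the same for all
    lacunary sets. With \<open>X\<close> empty this yields that (iii) implies (i).\<close>
  have T1_at: "\<exists>C. \<forall>p X x. lacunary p X \<longrightarrow> x \<in> insert p X \<longrightarrow>
      BMO_bounded_by \<rho> T K \<alpha> (\<alpha> + \<nu>) (\<lambda>y. infdist y (insert p X) powr a) A \<longrightarrow> I.T1_at x C" for A
  proof -
    let ?B = "\<bar>A\<bar> * V powr (- \<alpha> / ?d) * V powr ((\<alpha> + \<nu>) / ?d)"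
    have "0 \<le> ?B" by simp
    from I.T1_at_of_bounded[OF c0 c1 this] obtain C where
      C: "\<And>w x0. dbl \<kappa> 0 CD0 w \<Longrightarrow> ainf (phi_RH 2 CR) w \<Longrightarrow> (\<forall>z s. 0 < s \<longrightarrow> c0 * s powr (?d + I.\<gamma> - \<alpha>) \<le> wmeas w (ball z s)) \<Longrightarrow>
       (\<forall>s. 0 < s \<longrightarrow> wmeas w (ball x0 s) \<le> c1 * s powr (?d + I.\<gamma> - \<alpha>)) \<Longrightarrow>
       (\<forall>f n. bmo \<alpha> w f n \<longrightarrow> (\<exists>g. is_extended_value \<rho> T K f g \<and> bmo (\<alpha> + \<nu>) w g (?B * n))) \<Longrightarrow> I.T1_at x0 C"
      by blast
    show ?thesis
    proof (intro exI allI impI)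
      fix p :: 'a and X x
      let ?w = "\<lambda>y::'a. infdist y (insert p X) powr a"
      assume L: "lacunary p X" and x: "x \<in> insert p X" and b: "BMO_bounded_by \<rho> T K \<alpha> (\<alpha> + \<nu>) ?w A"
      show "I.T1_at x C"
      proof (rule C[OF _ _ lower[OF L] upper[OF L x]])
        show "dbl \<kappa> 0 CD0 ?w" "ainf (phi_RH 2 CR) ?w" using adm[OF L] by auto
        show "\<forall>f n. bmo \<alpha> ?w f n \<longrightarrow> (\<exists>g. is_extended_value \<rho> T K f g \<and> bmo (\<alpha> + \<nu>) ?w g (?B * n))"
          using bounded_byD[OF infdist_powr_weight[OF a0] b] by blast
      qed
    qed
  qed
  \<comment> \<open>A power weight is the distance to a one-point set. For \<kappa> = 1 both sides
    vanish at x0, by \<open>0 powr 0 = 0\<close>.\<close>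
  have power: "(\<lambda>x. norm (x - x0) powr (?d * (\<kappa> - 1))) = (\<lambda>y. infdist y (insert x0 {}) powr a)" for x0 :: 'a
    by (simp add: a_def dist_norm)
  have i_iii: "bounded_for_power_weights \<rho> T K \<nu> \<alpha> \<kappa>" if "T1_condition \<rho> T K \<nu> \<alpha> \<kappa>"
  proof -
    from I.T1_condition_bounded[OF that] obtain A where
      "\<And>w. dbl \<kappa> 0 CD0 w \<Longrightarrow> ainf (phi_RH 2 CR) w \<Longrightarrow> BMO_bounded_by \<rho> T K \<alpha> (\<alpha> + \<nu>) w A" by blast
    then have "\<forall>x0. BMO_bounded_by \<rho> T K \<alpha> (\<alpha> + \<nu>) (\<lambda>y. infdist y (insert x0 {}) powr a) A"
      using adm[OF lacunary_empty] by blast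
    then show ?thesis unfolding bounded_for_power_weights_def power by (rule exI)
  qed
  have iii_i: "T1_condition \<rho> T K \<nu> \<alpha> \<kappa>" if b: "bounded_for_power_weights \<rho> T K \<nu> \<alpha> \<kappa>"
  proof -
    from b obtain A where A: "\<forall>x0. BMO_bounded_by \<rho> T K \<alpha> (\<alpha> + \<nu>) (\<lambda>y. infdist y (insert x0 {}) powr a) A"
      unfolding bounded_for_power_weights_def power ..
    from T1_at[of A] obtain C where C: "\<And>p X x. lacunary p X \<Longrightarrow> x \<in> insert p X \<Longrightarrow>
      BMO_bounded_by \<rho> T K \<alpha> (\<alpha> + \<nu>) (\<lambda>y. infdist y (insert p X) powr a) A \<Longrightarrow> I.T1_at x C" by blast
    have "I.T1_at x C" for x by (rule C[OF lacunary_empty _ A[rule_format]]) simp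
    then show ?thesis using I.T1_conditionI by blast
  qed
  have i_adm: "bounded_for_admissible_weights \<rho> C0 T K \<nu> \<delta> c m \<alpha> \<kappa>" if T1: "T1_condition \<rho> T K \<nu> \<alpha> \<kappa>"
    unfolding bounded_for_admissible_weights_def
  proof (intro allI impI)
    fix c1 c2 c3 :: real and w :: "'a \<Rightarrow> real"
    assume cs: "0 \<le> c1" "0 \<le> c2" "0 \<le> c3"
      and sm: "c2 + c3 < c * (1 - (?d * (\<kappa> - 1) + \<alpha> + \<nu>) / \<delta>) * (4 * C0) powr (- m)"
      and w: "w \<in> E_infty_class \<rho> m c1 c2 \<inter> D_class \<rho> m \<kappa> c3"
    obtain CD \<phi> where C: "0 \<le> CD" "\<forall>e>0. 0 < \<phi> e" "dbl \<kappa> c3 CD w" "ainf \<phi> w"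
      using admissible_weight[OF w cs(2)] by blast
    interpret J: scz_bmo \<rho> k0 C0 \<nu> \<delta> c m T K CT "\<bar>CK\<bar>" \<alpha> \<kappa> c3 CD \<phi>
      by unfold_locales (use assms C cs sm ex in \<open>auto simp: a_def\<close>)
    show "\<exists>A. BMO_bounded_by \<rho> T K \<alpha> (\<alpha> + \<nu>) w A"
      using J.T1_condition_bounded[OF T1] C by blast
  qed
  \<comment> \<open>The bound now depends on the weight, hence on the lacunary set. It is uniform
    over the points of that set, and \<open>lacunary_uniform\<close> upgrades this to all
    centres.\<close>
  have adm_i: "T1_condition \<rho> T K \<nu> \<alpha> \<kappa>" if b: "bounded_for_admissible_weights \<rho> C0 T K \<nu> \<delta> c m \<alpha> \<kappa>"
  proof -
    have "\<exists>C. \<forall>x\<in>insert p X. I.T1_at x C" if L: "lacunary p X" for p X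
    proof -
      have "0 + 0 < c * (1 - (?d * (\<kappa> - 1) + \<alpha> + \<nu>) / \<delta>) * (4 * C0) powr (- m)" using pos by (simp add: a_def)
      from b[unfolded bounded_for_admissible_weights_def, rule_format, OF order_refl order_refl order_refl this lacunary_weight_classes[OF a0 a1 L ka]]
      obtain A where A: "BMO_bounded_by \<rho> T K \<alpha> (\<alpha> + \<nu>) (\<lambda>y. infdist y (insert p X) powr a) A" ..
      from T1_at[of A] obtain C where "\<And>x. x \<in> insert p X \<Longrightarrow> I.T1_at x C" using L A by blast
      then show ?thesis by blast
    qed
    from lacunary_uniform[OF I.T1_at_mono this] obtain C where "\<forall>x. I.T1_at x C" ..
    then show ?thesis using I.T1_conditionI by blast
  qed
  show ?thesis using i_iii iii_i i_adm adm_i by blast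
qed

end
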